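(* Let $n\ge 2$ and $d\ge d_0(n)$ be integers, let $a\in\mathbb{R}$ satisfy $a\ge -\lambda^2$ and $\nu_d>0$, and let $0<\alpha<\frac14+\frac12\nu_d$. There exists a constant $C>0$, depending on $n,a,d,\alpha$, such that for every $f\in L^2_{\ge d}(\mathbb{R}^n)$ the unique solution $u$ of $$i\partial_t u+\Delta u-\frac{a}{|x|^2}u=0,\qquad u(0,x)=f(x),$$ satisfies $$\big\|\,|x|^{-1/2-2\alpha}\,P_a^{1/4-\alpha}u\,\big\|_{L^2(\mathbb{R}^{n+1})}\le C\|f\|_{L^2(\mathbb{R}^n)}.$$
   Context: Notation: $\lambda=\frac{n-2}{2}$; $\nu_l=\sqrt{(\lambda+l)^2+a}$ for integers $l\ge 0$; $d_0(2)=1$ and $d_0(n)=0$ for $n\ge 3$. $L^2_{\ge d}(\mathbb{R}^n)$ is the subspace of $L^2(\mathbb{R}^n)$ of functions orthogonal to all spherical harmonics of degree less than $d$ (i.e. $\int_{S^{n-1}}f(r\omega)Y(\omega)\,d\omega=0$ for a.e. $r>0$ and every spherical harmonic $Y$ of degree $<d$). $P_a$ denotes the self-adjoint (Friedrichs) extension of $-\Delta+\frac{a}{|x|^2}$ on $L^2(\mathbb{R}^n)$. Concretely, on the $l$-th spherical harmonic subspace (sums of functions $\phi(r)Y(\omega)$, $Y$ of degree $l$), $F(P_a)=\mathcal{H}_{\nu_l}F(\rho^2)\mathcal{H}_{\nu_l}$ for Borel $F$, where $(\mathcal{H}_\nu\phi)(\rho)=\int_0^\infty (r\rho)^{-\lambda}J_\nu(r\rho)\phi(r)r^{n-1}\,dr$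 acts on the radial variable and $J_\nu$ is the Bessel function of the first kind. Powers of $P_a$ are defined by this functional calculus. The solution of the Schrödinger equation is $u(t)=e^{-itP_a}f$, $t\in\mathbb{R}$. The operator $f\mapsto |x|^{-1/2-2\alpha}P_a^{1/4-\alpha}u$ is understood as defined on a dense subspace of $L^2_{\ge d}(\mathbb{R}^n)$ where the powers make sense, and extended by continuity. *)

theory Defs
  imports "HOL-Analysis.Analysis"
begin

section \<open>Square-integrable functions\<close>

definition L2 :: "'a measure \<Rightarrow> ('a \<Rightarrow> complex) set" where
  "L2 M = {f \<in> borel_measurable M. integrable M (\<lambda>x. (cmod (f x))\<^sup>2)}"

definition L2norm :: "'a measure \<Rightarrow> ('a \<Rightarrow> complex) \<Rightarrow> real" where
  "L2norm M f = sqrt (\<integral>x. (cmod (f x))\<^sup>2 \<partial>M)"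

text \<open>
  The nonnegative integral is used so that a difference that is not square integrable
  counts as having infinite norm; the Bochner integral would make it \<open>0\<close>.
\<close>

definition L2_tendsto :: "'a measure \<Rightarrow> ('k \<Rightarrow> 'a \<Rightarrow> complex) \<Rightarrow> ('a \<Rightarrow> complex) \<Rightarrow> 'k filter \<Rightarrow> bool" where
  "L2_tendsto M F g K \<longleftrightarrow>
     ((\<lambda>k. \<integral>\<^sup>+x. ennreal ((cmod (F k x - g x))\<^sup>2) \<partial>M) \<longlongrightarrow> 0) K"


section \<open>Spherical harmonics\<close>

text \<open>
  Surface measure on the unit sphere, as the cone measure: a set \<open>A\<close> gets \<open>n\<close> times the volume
  of the cone \<open>{t \<omega>. 0 < t < 1, \<omega> \<in> A}\<close>. Then \<open>dx = r\<^sup>n\<^sup>-\<^sup>1 dr d\<omega>\<close> in polar coordinates.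
\<close>

definition sphere_measure :: "(real ^ 'n) measure" where
  "sphere_measure = scale_measure (of_nat CARD('n))
     (distr (restrict_space lborel (ball 0 1 - {0})) (restrict_space borel (sphere 0 1))
        (\<lambda>x. x /\<^sub>R norm x))"

lemma space_sphere_measure: "space (sphere_measure :: (real ^ 'n) measure) = sphere 0 1"
  by (simp add: sphere_measure_def space_scale_measure space_restrict_space)

lemma emeasure_sphere_measure:
  fixes A :: "(real ^ 'n) set"
  assumes "A \<in> sets borel" "A \<subseteq> sphere 0 1"
  shows "emeasure sphere_measure A =
    of_nat CARD('n) * emeasure lborel {x \<in> ball 0 1 - {0}. x /\<^sub>R norm x \<in> A}"
proof -
  let ?B = "ball 0 1 - {0} :: (real ^ 'n) set"
  have m: "(\<lambda>x. x /\<^sub>R norm x) \<in> restrict_space lborel ?B \<rightarrow>\<^sub>M restrict_space borel (sphere 0 1)"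
    by (rule measurable_restrict_space3) (auto simp: sphere_def)
  have A: "A \<in> sets (restrict_space borel (sphere 0 1))"
    using assms by (auto simp: sets_restrict_space)
  have "(\<lambda>x. x /\<^sub>R norm x) -` A \<inter> space (restrict_space lborel ?B) =
      {x \<in> ?B. x /\<^sub>R norm x \<in> A}"
    by (auto simp: space_restrict_space)
  moreover have "emeasure (restrict_space lborel ?B) {x \<in> ?B. x /\<^sub>R norm x \<in> A} =
      emeasure lborel {x \<in> ?B. x /\<^sub>R norm x \<in> A}"
    by (rule emeasure_restrict_space) auto
  ultimately show ?thesis
    unfolding sphere_measure_def by (simp only: emeasure_scale_measure emeasure_distr[OF m A])
qed

definition laplacian :: "(real ^ 'n \<Rightarrow> complex) \<Rightarrow> real ^ 'n \<Rightarrow> complex" where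
  "laplacian p x = (\<Sum>b\<in>Basis. vector_derivative
     (\<lambda>s. vector_derivative (\<lambda>t. p (x + t *\<^sub>R b)) (at s)) (at 0))"

definition solid_harmonic :: "nat \<Rightarrow> (real ^ 'n \<Rightarrow> complex) \<Rightarrow> bool" where
  "solid_harmonic l p \<longleftrightarrow> polynomial_function p \<and>
     (\<forall>c x. p (c *\<^sub>R x) = c ^ l *\<^sub>R p x) \<and> (\<forall>x. laplacian p x = 0)"

definition spherical_harmonic :: "nat \<Rightarrow> (real ^ 'n \<Rightarrow> complex) \<Rightarrow> bool" where
  "spherical_harmonic l Y \<longleftrightarrow> (\<exists>p. solid_harmonic l p \<and> (\<forall>\<omega>\<in>sphere 0 1. Y \<omega> = p \<omega>))"

definition L2_ge :: "nat \<Rightarrow> (real ^ 'n \<Rightarrow> complex) set" where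
  "L2_ge d = {f \<in> L2 lborel. \<forall>l<d. \<forall>Y. spherical_harmonic l Y \<longrightarrow>
     (AE r in lborel. r > 0 \<longrightarrow> (\<integral>\<omega>. f (r *\<^sub>R \<omega>) * Y \<omega> \<partial>sphere_measure) = 0)}"


section \<open>The Hankel transform\<close>

definition lam :: "nat \<Rightarrow> real" where
  "lam n = (real n - 2) / 2"

definition nu :: "nat \<Rightarrow> real \<Rightarrow> nat \<Rightarrow> real" where
  "nu n a l = sqrt ((lam n + real l)\<^sup>2 + a)"

definition d0 :: "nat \<Rightarrow> nat" where
  "d0 n = (if n = 2 then 1 else 0)"

text \<open>Intended for \<open>\<nu> \<ge> 0\<close> and \<open>z > 0\<close>; the value at \<open>z = 0\<close> is always \<open>0\<close>.\<close>

definition Bessel_J :: "real \<Rightarrow> real \<Rightarrow> real" where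
  "Bessel_J \<nu> z = (\<Sum>m. (-1) ^ m / (fact m * Gamma (real m + \<nu> + 1)) *
     (z / 2) powr (2 * real m + \<nu>))"

text \<open>The measure \<open>r\<^sup>n\<^sup>-\<^sup>1 dr\<close> on the positive half-line.\<close>

definition radial_measure :: "nat \<Rightarrow> real measure" where
  "radial_measure n = density lborel (\<lambda>r. ennreal (indicator {0<..} r * r ^ (n - 1)))"

definition hankel_integral :: "nat \<Rightarrow> real \<Rightarrow> (real \<Rightarrow> complex) \<Rightarrow> real \<Rightarrow> complex" where
  "hankel_integral n \<nu> \<phi> \<rho> =
     (\<integral>r. of_real ((r * \<rho>) powr (- lam n) * Bessel_J \<nu> (r * \<rho>)) * \<phi> r \<partial>radial_measure n)"

text \<open>
  \<open>hankel n \<nu> \<phi> \<psi>\<close> says that \<open>\<psi>\<close> represents the Hankel transform of the square-integrable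
  function \<open>\<phi>\<close>. The integral need not converge absolutely for such \<open>\<phi>\<close>, so, as for the
  Plancherel transform, it is the limit in mean of the integrals over \<open>0 < r \<le> R\<close>.
\<close>

definition hankel :: "nat \<Rightarrow> real \<Rightarrow> (real \<Rightarrow> complex) \<Rightarrow> (real \<Rightarrow> complex) \<Rightarrow> bool" where
  "hankel n \<nu> \<phi> \<psi> \<longleftrightarrow> \<phi> \<in> L2 (radial_measure n) \<and> \<psi> \<in> L2 (radial_measure n) \<and>
     L2_tendsto (radial_measure n)
       (\<lambda>R. hankel_integral n \<nu> (\<lambda>r. indicator {..R} r * \<phi> r)) \<psi> at_top"


section \<open>Functional calculus of \<open>P\<^sub>a\<close>\<close>

text \<open>The component of \<open>f\<close> along \<open>Y\<close>, as a function of the radius.\<close>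

definition sph_coeff :: "(real ^ 'n \<Rightarrow> complex) \<Rightarrow> (real ^ 'n \<Rightarrow> complex) \<Rightarrow> real \<Rightarrow> complex" where
  "sph_coeff Y f r = (\<integral>\<omega>. f (r *\<^sub>R \<omega>) * cnj (Y \<omega>) \<partial>sphere_measure)"

text \<open>
  \<open>func_calc a F f g\<close> says that \<open>f\<close> lies in the domain of \<open>F(P\<^sub>a)\<close> and that \<open>g\<close> represents
  \<open>F(P\<^sub>a) f\<close>, where \<open>P\<^sub>a\<close> is the Friedrichs extension of \<open>-\<Delta> + a/|x|\<^sup>2\<close> on \<open>L\<^sup>2\<close>. On components of
  degree \<open>l\<close>, \<open>F(P\<^sub>a)\<close> acts as \<open>H F(\<rho>\<^sup>2) H\<close> with \<open>H\<close> the Hankel transform of order \<open>\<nu>\<^sub>l\<close>. The domain is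
  the maximal one: all \<open>f\<close> for which these components are those of an \<open>L\<^sup>2\<close> function.
\<close>

definition func_calc ::
  "real \<Rightarrow> (real \<Rightarrow> complex) \<Rightarrow> (real ^ 'n \<Rightarrow> complex) \<Rightarrow> (real ^ 'n \<Rightarrow> complex) \<Rightarrow> bool" where
  "func_calc a F f g \<longleftrightarrow> f \<in> L2 lborel \<and> g \<in> L2 lborel \<and>
     (\<forall>l Y. spherical_harmonic l Y \<longrightarrow>
        (\<exists>\<psi>. hankel CARD('n) (nu CARD('n) a l) (sph_coeff Y f) \<psi> \<and>
             hankel CARD('n) (nu CARD('n) a l) (\<lambda>\<rho>. F (\<rho>\<^sup>2) * \<psi> \<rho>) (sph_coeff Y g)))"

text \<open>
  The solution \<open>u(t) = e\<^sup>-\<^sup>i\<^sup>t\<^sup>P f\<close> of \<open>i \<partial>\<^sub>t u + \<Delta>u - a/|x|\<^sup>2 u = 0\<close>, \<open>u(0) = f\<close>, with \<open>P = P\<^sub>a\<close>.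
\<close>

definition schroedinger_solution ::
  "real \<Rightarrow> (real ^ 'n \<Rightarrow> complex) \<Rightarrow> (real \<Rightarrow> real ^ 'n \<Rightarrow> complex) \<Rightarrow> bool" where
  "schroedinger_solution a f u \<longleftrightarrow>
     (\<forall>t. func_calc a (\<lambda>s. exp (- \<i> * of_real t * of_real s)) f (u t))"

definition P_power ::
  "real \<Rightarrow> real \<Rightarrow> (real ^ 'n \<Rightarrow> complex) \<Rightarrow> (real ^ 'n \<Rightarrow> complex) \<Rightarrow> bool" where
  "P_power a \<beta> = func_calc a (\<lambda>s. of_real (s powr \<beta>))"


section \<open>The smoothing operator\<close>

text \<open>
  \<open>smoothing_core a \<alpha> f G\<close>: the power \<open>1/4 - \<alpha>\<close> of \<open>P\<^sub>a\<close> can be applied to the solution \<open>u\<close> with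
  initial value \<open>f\<close>, and \<open>G\<close> represents \<open>|x|\<^sup>-\<^sup>1\<^sup>/\<^sup>2\<^sup>-\<^sup>2\<^sup>\<alpha> P\<^sub>a\<^sup>1\<^sup>/\<^sup>4\<^sup>-\<^sup>\<alpha> u\<close> on space-time. No integrability of
  \<open>G\<close> is required.
\<close>

definition smoothing_core ::
  "real \<Rightarrow> real \<Rightarrow> (real ^ 'n \<Rightarrow> complex) \<Rightarrow> (real \<times> (real ^ 'n) \<Rightarrow> complex) \<Rightarrow> bool" where
  "smoothing_core a \<alpha> f G \<longleftrightarrow> G \<in> borel_measurable lborel \<and>
     (\<exists>u. schroedinger_solution a f u \<and>
        (AE t in lborel. \<exists>w. P_power a (1 / 4 - \<alpha>) (u t) w \<and>
           (AE x in lborel. G (t, x) = of_real (norm x powr (- 1 / 2 - 2 * \<alpha>)) * w x)))"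

text \<open>
  \<open>smoothing d a \<alpha> f G\<close>: \<open>G\<close> is the value at \<open>f\<close> of the extension by continuity of the operator
  \<open>smoothing_core a \<alpha>\<close>, restricted to \<open>L2_ge d\<close>. The second conjunct says that \<open>f\<close> is a limit of
  elements of the domain, so the third is not vacuous and determines \<open>G\<close> almost everywhere.
\<close>

definition smoothing ::
  "nat \<Rightarrow> real \<Rightarrow> real \<Rightarrow> (real ^ 'n \<Rightarrow> complex) \<Rightarrow> (real \<times> (real ^ 'n) \<Rightarrow> complex) \<Rightarrow> bool" where
  "smoothing d a \<alpha> f G \<longleftrightarrow> G \<in> L2 lborel \<and>
     (\<exists>fs Gs. (\<forall>k. fs k \<in> L2_ge d \<and> smoothing_core a \<alpha> (fs k) (Gs k)) \<and>
        L2_tendsto lborel fs f sequentially) \<and>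
     (\<forall>fs Gs. (\<forall>k. fs k \<in> L2_ge d \<and> smoothing_core a \<alpha> (fs k) (Gs k)) \<longrightarrow>
        L2_tendsto lborel fs f sequentially \<longrightarrow> L2_tendsto lborel Gs G sequentially)"

end

theory Submission
  imports Defs "HOL-Probability.Probability"
begin

text \<open>
  On the component of degree \<open>l\<close> the Hankel transform of order \<open>\<nu>\<^sub>l\<close> diagonalises \<open>P\<^sub>a\<close>, so there
  \<open>P\<^sub>a\<^sup>1\<^sup>/\<^sup>4\<^sup>-\<^sup>\<alpha> u(t, r)\<close> is an integral of \<open>exp (- i t \<rho>\<^sup>2)\<close> against \<open>J\<^sub>\<nu>(r \<rho>)\<close> times the transform
  \<open>\<psi>\<close> of the initial value. Put \<open>\<mu> = 4 \<alpha>\<close>. For fixed \<open>r\<close>, Plancherel in \<open>t\<close> (with \<open>s = \<rho>\<^sup>2\<close> as frequency)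
  turns the square of the norm into an integral over \<open>\<rho>\<close> of \<open>J\<^sub>\<nu>(r \<rho>)\<^sup>2\<close> times a weight; by Tonelli and scaling,
  integrating \<open>r\<^sup>-\<^sup>1\<^sup>-\<^sup>\<mu>\<close> in \<open>r\<close> produces the constant \<open>\<integral> s\<^sup>-\<^sup>\<mu> J\<^sub>\<nu>(s)\<^sup>2 ds\<close>, finite exactly when
  \<open>0 < \<mu> < 2 \<nu> + 1\<close> and decreasing in \<open>\<nu>\<close>. Hence the constant for \<open>l = d\<close> serves for all \<open>l \<ge> d\<close>, and the modes
  are summed by Parseval over an orthonormal basis of spherical harmonics.

  The operator is bounded on its domain by this, and it extends to all of \<open>L\<^sup>2\<^sub>\<ge>\<^sub>d\<close> because sums of finitely many
  modes with \<open>\<psi>\<close> supported in a compact part of the half-line lie in the domain and are dense.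
\<close>

section \<open>Square-integrable functions\<close>

text \<open>The Hankel transforms in the hypotheses are only limits in mean, so no pointwise formula
  is available at once, and \<open>u\<close> is given separately for each t, without joint
  measurability. Two devices deal with this. The transform is tested against the Gaussians
  \<open>gauss_fun\<close>, where Weber's integral is explicit; uniqueness, inversion and isometry
  rest on the totality of this family, which is a polynomial moment problem in exp(-r^2/2). And
  frequencies are cut off at k: there the transform is an honest integral, jointly measurable in
  time and radius, the estimate holds uniformly in k, and Fatou's lemma removes the cutoff, so that
  Plancherel in time enters as an inequality. On the angular side, harmonics come from decomposing
  monomials, and degrees are separated by Gaussian integrals over the whole space, so that nothing
  is differentiated on the sphere. The factor pi in the constant is the 2 pi of Plancherel times the
  1/2 of ds = 2 \<rho> d\<rho>.\<close>

definition nsq :: "'a measure \<Rightarrow> ('a \<Rightarrow> complex) \<Rightarrow> ennreal" where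
  "nsq M f = (\<integral>\<^sup>+x. ennreal ((cmod (f x))\<^sup>2) \<partial>M)"

text \<open>Squared norms live in \<open>ennreal\<close>, so that Tonelli, Fatou and infinite sums
  over modes apply without integrability side conditions; this is the passage between the two
  views.\<close>

lemma L2_iff_nsq: "f \<in> L2 M \<longleftrightarrow> f \<in> borel_measurable M \<and> nsq M f < \<infinity>"
proof -
  have "f \<in> borel_measurable M \<Longrightarrow>
    integrable M (\<lambda>x. (cmod (f x))\<^sup>2) \<longleftrightarrow> (\<integral>\<^sup>+x. ennreal ((cmod (f x))\<^sup>2) \<partial>M) < \<infinity>"
    by (subst integrable_iff_bounded) simp
  then show ?thesis
    unfolding L2_def nsq_def by blast
qed

lemma L2_measurable: "f \<in> L2 M \<Longrightarrow> f \<in> borel_measurable M"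
  by (simp add: L2_def)

lemma L2_integrable: "f \<in> L2 M \<Longrightarrow> integrable M (\<lambda>x. (cmod (f x))\<^sup>2)"
  by (simp add: L2_def)

lemma L2norm_sq: "(L2norm M f)\<^sup>2 = (\<integral>x. (cmod (f x))\<^sup>2 \<partial>M)"
  by (simp add: L2norm_def)

lemma nsq_eq_L2norm: "f \<in> L2 M \<Longrightarrow> nsq M f = ennreal ((L2norm M f)\<^sup>2)"
  unfolding nsq_def L2norm_sq by (intro nn_integral_eq_integral) (auto simp: L2_def)

lemma L2_tendsto_nsq: "L2_tendsto M F g K \<longleftrightarrow> ((\<lambda>k. nsq M (\<lambda>x. F k x - g x)) \<longlongrightarrow> 0) K"
  unfolding L2_tendsto_def nsq_def ..

lemma nsq_cong_AE: "(AE x in M. f x = g x) \<Longrightarrow> nsq M f = nsq M g"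
  unfolding nsq_def by (intro nn_integral_cong_AE) auto

lemma nsq_diff_commute: "nsq M (\<lambda>x. f x - g x) = nsq M (\<lambda>x. g x - f x)"
  unfolding nsq_def by (simp add: norm_minus_commute)

lemma nsq_scale: "f \<in> borel_measurable M \<Longrightarrow> nsq M (\<lambda>x. c * f x) = ennreal ((cmod c)\<^sup>2) * nsq M f"
  unfolding nsq_def
  by (subst nn_integral_cmult[symmetric])
    (auto simp: norm_mult power_mult_distrib ennreal_mult intro!: nn_integral_cong)

text \<open>Weighted arithmetic-geometric mean for the cross term, read off from the square of sqrt
  e |a| - |b| / sqrt e.\<close>

lemma cmod_add_sq_le: 
  fixes a b :: complex assumes e: "e > 0"
  shows "(cmod (a + b))\<^sup>2 \<le> (1 + e) * (cmod a)\<^sup>2 + (1 + 1 / e) * (cmod b)\<^sup>2"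
proof -
  have "(cmod (a + b))\<^sup>2 \<le> (cmod a + cmod b)\<^sup>2"
    by (intro power_mono norm_triangle_ineq) auto
  also have "\<dots> = (cmod a)\<^sup>2 + 2 * cmod a * cmod b + (cmod b)\<^sup>2"
    by (simp add: power2_sum)
  also have "2 * cmod a * cmod b \<le> e * (cmod a)\<^sup>2 + (cmod b)\<^sup>2 / e"
  proof -
    have "0 \<le> (sqrt e * cmod a - cmod b / sqrt e)\<^sup>2" by simp
    also have "\<dots> = e * (cmod a)\<^sup>2 - 2 * cmod a * cmod b + (cmod b)\<^sup>2 / e"
      using e by (simp add: power2_diff power_mult_distrib power_divide)
    finally show ?thesis by simp
  qed
  finally show ?thesis by (simp add: algebra_simps)
qed

lemma nsq_add_le_eps:
  assumes [measurable]: "f \<in> borel_measurable M" "g \<in> borel_measurable M" and e: "e > 0"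
  shows "nsq M (\<lambda>x. f x + g x) \<le> ennreal (1 + e) * nsq M f + ennreal (1 + 1 / e) * nsq M g"
proof -
  have "nsq M (\<lambda>x. f x + g x) \<le> (\<integral>\<^sup>+x. ennreal (1 + e) * ennreal ((cmod (f x))\<^sup>2)
      + ennreal (1 + 1 / e) * ennreal ((cmod (g x))\<^sup>2) \<partial>M)"
    unfolding nsq_def
  proof (intro nn_integral_mono)
    fix x
    have "ennreal ((cmod (f x + g x))\<^sup>2) \<le> ennreal ((1 + e) * (cmod (f x))\<^sup>2 + (1 + 1 / e) * (cmod (g x))\<^sup>2)"
      using cmod_add_sq_le[OF e] by (intro ennreal_leI)
    also have "\<dots> = ennreal (1 + e) * ennreal ((cmod (f x))\<^sup>2)
      + ennreal (1 + 1 / e) * ennreal ((cmod (g x))\<^sup>2)"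
      using e by (subst ennreal_plus) (auto simp: ennreal_mult intro!: add_nonneg_nonneg)
    finally show "ennreal ((cmod (f x + g x))\<^sup>2) \<le> ennreal (1 + e) * ennreal ((cmod (f x))\<^sup>2)
      + ennreal (1 + 1 / e) * ennreal ((cmod (g x))\<^sup>2)" .
  qed
  also have "\<dots> = ennreal (1 + e) * nsq M f + ennreal (1 + 1 / e) * nsq M g"
    unfolding nsq_def by (subst nn_integral_add) (auto simp: nn_integral_cmult)
  finally show ?thesis .
qed

text \<open>Stands in for Minkowski's inequality while everything stays squared. The factor 2 is
  harmless in limits and reappears only in the size of the final constant.\<close>

lemma nsq_add_le:
  assumes "f \<in> borel_measurable M" "g \<in> borel_measurable M"
  shows "nsq M (\<lambda>x. f x + g x) \<le> 2 * nsq M f + 2 * nsq M g"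
  using nsq_add_le_eps[OF assms, of 1] by simp

lemma L2_add: "f \<in> L2 M \<Longrightarrow> g \<in> L2 M \<Longrightarrow> (\<lambda>x. f x + g x) \<in> L2 M"
  using nsq_add_le[of f M g]
  by (auto simp: L2_iff_nsq ennreal_mult_less_top intro!: order.strict_trans1[of "nsq M (\<lambda>x. f x + g x)"])

lemma L2_scale: "f \<in> L2 M \<Longrightarrow> (\<lambda>x. c * f x) \<in> L2 M"
  by (auto simp: L2_iff_nsq nsq_scale ennreal_mult_less_top)

lemma L2_diff: "f \<in> L2 M \<Longrightarrow> g \<in> L2 M \<Longrightarrow> (\<lambda>x. f x - g x) \<in> L2 M"
  using L2_add[of f M "\<lambda>x. (-1) * g x"] L2_scale[of g M "-1"] by simp

lemma L2_zero: "(\<lambda>x. 0) \<in> L2 M"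
  by (simp add: L2_iff_nsq nsq_def)

lemma L2_sum: "(\<And>i. i \<in> A \<Longrightarrow> f i \<in> L2 M) \<Longrightarrow> (\<lambda>x. \<Sum>i\<in>A. f i x) \<in> L2 M"
  by (induction A rule: infinite_finite_induct) (auto simp: L2_zero intro!: L2_add)

lemma L2_bounded_mult:
  assumes f: "f \<in> L2 M" and [measurable]: "h \<in> borel_measurable M"
    and h: "\<And>x. x \<in> space M \<Longrightarrow> cmod (h x) \<le> B"
  shows "(\<lambda>x. h x * f x) \<in> L2 M"
proof -
  have [measurable]: "f \<in> borel_measurable M" using f by (rule L2_measurable)
  have "nsq M (\<lambda>x. h x * f x) \<le> nsq M (\<lambda>x. of_real B * f x)"
    unfolding nsq_def
  proof (intro nn_integral_mono ennreal_leI power_mono)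
    fix x assume x: "x \<in> space M"
    have "cmod (h x * f x) \<le> B * cmod (f x)"
      unfolding norm_mult using h[OF x] by (intro mult_right_mono) auto
    also have "\<dots> \<le> cmod (of_real B * f x)"
      by (auto simp: norm_mult intro!: mult_right_mono)
    finally show "cmod (h x * f x) \<le> cmod (of_real B * f x)" .
  qed auto
  also have "\<dots> < \<infinity>" using L2_scale[OF f] by (simp add: L2_iff_nsq)
  finally show ?thesis by (simp add: L2_iff_nsq)
qed

lemma L2_cong_AE: "f \<in> L2 M \<Longrightarrow> (AE x in M. f x = g x) \<Longrightarrow> g \<in> borel_measurable M \<Longrightarrow> g \<in> L2 M"
  using nsq_cong_AE[of f g M] by (simp add: L2_iff_nsq)

lemma L2_mult_integrable:
  assumes f: "f \<in> L2 M" and g: "g \<in> L2 M"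
  shows "integrable M (\<lambda>x. f x * g x)"
proof (rule Bochner_Integration.integrable_bound)
  show "integrable M (\<lambda>x. (cmod (f x))\<^sup>2 + (cmod (g x))\<^sup>2)"
    using f g by (auto simp: L2_def)
  show "(\<lambda>x. f x * g x) \<in> borel_measurable M"
    using L2_measurable[OF f] L2_measurable[OF g] by measurable
  have "cmod (f x * g x) \<le> (cmod (f x))\<^sup>2 + (cmod (g x))\<^sup>2" for x
  proof -
    have "2 * cmod (f x) * cmod (g x) \<le> (cmod (f x))\<^sup>2 + (cmod (g x))\<^sup>2"
      using sum_squares_bound by blast
    moreover have "0 \<le> cmod (f x) * cmod (g x)" by simp
    ultimately show ?thesis unfolding norm_mult by linarith
  qed
  then show "AE x in M. norm (f x * g x) \<le> norm ((cmod (f x))\<^sup>2 + (cmod (g x))\<^sup>2)" by simp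
qed

lemma nsq_eq_0_iff: "f \<in> borel_measurable M \<Longrightarrow> nsq M f = 0 \<longleftrightarrow> (AE x in M. f x = 0)"
  unfolding nsq_def by (subst nn_integral_0_iff_AE) (auto simp: ennreal_eq_0_iff)

text \<open>The filter is arbitrary because the limit in mean inside \<open>hankel\<close> runs over
  real cutoffs, not over a sequence.\<close>

lemma nsq_limit_unique:
  assumes [measurable]: "\<And>k. F k \<in> borel_measurable M" "g \<in> borel_measurable M" "h \<in> borel_measurable M"
    and "L2_tendsto M F g K" "L2_tendsto M F h K" "K \<noteq> bot"
  shows "AE x in M. g x = h x"
proof -
  have le: "nsq M (\<lambda>x. g x - h x) \<le> 2 * nsq M (\<lambda>x. F k x - g x) + 2 * nsq M (\<lambda>x. F k x - h x)" for k
    using nsq_add_le[of "\<lambda>x. g x - F k x" M "\<lambda>x. F k x - h x"] nsq_diff_commute[of M "F k" g]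
    by simp
  have "((\<lambda>k. 2 * nsq M (\<lambda>x. F k x - g x) + 2 * nsq M (\<lambda>x. F k x - h x)) \<longlongrightarrow> 2 * 0 + 2 * 0) K"
    using assms(4,5) unfolding L2_tendsto_nsq by (intro tendsto_add tendsto_mult_ennreal tendsto_const) auto
  from tendsto_lowerbound[OF this always_eventually[OF allI[OF le]] \<open>K \<noteq> bot\<close>]
  have "nsq M (\<lambda>x. g x - h x) = 0" by simp
  then show ?thesis by (subst (asm) nsq_eq_0_iff) auto
qed

text \<open>Along a subsequence with squared distances below 2^-j the sum of the squared differences
  has finite integral, hence converges a.e., and its terms tend to 0.\<close>

lemma L2_AE_subseq:
  assumes [measurable]: "\<And>k. F k \<in> borel_measurable M" "g \<in> borel_measurable M"
    and lim: "L2_tendsto M F g sequentially"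
  shows "\<exists>r::nat \<Rightarrow> nat. strict_mono r \<and> (AE x in M. (\<lambda>j. F (r j) x) \<longlonglongrightarrow> g x)"
proof -
  have ex: "\<exists>k>m. nsq M (\<lambda>x. F k x - g x) < ennreal ((1/2)^j)" for m j
  proof -
    have "\<forall>\<^sub>F k in sequentially. nsq M (\<lambda>x. F k x - g x) < ennreal ((1/2)^j)"
      using lim unfolding L2_tendsto_nsq by (rule order_tendstoD) simp
    then have "\<forall>\<^sub>F k in sequentially. k > m \<and> nsq M (\<lambda>x. F k x - g x) < ennreal ((1/2)^j)"
      using eventually_gt_at_top by (rule eventually_conj[rotated])
    then show ?thesis by (rule eventually_happens'[rotated]) simp
  qed
  obtain r where r: "\<And>j. nsq M (\<lambda>x. F (r j) x - g x) < ennreal ((1/2)^j)" "\<And>j. r j < r (Suc j)"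
  proof -
    have "\<exists>r. \<forall>j. nsq M (\<lambda>x. F (r j) x - g x) < ennreal ((1/2)^j) \<and> r j < r (Suc j)"
    proof (rule dependent_nat_choice)
      show "\<exists>x. nsq M (\<lambda>y. F x y - g y) < ennreal ((1/2)^0)" using ex[of 0 0] by blast
      show "\<exists>y. nsq M (\<lambda>z. F y z - g z) < ennreal ((1/2)^Suc j) \<and> x < y" for x j
        using ex[of x "Suc j"] by blast
    qed
    then show ?thesis using that by blast
  qed
  have "(\<integral>\<^sup>+x. (\<Sum>j. ennreal ((cmod (F (r j) x - g x))\<^sup>2)) \<partial>M) = (\<Sum>j. nsq M (\<lambda>x. F (r j) x - g x))"
    unfolding nsq_def by (rule nn_integral_suminf) simp
  also have "\<dots> \<le> (\<Sum>j. ennreal ((1/2)^j))"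
    by (intro suminf_le less_imp_le[OF r(1)]) auto
  also have "\<dots> < \<infinity>"
    by (subst suminf_ennreal2) (auto intro!: summable_geometric)
  finally have "AE x in M. (\<Sum>j. ennreal ((cmod (F (r j) x - g x))\<^sup>2)) \<noteq> \<infinity>"
    by (intro nn_integral_PInf_AE) auto
  then have "AE x in M. (\<lambda>j. F (r j) x) \<longlonglongrightarrow> g x"
  proof eventually_elim
    case (elim x)
    have "summable (\<lambda>j. (cmod (F (r j) x - g x))\<^sup>2)"
      using elim by (intro summable_suminf_not_top) auto
    then have "(\<lambda>j. (cmod (F (r j) x - g x))\<^sup>2) \<longlonglongrightarrow> 0" by (rule summable_LIMSEQ_zero)
    then have "(\<lambda>j. sqrt ((cmod (F (r j) x - g x))\<^sup>2)) \<longlonglongrightarrow> sqrt 0" by (rule tendsto_real_sqrt)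
    then have "(\<lambda>j. cmod (F (r j) x - g x)) \<longlonglongrightarrow> 0" by simp
    then show ?case by (simp add: tendsto_norm_zero_iff LIM_zero_iff)
  qed
  moreover have "strict_mono r" using r(2) by (simp add: strict_mono_Suc_iff)
  ultimately show ?thesis by blast
qed

text \<open>The weight may be unbounded, like a negative power of the radius, so convergence in mean
  does not carry weighted integrals to the limit. Fatou along an a.e. convergent subsequence still
  gives lower semicontinuity.\<close>

lemma weighted_nsq_le_liminf:
  assumes [measurable]: "\<And>k. F k \<in> borel_measurable M" "g \<in> borel_measurable M" "v \<in> borel_measurable M"
    and lim: "L2_tendsto M F g sequentially"
  shows "(\<integral>\<^sup>+x. v x * ennreal ((cmod (g x))\<^sup>2) \<partial>M)
    \<le> liminf (\<lambda>k. \<integral>\<^sup>+x. v x * ennreal ((cmod (F k x))\<^sup>2) \<partial>M)"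
proof -
  let ?I = "\<lambda>k. \<integral>\<^sup>+x. v x * ennreal ((cmod (F k x))\<^sup>2) \<partial>M"
  \<comment> \<open>The liminf is realised along a subsequence before a.e. convergence is extracted,
    so that the second extraction cannot change its value.\<close>
  obtain r where r: "strict_mono r" "(?I \<circ> r) \<longlonglongrightarrow> liminf ?I"
    using liminf_subseq_lim by blast
  have "L2_tendsto M (\<lambda>j. F (r j)) g sequentially"
    using LIMSEQ_subseq_LIMSEQ[OF lim[unfolded L2_tendsto_nsq] r(1)]
    unfolding L2_tendsto_nsq o_def .
  from L2_AE_subseq[OF _ _ this] obtain s :: "nat \<Rightarrow> nat"
    where s: "strict_mono s" "AE x in M. (\<lambda>j. F (r (s j)) x) \<longlonglongrightarrow> g x"
    by auto
  have "(\<integral>\<^sup>+x. v x * ennreal ((cmod (g x))\<^sup>2) \<partial>M)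
      = (\<integral>\<^sup>+x. v x * liminf (\<lambda>j. ennreal ((cmod (F (r (s j)) x))\<^sup>2)) \<partial>M)"
  proof (rule nn_integral_cong_AE, use s(2) in eventually_elim)
    case (elim x)
    have "(\<lambda>j. ennreal ((cmod (F (r (s j)) x))\<^sup>2)) \<longlonglongrightarrow> ennreal ((cmod (g x))\<^sup>2)"
      using elim by (intro tendsto_intros)
    from lim_imp_Liminf[OF _ this] show ?case by simp
  qed
  also have "\<dots> \<le> (\<integral>\<^sup>+x. liminf (\<lambda>j. v x * ennreal ((cmod (F (r (s j)) x))\<^sup>2)) \<partial>M)"
  proof (intro nn_integral_mono)
    fix x
    show "v x * liminf (\<lambda>j. ennreal ((cmod (F (r (s j)) x))\<^sup>2))
        \<le> liminf (\<lambda>j. v x * ennreal ((cmod (F (r (s j)) x))\<^sup>2))"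
      unfolding liminf_SUP_INF SUP_mult_left_ennreal
      by (intro SUP_mono' INF_greatest mult_left_mono INF_lower) auto
  qed
  also have "\<dots> \<le> liminf (\<lambda>j. ?I (r (s j)))"
    by (intro nn_integral_liminf) simp
  also have "(\<lambda>j. ?I (r (s j))) \<longlonglongrightarrow> liminf ?I"
    using LIMSEQ_subseq_LIMSEQ[OF r(2) s(1)] by (simp add: o_def)
  from lim_imp_Liminf[OF _ this] have "liminf (\<lambda>j. ?I (r (s j))) = liminf ?I" by simp
  finally show ?thesis .
qed

text \<open>Riesz-Fischer: a fast subsequence converges a.e., and Fatou shows that its pointwise
  limit is the limit in mean of the full sequence.\<close>

lemma L2_complete:
  assumes F: "\<And>k. F k \<in> L2 M"
    and cauchy: "\<And>e::real. e > 0 \<Longrightarrow> \<exists>N. \<forall>m\<ge>N. \<forall>k\<ge>N. nsq M (\<lambda>x. F m x - F k x) \<le> ennreal e"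
  shows "\<exists>g\<in>L2 M. L2_tendsto M F g sequentially"
proof -
  have [measurable]: "F k \<in> borel_measurable M" for k using F by (rule L2_measurable)
  obtain N where N: "\<And>e m k. e > 0 \<Longrightarrow> m \<ge> N e \<Longrightarrow> k \<ge> N e \<Longrightarrow> nsq M (\<lambda>x. F m x - F k x) \<le> ennreal e"
    using cauchy by metis
  \<comment> \<open>The rate 4^-j leaves room for a weight 2^j: finiteness of the sum of 2^j times
    the squared increments makes the increments themselves eventually at most 2^(-j/2), which is
    summable. Square summability alone would not give this.\<close>
  obtain r where r: "\<And>j. r j \<ge> N ((1/4)^j)" "\<And>j. r j < r (Suc j)"
  proof -
    have "\<exists>r. \<forall>j. r j \<ge> N ((1/4)^j) \<and> r j < r (Suc j)"
    proof (rule dependent_nat_choice)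
      show "\<exists>x. N ((1/4)^0) \<le> x" by blast
      show "\<exists>y. N ((1/4)^Suc n) \<le> y \<and> x < y" for x n
        by (rule exI[of _ "max (Suc x) (N ((1/4)^Suc n))"]) auto
    qed
    then show ?thesis using that by blast
  qed
  let ?D = "\<lambda>j x. cmod (F (r (Suc j)) x - F (r j) x)"
  have D: "nsq M (\<lambda>x. F (r (Suc j)) x - F (r j) x) \<le> ennreal ((1/4)^j)" for j
    using r(1)[of j] r(2)[of j] by (intro N) auto
  have "(\<integral>\<^sup>+x. (\<Sum>j. ennreal (2^j) * ennreal ((?D j x)\<^sup>2)) \<partial>M)
      = (\<Sum>j. ennreal (2^j) * nsq M (\<lambda>x. F (r (Suc j)) x - F (r j) x))"
    unfolding nsq_def by (subst nn_integral_suminf) (auto simp: nn_integral_cmult)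
  also have "\<dots> \<le> (\<Sum>j. ennreal ((1/2)^j))"
  proof (intro suminf_le)
    fix j
    have "ennreal (2^j) * nsq M (\<lambda>x. F (r (Suc j)) x - F (r j) x) \<le> ennreal (2^j) * ennreal ((1/4)^j)"
      using D by (intro mult_left_mono) auto
    also have "\<dots> = ennreal ((1/2)^j)"
      by (subst ennreal_mult[symmetric]) (auto simp flip: power_mult_distrib)
    finally show "ennreal (2^j) * nsq M (\<lambda>x. F (r (Suc j)) x - F (r j) x) \<le> ennreal ((1/2)^j)" .
  qed auto
  also have "\<dots> < \<infinity>"
    by (subst suminf_ennreal2) (auto intro!: summable_geometric)
  finally have "AE x in M. (\<Sum>j. ennreal (2^j) * ennreal ((?D j x)\<^sup>2)) \<noteq> \<infinity>"
    by (intro nn_integral_PInf_AE) auto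
  then have conv: "AE x in M. convergent (\<lambda>j. F (r j) x)"
  proof eventually_elim
    case (elim x)
    have "summable (\<lambda>j. 2^j * (?D j x)\<^sup>2)"
      using elim by (intro summable_suminf_not_top) (auto simp: ennreal_mult)
    then have "(\<lambda>j. 2^j * (?D j x)\<^sup>2) \<longlonglongrightarrow> 0" by (rule summable_LIMSEQ_zero)
    then have "\<forall>\<^sub>F j in sequentially. 2^j * (?D j x)\<^sup>2 < 1"
      by (rule order_tendstoD) simp
    then have ev: "\<forall>\<^sub>F j in sequentially. norm (F (r (Suc j)) x - F (r j) x) \<le> (1 / sqrt 2)^j"
    proof eventually_elim
      case (elim j)
      have "((1 / sqrt 2)^j)\<^sup>2 = ((1 / sqrt 2)\<^sup>2)^j"
        by (metis power_mult mult.commute)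
      also have "\<dots> = 1 / 2^j" by (simp add: power_divide)
      finally have *: "((1 / sqrt 2)^j)\<^sup>2 = 1 / 2^j" .
      have "(?D j x)\<^sup>2 \<le> ((1 / sqrt 2)^j)\<^sup>2"
        using elim unfolding * by (simp add: pos_le_divide_eq mult.commute)
      then show ?case by (rule power2_le_imp_le) simp
    qed
    have "summable (\<lambda>j. F (r (Suc j)) x - F (r j) x)"
      by (rule summable_comparison_test_ev[OF ev]) (auto intro!: summable_geometric)
    then have "(\<lambda>n. \<Sum>j<n. F (r (Suc j)) x - F (r j) x) \<longlonglongrightarrow> suminf (\<lambda>j. F (r (Suc j)) x - F (r j) x)"
      by (rule summable_LIMSEQ)
    then have "(\<lambda>n. (\<Sum>j<n. F (r (Suc j)) x - F (r j) x) + F (r 0) x)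
        \<longlonglongrightarrow> suminf (\<lambda>j. F (r (Suc j)) x - F (r j) x) + F (r 0) x"
      by (intro tendsto_intros)
    moreover have "(\<Sum>j<n. F (r (Suc j)) x - F (r j) x) + F (r 0) x = F (r n) x" for n
      using sum_lessThan_telescope[of "\<lambda>n. F (r n) x" n] by simp
    ultimately show ?case by (auto simp: convergent_def)
  qed
  define g where "g x = lim (\<lambda>j. F (r j) x)" for x
  have [measurable]: "g \<in> borel_measurable M"
    unfolding g_def by measurable
  have AE: "AE x in M. (\<lambda>j. F (r j) x) \<longlonglongrightarrow> g x"
    using conv unfolding g_def by eventually_elim (simp add: convergent_LIMSEQ_iff)
  have "strict_mono r" using r(2) by (simp add: strict_mono_Suc_iff)
  then have r_ge: "r j \<ge> j" for j by (rule seq_suble)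
  have lim: "nsq M (\<lambda>x. F m x - g x) \<le> ennreal e" if e: "e > 0" "m \<ge> N e" for m e
  proof -
    have "nsq M (\<lambda>x. F m x - g x) = (\<integral>\<^sup>+x. liminf (\<lambda>j. ennreal ((cmod (F m x - F (r j) x))\<^sup>2)) \<partial>M)"
      unfolding nsq_def
    proof (rule nn_integral_cong_AE, use AE in eventually_elim)
      case (elim x)
      have "(\<lambda>j. ennreal ((cmod (F m x - F (r j) x))\<^sup>2)) \<longlonglongrightarrow> ennreal ((cmod (F m x - g x))\<^sup>2)"
        using elim by (intro tendsto_intros)
      from lim_imp_Liminf[OF _ this] show ?case by simp
    qed
    also have "\<dots> \<le> liminf (\<lambda>j. nsq M (\<lambda>x. F m x - F (r j) x))"
      unfolding nsq_def by (intro nn_integral_liminf) simp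
    also have "\<dots> \<le> ennreal e"
    proof (rule Liminf_le[OF sequentially_bot])
      show "\<forall>\<^sub>F j in sequentially. nsq M (\<lambda>x. F m x - F (r j) x) \<le> ennreal e"
        using eventually_ge_at_top[of "N e"]
      proof eventually_elim
        case (elim j)
        then show ?case using r_ge[of j] e by (intro N) auto
      qed
    qed
    finally show ?thesis .
  qed
  have "(\<lambda>x. F (N 1) x - g x) \<in> L2 M"
    unfolding L2_iff_nsq using lim[of 1 "N 1"] by (auto intro: order.strict_trans1)
  from L2_diff[OF F[of "N 1"] this]
  have "g \<in> L2 M" by simp
  moreover have "L2_tendsto M F g sequentially"
    unfolding L2_tendsto_nsq
  proof (rule order_tendstoI)
    fix a :: ennreal assume "0 < a"
    then obtain b where b: "0 < b" "b < a" using dense by blast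
    then have "b < top" by (auto intro: order.strict_trans2)
    then obtain e where e: "0 < e" "ennreal e < a"
      using b by (cases b) auto
    show "\<forall>\<^sub>F k in sequentially. nsq M (\<lambda>x. F k x - g x) < a"
      using lim[OF e(1)] e(2)
      by (intro eventually_mono[OF eventually_ge_at_top[of "N e"]]) (auto intro: order.strict_trans1)
  qed auto
  ultimately show ?thesis by blast
qed

section \<open>Orthonormal sequences\<close>

lemma norm_integral_le:
  fixes f :: "'a \<Rightarrow> 'b::{banach,second_countable_topology}"
  assumes "integrable M f" "integrable M g" "\<And>x. x \<in> space M \<Longrightarrow> norm (f x) \<le> g x"
  shows "norm (\<integral>x. f x \<partial>M) \<le> (\<integral>x. g x \<partial>M)"
  by (rule order_trans[OF integral_norm_bound integral_mono]) (use assms in auto)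

text \<open>Basis functions are real and only the expanded functions are complex, so that no
  conjugates occur in coefficients; \<open>rip\<close> pairs two basis functions and
  \<open>coef\<close> pairs data with a basis function.\<close>

definition rip :: "'a measure \<Rightarrow> ('a \<Rightarrow> real) \<Rightarrow> ('a \<Rightarrow> real) \<Rightarrow> real" where
  "rip M f g = (\<integral>x. f x * g x \<partial>M)"

definition L2R :: "'a measure \<Rightarrow> ('a \<Rightarrow> real) set" where
  "L2R M = {f. (\<lambda>x. complex_of_real (f x)) \<in> L2 M}"

lemma L2R_measurable: "f \<in> L2R M \<Longrightarrow> f \<in> borel_measurable M"
proof -
  assume "f \<in> L2R M"
  then have [measurable]: "(\<lambda>x. complex_of_real (f x)) \<in> borel_measurable M"
    unfolding L2R_def by (auto dest: L2_measurable)
  have "(\<lambda>x. Re (complex_of_real (f x))) \<in> borel_measurable M" by measurable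
  then show ?thesis by simp
qed

lemma L2R_iff: "f \<in> L2R M \<longleftrightarrow> f \<in> borel_measurable M \<and> integrable M (\<lambda>x. (f x)\<^sup>2)"
proof
  assume f: "f \<in> L2R M"
  then have "integrable M (\<lambda>x. (cmod (complex_of_real (f x)))\<^sup>2)"
    unfolding L2R_def by (blast dest: L2_integrable)
  then show "f \<in> borel_measurable M \<and> integrable M (\<lambda>x. (f x)\<^sup>2)"
    using L2R_measurable[OF f] by simp
next
  assume "f \<in> borel_measurable M \<and> integrable M (\<lambda>x. (f x)\<^sup>2)"
  then show "f \<in> L2R M"
    by (auto simp: L2R_def L2_def intro: borel_measurable_of_real)
qed

lemma L2R_zero: "(\<lambda>x. 0) \<in> L2R M"
  using L2_zero by (simp add: L2R_def)

lemma L2R_add: "f \<in> L2R M \<Longrightarrow> g \<in> L2R M \<Longrightarrow> (\<lambda>x. f x + g x) \<in> L2R M"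
  using L2_add[of "\<lambda>x. complex_of_real (f x)" M "\<lambda>x. complex_of_real (g x)"] by (simp add: L2R_def)

lemma L2R_scale: "f \<in> L2R M \<Longrightarrow> (\<lambda>x. c * f x) \<in> L2R M"
  using L2_scale[of "\<lambda>x. complex_of_real (f x)" M "complex_of_real c"] by (simp add: L2R_def)

lemma L2R_sum: "(\<And>i. i \<in> A \<Longrightarrow> f i \<in> L2R M) \<Longrightarrow> (\<lambda>x. \<Sum>i\<in>A. f i x) \<in> L2R M"
  by (induction A rule: infinite_finite_induct) (auto simp: L2R_zero intro!: L2R_add)

lemma L2R_mult_integrable:
  assumes "f \<in> L2R M" "g \<in> L2R M" shows "integrable M (\<lambda>x. f x * g x)"
proof -
  have "integrable M (\<lambda>x. Re (complex_of_real (f x) * complex_of_real (g x)))"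
    using assms by (intro integrable_Re L2_mult_integrable) (auto simp: L2R_def)
  then show ?thesis by simp
qed

lemma rip_sum_left:
  assumes "\<And>j. j \<in> A \<Longrightarrow> f j \<in> L2R M" "g \<in> L2R M"
  shows "rip M (\<lambda>x. \<Sum>j\<in>A. a j * f j x) g = (\<Sum>j\<in>A. a j * rip M (f j) g)"
proof -
  have "rip M (\<lambda>x. \<Sum>j\<in>A. a j * f j x) g = (\<integral>x. (\<Sum>j\<in>A. a j * (f j x * g x)) \<partial>M)"
    unfolding rip_def by (simp add: sum_distrib_right mult.assoc)
  also have "\<dots> = (\<Sum>j\<in>A. \<integral>x. a j * (f j x * g x) \<partial>M)"
    by (intro Bochner_Integration.integral_sum Bochner_Integration.integrable_mult_right L2R_mult_integrable assms)
  finally show ?thesis by (simp add: rip_def)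
qed

lemma rip_diff_left:
  assumes "f \<in> L2R M" "h \<in> L2R M" "g \<in> L2R M"
  shows "rip M (\<lambda>x. f x - h x) g = rip M f g - rip M h g"
  unfolding rip_def left_diff_distrib
  by (intro Bochner_Integration.integral_diff L2R_mult_integrable assms)

lemma rip_commute: "rip M f g = rip M g f"
  by (simp add: rip_def mult.commute)

lemma rip_self_eq_0:
  assumes "f \<in> L2R M" shows "rip M f f = 0 \<longleftrightarrow> (AE x in M. f x = 0)"
proof -
  have "rip M f f = 0 \<longleftrightarrow> (AE x in M. f x * f x = 0)"
    unfolding rip_def using L2R_mult_integrable[OF assms assms]
    by (subst integral_nonneg_eq_0_iff_AE) auto
  then show ?thesis by simp
qed

text \<open>Zero vectors are allowed because Gram-Schmidt is run on families that may be linearly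
  dependent. Keeping the null outputs leaves the numbering by natural numbers, and with it the
  degrees, aligned with the input.\<close>

definition orthonormal_or_zero :: "'a measure \<Rightarrow> (nat \<Rightarrow> 'a \<Rightarrow> real) \<Rightarrow> bool" where
  "orthonormal_or_zero M e \<longleftrightarrow> (\<forall>i. e i \<in> L2R M) \<and> (\<forall>i j. i \<noteq> j \<longrightarrow> rip M (e i) (e j) = 0) \<and>
     (\<forall>i. rip M (e i) (e i) = 0 \<or> rip M (e i) (e i) = 1)"

section \<open>Gram-Schmidt orthonormalisation of a sequence\<close>

definition normalized :: "'a measure \<Rightarrow> ('a \<Rightarrow> real) \<Rightarrow> 'a \<Rightarrow> real" where
  "normalized M v x = (if rip M v v = 0 then 0 else 1 / sqrt (rip M v v)) * v x"

fun gram_schmidt :: "'a measure \<Rightarrow> (nat \<Rightarrow> 'a \<Rightarrow> real) \<Rightarrow> nat \<Rightarrow> 'a \<Rightarrow> real" where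
  "gram_schmidt M g i = normalized M
     (\<lambda>x. g i x - (\<Sum>j<i. rip M (g i) (gram_schmidt M g j) * gram_schmidt M g j x))"

declare gram_schmidt.simps [simp del]

lemma rip_nonneg: "0 \<le> rip M f f"
  by (simp add: rip_def)

lemma L2R_normalized: "v \<in> L2R M \<Longrightarrow> normalized M v \<in> L2R M"
  unfolding normalized_def by (rule L2R_scale)

lemma rip_normalized: "rip M (normalized M v) (normalized M v) = (if rip M v v = 0 then 0 else 1)"
proof -
  define c where "c = (if rip M v v = 0 then 0 else 1 / sqrt (rip M v v))"
  have "rip M (normalized M v) (normalized M v) = (\<integral>x. c\<^sup>2 * (v x * v x) \<partial>M)"
    unfolding rip_def[of M "normalized M v"] normalized_def c_def[symmetric] by (simp add: power2_eq_square mult_ac)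
  also have "\<dots> = c\<^sup>2 * rip M v v" by (simp add: rip_def)
  finally show ?thesis by (simp add: c_def power_divide rip_nonneg)
qed

lemma gram_schmidt_props:
  assumes g: "\<And>i. g i \<in> L2R M"
  shows "gram_schmidt M g i \<in> L2R M \<and> (\<forall>j<i. rip M (gram_schmidt M g i) (gram_schmidt M g j) = 0) \<and>
    (rip M (gram_schmidt M g i) (gram_schmidt M g i) = 0 \<or> rip M (gram_schmidt M g i) (gram_schmidt M g i) = 1)"
proof (induction i rule: less_induct)
  case (less i)
  let ?e = "gram_schmidt M g"
  define v where "v x = g i x - (\<Sum>j<i. rip M (g i) (?e j) * ?e j x)" for x
  have e: "?e i = normalized M v"
    by (subst gram_schmidt.simps) (simp add: v_def[abs_def])
  have S: "(\<lambda>x. \<Sum>j<i. rip M (g i) (?e j) * ?e j x) \<in> L2R M"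
    using less by (intro L2R_sum L2R_scale) auto
  have v: "v \<in> L2R M"
    using L2R_add[OF g[of i] L2R_scale[OF S, of "-1"]] by (simp add: v_def[abs_def])
  have "rip M v (?e k) = 0" if k: "k < i" for k
  proof -
    have ek: "?e k \<in> L2R M" using less k by blast
    have "rip M v (?e k) = rip M (g i) (?e k) - (\<Sum>j<i. rip M (g i) (?e j) * rip M (?e j) (?e k))"
      unfolding v_def[abs_def]
      by (subst rip_diff_left[OF g S ek], subst rip_sum_left) (use less ek in auto)
    also have "(\<Sum>j<i. rip M (g i) (?e j) * rip M (?e j) (?e k))
        = (\<Sum>j\<in>{k}. rip M (g i) (?e j) * rip M (?e j) (?e k))"
    proof (rule sum.mono_neutral_right)
      show "\<forall>j\<in>{..<i} - {k}. rip M (g i) (?e j) * rip M (?e j) (?e k) = 0"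
      proof
        fix j assume "j \<in> {..<i} - {k}"
        then have "rip M (?e j) (?e k) = 0"
          using less[of j] less[OF k] rip_commute[of M "?e j" "?e k"] by (cases "j < k") auto
        then show "rip M (g i) (?e j) * rip M (?e j) (?e k) = 0" by simp
      qed
    qed (use k in auto)
    also have "rip M (g i) (?e k) - \<dots> = 0"
    proof (cases "rip M (?e k) (?e k) = 0")
      case True
      then have "AE x in M. ?e k x = 0" using rip_self_eq_0[OF ek] by simp
      then have "rip M (g i) (?e k) = (\<integral>x. 0 \<partial>M)"
        unfolding rip_def
        using L2R_measurable[OF g[of i]] L2R_measurable[OF ek]
        by (intro integral_cong_AE) auto
      then show ?thesis by simp
    next
      case False
      then have "rip M (?e k) (?e k) = 1" using less[OF k] by auto
      then show ?thesis by simp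
    qed
    finally show ?thesis .
  qed
  moreover have "rip M (normalized M v) w = (if rip M v v = 0 then 0 else 1 / sqrt (rip M v v)) * rip M v w" for w
    by (simp add: normalized_def[abs_def] rip_def)
  ultimately show ?case
    unfolding e using L2R_normalized[OF v] rip_normalized[of M v] by auto
qed

lemma gram_schmidt_orthonormal:
  assumes g: "\<And>i. g i \<in> L2R M"
  shows "orthonormal_or_zero M (gram_schmidt M g)"
  unfolding orthonormal_or_zero_def
proof (intro conjI allI impI)
  fix i j :: nat assume "i \<noteq> j"
  then show "rip M (gram_schmidt M g i) (gram_schmidt M g j) = 0"
    using gram_schmidt_props[where g=g and M=M, OF g]
    by (metis nat_neq_iff rip_commute)
qed (use gram_schmidt_props[where g=g and M=M, OF g] in auto)

text \<open>Triangular inversion of the process. It holds only a.e.: a residual of norm 0 is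
  replaced by the zero function, with which it agrees up to a null set.\<close>

lemma gram_schmidt_span:
  assumes g: "\<And>i. g i \<in> L2R M"
  shows "\<exists>b. AE x in M. g i x = (\<Sum>j\<le>i. b j * gram_schmidt M g j x)"
proof -
  let ?e = "gram_schmidt M g"
  define v where "v x = g i x - (\<Sum>j<i. rip M (g i) (?e j) * ?e j x)" for x
  have e: "?e i = normalized M v"
    by (subst gram_schmidt.simps) (simp add: v_def[abs_def])
  have S: "(\<lambda>x. \<Sum>j<i. rip M (g i) (?e j) * ?e j x) \<in> L2R M"
    using gram_schmidt_props[where g=g and M=M, OF g] by (intro L2R_sum L2R_scale) auto
  have v: "v \<in> L2R M"
    using L2R_add[OF g[of i] L2R_scale[OF S, of "-1"]] by (simp add: v_def[abs_def])
  define b where "b j = (if j = i then sqrt (rip M v v) else rip M (g i) (?e j))" for j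
  have sum: "(\<Sum>j\<le>i. b j * ?e j x) = (\<Sum>j<i. rip M (g i) (?e j) * ?e j x) + sqrt (rip M v v) * ?e i x" for x
  proof -
    have "{..i} = insert i {..<i}" by auto
    then show ?thesis by (simp add: b_def)
  qed
  have "AE x in M. v x = sqrt (rip M v v) * ?e i x"
  proof (cases "rip M v v = 0")
    case True
    then show ?thesis using rip_self_eq_0[OF v] by simp
  qed (simp add: e normalized_def)
  then have "AE x in M. g i x = (\<Sum>j\<le>i. b j * ?e j x)"
    unfolding sum by eventually_elim (simp add: v_def)
  then show ?thesis by blast
qed

text \<open>Projections onto outputs of another degree vanish by orthogonality, so each output stays
  in the piece of its input. With harmonics the grading is the degree; with a one-point index set
  the lemma says that an invariant linear space is not left.\<close>

lemma gram_schmidt_graded: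
  assumes g: "\<And>i. g i \<in> V (deg i)"
    and zero: "\<And>l. (\<lambda>x. 0) \<in> V l"
    and lin: "\<And>l u w c. u \<in> V l \<Longrightarrow> w \<in> V l \<Longrightarrow> (\<lambda>x. u x + c * w x) \<in> V l"
    and orth: "\<And>k l u w. u \<in> V k \<Longrightarrow> w \<in> V l \<Longrightarrow> k \<noteq> l \<Longrightarrow> rip M u w = 0"
  shows "gram_schmidt M g i \<in> V (deg i)"
proof (induction i rule: less_induct)
  case (less i)
  let ?e = "gram_schmidt M g"
  define v where "v x = g i x - (\<Sum>j<i. rip M (g i) (?e j) * ?e j x)" for x
  have e: "?e i = normalized M v"
    by (subst gram_schmidt.simps) (simp add: v_def[abs_def])
  \<comment> \<open>Generalised from all indices below i to any finite subset, so that summands can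
    be added one at a time.\<close>
  have "(\<lambda>x. \<Sum>j\<in>A. rip M (g i) (?e j) * ?e j x) \<in> V (deg i)" if "finite A" "A \<subseteq> {..<i}" for A
    using that
  proof (induction A)
    case (insert j A)
    show ?case
    proof (cases "deg j = deg i")
      case True
      with less[of j] insert have "?e j \<in> V (deg i)" by auto
      from lin[OF _ this, of "\<lambda>x. \<Sum>j\<in>A. rip M (g i) (?e j) * ?e j x" "rip M (g i) (?e j)"] insert
      show ?thesis by (simp add: add.commute)
    next
      case False
      with less[of j] insert have "rip M (g i) (?e j) = 0" by (intro orth[OF g]) auto
      then show ?thesis using insert by simp
    qed
  qed (simp add: zero)
  from lin[OF g this[OF _ order_refl], of "-1"] have v: "v \<in> V (deg i)"
    by (simp add: v_def[abs_def])
  from lin[OF zero v] show ?case unfolding e normalized_def by simp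
qed

section \<open>Coefficients, Bessel's identity and Parseval\<close>

definition coef :: "'a measure \<Rightarrow> ('a \<Rightarrow> real) \<Rightarrow> ('a \<Rightarrow> complex) \<Rightarrow> complex" where
  "coef M e f = (\<integral>x. f x * complex_of_real (e x) \<partial>M)"

lemma coef_integrable: "f \<in> L2 M \<Longrightarrow> e \<in> L2R M \<Longrightarrow> integrable M (\<lambda>x. f x * complex_of_real (e x))"
  by (intro L2_mult_integrable) (auto simp: L2R_def)

lemma coef_sub_scale:
  assumes "f \<in> L2 M" "h \<in> L2R M" "e \<in> L2R M"
  shows "coef M e (\<lambda>x. f x - c * complex_of_real (h x)) = coef M e f - c * complex_of_real (rip M h e)"
proof -
  have "coef M e (\<lambda>x. f x - c * complex_of_real (h x))
    = (\<integral>x. f x * complex_of_real (e x) - c * complex_of_real (h x * e x) \<partial>M)"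
    unfolding coef_def by (simp add: left_diff_distrib mult.assoc)
  also have "\<dots> = coef M e f - (\<integral>x. c * complex_of_real (h x * e x) \<partial>M)"
    unfolding coef_def
    by (intro Bochner_Integration.integral_diff coef_integrable assms
        Bochner_Integration.integrable_mult_right integrable_of_real L2R_mult_integrable)
  finally show ?thesis by (simp add: rip_def del: of_real_mult)
qed

lemma coef_cong_AE:
  assumes "AE x in M. f x = g x" "f \<in> borel_measurable M" "g \<in> borel_measurable M" "e \<in> borel_measurable M"
  shows "coef M e f = coef M e g"
  unfolding coef_def using assms by (intro integral_cong_AE) auto

lemma L2norm_sub_scale:
  assumes f: "f \<in> L2 M" and e: "e \<in> L2R M"
  shows "(L2norm M (\<lambda>x. f x - c * complex_of_real (e x)))\<^sup>2
    = (L2norm M f)\<^sup>2 - 2 * Re (cnj c * coef M e f) + (cmod c)\<^sup>2 * rip M e e"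
proof -
  have *: "(cmod (a - c * complex_of_real t))\<^sup>2
      = (cmod a)\<^sup>2 - 2 * Re (cnj c * (a * complex_of_real t)) + (cmod c)\<^sup>2 * (t * t)" for a t
    unfolding cmod_power2 by (simp add: power2_eq_square algebra_simps)
  have i: "integrable M (\<lambda>x. cnj c * (f x * complex_of_real (e x)))"
    by (intro Bochner_Integration.integrable_mult_right coef_integrable assms)
  have "(\<integral>x. 2 * Re (cnj c * (f x * complex_of_real (e x))) \<partial>M) = 2 * Re (cnj c * coef M e f)"
    using integral_Re[OF i] unfolding coef_def
    by (simp only: Bochner_Integration.integral_mult_right_zero)
  moreover have "(L2norm M (\<lambda>x. f x - c * complex_of_real (e x)))\<^sup>2 = (L2norm M f)\<^sup>2
      - (\<integral>x. 2 * Re (cnj c * (f x * complex_of_real (e x))) \<partial>M) + (cmod c)\<^sup>2 * rip M e e"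
  proof -
    note I = L2_integrable[OF f] Bochner_Integration.integrable_mult_right[OF integrable_Re[OF i], of 2]
    show ?thesis
      unfolding L2norm_sq * rip_def
      by (subst Bochner_Integration.integral_add[OF Bochner_Integration.integrable_diff[OF I]],
          use L2R_mult_integrable[OF e e] in simp,
          subst Bochner_Integration.integral_diff[OF I]) simp
  qed
  ultimately show ?thesis by simp
qed

lemma coef_eq_0: "e \<in> L2R M \<Longrightarrow> f \<in> borel_measurable M \<Longrightarrow> rip M e e = 0 \<Longrightarrow> coef M e f = 0"
proof -
  assume e: "e \<in> L2R M" "f \<in> borel_measurable M" "rip M e e = 0"
  then have "AE x in M. e x = 0" using rip_self_eq_0 by blast
  then have "coef M e f = (\<integral>x. 0 \<partial>M)"
    unfolding coef_def using e L2R_measurable[OF e(1)] by (intro integral_cong_AE) auto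
  then show ?thesis by simp
qed

text \<open>One component is subtracted at a time. For a zero basis vector the coefficient is 0 as
  well, so the formulas for orthonormal vectors persist unchanged.\<close>

lemma bessel_identity:
  assumes e: "orthonormal_or_zero M e" and f: "f \<in> L2 M"
  defines "S \<equiv> \<lambda>N x. \<Sum>i<N. coef M (e i) f * complex_of_real (e i x)"
  shows "S N \<in> L2 M"
    and "coef M (e j) (\<lambda>x. f x - S N x) = (if j < N then 0 else coef M (e j) f)"
    and "(L2norm M (\<lambda>x. f x - S N x))\<^sup>2 = (L2norm M f)\<^sup>2 - (\<Sum>i<N. (cmod (coef M (e i) f))\<^sup>2)"
proof -
  have eL: "e i \<in> L2R M" for i using e by (simp add: orthonormal_or_zero_def)
  have S: "S N \<in> L2 M" for N
    unfolding S_def by (intro L2_sum L2_scale) (use eL in \<open>auto simp: L2R_def\<close>)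
  show "S N \<in> L2 M" by fact
  have SucS: "f x - S (Suc N) x = (f x - S N x) - coef M (e N) f * complex_of_real (e N x)" for N x
    by (simp add: S_def)
  have c: "coef M (e j) (\<lambda>x. f x - S N x) = (if j < N then 0 else coef M (e j) f)" for j N
  proof (induction N)
    case (Suc N)
    have "coef M (e j) (\<lambda>x. f x - S (Suc N) x)
        = coef M (e j) (\<lambda>x. f x - S N x) - coef M (e N) f * complex_of_real (rip M (e N) (e j))"
      unfolding SucS by (rule coef_sub_scale[OF L2_diff[OF f S] eL eL])
    also have "\<dots> = (if j < Suc N then 0 else coef M (e j) f)"
    proof (cases "j = N")
      case True
      have "rip M (e N) (e N) = 0 \<or> rip M (e N) (e N) = 1" using e by (simp add: orthonormal_or_zero_def)
      then show ?thesis
      proof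
        assume 0: "rip M (e N) (e N) = 0"
        show ?thesis using True 0 coef_eq_0[OF eL L2_measurable[OF L2_diff[OF f S]] 0] coef_eq_0[OF eL L2_measurable[OF f] 0] by simp
      qed (use Suc.IH True in \<open>cases "j < N"; simp\<close>)
    next
      case False
      then have "rip M (e N) (e j) = 0" using e by (simp add: orthonormal_or_zero_def)
      then show ?thesis using False by (simp add: Suc.IH less_Suc_eq)
    qed
    finally show ?case .
  qed (simp add: S_def)
  then show "coef M (e j) (\<lambda>x. f x - S N x) = (if j < N then 0 else coef M (e j) f)" .
  show "(L2norm M (\<lambda>x. f x - S N x))\<^sup>2 = (L2norm M f)\<^sup>2 - (\<Sum>i<N. (cmod (coef M (e i) f))\<^sup>2)"
  proof (induction N)
    case (Suc N)
    have "(L2norm M (\<lambda>x. f x - S (Suc N) x))\<^sup>2 = (L2norm M (\<lambda>x. f x - S N x))\<^sup>2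
        - 2 * Re (cnj (coef M (e N) f) * coef M (e N) (\<lambda>x. f x - S N x))
        + (cmod (coef M (e N) f))\<^sup>2 * rip M (e N) (e N)"
      unfolding SucS by (rule L2norm_sub_scale[OF L2_diff[OF f S] eL])
    also have "coef M (e N) (\<lambda>x. f x - S N x) = coef M (e N) f" using c by simp
    also have "Re (cnj (coef M (e N) f) * coef M (e N) f) = (cmod (coef M (e N) f))\<^sup>2"
      unfolding cmod_power2 by (simp add: power2_eq_square)
    also have "(cmod (coef M (e N) f))\<^sup>2 * rip M (e N) (e N) = (cmod (coef M (e N) f))\<^sup>2"
    proof -
      have "rip M (e N) (e N) = 0 \<or> rip M (e N) (e N) = 1" using e by (simp add: orthonormal_or_zero_def)
      then show ?thesis
      proof
        assume 0: "rip M (e N) (e N) = 0"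
        show ?thesis using coef_eq_0[OF eL L2_measurable[OF f] 0] by simp
      qed simp
    qed
    finally show ?case using Suc by simp
  qed (simp add: S_def)
qed

text \<open>The product under the integral is bounded by t e^2 + |F - f|^2 / t with t > 0 free, in
  place of Cauchy-Schwarz; t is fixed first, then k is taken large.\<close>

lemma coef_limit:
  assumes F: "\<And>k. F k \<in> L2 M" "f \<in> L2 M" and e: "e \<in> L2R M"
    and lim: "L2_tendsto M F f sequentially"
  shows "(\<lambda>k. coef M e (F k)) \<longlonglongrightarrow> coef M e f"
proof -
  have eL: "(\<lambda>x. complex_of_real (e x)) \<in> L2 M" using e by (simp add: L2R_def)
  have "cmod (coef M e (F k) - coef M e f) \<le> t * rip M e e + (L2norm M (\<lambda>x. F k x - f x))\<^sup>2 / t"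
    if t: "t > 0" for k t
  proof -
    have d: "(\<lambda>x. F k x - f x) \<in> L2 M" using F by (intro L2_diff)
    have "coef M e (F k) - coef M e f = (\<integral>x. (F k x - f x) * complex_of_real (e x) \<partial>M)"
      unfolding coef_def left_diff_distrib
      by (intro Bochner_Integration.integral_diff[symmetric] coef_integrable F e)
    also have "cmod \<dots> \<le> (\<integral>x. t * (e x * e x) + (cmod (F k x - f x))\<^sup>2 / t \<partial>M)"
    proof (rule norm_integral_le)
      show "integrable M (\<lambda>x. t * (e x * e x) + (cmod (F k x - f x))\<^sup>2 / t)"
        using L2_integrable[OF d] L2R_mult_integrable[OF e e] by auto
      fix x
      have "0 \<le> (sqrt t * \<bar>e x\<bar> - cmod (F k x - f x) / sqrt t)\<^sup>2" by simp
      also have "\<dots> = t * (e x * e x) - 2 * (cmod (F k x - f x) * \<bar>e x\<bar>) + (cmod (F k x - f x))\<^sup>2 / t"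
        using t by (simp add: power2_diff power_mult_distrib power_divide) (simp add: power2_eq_square)
      finally have "2 * (cmod (F k x - f x) * \<bar>e x\<bar>) \<le> t * (e x * e x) + (cmod (F k x - f x))\<^sup>2 / t" by simp
      moreover have "0 \<le> cmod (F k x - f x) * \<bar>e x\<bar>" by simp
      ultimately show "norm ((F k x - f x) * complex_of_real (e x)) \<le> t * (e x * e x) + (cmod (F k x - f x))\<^sup>2 / t"
        unfolding norm_mult norm_of_real by linarith
    qed (rule coef_integrable[OF d e])
    also have "\<dots> = t * rip M e e + (L2norm M (\<lambda>x. F k x - f x))\<^sup>2 / t"
      unfolding rip_def L2norm_sq using L2_integrable[OF d] L2R_mult_integrable[OF e e]
      by (subst Bochner_Integration.integral_add) auto
    finally show ?thesis .
  qed
  note bound = this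
  have "(\<lambda>k. ennreal ((L2norm M (\<lambda>x. F k x - f x))\<^sup>2)) \<longlonglongrightarrow> ennreal 0"
    using lim unfolding L2_tendsto_nsq by (subst (asm) nsq_eq_L2norm[OF L2_diff[OF F]]) auto
  then have sq: "(\<lambda>k. (L2norm M (\<lambda>x. F k x - f x))\<^sup>2) \<longlonglongrightarrow> 0"
    by (subst (asm) tendsto_ennreal_iff) auto
  show ?thesis
  proof (rule LIM_zero_cancel, rule tendstoI)
    fix d :: real assume d: "0 < d"
    \<comment> \<open>Makes the first of the two terms at most d/2; the summand 1 guards against a
      basis function of norm 0.\<close>
    define t where "t = d / (2 * (rip M e e + 1))"
    have pos: "rip M e e + 1 > 0" using rip_nonneg[of M e] by linarith
    have t: "t > 0" using d pos by (simp add: t_def)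
    have "t * rip M e e \<le> t * (rip M e e + 1)" using t by simp
    also have "\<dots> = d / 2" using pos by (simp add: t_def field_simps)
    finally have t1: "t * rip M e e \<le> d / 2" .
    have "\<forall>\<^sub>F k in sequentially. (L2norm M (\<lambda>x. F k x - f x))\<^sup>2 < t * d / 2"
      using sq by (rule order_tendstoD) (use t d in auto)
    then show "\<forall>\<^sub>F k in sequentially. dist (coef M e (F k) - coef M e f) 0 < d"
    proof eventually_elim
      case (elim k)
      have "(L2norm M (\<lambda>x. F k x - f x))\<^sup>2 / t < d / 2"
        using elim t by (simp add: pos_divide_less_eq mult.commute)
      with bound[OF t, of k] t1 have "cmod (coef M e (F k) - coef M e f) < d" by linarith
      then show ?case by simp
    qed
  qed
qed

text \<open>Partial sums are Cauchy by Bessel, so they have a limit g in L2. All coefficients of f -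
  g vanish, and totality identifies g with f.\<close>

lemma parseval:
  assumes e: "orthonormal_or_zero M e" and f: "f \<in> L2 M"
    and total: "\<And>h. h \<in> L2 M \<Longrightarrow> (\<And>i. coef M (e i) h = 0) \<Longrightarrow> AE x in M. h x = 0"
  shows "L2_tendsto M (\<lambda>N x. \<Sum>i<N. coef M (e i) f * complex_of_real (e i x)) f sequentially"
    and "(\<lambda>i. (cmod (coef M (e i) f))\<^sup>2) sums (L2norm M f)\<^sup>2"
    and "nsq M f = (\<Sum>i. ennreal ((cmod (coef M (e i) f))\<^sup>2))"
proof -
  have eL: "e i \<in> L2R M" for i using e by (simp add: orthonormal_or_zero_def)
  define S where "S N x = (\<Sum>i<N. coef M (e i) f * complex_of_real (e i x))" for N x
  note B = bessel_identity[OF e f, folded S_def]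
  have Sl: "S N \<in> L2 M" for N using B(1) by (simp add: S_def[abs_def])
  have le: "(\<Sum>i<N. (cmod (coef M (e i) f))\<^sup>2) \<le> (L2norm M f)\<^sup>2" for N
    using B(3)[of N] zero_le_power2[of "L2norm M (\<lambda>x. f x - S N x)"] by linarith
  have summ: "summable (\<lambda>i. (cmod (coef M (e i) f))\<^sup>2)"
    by (rule summableI_nonneg_bounded[OF _ le]) auto
  have SD: "(L2norm M (\<lambda>x. S N' x - S N x))\<^sup>2 = (\<Sum>i\<in>{N..<N'}. (cmod (coef M (e i) f))\<^sup>2)" if "N \<le> N'" for N N'
    using that
  proof (induction N' rule: dec_induct)
    case base
    show ?case by (simp add: L2norm_def)
  next
    case (step n)
    have 1: "coef M (e n) (\<lambda>x. S n x - S N x) = 0"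
    proof -
      have "coef M (e n) (\<lambda>x. S n x - S N x)
          = coef M (e n) (\<lambda>x. (f x - S N x) - (f x - S n x))" by simp
      also have "\<dots> = coef M (e n) (\<lambda>x. f x - S N x) - coef M (e n) (\<lambda>x. f x - S n x)"
        unfolding coef_def left_diff_distrib[of "f _ - S N _"]
        by (intro Bochner_Integration.integral_diff coef_integrable L2_diff f Sl eL)
      also have "\<dots> = 0" using B(2) step(1) by simp
      finally show ?thesis .
    qed
    have "(L2norm M (\<lambda>x. S (Suc n) x - S N x))\<^sup>2
      = (L2norm M (\<lambda>x. (S n x - S N x) - (- coef M (e n) f) * complex_of_real (e n x)))\<^sup>2"
      by (simp add: S_def algebra_simps)
    also have "\<dots> = (L2norm M (\<lambda>x. S n x - S N x))\<^sup>2 + (cmod (coef M (e n) f))\<^sup>2 * rip M (e n) (e n)"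
      by (subst L2norm_sub_scale[OF L2_diff[OF Sl Sl] eL]) (simp add: 1)
    also have "(cmod (coef M (e n) f))\<^sup>2 * rip M (e n) (e n) = (cmod (coef M (e n) f))\<^sup>2"
    proof -
      have "rip M (e n) (e n) = 0 \<or> rip M (e n) (e n) = 1" using e by (simp add: orthonormal_or_zero_def)
      then show ?thesis
      proof
        assume 0: "rip M (e n) (e n) = 0"
        show ?thesis using coef_eq_0[OF eL L2_measurable[OF f] 0] by simp
      qed simp
    qed
    finally show ?case using step by simp
  qed
  have "\<exists>g\<in>L2 M. L2_tendsto M S g sequentially"
  proof (rule L2_complete[OF Sl])
    fix d :: real assume d: "0 < d"
    obtain N where N: "\<And>m n. m \<ge> N \<Longrightarrow> norm (\<Sum>i=m..<n. (cmod (coef M (e i) f))\<^sup>2) < d"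
      using summ d unfolding summable_Cauchy by meson
    have le1: "nsq M (\<lambda>x. S m x - S k x) \<le> ennreal d" if "m \<ge> k" "k \<ge> N" for m k
      unfolding nsq_eq_L2norm[OF L2_diff[OF Sl Sl]] SD[OF that(1)]
      using N[OF that(2), of m] by (intro ennreal_leI) auto
    show "\<exists>N. \<forall>m\<ge>N. \<forall>k\<ge>N. nsq M (\<lambda>x. S m x - S k x) \<le> ennreal d"
    proof (intro exI[of _ N] allI impI)
      fix m k assume mk: "N \<le> m" "N \<le> k"
      show "nsq M (\<lambda>x. S m x - S k x) \<le> ennreal d"
      proof (cases "k \<le> m")
        case False
        then show ?thesis using le1[of m k] mk by (subst nsq_diff_commute) (auto intro: le1)
      qed (use mk in \<open>auto intro: le1\<close>)
    qed
  qed
  then obtain g where g: "g \<in> L2 M" "L2_tendsto M S g sequentially" by blast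
  have "AE x in M. f x - g x = 0"
  proof (rule total)
    show fg: "(\<lambda>x. f x - g x) \<in> L2 M" using f g by (intro L2_diff)
    fix j
    have "L2_tendsto M (\<lambda>N x. f x - S N x) (\<lambda>x. f x - g x) sequentially"
      using g(2) unfolding L2_tendsto_nsq by (subst (asm) nsq_diff_commute) simp
    then have "(\<lambda>N. coef M (e j) (\<lambda>x. f x - S N x)) \<longlonglongrightarrow> coef M (e j) (\<lambda>x. f x - g x)"
      by (intro coef_limit eL L2_diff f Sl fg)
    moreover have "(\<lambda>N. coef M (e j) (\<lambda>x. f x - S N x)) \<longlonglongrightarrow> 0"
      by (rule tendsto_eventually, rule eventually_mono[OF eventually_gt_at_top[of j]]) (simp add: B(2))
    ultimately show "coef M (e j) (\<lambda>x. f x - g x) = 0" using LIMSEQ_unique by blast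
  qed
  then have fg: "AE x in M. f x = g x" by eventually_elim simp
  have lim: "L2_tendsto M S f sequentially"
    unfolding L2_tendsto_nsq
  proof -
    have "nsq M (\<lambda>x. S k x - f x) = nsq M (\<lambda>x. S k x - g x)" for k
      by (rule nsq_cong_AE, use fg in eventually_elim) simp
    then show "(\<lambda>k. nsq M (\<lambda>x. S k x - f x)) \<longlonglongrightarrow> 0" using g(2) by (simp add: L2_tendsto_nsq)
  qed
  then show "L2_tendsto M (\<lambda>N x. \<Sum>i<N. coef M (e i) f * complex_of_real (e i x)) f sequentially"
    by (simp add: S_def[abs_def])
  have "(\<lambda>N. ennreal ((L2norm M (\<lambda>x. f x - S N x))\<^sup>2)) \<longlonglongrightarrow> ennreal 0"
    using lim unfolding L2_tendsto_nsq
    by (subst (asm) nsq_diff_commute) (simp add: nsq_eq_L2norm[OF L2_diff[OF f Sl]])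
  then have "(\<lambda>N. (L2norm M (\<lambda>x. f x - S N x))\<^sup>2) \<longlonglongrightarrow> 0"
    by (subst (asm) tendsto_ennreal_iff) auto
  then have "(\<lambda>N. (L2norm M f)\<^sup>2 - (L2norm M (\<lambda>x. f x - S N x))\<^sup>2) \<longlonglongrightarrow> (L2norm M f)\<^sup>2 - 0"
    by (intro tendsto_intros)
  then show sums: "(\<lambda>i. (cmod (coef M (e i) f))\<^sup>2) sums (L2norm M f)\<^sup>2"
    unfolding sums_def B(3) by simp
  show "nsq M f = (\<Sum>i. ennreal ((cmod (coef M (e i) f))\<^sup>2))"
    unfolding nsq_eq_L2norm[OF f]
    by (subst suminf_ennreal2[OF _ summ]) (use sums_unique[OF sums] in auto)
qed

text \<open>Used to transfer totality: a function orthogonal to every output is orthogonal to every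
  input, since inputs are a.e. finite combinations of outputs.\<close>

lemma gram_schmidt_total:
  assumes g: "\<And>i. g i \<in> L2R M" and h: "h \<in> L2 M" and zero: "\<And>i. coef M (gram_schmidt M g i) h = 0"
  shows "coef M (g i) h = 0"
proof -
  let ?e = "gram_schmidt M g"
  have eL: "?e j \<in> L2R M" for j using gram_schmidt_orthonormal[of g M] g by (simp add: orthonormal_or_zero_def)
  obtain b where b: "AE x in M. g i x = (\<Sum>j\<le>i. b j * ?e j x)"
    using gram_schmidt_span[of g M i] g by blast
  note [measurable] = L2R_measurable[OF eL] L2_measurable[OF h] L2R_measurable[OF g]
  have "coef M (g i) h = (\<integral>x. (\<Sum>j\<le>i. complex_of_real (b j) * (h x * complex_of_real (?e j x))) \<partial>M)"
    unfolding coef_def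
    by (intro integral_cong_AE, measurable) (use b in eventually_elim, simp add: sum_distrib_left mult_ac)
  also have "\<dots> = (\<Sum>j\<le>i. complex_of_real (b j) * coef M (?e j) h)"
    unfolding coef_def by (subst Bochner_Integration.integral_sum) (auto intro!: coef_integrable h eL)
  finally show ?thesis by (simp add: zero)
qed

section \<open>Uniqueness from polynomial moments\<close>

text \<open>Stone-Weierstrass on the compact set K: a uniform error e of the approximating
  polynomial costs at most e times the integral of |G|.\<close>

lemma integral_continuous_eq_0:
  fixes T :: "'a \<Rightarrow> 'b::euclidean_space" and G :: "'a \<Rightarrow> real"
  assumes G: "integrable M G" and [measurable]: "T \<in> borel_measurable M"
    and K: "compact K" "\<And>x. x \<in> space M \<Longrightarrow> T x \<in> K"
    and mom: "\<And>p. real_polynomial_function p \<Longrightarrow> (\<integral>x. G x * p (T x) \<partial>M) = 0"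
    and c: "continuous_on UNIV c"
  shows "(\<integral>x. G x * c (T x) \<partial>M) = (0::real)"
proof -
  have [measurable]: "c \<in> borel_measurable borel"
    using c by (rule borel_measurable_continuous_onI)
  have contK: "continuous_on K c" using c continuous_on_subset by blast
  have int: "integrable M (\<lambda>x. G x * q (T x))" if "continuous_on UNIV q" for q :: "'b \<Rightarrow> real"
  proof -
    have [measurable]: "q \<in> borel_measurable borel"
      using that by (rule borel_measurable_continuous_onI)
    have "bounded (q ` K)"
      using K(1) that by (intro compact_imp_bounded compact_continuous_image) (auto intro: continuous_on_subset)
    then obtain B where B: "\<And>y. y \<in> K \<Longrightarrow> \<bar>q y\<bar> \<le> B"
      unfolding bounded_iff by (auto simp del: abs_le_iff) 
    show ?thesis
    proof (rule Bochner_Integration.integrable_bound)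
      show "integrable M (\<lambda>x. B * G x)" using G by simp
      show "(\<lambda>x. G x * q (T x)) \<in> borel_measurable M" using G by measurable
      show "AE x in M. norm (G x * q (T x)) \<le> norm (B * G x)"
      proof (rule AE_I2)
        fix x assume "x \<in> space M"
        then have "\<bar>q (T x)\<bar> \<le> \<bar>B\<bar>" using B[OF K(2)] by (meson abs_ge_self order_trans)
        then show "norm (G x * q (T x)) \<le> norm (B * G x)"
          using mult_right_mono[of "\<bar>q (T x)\<bar>" "\<bar>B\<bar>" "\<bar>G x\<bar>"] by (simp add: abs_mult mult.commute)
      qed
    qed
  qed
  have "\<bar>\<integral>x. G x * c (T x) \<partial>M\<bar> \<le> e * (\<integral>x. \<bar>G x\<bar> \<partial>M)" if e: "e > 0" for e
  proof -
    obtain p where p: "real_polynomial_function p" "\<And>y. y \<in> K \<Longrightarrow> \<bar>c y - p y\<bar> < e"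
      using Stone_Weierstrass_real_polynomial_function[OF K(1) contK e] by blast
    have cp: "continuous_on UNIV p"
      using p(1) by (simp add: continuous_on_polymonial_function real_polynomial_function_eq)
    have "(\<integral>x. G x * c (T x) \<partial>M) = (\<integral>x. G x * c (T x) \<partial>M) - (\<integral>x. G x * p (T x) \<partial>M)"
      using mom[OF p(1)] by simp
    also have "\<dots> = (\<integral>x. G x * c (T x) - G x * p (T x) \<partial>M)"
      by (rule Bochner_Integration.integral_diff[symmetric]) (intro int c cp)+
    also have "norm \<dots> \<le> (\<integral>x. e * \<bar>G x\<bar> \<partial>M)"
    proof (rule norm_integral_le)
      show "integrable M (\<lambda>x. G x * c (T x) - G x * p (T x))"
        by (intro Bochner_Integration.integrable_diff int c cp)
      show "integrable M (\<lambda>x. e * \<bar>G x\<bar>)" using G by simp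
      fix x assume "x \<in> space M"
      then have "\<bar>c (T x) - p (T x)\<bar> \<le> e" using p(2)[OF K(2)] by (simp add: less_imp_le)
      then show "norm (G x * c (T x) - G x * p (T x)) \<le> e * \<bar>G x\<bar>"
        unfolding right_diff_distrib[symmetric] using mult_right_mono[of "\<bar>c (T x) - p (T x)\<bar>" e "\<bar>G x\<bar>"] by (simp add: abs_mult mult.commute)
    qed
    finally show ?thesis by simp
  qed
  note bound = this
  define I where "I = (\<integral>x. \<bar>G x\<bar> \<partial>M)"
  have "\<bar>\<integral>x. G x * c (T x) \<partial>M\<bar> \<le> 0"
  proof (rule field_le_epsilon)
    fix d :: real assume d: "0 < d"
    have I: "I \<ge> 0" by (simp add: I_def)
    have "d / (I + 1) * I \<le> d"
      using d I by (simp add: pos_divide_le_eq field_simps)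
    then show "\<bar>\<integral>x. G x * c (T x) \<partial>M\<bar> \<le> 0 + d"
      using bound[of "d / (I + 1)"] d I unfolding I_def[symmetric] by fastforce
  qed
  then show ?thesis by simp
qed

text \<open>From continuous functions to indicators of closed sets by dominated convergence, and
  from there to Borel sets by Dynkin's theorem.\<close>

lemma integral_borel_eq_0:
  fixes T :: "'a \<Rightarrow> 'b::euclidean_space" and G :: "'a \<Rightarrow> real"
  assumes G: "integrable M G" and T[measurable]: "T \<in> borel_measurable M"
    and K: "compact K" "\<And>x. x \<in> space M \<Longrightarrow> T x \<in> K"
    and mom: "\<And>p. real_polynomial_function p \<Longrightarrow> (\<integral>x. G x * p (T x) \<partial>M) = 0"
    and B: "B \<in> sets borel"
  shows "(\<integral>x. G x * indicator B (T x) \<partial>M) = (0::real)"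
proof -
  have [measurable]: "G \<in> borel_measurable M" using G by simp
  have int: "integrable M (\<lambda>x. G x * indicator B (T x))" if [measurable]: "B \<in> sets borel" for B
    by (rule Bochner_Integration.integrable_bound[OF G]) (auto simp: indicator_def)
  have closed: "(\<integral>x. G x * indicator C (T x) \<partial>M) = 0" if C: "closed C" for C
  proof (cases "C = {}")
    case False
    \<comment> \<open>Continuous functions with values in [0,1] that decrease to the indicator of C,
      because a point outside the closed set has positive distance to it.\<close>
    define c where "c k y = max 0 (1 - real k * infdist y C)" for k y
    have cont: "continuous_on UNIV (c k)" for k
      unfolding c_def by (intro continuous_intros)
    have [measurable]: "c k \<in> borel_measurable borel" for k
      using cont by (rule borel_measurable_continuous_onI)
    have [measurable]: "C \<in> sets borel" using C by simp
    have "(\<lambda>k. \<integral>x. G x * c k (T x) \<partial>M) \<longlonglongrightarrow> (\<integral>x. G x * indicator C (T x) \<partial>M)"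
    proof (rule integral_dominated_convergence[where w="\<lambda>x. \<bar>G x\<bar>"])
      show "integrable M (\<lambda>x. \<bar>G x\<bar>)" using G by simp
      show "AE x in M. (\<lambda>k. G x * c k (T x)) \<longlonglongrightarrow> G x * indicator C (T x)"
      proof (intro AE_I2 tendsto_mult tendsto_const)
        fix x
        show "(\<lambda>k. c k (T x)) \<longlonglongrightarrow> indicator C (T x)"
        proof (cases "T x \<in> C")
          case True
          then show ?thesis by (simp add: c_def)
        next
          case F: False
          have d: "infdist (T x) C > 0"
            using F C False by (metis in_closed_iff_infdist_zero infdist_nonneg less_eq_real_def)
          have "\<forall>\<^sub>F k in sequentially. real k > 1 / infdist (T x) C"
            using filterlim_real_sequentially by (simp add: filterlim_at_top_dense)
          then have "\<forall>\<^sub>F k in sequentially. c k (T x) = 0"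
            by eventually_elim (use d in \<open>simp add: c_def pos_divide_less_eq\<close>)
          then show ?thesis using F by (simp add: tendsto_eventually)
        qed
      qed
      show "AE x in M. norm (G x * c k (T x)) \<le> \<bar>G x\<bar>" for k
      proof (rule AE_I2)
        fix x
        have "\<bar>c k (T x)\<bar> \<le> 1" by (auto simp: c_def infdist_nonneg)
        then show "norm (G x * c k (T x)) \<le> \<bar>G x\<bar>" by (simp add: abs_mult mult_left_le)
      qed
    qed measurable
    moreover have "(\<integral>x. G x * c k (T x) \<partial>M) = 0" for k
      by (rule integral_continuous_eq_0[OF G T K mom cont])
    ultimately show ?thesis by (simp add: LIMSEQ_const_iff)
  qed simp
  have "B \<in> sigma_sets UNIV (Collect closed)"
    using B by (simp add: borel_eq_closed sets_measure_of)
  have "Int_stable (Collect (closed :: 'b set \<Rightarrow> bool))" by (auto simp: Int_stable_def)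
  moreover have "Collect (closed :: 'b set \<Rightarrow> bool) \<subseteq> Pow UNIV" by simp
  ultimately show ?thesis using \<open>B \<in> sigma_sets UNIV (Collect closed)\<close>
  proof (induction B rule: sigma_sets_induct_disjoint)
    case (basic A)
    then show ?case using closed by simp
  next
    case empty
    then show ?case by simp
  next
    case (compl A)
    have A: "A \<in> sets borel" using compl(1) by (simp add: borel_eq_closed sets_measure_of)
    have "(\<integral>x. G x * indicator (UNIV - A) (T x) \<partial>M) = (\<integral>x. G x * indicator UNIV (T x) - G x * indicator A (T x) \<partial>M)"
      by (intro Bochner_Integration.integral_cong) (auto simp: indicator_def)
    also have "\<dots> = (\<integral>x. G x * indicator UNIV (T x) \<partial>M) - (\<integral>x. G x * indicator A (T x) \<partial>M)"
      by (intro Bochner_Integration.integral_diff int A) auto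
    finally show ?case using compl(2) closed[of UNIV] by simp
  next
    case (union A)
    have A[measurable]: "A i \<in> sets borel" for i
      using union(2) by (auto simp: borel_eq_closed sets_measure_of)
    have "(\<lambda>n. \<integral>x. G x * indicator (\<Union>i<n. A i) (T x) \<partial>M) \<longlonglongrightarrow> (\<integral>x. G x * indicator (\<Union>i. A i) (T x) \<partial>M)"
    proof (rule integral_dominated_convergence[where w="\<lambda>x. \<bar>G x\<bar>"])
      show "AE x in M. (\<lambda>n. G x * indicator (\<Union>i<n. A i) (T x)) \<longlonglongrightarrow> G x * indicator (\<Union>i. A i) (T x)"
        by (intro AE_I2 tendsto_mult tendsto_const LIMSEQ_indicator_UN)
    qed (use G in \<open>auto simp: indicator_def\<close>)
    moreover have "(\<integral>x. G x * indicator (\<Union>i<n. A i) (T x) \<partial>M) = 0" for n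
    proof -
      have "indicator (\<Union>i<n. A i) y = (\<Sum>i<n. indicator (A i) y :: real)" for y
        by (rule indicator_UN_disjoint) (use union(1) in \<open>auto simp: disjoint_family_on_def\<close>)
      then have "(\<integral>x. G x * indicator (\<Union>i<n. A i) (T x) \<partial>M) = (\<integral>x. (\<Sum>i<n. G x * indicator (A i) (T x)) \<partial>M)"
        by (simp add: sum_distrib_left)
      also have "\<dots> = (\<Sum>i<n. \<integral>x. G x * indicator (A i) (T x) \<partial>M)"
        by (intro Bochner_Integration.integral_sum int A)
      finally show ?thesis using union(3) by simp
    qed
    ultimately show ?case by (simp add: LIMSEQ_const_iff)
  qed
qed

text \<open>The hypothesis \<open>inj\<close> says that T generates the whole sigma-algebra up to
  null sets. Integrals over arbitrary measurable sets then become integrals over preimages of Borel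
  sets, which the moments control. It is applied to the half-line with T r = exp(-r^2/2) and to the
  sphere with the identity.\<close>

lemma AE_eq_0_if_moments_eq_0:
  fixes T :: "'a \<Rightarrow> 'b::euclidean_space" and G :: "'a \<Rightarrow> complex"
  assumes G: "integrable M G" and T: "T \<in> borel_measurable M"
    and K: "compact K" "\<And>x. x \<in> space M \<Longrightarrow> T x \<in> K"
    and mom: "\<And>p. real_polynomial_function p \<Longrightarrow> (\<integral>x. G x * complex_of_real (p (T x)) \<partial>M) = 0"
    and inj: "\<And>A. A \<in> sets M \<Longrightarrow> \<exists>B\<in>sets borel. AE x in M. x \<in> A \<longleftrightarrow> T x \<in> B"
  shows "AE x in M. G x = 0"
proof -
  have *: "AE x in M. h x = 0" if h: "integrable M h"
    and hp: "\<And>p. real_polynomial_function p \<Longrightarrow> (\<integral>x. h x * p (T x) \<partial>M) = 0" for h :: "'a \<Rightarrow> real"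
  proof (rule density_unique_real)
    show "integrable M h" by fact
    fix A assume A[measurable]: "A \<in> sets M"
    obtain B where B: "B \<in> sets borel" "AE x in M. x \<in> A \<longleftrightarrow> T x \<in> B" using inj[OF A] by blast
    note [measurable] = B(1) T
    have [measurable]: "h \<in> borel_measurable M" using h by simp
    have "(\<integral>x\<in>A. h x \<partial>M) = (\<integral>x. h x * indicator B (T x) \<partial>M)"
      unfolding set_lebesgue_integral_def
      by (intro integral_cong_AE, measurable) (use B(2) in eventually_elim, auto simp: indicator_def)
    also have "\<dots> = 0" by (rule integral_borel_eq_0[OF h T K hp B(1)])
    finally show "(\<integral>x\<in>A. h x \<partial>M) = (\<integral>x\<in>A. 0 \<partial>M)" by (simp add: set_lebesgue_integral_def)
  qed simp
  have bdd: "integrable M (\<lambda>x. G x * complex_of_real (p (T x)))" if p: "real_polynomial_function p" for p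
  proof -
    have cp: "continuous_on UNIV p"
      using p by (simp add: continuous_on_polymonial_function real_polynomial_function_eq)
    have [measurable]: "p \<in> borel_measurable borel"
      using cp by (rule borel_measurable_continuous_onI)
    note [measurable] = T
    have "bounded (p ` K)"
      using K(1) cp by (intro compact_imp_bounded compact_continuous_image) (auto intro: continuous_on_subset)
    then obtain B where B: "\<And>y. y \<in> K \<Longrightarrow> \<bar>p y\<bar> \<le> B"
      unfolding bounded_iff by (auto simp del: abs_le_iff) 
    show ?thesis
    proof (rule Bochner_Integration.integrable_bound)
      show "integrable M (\<lambda>x. complex_of_real B * G x)" using G by simp
      show "(\<lambda>x. G x * complex_of_real (p (T x))) \<in> borel_measurable M" using G by measurable
      show "AE x in M. norm (G x * complex_of_real (p (T x))) \<le> norm (complex_of_real B * G x)"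
      proof (rule AE_I2)
        fix x assume "x \<in> space M"
        then have "\<bar>p (T x)\<bar> \<le> \<bar>B\<bar>" using B[OF K(2)] by (meson abs_ge_self order_trans)
        then show "norm (G x * complex_of_real (p (T x))) \<le> norm (complex_of_real B * G x)"
          using mult_right_mono[of "\<bar>p (T x)\<bar>" "\<bar>B\<bar>" "cmod (G x)"] by (simp add: norm_mult mult.commute)
      qed
    qed
  qed
  have "AE x in M. Re (G x) = 0"
  proof (rule *)
    fix p :: "'b \<Rightarrow> real" assume p: "real_polynomial_function p"
    show "(\<integral>x. Re (G x) * p (T x) \<partial>M) = 0"
      using integral_Re[OF bdd[OF p]] mom[OF p] by simp
  qed (use G in auto)
  moreover have "AE x in M. Im (G x) = 0"
  proof (rule *)
    fix p :: "'b \<Rightarrow> real" assume p: "real_polynomial_function p"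
    show "(\<integral>x. Im (G x) * p (T x) \<partial>M) = 0"
      using integral_Im[OF bdd[OF p]] mom[OF p] by simp
  qed (use G in auto)
  ultimately show ?thesis by eventually_elim (simp add: complex_eq_iff)
qed

section \<open>Power substitutions on the half-line\<close>

lemma indicator_subset_mono: "A \<subseteq> B \<Longrightarrow> indicator A x \<le> (indicator B x :: ennreal)"
  by (auto simp: indicator_def)

text \<open>The substitution rule is applied on [exp(-k), exp k], and monotone convergence exhausts
  the half-line.\<close>

lemma nn_integral_exp_substitution:
  fixes f :: "real \<Rightarrow> ennreal"
  assumes [measurable]: "f \<in> borel_measurable borel"
  shows "(\<integral>\<^sup>+x. f x * indicator {0<..} x \<partial>lborel) = (\<integral>\<^sup>+s. f (exp s) * ennreal (exp s) \<partial>lborel)"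
proof -
  let ?M1 = "density lborel (indicator {0<..}) :: real measure"
  let ?M2 = "distr (density lborel (\<lambda>s. ennreal (exp s))) borel exp :: real measure"
  \<comment> \<open>An identity of measures needs only indicators as integrands and then serves
    every measurable f.\<close>
  have "?M1 = ?M2"
  proof (rule measure_eqI)
    fix A assume "A \<in> sets ?M1"
    then have A[measurable]: "A \<in> sets borel" by simp
    have lim1: "(\<lambda>k. \<integral>\<^sup>+x. indicator A x * indicator {exp (- real k)..exp (real k)} x \<partial>lborel)
       \<longlonglongrightarrow> (\<integral>\<^sup>+x. indicator A x * indicator {0<..} x \<partial>lborel)"
    proof (rule nn_integral_LIMSEQ)
      show "incseq (\<lambda>k x. indicator A x * indicator {exp (- real k)..exp (real k)} x :: ennreal)"
      proof (intro incseq_SucI le_funI mult_left_mono)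
        fix k x
        have "{exp (- real k)..exp (real k)} \<subseteq> {exp (- real (Suc k))..exp (real (Suc k))}" 
          by (intro atLeastatMost_subset_iff[THEN iffD2]) auto
        then show "indicator {exp (- real k)..exp (real k)} x \<le> (indicator {exp (- real (Suc k))..exp (real (Suc k))} x :: ennreal)"
          by (intro indicator_subset_mono)
      qed simp
      show "(\<lambda>k. indicator A x * indicator {exp (- real k)..exp (real k)} x) \<longlonglongrightarrow> (indicator A x * indicator {0<..} x :: ennreal)" for x
      proof (cases "x > 0")
        case True
        obtain k0 :: nat where k0: "real k0 \<ge> \<bar>ln x\<bar>" using real_arch_simple by blast
        have "indicator {exp (- real k)..exp (real k)} x = (1::ennreal)" if "k \<ge> k0" for k
        proof -
          have "exp (- real k) \<le> exp (ln x)" "exp (ln x) \<le> exp (real k)"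
            using that k0 by (auto simp: abs_le_iff)
          then show ?thesis using True by simp
        qed
        then have "\<forall>\<^sub>F k in sequentially. indicator A x * indicator {exp (- real k)..exp (real k)} x = (indicator A x * indicator {0<..} x :: ennreal)"
          using True by (intro eventually_sequentiallyI[of k0]) auto
        then show ?thesis by (rule tendsto_eventually)
      next
        case False
        then have "x \<notin> {exp (- real k)..exp (real k)}" for k
          using exp_gt_zero[of "- real k"] by (auto simp del: exp_gt_zero)
        then show ?thesis using False by simp
      qed
    qed measurable
    have lim2: "(\<lambda>k. \<integral>\<^sup>+s. indicator A (exp s) * ennreal (exp s) * indicator {- real k..real k} s \<partial>lborel)
       \<longlonglongrightarrow> (\<integral>\<^sup>+s. indicator A (exp s) * ennreal (exp s) \<partial>lborel)"
    proof (rule nn_integral_LIMSEQ)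
      show "incseq (\<lambda>k s. indicator A (exp s) * ennreal (exp s) * indicator {- real k..real k} s)"
        by (intro incseq_SucI le_funI mult_left_mono) (auto simp: indicator_def)
      show "(\<lambda>k. indicator A (exp s) * ennreal (exp s) * indicator {- real k..real k} s) \<longlonglongrightarrow> indicator A (exp s) * ennreal (exp s)" for s
      proof -
        obtain k0 :: nat where k0: "real k0 \<ge> \<bar>s\<bar>" using real_arch_simple by blast
        have "\<forall>\<^sub>F k in sequentially. indicator A (exp s) * ennreal (exp s) * indicator {- real k..real k} s = indicator A (exp s) * ennreal (exp s)"
          by (intro eventually_sequentiallyI[of k0]) (use k0 in \<open>auto simp: abs_le_iff\<close>)
        then show ?thesis by (rule tendsto_eventually)
      qed
    qed measurable
    have eq: "(\<integral>\<^sup>+x. indicator A x * indicator {exp (- real k)..exp (real k)} x \<partial>lborel)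
       = (\<integral>\<^sup>+s. indicator A (exp s) * ennreal (exp s) * indicator {- real k..real k} s \<partial>lborel)" for k
    proof -
      have "(\<integral>\<^sup>+x. ennreal (indicator A x * indicator {exp (- real k)..exp (real k)} x) \<partial>lborel)
       = (\<integral>\<^sup>+s. ennreal (indicator A (exp s) * exp s * indicator {- real k..real k} s) \<partial>lborel)"
        by (rule nn_integral_substitution)
          (auto simp: set_borel_measurable_def intro!: DERIV_exp continuous_intros)
      then show ?thesis by (simp add: ennreal_mult ennreal_indicator)
    qed
    have [measurable]: "exp -` A \<in> sets borel"
      using measurable_sets[of "exp :: real \<Rightarrow> real" borel borel A] by simp
    have "emeasure ?M1 A = (\<integral>\<^sup>+x. indicator A x * indicator {0<..} x \<partial>lborel)"
      by (subst emeasure_density) (auto simp: mult.commute)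
    also have "\<dots> = (\<integral>\<^sup>+s. indicator A (exp s) * ennreal (exp s) \<partial>lborel)"
      using lim1 lim2 unfolding eq by (rule LIMSEQ_unique)
    also have "\<dots> = emeasure ?M2 A"
      by (subst emeasure_distr, simp, simp, subst emeasure_density)
        (auto intro!: nn_integral_cong simp: indicator_def)
    finally show "emeasure ?M1 A = emeasure ?M2 A" .
  qed simp
  have "(\<integral>\<^sup>+x. f x * indicator {0<..} x \<partial>lborel) = (\<integral>\<^sup>+x. f x \<partial>?M1)"
    by (subst nn_integral_density) (auto simp: mult.commute)
  also have "\<dots> = (\<integral>\<^sup>+x. f x \<partial>?M2)" using \<open>?M1 = ?M2\<close> by simp
  also have "\<dots> = (\<integral>\<^sup>+s. f (exp s) * ennreal (exp s) \<partial>lborel)"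
    by (subst nn_integral_distr, simp, simp, subst nn_integral_density) (auto simp: mult.commute)
  finally show ?thesis .
qed

text \<open>In the logarithmic variable x = exp s the map x -> c x^a is affine. Negative a only
  reverses orientation, hence the absolute value in the density.\<close>

lemma nn_integral_power_substitution:
  fixes f :: "real \<Rightarrow> ennreal"
  assumes [measurable]: "f \<in> borel_measurable borel" and a: "a \<noteq> 0" and c: "c > 0"
  shows "(\<integral>\<^sup>+x. f x * indicator {0<..} x \<partial>lborel)
    = (\<integral>\<^sup>+x. f (c * x powr a) * ennreal (c * \<bar>a\<bar> * x powr (a - 1)) * indicator {0<..} x \<partial>lborel)"
proof -
  have "(\<integral>\<^sup>+x. f x * indicator {0<..} x \<partial>lborel) = (\<integral>\<^sup>+s. f (exp s) * ennreal (exp s) \<partial>lborel)"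
    by (rule nn_integral_exp_substitution) measurable
  also have "\<dots> = \<bar>a\<bar> * (\<integral>\<^sup>+s. f (exp (ln c + a * s)) * ennreal (exp (ln c + a * s)) \<partial>lborel)"
    by (rule nn_integral_real_affine) (use a in auto)
  also have "\<dots> = (\<integral>\<^sup>+s. ennreal \<bar>a\<bar> * (f (exp (ln c + a * s)) * ennreal (exp (ln c + a * s))) \<partial>lborel)"
    by (subst nn_integral_cmult) auto
  also have "\<dots> = (\<integral>\<^sup>+s. (\<lambda>x. f (c * x powr a) * ennreal (c * \<bar>a\<bar> * x powr (a - 1))) (exp s) * ennreal (exp s) \<partial>lborel)"
  proof (rule nn_integral_cong)
    fix s :: real
    have 1: "exp (ln c + a * s) = c * exp s powr a"
      using c by (simp add: exp_add powr_def)
    have "ennreal \<bar>a\<bar> * ennreal (exp (ln c + a * s)) = ennreal (c * \<bar>a\<bar> * exp s powr (a - 1)) * ennreal (exp s)"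
    proof -
      have "\<bar>a\<bar> * exp (ln c + a * s) = c * \<bar>a\<bar> * exp s powr (a - 1) * exp s"
        using c by (simp add: exp_add powr_def algebra_simps exp_diff)
      then show ?thesis using c by (simp add: ennreal_mult[symmetric])
    qed
    then show "ennreal \<bar>a\<bar> * (f (exp (ln c + a * s)) * ennreal (exp (ln c + a * s)))
        = (\<lambda>x. f (c * x powr a) * ennreal (c * \<bar>a\<bar> * x powr (a - 1))) (exp s) * ennreal (exp s)"
      unfolding 1 by (metis (no_types, lifting) mult.assoc mult.left_commute)
  qed
  also have "\<dots> = (\<integral>\<^sup>+x. f (c * x powr a) * ennreal (c * \<bar>a\<bar> * x powr (a - 1)) * indicator {0<..} x \<partial>lborel)"
    by (rule nn_integral_exp_substitution[symmetric]) measurable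
  finally show ?thesis .
qed

section \<open>Bessel functions\<close>

text \<open>Euler's integral under t = c x^a. The exponent 2 gives Gaussian moments, 1 represents
  negative powers of s^2 as integrals over \<tau>, and -1 evaluates integrals of
  exp(-y/\<tau>).\<close>

lemma nn_integral_gamma_power:
  assumes q: "q > 0" and c: "c > 0" and a: "a \<noteq> 0"
  shows "(\<integral>\<^sup>+x. ennreal (x powr (a * q - 1) * exp (- c * x powr a)) * indicator {0<..} x \<partial>lborel)
    = ennreal (Gamma q / (\<bar>a\<bar> * c powr q))"
proof -
  have "ennreal (Gamma q) = (\<integral>\<^sup>+t. ennreal (indicator {0..} t * t powr (q - 1) / exp t) \<partial>lborel)"
    using Gamma_conv_nn_integral_real[OF q] .
  also have "\<dots> = (\<integral>\<^sup>+t. ennreal (t powr (q - 1) * exp (- t)) * indicator {0<..} t \<partial>lborel)"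
    by (intro nn_integral_cong_AE eventually_mono[OF AE_lborel_singleton[of 0]])
      (auto simp: indicator_def exp_minus field_simps)
  also have "\<dots> = (\<integral>\<^sup>+x. ennreal ((c * x powr a) powr (q - 1) * exp (- (c * x powr a)))
      * ennreal (c * \<bar>a\<bar> * x powr (a - 1)) * indicator {0<..} x \<partial>lborel)"
    by (rule nn_integral_power_substitution) (use a c in auto)
  also have "\<dots> = (\<integral>\<^sup>+x. ennreal (\<bar>a\<bar> * c powr q) *
      (ennreal (x powr (a * q - 1) * exp (- c * x powr a)) * indicator {0<..} x) \<partial>lborel)"
  proof (rule nn_integral_cong)
    fix x :: real
    show "ennreal ((c * x powr a) powr (q - 1) * exp (- (c * x powr a)))
      * ennreal (c * \<bar>a\<bar> * x powr (a - 1)) * indicator {0<..} x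
      = ennreal (\<bar>a\<bar> * c powr q) *
      (ennreal (x powr (a * q - 1) * exp (- c * x powr a)) * indicator {0<..} x)"
    proof (cases "x > 0")
      case True
      have 1: "(c * x powr a) powr (q - 1) = c powr (q - 1) * x powr (a * (q - 1))"
        using c True by (simp add: powr_mult powr_powr)
      have 2: "c powr (q - 1) * c = c powr q" using c by (simp add: powr_mult_base[symmetric] powr_diff)
      have 3: "x powr (a * (q - 1)) * x powr (a - 1) = x powr (a * q - 1)"
        using True by (simp add: powr_add[symmetric] algebra_simps)
      have "(c * x powr a) powr (q - 1) * exp (- (c * x powr a)) * (c * \<bar>a\<bar> * x powr (a - 1))
        = \<bar>a\<bar> * (c powr (q - 1) * c) * ((x powr (a * (q - 1)) * x powr (a - 1)) * exp (- c * x powr a))"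
        unfolding 1 by simp
      also have "\<dots> = (\<bar>a\<bar> * c powr q) * (x powr (a * q - 1) * exp (- c * x powr a))"
        unfolding 2 3 ..
      finally show ?thesis using True c by (simp add: ennreal_mult[symmetric])
    qed simp
  qed
  also have "\<dots> = ennreal (\<bar>a\<bar> * c powr q) *
      (\<integral>\<^sup>+x. ennreal (x powr (a * q - 1) * exp (- c * x powr a)) * indicator {0<..} x \<partial>lborel)"
    by (rule nn_integral_cmult) auto
  finally have *: "ennreal (\<bar>a\<bar> * c powr q) *
      (\<integral>\<^sup>+x. ennreal (x powr (a * q - 1) * exp (- c * x powr a)) * indicator {0<..} x \<partial>lborel) = ennreal (Gamma q)" ..
  have pos: "\<bar>a\<bar> * c powr q > 0" using a c by simp
  have "(\<integral>\<^sup>+x. ennreal (x powr (a * q - 1) * exp (- c * x powr a)) * indicator {0<..} x \<partial>lborel)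
    = (ennreal (1 / (\<bar>a\<bar> * c powr q)) * ennreal (\<bar>a\<bar> * c powr q)) *
      (\<integral>\<^sup>+x. ennreal (x powr (a * q - 1) * exp (- c * x powr a)) * indicator {0<..} x \<partial>lborel)"
  proof -
    have "ennreal (1 / (\<bar>a\<bar> * c powr q)) * ennreal (\<bar>a\<bar> * c powr q) = 1"
      by (subst ennreal_mult[symmetric]) (use pos in auto)
    then show ?thesis by simp
  qed
  also have "\<dots> = ennreal (1 / (\<bar>a\<bar> * c powr q)) * ennreal (Gamma q)"
    unfolding mult.assoc * ..
  also have "\<dots> = ennreal (Gamma q / (\<bar>a\<bar> * c powr q))"
    using pos q by (simp add: ennreal_mult[symmetric])
  finally show ?thesis .
qed

lemma has_bochner_integral_gauss_moment:
  fixes q b :: real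
  assumes q: "q > 0" and b: "b > 0"
  shows "has_bochner_integral lborel (\<lambda>r. indicator {0<..} r * (r powr (2 * q - 1) * exp (- b * r\<^sup>2)))
    (Gamma q / (2 * b powr q))"
proof (rule has_bochner_integral_nn_integral)
  have "(\<integral>\<^sup>+r. ennreal (indicator {0<..} r * (r powr (2 * q - 1) * exp (- b * r\<^sup>2))) \<partial>lborel)
    = (\<integral>\<^sup>+x. ennreal (x powr (2 * q - 1) * exp (- b * x powr 2)) * indicator {0<..} x \<partial>lborel)"
    by (intro nn_integral_cong) (auto simp: indicator_def powr_numeral)
  then show "(\<integral>\<^sup>+r. ennreal (indicator {0<..} r * (r powr (2 * q - 1) * exp (- b * r\<^sup>2))) \<partial>lborel)
    = ennreal (Gamma q / (2 * b powr q))"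
    using nn_integral_gamma_power[OF q b, of 2] by simp
qed (use q b in \<open>auto simp: indicator_def less_imp_le\<close>)

section \<open>The power series of the Bessel function and Weber's integral\<close>

definition bessel_coeff :: "real \<Rightarrow> nat \<Rightarrow> real" where
  "bessel_coeff \<nu> m = 1 / (fact m * Gamma (real m + \<nu> + 1))"

lemma bessel_coeff_pos: "\<nu> \<ge> 0 \<Longrightarrow> bessel_coeff \<nu> m > 0"
  by (simp add: bessel_coeff_def Gamma_real_pos)

lemma pos_notin_nonpos_Ints: "x > (0::real) \<Longrightarrow> x \<notin> \<int>\<^sub>\<le>\<^sub>0"
  by (auto elim!: nonpos_Ints_cases)

lemma norm_alternating: "c \<ge> 0 \<Longrightarrow> x \<ge> 0 \<Longrightarrow> norm ((-1) ^ m * c * x ^ m) = c * (x ^ m :: real)"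
  by (simp add: abs_mult)

lemma Gamma_shift_ge:
  assumes "x \<ge> (1::real)" shows "Gamma x \<le> Gamma (real m + x)"
proof (induction m)
  case (Suc m)
  have "Gamma (real m + x) \<le> (real m + x) * Gamma (real m + x)"
    using assms by (simp add: Gamma_real_pos)
  also have "\<dots> = Gamma (real (Suc m) + x)"
    using Gamma_plus1[OF pos_notin_nonpos_Ints, of "real m + x"] assms by (simp add: add_ac)
  finally show ?case using Suc by simp
qed simp

text \<open>Dominates the series by a multiple of the exponential series, since Gamma does not
  decrease under integer shifts of an argument that is at least 1.\<close>

lemma bessel_coeff_le:
  assumes "\<nu> \<ge> 0" shows "bessel_coeff \<nu> m \<le> (1 / Gamma (\<nu> + 1)) * (1 / fact m)"
proof -
  have "Gamma (\<nu> + 1) \<le> Gamma (real m + \<nu> + 1)"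
    using Gamma_shift_ge[of "\<nu> + 1" m] assms by (simp add: add_ac)
  moreover have "Gamma (\<nu> + 1) > 0" using assms by (simp add: Gamma_real_pos)
  ultimately show ?thesis
    unfolding bessel_coeff_def by (simp add: frac_le mult_left_mono mult.commute)
qed

lemma summable_exp_series: "summable (\<lambda>m. (1 / fact m) * x ^ m :: real)"
  using summable_exp[of x] by (simp add: field_simps)

lemma summable_bessel_coeff:
  assumes "\<nu> \<ge> 0" "x \<ge> 0" shows "summable (\<lambda>m. bessel_coeff \<nu> m * x ^ m)"
proof (rule summable_comparison_test')
  show "summable (\<lambda>m. (1 / Gamma (\<nu> + 1)) * ((1 / fact m) * x ^ m))"
    by (intro summable_mult summable_exp_series)
  fix m
  show "norm (bessel_coeff \<nu> m * x ^ m) \<le> (1 / Gamma (\<nu> + 1)) * ((1 / fact m) * x ^ m)"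
    using mult_right_mono[OF bessel_coeff_le[OF assms(1), of m], of "x ^ m"] bessel_coeff_pos[OF assms(1), of m] assms(2)
    by (simp add: abs_mult)
qed

lemma powr_2m_add: "z > 0 \<Longrightarrow> z powr (2 * real m + \<nu>) = z powr \<nu> * (z\<^sup>2) ^ m"
proof -
  assume z: "z > 0"
  have "z powr (2 * real m) = (z\<^sup>2) ^ m"
    using z powr_realpow[of z "2 * m"] by (simp add: power_mult)
  then show ?thesis using z by (simp add: powr_add)
qed

lemma Bessel_J_eq:
  assumes "z > 0" "\<nu> \<ge> 0"
  shows "Bessel_J \<nu> z = (z / 2) powr \<nu> * (\<Sum>m. (-1) ^ m * bessel_coeff \<nu> m * ((z / 2)\<^sup>2) ^ m)"
proof -
  have "Bessel_J \<nu> z = (\<Sum>m. (z / 2) powr \<nu> * ((-1) ^ m * bessel_coeff \<nu> m * ((z / 2)\<^sup>2) ^ m))"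
    unfolding Bessel_J_def using assms
    by (intro suminf_cong) (simp add: powr_2m_add bessel_coeff_def)
  also have "\<dots> = (z / 2) powr \<nu> * (\<Sum>m. (-1) ^ m * bessel_coeff \<nu> m * ((z / 2)\<^sup>2) ^ m)"
  proof (rule suminf_mult)
    have "summable (\<lambda>m. norm ((-1) ^ m * bessel_coeff \<nu> m * ((z / 2)\<^sup>2) ^ m))"
      using summable_bessel_coeff[OF assms(2), of "(z/2)\<^sup>2"] bessel_coeff_pos[OF assms(2)]
      by (simp add: norm_alternating less_imp_le del: real_norm_def)
    then show "summable (\<lambda>m. (-1) ^ m * bessel_coeff \<nu> m * ((z / 2)\<^sup>2) ^ m)"
      by (rule summable_norm_cancel)
  qed
  finally show ?thesis .
qed

lemma Bessel_J_measurable [measurable]: "Bessel_J \<nu> \<in> borel_measurable borel"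
  unfolding Bessel_J_def by measurable

text \<open>Weber's integral by termwise integration: the m-th Gaussian moment cancels the Gamma
  factor of the m-th coefficient, leaving the series of exp(-\<rho>^2/(2p)). Without alternating
  signs the same computation bounds the absolute integral, with exp(\<rho>^2/(2p)) instead; that
  bound later justifies Fubini.\<close>

lemma bessel_gauss:
  assumes \<nu>: "\<nu> \<ge> 0" and \<rho>: "\<rho> > 0" and p: "p > 0"
  shows "integrable lborel (\<lambda>r. indicator {0<..} r * (Bessel_J \<nu> (r * \<rho>) * (r powr (\<nu> + 1) * exp (- (p / 2) * r\<^sup>2))))"
    and "(\<integral>r. indicator {0<..} r * (Bessel_J \<nu> (r * \<rho>) * (r powr (\<nu> + 1) * exp (- (p / 2) * r\<^sup>2))) \<partial>lborel)
      = \<rho> powr \<nu> * p powr (- \<nu> - 1) * exp (- \<rho>\<^sup>2 / (2 * p))"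
    and "(\<integral>r. \<bar>indicator {0<..} r * (Bessel_J \<nu> (r * \<rho>) * (r powr (\<nu> + 1) * exp (- (p / 2) * r\<^sup>2)))\<bar> \<partial>lborel)
      \<le> \<rho> powr \<nu> * p powr (- \<nu> - 1) * exp (\<rho>\<^sup>2 / (2 * p))"
proof -
  define g where "g m r = indicator {0<..} r * (r powr (2 * (real m + \<nu> + 1) - 1) * exp (- (p / 2) * r\<^sup>2))" for m r
  define c where "c m = bessel_coeff \<nu> m * (\<rho> / 2) powr (2 * real m + \<nu>)" for m
  define f where "f m r = (-1) ^ m * c m * g m r" for m r
  have g: "has_bochner_integral lborel (g m) (Gamma (real m + \<nu> + 1) / (2 * (p / 2) powr (real m + \<nu> + 1)))" for m
    unfolding g_def by (rule has_bochner_integral_gauss_moment) (use \<nu> p in auto)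
  have g0: "g m r \<ge> 0" for m r by (simp add: g_def)
  have c0: "c m \<ge> 0" for m using bessel_coeff_pos[OF \<nu>, of m] by (simp add: c_def)
  define A where "A = \<rho> powr \<nu> * p powr (- \<nu> - 1)"
  have ev: "c m * (Gamma (real m + \<nu> + 1) / (2 * (p / 2) powr (real m + \<nu> + 1))) = A * ((1 / fact m) * (\<rho>\<^sup>2 / (2 * p)) ^ m)" for m
  proof -
    have G: "Gamma (real m + \<nu> + 1) > 0" using \<nu> by (simp add: Gamma_real_pos)
    have 1: "(\<rho> / 2) powr (2 * real m + \<nu>) = (\<rho> powr \<nu> / 2 powr \<nu>) * (\<rho>\<^sup>2 / 4) ^ m"
      using \<rho> by (simp add: powr_2m_add powr_divide power_divide)
    have 2: "(p / 2) powr (real m + \<nu> + 1) = (p / 2) ^ m * (p powr (\<nu> + 1) / (2 powr \<nu> * 2))"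
      using p by (simp add: powr_add powr_realpow powr_divide power_divide)
    have 3: "p powr (- \<nu> - 1) = 1 / p powr (\<nu> + 1)"
      by (metis minus_diff_eq powr_minus_divide uminus_add_conv_diff add.commute diff_minus_eq_add add_uminus_conv_diff)
    have 4: "(\<rho>\<^sup>2 / 4) ^ m / (p / 2) ^ m = (\<rho>\<^sup>2 / (2 * p)) ^ m"
      unfolding power_divide[symmetric] by (rule arg_cong[where f="\<lambda>x. x ^ m"]) (use p in \<open>simp add: field_simps\<close>)
    have "c m * (Gamma (real m + \<nu> + 1) / (2 * (p / 2) powr (real m + \<nu> + 1)))
      = (1 / fact m) * (\<rho> powr \<nu> / p powr (\<nu> + 1)) * ((\<rho>\<^sup>2 / 4) ^ m / (p / 2) ^ m)"
      unfolding c_def bessel_coeff_def 1 2 using G p by (simp add: field_simps)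
    then show ?thesis unfolding 4 A_def 3 by simp
  qed
  have fi: "has_bochner_integral lborel (f m) ((-1) ^ m * (A * ((1 / fact m) * (\<rho>\<^sup>2 / (2 * p)) ^ m)))" for m
    unfolding f_def ev[symmetric] using has_bochner_integral_mult_right[OF g[of m], of "(-1)^m * c m"]
    by (simp add: mult.assoc)
  have nf: "norm (f m r) = c m * g m r" for m r
    using c0 g0 by (simp add: f_def abs_mult)
  have nfi: "has_bochner_integral lborel (\<lambda>r. norm (f m r)) (A * ((1 / fact m) * (\<rho>\<^sup>2 / (2 * p)) ^ m))" for m
    unfolding nf ev[symmetric] by (intro has_bochner_integral_mult_right g)
  have fr: "f m r = indicator {0<..} r * (r powr (\<nu> + 1) * exp (- (p / 2) * r\<^sup>2)) *
     ((r * \<rho> / 2) powr \<nu> * ((-1) ^ m * bessel_coeff \<nu> m * ((r * \<rho> / 2)\<^sup>2) ^ m))" for m r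
  proof (cases "r > 0")
    case True
    have "r powr (2 * (real m + \<nu> + 1) - 1) = r powr (2 * real m + \<nu>) * r powr (\<nu> + 1)"
      using True by (simp add: powr_add[symmetric] algebra_simps)
    moreover have "(\<rho> / 2) powr (2 * real m + \<nu>) * r powr (2 * real m + \<nu>) = (r * \<rho> / 2) powr (2 * real m + \<nu>)"
      using True \<rho> by (simp add: powr_mult[symmetric] field_simps)
    moreover have "(r * \<rho> / 2) powr (2 * real m + \<nu>) = (r * \<rho> / 2) powr \<nu> * ((r * \<rho> / 2)\<^sup>2) ^ m"
      using True \<rho> by (intro powr_2m_add) simp
    ultimately show ?thesis using True by (simp add: f_def g_def c_def mult_ac)
  qed (simp add: f_def g_def)
  have summ: "summable (\<lambda>m. norm (f m r))" for r
  proof -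
    have "summable (\<lambda>m. indicator {0<..} r * (r powr (\<nu> + 1) * exp (- (p / 2) * r\<^sup>2)) *
     ((r * \<rho> / 2) powr \<nu> * (bessel_coeff \<nu> m * ((r * \<rho> / 2)\<^sup>2) ^ m)))"
      by (intro summable_mult summable_bessel_coeff \<nu>) auto
    also have "(\<lambda>m. indicator {0<..} r * (r powr (\<nu> + 1) * exp (- (p / 2) * r\<^sup>2)) *
     ((r * \<rho> / 2) powr \<nu> * (bessel_coeff \<nu> m * ((r * \<rho> / 2)\<^sup>2) ^ m))) = (\<lambda>m. norm (f m r))"
      unfolding fr using bessel_coeff_pos[OF \<nu>] \<rho> by (auto simp: abs_mult indicator_def power_abs less_imp_le)
    finally show ?thesis .
  qed
  have sumf: "(\<Sum>m. f m r) = indicator {0<..} r * (Bessel_J \<nu> (r * \<rho>) * (r powr (\<nu> + 1) * exp (- (p / 2) * r\<^sup>2)))" for r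
  proof (cases "r > 0")
    case True
    have "summable (\<lambda>m. norm ((-1) ^ m * bessel_coeff \<nu> m * ((r * \<rho> / 2)\<^sup>2) ^ m))"
      using summable_bessel_coeff[OF \<nu>, of "(r * \<rho> / 2)\<^sup>2"] bessel_coeff_pos[OF \<nu>]
      by (simp add: norm_alternating less_imp_le del: real_norm_def)
    then have s: "summable (\<lambda>m. (-1) ^ m * bessel_coeff \<nu> m * ((r * \<rho> / 2)\<^sup>2) ^ m)"
      by (rule summable_norm_cancel)
    have "(\<Sum>m. f m r) = indicator {0<..} r * (r powr (\<nu> + 1) * exp (- (p / 2) * r\<^sup>2)) *
      ((r * \<rho> / 2) powr \<nu> * (\<Sum>m. (-1) ^ m * bessel_coeff \<nu> m * ((r * \<rho> / 2)\<^sup>2) ^ m))"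
      unfolding fr by (simp add: suminf_mult[OF s] suminf_mult[OF summable_mult[OF s]])
    then show ?thesis using True \<rho> \<nu> by (simp add: Bessel_J_eq)
  qed (simp add: fr)
  have sE: "summable (\<lambda>m. A * ((1 / fact m) * (\<rho>\<^sup>2 / (2 * p)) ^ m))"
    by (intro summable_mult summable_exp_series)
  have I: "integrable lborel (f m)" for m using fi by (auto simp: has_bochner_integral_iff)
  have S: "summable (\<lambda>m. \<integral>r. norm (f m r) \<partial>lborel)"
    using nfi sE by (simp add: has_bochner_integral_iff)
  show "integrable lborel (\<lambda>r. indicator {0<..} r * (Bessel_J \<nu> (r * \<rho>) * (r powr (\<nu> + 1) * exp (- (p / 2) * r\<^sup>2))))"
    using integrable_suminf[OF I AE_I2[OF summ] S] unfolding sumf .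
  have E: "(\<lambda>m. (1 / fact m) * x ^ m) sums exp x" for x :: real
    using exp_converges[of x] by (simp add: field_simps)
  have "(\<lambda>m. A * ((1 / fact m) * (- (\<rho>\<^sup>2 / (2 * p))) ^ m)) sums (A * exp (- (\<rho>\<^sup>2 / (2 * p))))"
    by (intro sums_mult E)
  also have "(\<lambda>m. A * ((1 / fact m) * (- (\<rho>\<^sup>2 / (2 * p))) ^ m)) = (\<lambda>m. integral\<^sup>L lborel (f m))"
    unfolding power_minus[of "\<rho>\<^sup>2 / (2 * p)"] using fi by (auto simp: has_bochner_integral_iff fun_eq_iff)
  finally show "(\<integral>r. indicator {0<..} r * (Bessel_J \<nu> (r * \<rho>) * (r powr (\<nu> + 1) * exp (- (p / 2) * r\<^sup>2))) \<partial>lborel)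
      = \<rho> powr \<nu> * p powr (- \<nu> - 1) * exp (- \<rho>\<^sup>2 / (2 * p))"
    using sums_unique2[OF sums_integral[OF I AE_I2[OF summ] S]] unfolding sumf A_def by simp
  have I': "integrable lborel (\<lambda>r. norm (f m r))" for m using nfi by (auto simp: has_bochner_integral_iff)
  have "(\<integral>r. norm (\<Sum>m. f m r) \<partial>lborel) \<le> (\<integral>r. (\<Sum>m. norm (f m r)) \<partial>lborel)"
    by (intro integral_mono integrable_norm integrable_suminf I AE_I2[OF summ] S I' summable_norm[OF summ])
      (use summ S in auto)
  also have "\<dots> = (\<Sum>m. \<integral>r. norm (f m r) \<partial>lborel)"
    by (rule integral_suminf) (use I' summ S in auto)
  also have "\<dots> = A * exp (\<rho>\<^sup>2 / (2 * p))"
    using nfi sums_unique[OF sums_mult[OF E[of "\<rho>\<^sup>2 / (2 * p)"], of A]] by (simp add: has_bochner_integral_iff)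
  finally show "(\<integral>r. \<bar>indicator {0<..} r * (Bessel_J \<nu> (r * \<rho>) * (r powr (\<nu> + 1) * exp (- (p / 2) * r\<^sup>2)))\<bar> \<partial>lborel)
      \<le> \<rho> powr \<nu> * p powr (- \<nu> - 1) * exp (\<rho>\<^sup>2 / (2 * p))"
    unfolding sumf A_def by simp
qed

section \<open>The square of the Bessel function and its weighted integral\<close>

definition bessel_sq_coeff :: "real \<Rightarrow> nat \<Rightarrow> real" where
  "bessel_sq_coeff \<nu> N = Gamma (2 * real N + 2 * \<nu> + 1) /
     (fact N * (Gamma (real N + \<nu> + 1))\<^sup>2 * Gamma (real N + 2 * \<nu> + 1))"

text \<open>After multiplication by Gamma(N+\<nu>+1)^2 each summand is a product of generalised
  binomials with upper entry N+\<nu>, so the sum is Vandermonde's convolution.\<close>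

lemma bessel_coeff_convolution:
  assumes \<nu>: "\<nu> \<ge> 0"
  shows "(\<Sum>i\<le>N. bessel_coeff \<nu> i * bessel_coeff \<nu> (N - i)) = bessel_sq_coeff \<nu> N"
proof -
  let ?G = "Gamma (real N + \<nu> + 1)"
  have G: "?G > 0" using \<nu> by (simp add: Gamma_real_pos)
  have ch: "(real N + \<nu>) gchoose k = ?G / (fact k * Gamma (real N - real k + \<nu> + 1))" if "k \<le> N" for k
    using gbinomial_Gamma[of "real N + \<nu>" k] \<nu> pos_notin_nonpos_Ints[of "real N + \<nu> + 1"] by (simp add: algebra_simps)
  have "?G\<^sup>2 * (\<Sum>i\<le>N. bessel_coeff \<nu> i * bessel_coeff \<nu> (N - i))
    = (\<Sum>i\<le>N. ((real N + \<nu>) gchoose i) * ((real N + \<nu>) gchoose (N - i)))"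
    unfolding sum_distrib_left
  proof (rule sum.cong)
    fix i assume "i \<in> {..N}"
    then show "?G\<^sup>2 * (bessel_coeff \<nu> i * bessel_coeff \<nu> (N - i)) = ((real N + \<nu>) gchoose i) * ((real N + \<nu>) gchoose (N - i))"
      by (simp add: ch of_nat_diff bessel_coeff_def power2_eq_square)
  qed simp
  also have "\<dots> = ((real N + \<nu>) + (real N + \<nu>)) gchoose N"
    using gbinomial_Vandermonde[of "real N + \<nu>" "real N + \<nu>" N] by (simp add: atLeast0AtMost)
  also have "\<dots> = Gamma (2 * real N + 2 * \<nu> + 1) / (fact N * Gamma (real N + 2 * \<nu> + 1))"
    using gbinomial_Gamma[of "2 * real N + 2 * \<nu>" N] \<nu> pos_notin_nonpos_Ints[of "2 * real N + 2 * \<nu> + 1"] by (simp add: algebra_simps)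
  finally have *: "?G\<^sup>2 * (\<Sum>i\<le>N. bessel_coeff \<nu> i * bessel_coeff \<nu> (N - i)) =
    Gamma (2 * real N + 2 * \<nu> + 1) / (fact N * Gamma (real N + 2 * \<nu> + 1))" .
  have "(\<Sum>i\<le>N. bessel_coeff \<nu> i * bessel_coeff \<nu> (N - i)) =
    (?G\<^sup>2 * (\<Sum>i\<le>N. bessel_coeff \<nu> i * bessel_coeff \<nu> (N - i))) / ?G\<^sup>2"
    using G by simp
  also have "\<dots> = Gamma (2 * real N + 2 * \<nu> + 1) / (fact N * Gamma (real N + 2 * \<nu> + 1)) / ?G\<^sup>2"
    unfolding * ..
  finally have "(\<Sum>i\<le>N. bessel_coeff \<nu> i * bessel_coeff \<nu> (N - i)) =
    Gamma (2 * real N + 2 * \<nu> + 1) / (fact N * Gamma (real N + 2 * \<nu> + 1)) / ?G\<^sup>2" .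
  then show ?thesis unfolding bessel_sq_coeff_def by (simp add: mult_ac)
qed

text \<open>Cauchy product of the series with itself; absolute convergence is the same product for
  the series with all signs positive.\<close>

lemma Bessel_J_square_sums:
  assumes z: "z > 0" and \<nu>: "\<nu> \<ge> 0"
  shows "(\<lambda>N. (-1) ^ N * bessel_sq_coeff \<nu> N * (z / 2) powr (2 * real N + 2 * \<nu>)) sums (Bessel_J \<nu> z)\<^sup>2"
    and "summable (\<lambda>N. norm ((-1) ^ N * bessel_sq_coeff \<nu> N * (z / 2) powr (2 * real N + 2 * \<nu>)))"
proof -
  let ?x = "(z / 2)\<^sup>2"
  let ?a = "\<lambda>m. (-1) ^ m * bessel_coeff \<nu> m * ?x ^ m"
  have sa: "summable (\<lambda>m. norm (?a m))"
    using summable_bessel_coeff[OF \<nu>, of ?x] bessel_coeff_pos[OF \<nu>]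
    by (simp add: norm_alternating less_imp_le del: real_norm_def)
  have conv: "(\<Sum>i\<le>N. ?a i * ?a (N - i)) = (-1) ^ N * bessel_sq_coeff \<nu> N * ?x ^ N" for N
  proof -
    have "(\<Sum>i\<le>N. ?a i * ?a (N - i)) = (\<Sum>i\<le>N. ((-1) ^ N * ?x ^ N) * (bessel_coeff \<nu> i * bessel_coeff \<nu> (N - i)))"
    proof (rule sum.cong)
      fix i assume "i \<in> {..N}"
      then have "(-1::real) ^ N = (-1) ^ i * (-1) ^ (N - i)" "?x ^ N = ?x ^ i * ?x ^ (N - i)"
        by (simp_all flip: power_add)
      then show "?a i * ?a (N - i) = ((-1) ^ N * ?x ^ N) * (bessel_coeff \<nu> i * bessel_coeff \<nu> (N - i))"
        by (simp only: mult_ac)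
    qed simp
    then show ?thesis unfolding sum_distrib_left[symmetric] bessel_coeff_convolution[OF \<nu>] by (simp only: mult_ac)
  qed
  have pw: "(z / 2) powr (2 * real N + 2 * \<nu>) = ((z / 2) powr \<nu>)\<^sup>2 * ?x ^ N" for N
    using z powr_2m_add[of "z/2" N "2 * \<nu>"] by (simp add: powr_powr[symmetric] powr_numeral mult.commute[of 2 \<nu>])
  have "(\<lambda>N. ((z / 2) powr \<nu>)\<^sup>2 * ((-1) ^ N * bessel_sq_coeff \<nu> N * ?x ^ N)) sums (((z / 2) powr \<nu>)\<^sup>2 * ((\<Sum>m. ?a m) * (\<Sum>m. ?a m)))"
    using Cauchy_product_sums[OF sa sa] unfolding conv by (rule sums_mult)
  then show "(\<lambda>N. (-1) ^ N * bessel_sq_coeff \<nu> N * (z / 2) powr (2 * real N + 2 * \<nu>)) sums (Bessel_J \<nu> z)\<^sup>2"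
    unfolding pw by (simp add: Bessel_J_eq[OF z \<nu>] power2_eq_square mult_ac)
  have "bessel_coeff \<nu> m * ?x ^ m \<ge> 0" for m
    using bessel_coeff_pos[OF \<nu>, of m] by (intro mult_nonneg_nonneg) auto
  then have sb: "summable (\<lambda>m. norm (bessel_coeff \<nu> m * ?x ^ m))"
    using summable_bessel_coeff[OF \<nu>, of ?x] by (simp only: real_norm_def abs_of_nonneg zero_le_power2)
  have "(\<Sum>i\<le>N. (bessel_coeff \<nu> i * ?x ^ i) * (bessel_coeff \<nu> (N - i) * ?x ^ (N - i))) = bessel_sq_coeff \<nu> N * ?x ^ N" for N
  proof -
    have "(\<Sum>i\<le>N. (bessel_coeff \<nu> i * ?x ^ i) * (bessel_coeff \<nu> (N - i) * ?x ^ (N - i))) = (\<Sum>i\<le>N. ?x ^ N * (bessel_coeff \<nu> i * bessel_coeff \<nu> (N - i)))"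
    proof (rule sum.cong)
      fix i assume "i \<in> {..N}"
      then have "?x ^ N = ?x ^ i * ?x ^ (N - i)"
        by (simp flip: power_add)
      then show "(bessel_coeff \<nu> i * ?x ^ i) * (bessel_coeff \<nu> (N - i) * ?x ^ (N - i)) = ?x ^ N * (bessel_coeff \<nu> i * bessel_coeff \<nu> (N - i))"
        by (simp only: mult_ac)
    qed simp
    then show ?thesis unfolding sum_distrib_left[symmetric] bessel_coeff_convolution[OF \<nu>] by (simp only: mult_ac)
  qed
  with Cauchy_product_sums[OF sb sb] have "summable (\<lambda>N. bessel_sq_coeff \<nu> N * ?x ^ N)"
    by (simp add: sums_iff)
  then have "summable (\<lambda>N. ((z / 2) powr \<nu>)\<^sup>2 * (bessel_sq_coeff \<nu> N * ?x ^ N))" by (rule summable_mult)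
  moreover have "bessel_sq_coeff \<nu> N \<ge> 0" for N
    using \<nu> by (auto simp: bessel_sq_coeff_def intro!: divide_nonneg_nonneg mult_nonneg_nonneg Gamma_real_nonneg)
  ultimately show "summable (\<lambda>N. norm ((-1) ^ N * bessel_sq_coeff \<nu> N * (z / 2) powr (2 * real N + 2 * \<nu>)))"
    unfolding pw by (simp add: abs_mult mult_ac del: power2_abs power_divide)
qed

lemma Gamma_duplication_real:
  assumes "x > (0::real)"
  shows "Gamma x * Gamma (x + 1/2) = 2 powr (1 - 2 * x) * sqrt pi * Gamma (2 * x)"
proof -
  have nn: "complex_of_real y \<notin> \<int>\<^sub>\<le>\<^sub>0" if "y > 0" for y
    using that by (auto elim!: nonpos_Ints_cases simp: complex_eq_iff)
  have "Gamma (complex_of_real x) * Gamma (complex_of_real x + 1/2) =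
     exp ((1 - 2 * complex_of_real x) * of_real (ln 2)) * of_real (sqrt pi) * Gamma (2 * complex_of_real x)"
    using nn[of x] nn[of "x + 1/2"] assms by (intro Gamma_legendre_duplication) auto
  also have "complex_of_real x + 1/2 = complex_of_real (x + 1/2)" by simp
  also have "2 * complex_of_real x = complex_of_real (2 * x)" by simp
  also have "exp ((1 - complex_of_real (2 * x)) * of_real (ln 2)) = complex_of_real (2 powr (1 - 2 * x))"
    by (simp add: powr_def exp_of_real[symmetric])
  finally show ?thesis
    unfolding Gamma_complex_of_real of_real_mult[symmetric] of_real_eq_iff .
qed

lemma has_bochner_integral_Beta:
  assumes "a > 0" "b > (0::real)"
  shows "has_bochner_integral lborel (\<lambda>t. indicator {0..1} t * (t powr (a - 1) * (1 - t) powr (b - 1))) (Beta a b)"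
proof (rule has_bochner_integral_nn_integral)
  show "(\<integral>\<^sup>+t. ennreal (indicator {0..1} t * (t powr (a - 1) * (1 - t) powr (b - 1))) \<partial>lborel) = ennreal (Beta a b)"
    using nn_integral_has_integral_lebesgue[OF _ has_integral_Beta_real[OF assms]] by simp
  show "0 \<le> Beta a b"
    using assms by (simp add: Beta_def Gamma_real_nonneg)
qed (auto simp: indicator_def)

text \<open>Uniform bound on the Beta factors, so that only an exponential series has to be summed
  in the termwise integration of the square.\<close>

lemma Beta_shift_le:
  assumes "a > 0" "b > (0::real)"
  shows "Beta (real N + a) b \<le> Beta a b"
proof (rule has_integral_le[OF has_integral_Beta_real has_integral_Beta_real])
  fix x :: real assume x: "x \<in> {0..1}"
  have "x powr (real N + a - 1) \<le> x powr (a - 1)"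
  proof (cases "x = 0")
    case False
    then show ?thesis using x by (intro powr_mono') auto
  qed simp
  then show "x powr (real N + a - 1) * (1 - x) powr (b - 1) \<le> x powr (a - 1) * (1 - x) powr (b - 1)"
    by (intro mult_right_mono) auto
qed (use assms in auto)

text \<open>
  The power series of \<open>J\<^sub>\<nu>\<^sup>2\<close>, integrated term by term, is a series of Beta integrals, namely the
  one obtained from the exponential series of \<open>exp (- y / \<tau>)\<close>.
\<close>

lemma nn_integral_bessel_sq_gauss:
  assumes \<nu>: "\<nu> \<ge> 0" and \<tau>: "\<tau> > 0"
  shows "(\<integral>\<^sup>+s. ennreal (indicator {0<..} s * ((Bessel_J \<nu> s)\<^sup>2 * (s * exp (- \<tau> * s\<^sup>2)))) \<partial>lborel)
    = ennreal (1 / (2 * sqrt pi * Gamma (\<nu> + 1/2))) * (\<integral>\<^sup>+y. ennreal (indicator {0..1} y *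
       (y powr (\<nu> - 1/2) * (1 - y) powr (\<nu> - 1/2) * (\<tau> powr (- \<nu> - 1) * exp (- y / \<tau>)))) \<partial>lborel)"
proof -
  define C where "C = 1 / (2 * sqrt pi * Gamma (\<nu> + 1/2))"
  have GC: "Gamma (\<nu> + 1/2) > 0" using \<nu> by (simp add: Gamma_real_pos)
  have C: "C > 0" using GC by (simp add: C_def)
  define g where "g N s = indicator {0<..} s * (s powr (2 * (real N + \<nu> + 1) - 1) * exp (- \<tau> * s\<^sup>2))" for N s
  define c where "c N = bessel_sq_coeff \<nu> N * (1 / 2) powr (2 * real N + 2 * \<nu>)" for N
  define f where "f N s = (-1) ^ N * c N * g N s" for N s
  define b where "b N t = indicator {0..1} t * (t powr (real N + (\<nu> + 1/2) - 1) * (1 - t) powr (\<nu> + 1/2 - 1))" for N t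
  define e where "e N = C * \<tau> powr (- \<nu> - 1) * ((1 / fact N) * (1 / \<tau>) ^ N)" for N
  define h where "h N t = (-1) ^ N * e N * b N t" for N t
  define D where "D N = e N * Beta (real N + (\<nu> + 1/2)) (\<nu> + 1/2)" for N
  have g: "has_bochner_integral lborel (g N) (Gamma (real N + \<nu> + 1) / (2 * \<tau> powr (real N + \<nu> + 1)))" for N
    unfolding g_def by (rule has_bochner_integral_gauss_moment) (use \<nu> \<tau> in auto)
  have b: "has_bochner_integral lborel (b N) (Beta (real N + (\<nu> + 1/2)) (\<nu> + 1/2))" for N
    unfolding b_def by (rule has_bochner_integral_Beta) (use \<nu> in auto)
  have g0: "g N s \<ge> 0" and b0: "b N s \<ge> 0" for N s by (simp_all add: g_def b_def)
  have c0: "c N \<ge> 0" for N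
    using \<nu> by (auto simp: c_def bessel_sq_coeff_def intro!: divide_nonneg_nonneg mult_nonneg_nonneg Gamma_real_nonneg)
  have e0: "e N \<ge> 0" for N using C \<tau> by (simp add: e_def)
  \<comment> \<open>Legendre duplication replaces 2^(-2N-2\<nu>) Gamma(2N+2\<nu>+1) by
    Gamma(N+\<nu>+1/2) Gamma(N+\<nu>+1) / sqrt pi. One Gamma cancels and the rest is a Beta value
    times a term of an exponential series.\<close>
  have ev: "c N * (Gamma (real N + \<nu> + 1) / (2 * \<tau> powr (real N + \<nu> + 1))) = D N" for N
  proof -
    define G1 where "G1 = Gamma (real N + \<nu> + 1)"
    define Gx where "Gx = Gamma (real N + \<nu> + 1/2)"
    define G2 where "G2 = Gamma (real N + 2 * \<nu> + 1)"
    define P where "P = (1 / 2::real) powr (2 * real N + 2 * \<nu>)"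
    have pos: "G1 > 0" "G2 > 0" "Gx > 0" using \<nu> by (simp_all add: G1_def G2_def Gx_def Gamma_real_pos)
    have "Gx * G1 = 2 powr (1 - 2 * (real N + \<nu> + 1/2)) * sqrt pi * Gamma (2 * (real N + \<nu> + 1/2))"
      using Gamma_duplication_real[of "real N + \<nu> + 1/2"] \<nu> by (simp add: Gx_def G1_def add.assoc)
    moreover have "2 powr (1 - 2 * (real N + \<nu> + 1/2)) = P"
      by (simp add: P_def powr_divide powr_minus_divide[symmetric] algebra_simps)
    moreover have "2 * (real N + \<nu> + 1/2) = 2 * real N + 2 * \<nu> + 1" by simp
    ultimately have "Gx * G1 = P * sqrt pi * Gamma (2 * real N + 2 * \<nu> + 1)" by (simp only:)
    then have dup: "P * Gamma (2 * real N + 2 * \<nu> + 1) = Gx * G1 / sqrt pi" by simp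
    have tp: "1 / \<tau> powr (real N + \<nu> + 1) = \<tau> powr (- \<nu> - 1) * (1 / \<tau>) ^ N"
    proof -
      have "1 / \<tau> powr (real N + \<nu> + 1) = \<tau> powr (- (real N + \<nu> + 1))" by (simp only: powr_minus_divide)
      also have "\<dots> = \<tau> powr (- \<nu> - 1) * \<tau> powr (- real N)"
        unfolding powr_add[symmetric] by (rule arg_cong[where f="\<lambda>x. \<tau> powr x"]) simp
      also have "\<tau> powr (- real N) = (1 / \<tau>) ^ N"
        using \<tau> by (simp add: powr_minus_divide powr_realpow power_divide)
      finally show ?thesis .
    qed
    have "c N * (G1 / (2 * \<tau> powr (real N + \<nu> + 1)))
      = (P * Gamma (2 * real N + 2 * \<nu> + 1)) / (fact N * G1\<^sup>2 * G2) * (G1 / 2) * (1 / \<tau> powr (real N + \<nu> + 1))"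
      by (simp add: c_def bessel_sq_coeff_def G1_def G2_def P_def mult_ac)
    also have "\<dots> = Gx / (2 * sqrt pi * fact N * G2) * (\<tau> powr (- \<nu> - 1) * (1 / \<tau>) ^ N)"
      unfolding dup tp using pos by (simp add: power2_eq_square)
    also have "\<dots> = e N * (Gx * Gamma (\<nu> + 1/2) / G2)"
      using GC by (simp add: e_def C_def mult_ac)
    also have "Gx * Gamma (\<nu> + 1/2) / G2 = Beta (real N + (\<nu> + 1/2)) (\<nu> + 1/2)"
      by (simp add: Beta_def Gx_def G2_def add_ac)
    finally show ?thesis by (simp add: D_def G1_def)
  qed
  have fi: "has_bochner_integral lborel (f N) ((-1) ^ N * D N)" for N
    unfolding f_def ev[symmetric] using has_bochner_integral_mult_right[OF g[of N], of "(-1)^N * c N"]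
    by (simp add: mult.assoc)
  have hi: "has_bochner_integral lborel (h N) ((-1) ^ N * D N)" for N
    unfolding h_def D_def using has_bochner_integral_mult_right[OF b[of N], of "(-1)^N * e N"]
    by (simp add: mult.assoc)
  have nf: "norm (f N s) = c N * g N s" and nh: "norm (h N s) = e N * b N s" for N s
    using c0 g0 e0 b0 by (simp_all add: f_def h_def abs_mult)
  have nfi: "has_bochner_integral lborel (\<lambda>s. norm (f N s)) (D N)" for N
    unfolding nf ev[symmetric] by (intro has_bochner_integral_mult_right g)
  have nhi: "has_bochner_integral lborel (\<lambda>s. norm (h N s)) (D N)" for N
    unfolding nh D_def by (intro has_bochner_integral_mult_right b)
  have sD: "summable D"
  proof (rule summable_comparison_test')
    show "summable (\<lambda>N. C * \<tau> powr (- \<nu> - 1) * Beta (\<nu> + 1/2) (\<nu> + 1/2) * ((1 / fact N) * (1 / \<tau>) ^ N))"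
      by (intro summable_mult summable_exp_series)
    fix N
    have "0 \<le> Beta (real N + (\<nu> + 1/2)) (\<nu> + 1/2)" using \<nu> by (simp add: Beta_def Gamma_real_nonneg)
    then show "norm (D N) \<le> C * \<tau> powr (- \<nu> - 1) * Beta (\<nu> + 1/2) (\<nu> + 1/2) * ((1 / fact N) * (1 / \<tau>) ^ N)"
      using mult_left_mono[OF Beta_shift_le[of "\<nu> + 1/2" "\<nu> + 1/2" N] e0[of N]] e0[of N] \<nu>
      by (simp add: D_def abs_mult) (simp add: e_def mult_ac)
  qed
  have Sf: "(\<lambda>N. f N s) sums (indicator {0<..} s * ((Bessel_J \<nu> s)\<^sup>2 * (s * exp (- \<tau> * s\<^sup>2)))) \<and> summable (\<lambda>N. norm (f N s))" for s
  proof (cases "s > 0")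
    case True
    have *: "f N s = (s * exp (- \<tau> * s\<^sup>2)) * ((-1) ^ N * bessel_sq_coeff \<nu> N * (s / 2) powr (2 * real N + 2 * \<nu>))" for N
    proof -
      have "s powr (2 * (real N + \<nu> + 1) - 1) = s * s powr (2 * real N + 2 * \<nu>)"
        using True by (simp add: powr_mult_base algebra_simps)
      moreover have "(1 / 2) powr (2 * real N + 2 * \<nu>) * s powr (2 * real N + 2 * \<nu>) = (s / 2) powr (2 * real N + 2 * \<nu>)"
        using True by (simp add: powr_mult[symmetric])
      ultimately show ?thesis using True by (simp add: f_def g_def c_def mult_ac)
    qed
    show ?thesis
      unfolding * using sums_mult[OF Bessel_J_square_sums(1)[OF True \<nu>], of "s * exp (- \<tau> * s\<^sup>2)"]
        summable_mult[OF Bessel_J_square_sums(2)[OF True \<nu>], of "\<bar>s * exp (- \<tau> * s\<^sup>2)\<bar>"] True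
      by (simp add: mult_ac abs_mult)
  qed (simp add: f_def g_def)
  have Sh: "(\<lambda>N. h N y) sums (C * (indicator {0..1} y * (y powr (\<nu> - 1/2) * (1 - y) powr (\<nu> - 1/2) * (\<tau> powr (- \<nu> - 1) * exp (- y / \<tau>)))))
     \<and> summable (\<lambda>N. norm (h N y))" for y
  proof (cases "y > 0 \<and> y \<le> 1")
    case True
    define K where "K = C * \<tau> powr (- \<nu> - 1) * (y powr (\<nu> - 1/2) * (1 - y) powr (\<nu> - 1/2))"
    have *: "h N y = K * ((1 / fact N) * (- (y / \<tau>)) ^ N)" for N
    proof -
      have 1: "y powr (real N + (\<nu> + 1/2) - 1) = y ^ N * y powr (\<nu> - 1/2)"
        using True by (simp add: powr_realpow[symmetric] powr_add[symmetric] algebra_simps)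
      have 2: "(- (y / \<tau>)) ^ N = (-1) ^ N * ((1 / \<tau>) ^ N * y ^ N)"
        by (subst power_minus) (simp add: power_divide)
      show ?thesis using True unfolding h_def b_def e_def K_def 1 2 by simp
    qed
    have E: "(\<lambda>m. (1 / fact m) * x ^ m) sums exp x" for x :: real
      using exp_converges[of x] by (simp add: field_simps)
    have "summable (\<lambda>N. norm (K * ((1 / fact N) * (- (y / \<tau>)) ^ N)))"
      using summable_mult[OF summable_exp_series[of "\<bar>y / \<tau>\<bar>"], of "\<bar>K\<bar>"] by (simp add: abs_mult power_abs)
    then show ?thesis unfolding *
      using sums_mult[OF E[of "- (y / \<tau>)"], of K] True by (simp add: K_def mult_ac)
  next
    case False
    \<comment> \<open>At y = 0 both sides vanish, because \<open>powr\<close> with base 0 returns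
      0.\<close>
    then have "indicator {0..1} y = (0::real) \<or> y = 0" by (auto simp: indicator_def)
    then show ?thesis by (auto simp: h_def b_def)
  qed
  have If: "integrable lborel (f N)" and Ih: "integrable lborel (h N)" for N
    using fi hi by (auto simp: has_bochner_integral_iff)
  have sf: "summable (\<lambda>N. \<integral>s. norm (f N s) \<partial>lborel)" and sh: "summable (\<lambda>N. \<integral>s. norm (h N s) \<partial>lborel)"
    using nfi nhi sD by (simp_all add: has_bochner_integral_iff)
  have AEf: "AE s in lborel. summable (\<lambda>N. norm (f N s))" and AEh: "AE s in lborel. summable (\<lambda>N. norm (h N s))"
    using Sf Sh by auto
  have suf: "(\<Sum>N. f N s) = indicator {0<..} s * ((Bessel_J \<nu> s)\<^sup>2 * (s * exp (- \<tau> * s\<^sup>2)))" for s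
    using Sf[of s] by (simp add: sums_iff)
  have suh: "(\<Sum>N. h N y) = C * (indicator {0..1} y * (y powr (\<nu> - 1/2) * (1 - y) powr (\<nu> - 1/2) * (\<tau> powr (- \<nu> - 1) * exp (- y / \<tau>))))" for y
    using Sh[of y] by (simp add: sums_iff)
  \<comment> \<open>The two series live on different half-lines, but their termwise integrals are
    the same numbers (-1)^N D N; absolute summability of D lets both be summed under the
    integral.\<close>
  have eq: "(\<integral>s. (\<Sum>N. f N s) \<partial>lborel) = (\<integral>y. (\<Sum>N. h N y) \<partial>lborel)"
    using integral_suminf[OF If AEf sf] integral_suminf[OF Ih AEh sh] fi hi by (simp add: has_bochner_integral_iff)
  have "(\<integral>\<^sup>+s. ennreal (\<Sum>N. f N s) \<partial>lborel) = ennreal (\<integral>s. (\<Sum>N. f N s) \<partial>lborel)"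
    by (rule nn_integral_eq_integral[OF integrable_suminf[OF If AEf sf]]) (auto simp: suf indicator_def)
  also have "\<dots> = (\<integral>\<^sup>+y. ennreal (\<Sum>N. h N y) \<partial>lborel)"
    unfolding eq by (rule nn_integral_eq_integral[OF integrable_suminf[OF Ih AEh sh], symmetric])
      (use C in \<open>auto simp: suh indicator_def\<close>)
  also have "\<dots> = (\<integral>\<^sup>+y. ennreal C * ennreal (indicator {0..1} y *
       (y powr (\<nu> - 1/2) * (1 - y) powr (\<nu> - 1/2) * (\<tau> powr (- \<nu> - 1) * exp (- y / \<tau>)))) \<partial>lborel)"
    unfolding suh using C by (intro nn_integral_cong ennreal_mult) (auto simp: indicator_def)
  also have "\<dots> = ennreal C * (\<integral>\<^sup>+y. ennreal (indicator {0..1} y *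
       (y powr (\<nu> - 1/2) * (1 - y) powr (\<nu> - 1/2) * (\<tau> powr (- \<nu> - 1) * exp (- y / \<tau>)))) \<partial>lborel)"
    by (rule nn_integral_cmult) measurable
  finally show ?thesis unfolding suf C_def .
qed

text \<open>The Weber-Schafheitlin integral at equal arguments. Duplication has been used to collect
  all factors free of \<nu> in front, so that the dependence on the order sits in one Gamma
  quotient.\<close>

definition bessel_const :: "real \<Rightarrow> real \<Rightarrow> real" where
  "bessel_const \<mu> \<nu> = Gamma (\<mu> / 2) / (2 * sqrt pi * Gamma ((\<mu> + 1) / 2)) *
     (Gamma (\<nu> + 1/2 - \<mu> / 2) / Gamma (\<nu> + 1/2 + \<mu> / 2))"

text \<open>
  Write \<open>s\<^sup>-\<^sup>\<mu>\<^sup>-\<^sup>1\<close> as a Gamma integral of \<open>exp (- \<tau> s\<^sup>2)\<close> over \<open>\<tau>\<close> and apply the previous lemma; what remains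
  is a Gamma and a Beta integral.
\<close>

lemma nn_integral_bessel_sq:
  assumes \<nu>: "\<nu> \<ge> 0" and \<mu>: "0 < \<mu>" "\<mu> < 2 * \<nu> + 1"
  shows "(\<integral>\<^sup>+s. ennreal (s powr (- \<mu>) * (Bessel_J \<nu> s)\<^sup>2) * indicator {0<..} s \<partial>lborel) = ennreal (bessel_const \<mu> \<nu>)"
proof -
  \<comment> \<open>Chosen so that s times s^(-2q) is s^(-\<mu>). The exponent Q then governs the
    remaining integral over \<tau>, and Q > 0 is exactly \<mu> < 2\<nu>+1, while \<mu> > 0 is what
    the Beta integral in y requires at 0.\<close>
  define q where "q = (\<mu> + 1) / 2"
  define Q where "Q = \<nu> + 1/2 - \<mu> / 2"
  define C where "C = 1 / (2 * sqrt pi * Gamma (\<nu> + 1/2))"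
  have q: "q > 0" and Q: "Q > 0" using \<mu> by (auto simp: q_def Q_def)
  have C: "C > 0" using \<nu> by (simp add: C_def Gamma_real_pos)
  have Gq: "Gamma q > 0" and GQ: "Gamma Q > 0" using q Q by (simp_all add: Gamma_real_pos)
  let ?b = "\<lambda>y. y powr (\<nu> - 1/2) * (1 - y) powr (\<nu> - 1/2)"
  have "ennreal (Gamma q) * (\<integral>\<^sup>+s. ennreal (s powr (- \<mu>) * (Bessel_J \<nu> s)\<^sup>2) * indicator {0<..} s \<partial>lborel)
    = (\<integral>\<^sup>+s. ennreal (Gamma q) * (ennreal (s powr (- \<mu>) * (Bessel_J \<nu> s)\<^sup>2) * indicator {0<..} s) \<partial>lborel)"
    by (rule nn_integral_cmult[symmetric]) measurable
  also have "\<dots> = (\<integral>\<^sup>+s. (\<integral>\<^sup>+\<tau>. ennreal (indicator {0<..} s * ((Bessel_J \<nu> s)\<^sup>2 * (s * exp (- \<tau> * s\<^sup>2)))) *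
      (ennreal (\<tau> powr (q - 1)) * indicator {0<..} \<tau>) \<partial>lborel) \<partial>lborel)"
  proof (rule nn_integral_cong)
    fix s :: real
    show "ennreal (Gamma q) * (ennreal (s powr (- \<mu>) * (Bessel_J \<nu> s)\<^sup>2) * indicator {0<..} s)
      = (\<integral>\<^sup>+\<tau>. ennreal (indicator {0<..} s * ((Bessel_J \<nu> s)\<^sup>2 * (s * exp (- \<tau> * s\<^sup>2)))) *
      (ennreal (\<tau> powr (q - 1)) * indicator {0<..} \<tau>) \<partial>lborel)"
    proof (cases "s > 0")
      case True
      have s2: "s\<^sup>2 > 0" using True by simp
      have "(\<integral>\<^sup>+\<tau>. ennreal (indicator {0<..} s * ((Bessel_J \<nu> s)\<^sup>2 * (s * exp (- \<tau> * s\<^sup>2)))) *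
        (ennreal (\<tau> powr (q - 1)) * indicator {0<..} \<tau>) \<partial>lborel)
        = (\<integral>\<^sup>+\<tau>. ennreal ((Bessel_J \<nu> s)\<^sup>2 * s) * (ennreal (\<tau> powr (1 * q - 1) * exp (- s\<^sup>2 * \<tau> powr 1)) * indicator {0<..} \<tau>) \<partial>lborel)"
      proof (rule nn_integral_cong)
        fix \<tau> :: real
        show "ennreal (indicator {0<..} s * ((Bessel_J \<nu> s)\<^sup>2 * (s * exp (- \<tau> * s\<^sup>2)))) *
        (ennreal (\<tau> powr (q - 1)) * indicator {0<..} \<tau>) = ennreal ((Bessel_J \<nu> s)\<^sup>2 * s) * (ennreal (\<tau> powr (1 * q - 1) * exp (- s\<^sup>2 * \<tau> powr 1)) * indicator {0<..} \<tau>)"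
          using True by (cases "\<tau> > 0") (simp_all add: ennreal_mult[symmetric] mult_ac)
      qed
      also have "\<dots> = ennreal ((Bessel_J \<nu> s)\<^sup>2 * s) * ennreal (Gamma q / (\<bar>1\<bar> * (s\<^sup>2) powr q))"
        by (subst nn_integral_cmult, measurable, subst nn_integral_gamma_power[OF q s2, of 1]) simp_all
      also have "\<dots> = ennreal (Gamma q * (s powr (- \<mu>) * (Bessel_J \<nu> s)\<^sup>2))"
      proof -
        have "(s\<^sup>2) powr q = s powr (2 * q)"
          using True powr_powr[of s 2 q] by (simp add: powr_numeral)
        also have "2 * q = \<mu> + 1" by (simp add: q_def)
        also have "s powr (\<mu> + 1) = s powr \<mu> * s" using True by (simp add: powr_add)
        finally have "(Bessel_J \<nu> s)\<^sup>2 * s * (Gamma q / (\<bar>1\<bar> * (s\<^sup>2) powr q)) = Gamma q * (s powr (- \<mu>) * (Bessel_J \<nu> s)\<^sup>2)"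
          using True by (simp add: powr_minus_divide)
        then show ?thesis using True Gq by (simp add: ennreal_mult[symmetric])
      qed
      also have "\<dots> = ennreal (Gamma q) * (ennreal (s powr (- \<mu>) * (Bessel_J \<nu> s)\<^sup>2) * indicator {0<..} s)"
        using True Gq by (simp add: ennreal_mult)
      finally show ?thesis ..
    qed simp
  qed
  also have "\<dots> = (\<integral>\<^sup>+\<tau>. (\<integral>\<^sup>+s. ennreal (indicator {0<..} s * ((Bessel_J \<nu> s)\<^sup>2 * (s * exp (- \<tau> * s\<^sup>2)))) *
      (ennreal (\<tau> powr (q - 1)) * indicator {0<..} \<tau>) \<partial>lborel) \<partial>lborel)"
    by (rule lborel_pair.Fubini'[symmetric]) measurable
  also have "\<dots> = (\<integral>\<^sup>+\<tau>. (\<integral>\<^sup>+y. ennreal (C * (indicator {0..1} y * ?b y)) *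
      (ennreal (\<tau> powr (q - \<nu> - 2) * exp (- y / \<tau>)) * indicator {0<..} \<tau>) \<partial>lborel) \<partial>lborel)"
  proof (rule nn_integral_cong)
    fix \<tau> :: real
    show "(\<integral>\<^sup>+s. ennreal (indicator {0<..} s * ((Bessel_J \<nu> s)\<^sup>2 * (s * exp (- \<tau> * s\<^sup>2)))) *
      (ennreal (\<tau> powr (q - 1)) * indicator {0<..} \<tau>) \<partial>lborel)
      = (\<integral>\<^sup>+y. ennreal (C * (indicator {0..1} y * ?b y)) *
      (ennreal (\<tau> powr (q - \<nu> - 2) * exp (- y / \<tau>)) * indicator {0<..} \<tau>) \<partial>lborel)"
    proof (cases "\<tau> > 0")
      case True
      have "(\<integral>\<^sup>+s. ennreal (indicator {0<..} s * ((Bessel_J \<nu> s)\<^sup>2 * (s * exp (- \<tau> * s\<^sup>2)))) *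
        (ennreal (\<tau> powr (q - 1)) * indicator {0<..} \<tau>) \<partial>lborel)
        = (\<integral>\<^sup>+s. ennreal (indicator {0<..} s * ((Bessel_J \<nu> s)\<^sup>2 * (s * exp (- \<tau> * s\<^sup>2)))) \<partial>lborel) * ennreal (\<tau> powr (q - 1))"
        using True by (subst nn_integral_multc[symmetric]) auto
      also have "\<dots> = (ennreal C * (\<integral>\<^sup>+y. ennreal (indicator {0..1} y *
       (?b y * (\<tau> powr (- \<nu> - 1) * exp (- y / \<tau>)))) \<partial>lborel)) * ennreal (\<tau> powr (q - 1))"
        unfolding nn_integral_bessel_sq_gauss[OF \<nu> True] C_def ..
      also have "\<dots> = (\<integral>\<^sup>+y. ennreal C * (ennreal (indicator {0..1} y *
       (?b y * (\<tau> powr (- \<nu> - 1) * exp (- y / \<tau>)))) * ennreal (\<tau> powr (q - 1))) \<partial>lborel)"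
        by (subst nn_integral_cmult, measurable, subst nn_integral_multc, measurable) (simp add: mult.assoc)
      also have "\<dots> = (\<integral>\<^sup>+y. ennreal (C * (indicator {0..1} y * ?b y)) *
      (ennreal (\<tau> powr (q - \<nu> - 2) * exp (- y / \<tau>)) * indicator {0<..} \<tau>) \<partial>lborel)"
      proof (rule nn_integral_cong)
        fix y :: real
        have "\<tau> powr (q - \<nu> - 2) = \<tau> powr (- \<nu> - 1) * \<tau> powr (q - 1)" by (simp add: powr_add[symmetric])
        then have *: "C * (indicator {0..1} y * (?b y * (\<tau> powr (- \<nu> - 1) * exp (- y / \<tau>))) * \<tau> powr (q - 1))
          = C * (indicator {0..1} y * ?b y) * (\<tau> powr (q - \<nu> - 2) * exp (- y / \<tau>))" by simp
        have "ennreal C * (ennreal (indicator {0..1} y * (?b y * (\<tau> powr (- \<nu> - 1) * exp (- y / \<tau>)))) * ennreal (\<tau> powr (q - 1)))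
          = ennreal (C * (indicator {0..1} y * (?b y * (\<tau> powr (- \<nu> - 1) * exp (- y / \<tau>))) * \<tau> powr (q - 1)))"
          using C by (subst ennreal_mult[symmetric], simp, simp, subst ennreal_mult[symmetric]) auto
        also have "\<dots> = ennreal (C * (indicator {0..1} y * ?b y)) * ennreal (\<tau> powr (q - \<nu> - 2) * exp (- y / \<tau>))"
          unfolding * using C by (intro ennreal_mult) auto
        finally show "ennreal C * (ennreal (indicator {0..1} y * (?b y * (\<tau> powr (- \<nu> - 1) * exp (- y / \<tau>)))) * ennreal (\<tau> powr (q - 1)))
          = ennreal (C * (indicator {0..1} y * ?b y)) * (ennreal (\<tau> powr (q - \<nu> - 2) * exp (- y / \<tau>)) * indicator {0<..} \<tau>)"
          using True by simp
      qed
      finally show ?thesis .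
    qed simp
  qed
  also have "\<dots> = (\<integral>\<^sup>+y. (\<integral>\<^sup>+\<tau>. ennreal (C * (indicator {0..1} y * ?b y)) *
      (ennreal (\<tau> powr (q - \<nu> - 2) * exp (- y / \<tau>)) * indicator {0<..} \<tau>) \<partial>lborel) \<partial>lborel)"
    by (rule lborel_pair.Fubini') measurable
  also have "\<dots> = (\<integral>\<^sup>+y. ennreal (C * Gamma Q) * ennreal (indicator {0..1} y * (y powr (\<mu> / 2 - 1) * (1 - y) powr ((\<nu> + 1/2) - 1))) \<partial>lborel)"
  proof (rule nn_integral_cong_AE, rule eventually_mono[OF AE_lborel_singleton[of 0]])
    fix y :: real assume y0: "y \<noteq> 0"
    show "(\<integral>\<^sup>+\<tau>. ennreal (C * (indicator {0..1} y * ?b y)) *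
      (ennreal (\<tau> powr (q - \<nu> - 2) * exp (- y / \<tau>)) * indicator {0<..} \<tau>) \<partial>lborel)
      = ennreal (C * Gamma Q) * ennreal (indicator {0..1} y * (y powr (\<mu> / 2 - 1) * (1 - y) powr ((\<nu> + 1/2) - 1)))"
    proof (cases "y > 0 \<and> y \<le> 1")
      case True
      then have y: "y > 0" by simp
      have "(\<integral>\<^sup>+\<tau>. ennreal (\<tau> powr (q - \<nu> - 2) * exp (- y / \<tau>)) * indicator {0<..} \<tau> \<partial>lborel)
        = (\<integral>\<^sup>+\<tau>. ennreal (\<tau> powr ((-1) * Q - 1) * exp (- y * \<tau> powr (-1))) * indicator {0<..} \<tau> \<partial>lborel)"
      proof -
        have e: "q - \<nu> - 2 = (-1) * Q - 1" by (simp add: q_def Q_def field_simps)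
        have "ennreal (x powr (q - \<nu> - 2) * exp (- y / x)) * indicator {0<..} x
          = ennreal (x powr ((-1) * Q - 1) * exp (- y * x powr (-1))) * indicator {0<..} x" for x
        proof (cases "x > 0")
          case True
          then have "- y / x = - y * x powr (-1)" by (simp add: powr_minus_divide)
          then show ?thesis unfolding e by (simp only:)
        qed simp
        then show ?thesis by (intro nn_integral_cong)
      qed
      also have "\<dots> = ennreal (Gamma Q / y powr Q)"
        using nn_integral_gamma_power[OF Q y, of "-1"] by simp
      finally have *: "(\<integral>\<^sup>+\<tau>. ennreal (\<tau> powr (q - \<nu> - 2) * exp (- y / \<tau>)) * indicator {0<..} \<tau> \<partial>lborel) = ennreal (Gamma Q / y powr Q)" .
      have **: "y powr (\<nu> - 1/2) / y powr Q = y powr (\<mu> / 2 - 1)"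
        by (simp add: powr_diff[symmetric] Q_def)
      have "(\<integral>\<^sup>+\<tau>. ennreal (C * (indicator {0..1} y * ?b y)) *
        (ennreal (\<tau> powr (q - \<nu> - 2) * exp (- y / \<tau>)) * indicator {0<..} \<tau>) \<partial>lborel)
        = ennreal (C * (indicator {0..1} y * ?b y)) * ennreal (Gamma Q / y powr Q)"
        by (subst nn_integral_cmult, measurable, subst *, rule refl)
      also have "\<dots> = ennreal ((C * Gamma Q) * ((y powr (\<nu> - 1/2) / y powr Q) * (1 - y) powr (\<nu> - 1/2)))"
        using True C GQ by (subst ennreal_mult[symmetric]) (auto simp: mult_ac)
      also have "\<dots> = ennreal (C * Gamma Q) * ennreal (indicator {0..1} y * (y powr (\<mu> / 2 - 1) * (1 - y) powr ((\<nu> + 1/2) - 1)))"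
        unfolding ** using True C GQ by (subst ennreal_mult) (auto simp: algebra_simps)
      finally show ?thesis .
    next
      case False
      then have "indicator {0..1} y = (0::real)" using y0 by (auto simp: indicator_def)
      then show ?thesis by simp
    qed
  qed
  also have "\<dots> = ennreal (C * Gamma Q) * ennreal (Beta (\<mu> / 2) (\<nu> + 1/2))"
  proof (subst nn_integral_cmult)
    have "has_bochner_integral lborel (\<lambda>t. indicator {0..1} t * (t powr (\<mu> / 2 - 1) * (1 - t) powr ((\<nu> + 1/2) - 1))) (Beta (\<mu> / 2) (\<nu> + 1/2))"
      by (rule has_bochner_integral_Beta) (use \<mu> \<nu> in auto)
    then have "(\<integral>\<^sup>+t. ennreal (indicator {0..1} t * (t powr (\<mu> / 2 - 1) * (1 - t) powr ((\<nu> + 1/2) - 1))) \<partial>lborel) = ennreal (Beta (\<mu> / 2) (\<nu> + 1/2))"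
      by (subst nn_integral_eq_integral) (auto simp: has_bochner_integral_iff indicator_def)
    then show "ennreal (C * Gamma Q) * (\<integral>\<^sup>+t. ennreal (indicator {0..1} t * (t powr (\<mu> / 2 - 1) * (1 - t) powr ((\<nu> + 1/2) - 1))) \<partial>lborel)
      = ennreal (C * Gamma Q) * ennreal (Beta (\<mu> / 2) (\<nu> + 1/2))" by simp
  qed measurable
  also have "\<dots> = ennreal (Gamma q) * ennreal (bessel_const \<mu> \<nu>)"
  proof -
    have "Gamma (\<nu> + 1/2) > 0" using \<nu> by (simp add: Gamma_real_pos)
    then have "C * Gamma Q * Beta (\<mu> / 2) (\<nu> + 1/2) = Gamma q * bessel_const \<mu> \<nu>"
      using Gq by (simp add: C_def Beta_def bessel_const_def q_def Q_def add_ac mult_ac)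
    moreover have "Beta (\<mu> / 2) (\<nu> + 1/2) \<ge> 0" "bessel_const \<mu> \<nu> \<ge> 0"
      using \<mu> \<nu> by (auto simp: Beta_def bessel_const_def intro!: mult_nonneg_nonneg divide_nonneg_nonneg Gamma_real_nonneg)
    ultimately show ?thesis using C Gq GQ by (simp add: ennreal_mult[symmetric])
  qed
  finally have *: "ennreal (Gamma q) * (\<integral>\<^sup>+s. ennreal (s powr (- \<mu>) * (Bessel_J \<nu> s)\<^sup>2) * indicator {0<..} s \<partial>lborel)
    = ennreal (Gamma q) * ennreal (bessel_const \<mu> \<nu>)" .
  then show ?thesis
    using Gq by (subst (asm) ennreal_mult_cancel_left) (auto simp: ennreal_eq_0_iff)
qed

text \<open>The logarithm of the Gamma quotient has derivative Digamma(x - \<mu>/2) - Digamma(x +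
  \<mu>/2), which is at most 0 because Digamma increases. This makes the constant uniform in all
  higher degrees.\<close>

lemma bessel_const_antimono:
  assumes \<mu>: "0 < \<mu>" "\<mu> < 2 * \<nu>0 + 1" and le: "\<nu>0 \<le> \<nu>"
  shows "bessel_const \<mu> \<nu> \<le> bessel_const \<mu> \<nu>0"
proof -
  define F where "F x = ln_Gamma (x - \<mu> / 2) - ln_Gamma (x + \<mu> / 2)" for x :: real
  have "F (\<nu> + 1/2) \<le> F (\<nu>0 + 1/2)"
  proof (rule DERIV_nonpos_imp_nonincreasing[of "\<nu>0 + 1/2" "\<nu> + 1/2" F])
    fix x assume x: "\<nu>0 + 1/2 \<le> x" "x \<le> \<nu> + 1/2"
    have "(F has_field_derivative (Digamma (x - \<mu> / 2) - Digamma (x + \<mu> / 2))) (at x)"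
      unfolding F_def using x \<mu> by (auto intro!: derivative_eq_intros)
    moreover have "Digamma (x - \<mu> / 2) - Digamma (x + \<mu> / 2) \<le> 0"
      using Digamma_real_mono[of "x - \<mu> / 2" "x + \<mu> / 2"] x \<mu> by simp
    ultimately show "\<exists>y. (F has_field_derivative y) (at x) \<and> y \<le> 0" by blast
  qed (use le in simp)
  then have "exp (F (\<nu> + 1/2)) \<le> exp (F (\<nu>0 + 1/2))" by simp
  moreover have "exp (F x) = Gamma (x - \<mu> / 2) / Gamma (x + \<mu> / 2)" if "x > \<mu> / 2" for x
    using that \<mu> by (simp add: F_def exp_diff Gamma_real_pos_exp)
  ultimately have "Gamma (\<nu> + 1/2 - \<mu> / 2) / Gamma (\<nu> + 1/2 + \<mu> / 2) \<le> Gamma (\<nu>0 + 1/2 - \<mu> / 2) / Gamma (\<nu>0 + 1/2 + \<mu> / 2)"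
    using \<mu> le by simp
  then show ?thesis
    unfolding bessel_const_def using \<mu> by (intro mult_left_mono) (auto intro!: divide_nonneg_nonneg Gamma_real_nonneg)
qed

section \<open>The Hankel transform\<close>

lemma sets_radial_measure [simp, measurable_cong]: "sets (radial_measure n) = sets borel"
  by (simp add: radial_measure_def)

lemma space_radial_measure [simp]: "space (radial_measure n) = UNIV"
  by (simp add: radial_measure_def)

lemma sigma_finite_radial_measure: "sigma_finite_measure (radial_measure n)"
  unfolding radial_measure_def
  by (subst sigma_finite_measure.sigma_finite_iff_density_finite[OF sigma_finite_lborel]) auto

lemma AE_radial_iff:
  assumes "Measurable.pred borel P"
  shows "(AE r in radial_measure n. P r) \<longleftrightarrow> (AE r in lborel. r > 0 \<longrightarrow> P r)"
  unfolding radial_measure_def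
  by (subst AE_density) (auto simp: indicator_def zero_less_power intro!: AE_cong)

lemma AE_radial_pos: "AE r in radial_measure n. r > 0"
  unfolding radial_measure_def by (subst AE_density) (auto simp: indicator_def)

lemma nn_integral_radial:
  assumes [measurable]: "f \<in> borel_measurable borel"
  shows "(\<integral>\<^sup>+r. f r \<partial>radial_measure n) = (\<integral>\<^sup>+r. f r * ennreal (r ^ (n - 1)) * indicator {0<..} r \<partial>lborel)"
proof -
  have "(\<integral>\<^sup>+r. f r \<partial>radial_measure n) = (\<integral>\<^sup>+r. ennreal (indicator {0<..} r * r ^ (n - 1)) * f r \<partial>lborel)"
    unfolding radial_measure_def by (rule nn_integral_density) auto
  also have "\<dots> = (\<integral>\<^sup>+r. f r * ennreal (r ^ (n - 1)) * indicator {0<..} r \<partial>lborel)"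
    by (intro nn_integral_cong) (auto simp: indicator_def mult.commute)
  finally show ?thesis .
qed

lemma has_bochner_integral_radial:
  fixes f :: "real \<Rightarrow> real"
  assumes [measurable]: "f \<in> borel_measurable borel"
  shows "has_bochner_integral (radial_measure n) f I \<longleftrightarrow>
    has_bochner_integral lborel (\<lambda>r. indicator {0<..} r * (r ^ (n - 1) * f r)) I"
proof -
  have 0: "AE r::real in lborel. 0 \<le> indicator {0<..} r * r ^ (n - 1)"
  proof (intro AE_I2)
    show "0 \<le> indicator {0<..} r * r ^ (n - 1)" for r :: real by (cases "r > 0") auto
  qed
  show ?thesis
    unfolding radial_measure_def has_bochner_integral_iff
    using integrable_density[OF _ _ 0, of f] integral_density[OF _ _ 0, of f]
    by (simp add: mult.assoc)
qed

text \<open>The radial profiles that Weber's integral maps to each other: the transform sends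
  parameter p to 1/p up to the scalar p^(-\<nu>-1).\<close>

definition gauss_fun :: "nat \<Rightarrow> real \<Rightarrow> real \<Rightarrow> real \<Rightarrow> real" where
  "gauss_fun n \<nu> p r = r powr (\<nu> - lam n) * exp (- (p / 2) * r\<^sup>2)"

definition hankel_kernel :: "nat \<Rightarrow> real \<Rightarrow> real \<Rightarrow> real \<Rightarrow> real" where
  "hankel_kernel n \<nu> r \<rho> = (r * \<rho>) powr (- lam n) * Bessel_J \<nu> (r * \<rho>)"

lemma hankel_kernel_commute: "hankel_kernel n \<nu> r \<rho> = hankel_kernel n \<nu> \<rho> r"
  by (simp add: hankel_kernel_def mult.commute)

lemma hankel_integral_kernel:
  "hankel_integral n \<nu> f \<rho> = (\<integral>r. complex_of_real (hankel_kernel n \<nu> r \<rho>) * f r \<partial>radial_measure n)"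
  by (simp add: hankel_integral_def hankel_kernel_def)

lemma hankel_kernel_measurable [measurable]:
  assumes [measurable]: "f \<in> borel_measurable M" "g \<in> borel_measurable M"
  shows "(\<lambda>x. hankel_kernel n \<nu> (f x) (g x)) \<in> borel_measurable M"
  unfolding hankel_kernel_def by measurable

lemma gauss_fun_measurable [measurable]: "gauss_fun n \<nu> p \<in> borel_measurable borel"
  unfolding gauss_fun_def by measurable

lemma powr_radial:
  assumes "r > 0" "n \<ge> 1" shows "r ^ (n - 1) = r powr (2 * lam n + 1)"
proof -
  have "r ^ (n - 1) = r powr real (n - 1)" by (rule powr_realpow[OF assms(1), symmetric])
  also have "real (n - 1) = 2 * lam n + 1" using assms by (simp add: lam_def of_nat_diff field_simps)
  finally show ?thesis .
qed

text \<open>The density r^(2 \<lambda> + 1), the factor r^(-\<lambda>) of the kernel and the factor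
  r^(\<nu>-\<lambda>) of the Gaussian combine to r^(\<nu>+1), which is the weight in
  \<open>bessel_gauss\<close>.\<close>

lemma hankel_gauss:
  assumes n: "n \<ge> 1" and \<nu>: "\<nu> \<ge> 0" and \<rho>: "\<rho> > 0" and p: "p > 0"
  shows "has_bochner_integral (radial_measure n) (\<lambda>r. hankel_kernel n \<nu> r \<rho> * gauss_fun n \<nu> p r)
      (p powr (- \<nu> - 1) * gauss_fun n \<nu> (1 / p) \<rho>)"
    and "(\<integral>\<^sup>+r. ennreal \<bar>hankel_kernel n \<nu> r \<rho> * gauss_fun n \<nu> p r\<bar> \<partial>radial_measure n)
      \<le> ennreal (p powr (- \<nu> - 1) * (\<rho> powr (\<nu> - lam n) * exp (\<rho>\<^sup>2 / (2 * p))))"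
proof -
  let ?f = "\<lambda>r. indicator {0<..} r * (Bessel_J \<nu> (r * \<rho>) * (r powr (\<nu> + 1) * exp (- (p / 2) * r\<^sup>2)))"
  have eq: "indicator {0<..} r * (r ^ (n - 1) * (hankel_kernel n \<nu> r \<rho> * gauss_fun n \<nu> p r)) = \<rho> powr (- lam n) * ?f r" for r
  proof (cases "r > 0")
    case True
    have "r powr (2 * lam n + 1) * (r powr (- lam n) * r powr (\<nu> - lam n)) = r powr (\<nu> + 1)"
      by (simp add: powr_add[symmetric] add.commute)
    then have "r ^ (n - 1) * ((r * \<rho>) powr (- lam n) * r powr (\<nu> - lam n)) = \<rho> powr (- lam n) * r powr (\<nu> + 1)"
      using True \<rho> powr_radial[OF True n] by (simp add: powr_mult)
    then show ?thesis using True by (simp add: hankel_kernel_def gauss_fun_def)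
  qed simp
  have pw: "\<rho> powr (- lam n) * \<rho> powr \<nu> = \<rho> powr (\<nu> - lam n)"
    by (simp add: powr_add[symmetric])
  have "has_bochner_integral lborel ?f (\<rho> powr \<nu> * p powr (- \<nu> - 1) * exp (- \<rho>\<^sup>2 / (2 * p)))"
    using bessel_gauss(1,2)[OF \<nu> \<rho> p] by (simp add: has_bochner_integral_iff)
  note * = has_bochner_integral_mult_right[OF this, of "\<rho> powr (- lam n)"]
  show "has_bochner_integral (radial_measure n) (\<lambda>r. hankel_kernel n \<nu> r \<rho> * gauss_fun n \<nu> p r)
      (p powr (- \<nu> - 1) * gauss_fun n \<nu> (1 / p) \<rho>)"
  proof (subst has_bochner_integral_radial, measurable)
    have "exp (- \<rho>\<^sup>2 / (2 * p)) = exp (- (1 / p / 2) * \<rho>\<^sup>2)" by (simp add: field_simps)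
    then have v: "\<rho> powr (- lam n) * (\<rho> powr \<nu> * p powr (- \<nu> - 1) * exp (- \<rho>\<^sup>2 / (2 * p)))
      = p powr (- \<nu> - 1) * gauss_fun n \<nu> (1 / p) \<rho>"
      unfolding gauss_fun_def pw[symmetric] by simp
    show "has_bochner_integral lborel (\<lambda>r. indicator {0<..} r * (r ^ (n - 1) * (hankel_kernel n \<nu> r \<rho> * gauss_fun n \<nu> p r)))
      (p powr (- \<nu> - 1) * gauss_fun n \<nu> (1 / p) \<rho>)"
      unfolding eq using *[unfolded v] .
  qed
  have "(\<integral>\<^sup>+r. ennreal \<bar>hankel_kernel n \<nu> r \<rho> * gauss_fun n \<nu> p r\<bar> \<partial>radial_measure n)
    = (\<integral>\<^sup>+r. ennreal (\<rho> powr (- lam n)) * ennreal \<bar>?f r\<bar> \<partial>lborel)"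
  proof (subst nn_integral_radial, measurable, rule nn_integral_cong)
    fix r :: real
    show "ennreal \<bar>hankel_kernel n \<nu> r \<rho> * gauss_fun n \<nu> p r\<bar> * ennreal (r ^ (n - 1)) * indicator {0<..} r
      = ennreal (\<rho> powr (- lam n)) * ennreal \<bar>?f r\<bar>"
    proof (cases "r > 0")
      case True
      then have "\<bar>hankel_kernel n \<nu> r \<rho> * gauss_fun n \<nu> p r\<bar> * r ^ (n - 1)
        = \<bar>indicator {0<..} r * (r ^ (n - 1) * (hankel_kernel n \<nu> r \<rho> * gauss_fun n \<nu> p r))\<bar>"
        by (simp add: abs_mult)
      also have "\<dots> = \<rho> powr (- lam n) * \<bar>?f r\<bar>" unfolding eq by (simp add: abs_mult)
      finally show ?thesis using True by (simp only: indicator_simps greaterThan_iff mult_1_right ennreal_mult[symmetric] abs_ge_zero zero_le_power less_imp_le powr_ge_zero)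
    qed simp
  qed
  also have "\<dots> = ennreal (\<rho> powr (- lam n)) * ennreal (\<integral>r. \<bar>?f r\<bar> \<partial>lborel)"
    by (subst nn_integral_cmult, measurable, subst nn_integral_eq_integral) (use bessel_gauss(1)[OF \<nu> \<rho> p] in auto)
  also have "\<dots> \<le> ennreal (\<rho> powr (- lam n)) * ennreal (\<rho> powr \<nu> * p powr (- \<nu> - 1) * exp (\<rho>\<^sup>2 / (2 * p)))"
    by (intro mult_left_mono ennreal_leI bessel_gauss(3)[OF \<nu> \<rho> p]) auto
  also have "\<dots> = ennreal (p powr (- \<nu> - 1) * (\<rho> powr (\<nu> - lam n) * exp (\<rho>\<^sup>2 / (2 * p))))"
    by (simp add: ennreal_mult[symmetric] pw[symmetric] mult_ac)
  finally show "(\<integral>\<^sup>+r. ennreal \<bar>hankel_kernel n \<nu> r \<rho> * gauss_fun n \<nu> p r\<bar> \<partial>radial_measure n)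
      \<le> ennreal (p powr (- \<nu> - 1) * (\<rho> powr (\<nu> - lam n) * exp (\<rho>\<^sup>2 / (2 * p))))" .
qed

lemma gauss_fun_product:
  assumes n: "n \<ge> 1" and \<nu>: "\<nu> \<ge> 0" and p: "p > 0" "q > 0"
  shows "has_bochner_integral (radial_measure n) (\<lambda>r. gauss_fun n \<nu> p r * gauss_fun n \<nu> q r)
    (Gamma (\<nu> + 1) / (2 * ((p + q) / 2) powr (\<nu> + 1)))"
proof (subst has_bochner_integral_radial)
  have *: "indicator {0<..} r * (r ^ (n - 1) * (gauss_fun n \<nu> p r * gauss_fun n \<nu> q r))
    = indicator {0<..} r * (r powr (2 * (\<nu> + 1) - 1) * exp (- ((p + q) / 2) * r\<^sup>2))" for r
  proof (cases "r > 0")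
    case True
    have "r powr (2 * lam n + 1) * (r powr (\<nu> - lam n) * r powr (\<nu> - lam n)) = r powr (2 * (\<nu> + 1) - 1)"
      by (simp add: powr_add[symmetric])
    moreover have "exp (- (p / 2) * r\<^sup>2) * exp (- (q / 2) * r\<^sup>2) = exp (- ((p + q) / 2) * r\<^sup>2)"
      by (simp add: exp_add[symmetric] field_simps)
    ultimately show ?thesis using True powr_radial[OF True n] by (simp add: gauss_fun_def mult_ac)
  qed simp
  show "has_bochner_integral lborel (\<lambda>r. indicator {0<..} r * (r ^ (n - 1) * (gauss_fun n \<nu> p r * gauss_fun n \<nu> q r)))
     (Gamma (\<nu> + 1) / (2 * ((p + q) / 2) powr (\<nu> + 1)))"
    unfolding * by (rule has_bochner_integral_gauss_moment) (use \<nu> p in auto)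
qed measurable

lemma gauss_fun_L2R: "n \<ge> 1 \<Longrightarrow> \<nu> \<ge> 0 \<Longrightarrow> p > 0 \<Longrightarrow> gauss_fun n \<nu> p \<in> L2R (radial_measure n)"
  using gauss_fun_product[of n \<nu> p p] by (auto simp: L2R_iff has_bochner_integral_iff power2_eq_square)

text \<open>Integer parameters suffice, and this countable family is what Gram-Schmidt is fed with:
  the functions are the one with p = 1 times powers of T, so their moments are polynomial moments in
  T.\<close>

lemma gauss_moments_unique_nat:
  assumes [measurable]: "g \<in> borel_measurable (radial_measure n)"
    and int: "\<And>i. integrable (radial_measure n) (\<lambda>r. g r * complex_of_real (gauss_fun n \<nu> (real i + 1) r))"
    and zero: "\<And>i. coef (radial_measure n) (gauss_fun n \<nu> (real i + 1)) g = 0"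
  shows "AE r in radial_measure n. g r = 0"
proof -
  let ?M = "radial_measure n"
  define T where "T r = exp (- r\<^sup>2 / 2)" for r :: real
  have [measurable]: "T \<in> borel_measurable borel" unfolding T_def by measurable
  have pow: "gauss_fun n \<nu> 1 r * T r ^ j = gauss_fun n \<nu> (real j + 1) r" for r j
    by (simp add: gauss_fun_def T_def exp_of_nat_mult[symmetric] exp_add[symmetric] field_simps)
  have "AE r in ?M. g r * complex_of_real (gauss_fun n \<nu> 1 r) = 0"
  proof (rule AE_eq_0_if_moments_eq_0[where T=T and K="{0..1::real}"])
    show "integrable ?M (\<lambda>r. g r * complex_of_real (gauss_fun n \<nu> 1 r))" using int[of 0] by simp
    show "T \<in> borel_measurable ?M" by measurable
    show "T x \<in> {0..1}" for x by (simp add: T_def)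
    fix p :: "real \<Rightarrow> real" assume "real_polynomial_function p"
    then obtain a N where p: "p = (\<lambda>x. \<Sum>i\<le>N. a i * x ^ i)"
      unfolding real_polynomial_function_iff_sum by blast
    have "(\<integral>r. g r * complex_of_real (gauss_fun n \<nu> 1 r) * complex_of_real (p (T r)) \<partial>?M)
      = (\<integral>r. (\<Sum>i\<le>N. complex_of_real (a i) * (g r * complex_of_real (gauss_fun n \<nu> (real i + 1) r))) \<partial>?M)"
      unfolding p pow[symmetric] by (simp add: sum_distrib_left mult_ac)
    also have "\<dots> = (\<Sum>i\<le>N. complex_of_real (a i) * coef ?M (gauss_fun n \<nu> (real i + 1)) g)"
      unfolding coef_def
      by (subst Bochner_Integration.integral_sum) (auto intro!: int)
    also have "\<dots> = 0" by (simp add: zero)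
    finally show "(\<integral>r. g r * complex_of_real (gauss_fun n \<nu> 1 r) * complex_of_real (p (T r)) \<partial>?M) = 0" .
  next
    fix A assume "A \<in> sets ?M"
    then have [measurable]: "A \<in> sets borel" by simp
    \<comment> \<open>The image of A under T, with sqrt(-2 ln x) inverting T on the positive
      half-line; only there is T injective, hence the equivalence a.e. for the radial
      measure.\<close>
    define B where "B = {x::real. x > 0 \<and> sqrt (- 2 * ln x) \<in> A}"
    have "B \<in> sets borel" unfolding B_def by measurable
    moreover have "AE r in ?M. r \<in> A \<longleftrightarrow> T r \<in> B"
      using AE_radial_pos by eventually_elim (simp add: B_def T_def)
    ultimately show "\<exists>B\<in>sets borel. AE r in ?M. r \<in> A \<longleftrightarrow> T r \<in> B" by blast
  qed (simp add: compact_Icc)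
  with AE_radial_pos[of n] show ?thesis
    by eventually_elim (auto simp: gauss_fun_def)
qed

lemma gauss_moments_unique:
  assumes "g \<in> borel_measurable (radial_measure n)"
    and "\<And>p. p > 0 \<Longrightarrow> integrable (radial_measure n) (\<lambda>r. g r * complex_of_real (gauss_fun n \<nu> p r))"
    and "\<And>p. p > 0 \<Longrightarrow> coef (radial_measure n) (gauss_fun n \<nu> p) g = 0"
  shows "AE r in radial_measure n. g r = 0"
  using assms by (intro gauss_moments_unique_nat[where \<nu>=\<nu>]) auto

text \<open>
  Self-adjointness of the transform, tested on the functions \<open>gauss_fun n \<nu> p\<close>, which it maps to
  multiples of each other, serves as definition of the unitary extension to \<open>L\<^sup>2\<close>.
\<close>

definition hankel_pair :: "nat \<Rightarrow> real \<Rightarrow> (real \<Rightarrow> complex) \<Rightarrow> (real \<Rightarrow> complex) \<Rightarrow> bool" where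
  "hankel_pair n \<nu> f g \<longleftrightarrow> f \<in> L2 (radial_measure n) \<and> g \<in> L2 (radial_measure n) \<and>
     (\<forall>p>0. coef (radial_measure n) (gauss_fun n \<nu> p) g
        = complex_of_real (p powr (- \<nu> - 1)) * coef (radial_measure n) (gauss_fun n \<nu> (1 / p)) f)"

text \<open>Replacing p by 1/p turns the relation into the one for the swapped pair, since the two
  scalars are inverse to each other. This is the self-inversion of the Hankel transform.\<close>

lemma hankel_pair_sym: "hankel_pair n \<nu> f g \<Longrightarrow> hankel_pair n \<nu> g f"
  unfolding hankel_pair_def
proof (elim conjE, intro conjI allI impI)
  fix p :: real assume p: "p > 0"
    and *: "\<forall>p>0. coef (radial_measure n) (gauss_fun n \<nu> p) g
        = complex_of_real (p powr (- \<nu> - 1)) * coef (radial_measure n) (gauss_fun n \<nu> (1 / p)) f"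
  have "p powr (- \<nu> - 1) * (1 / p) powr (- \<nu> - 1) = 1"
    using p by (simp add: powr_mult[symmetric])
  then have "complex_of_real (p powr (- \<nu> - 1)) * complex_of_real ((1 / p) powr (- \<nu> - 1)) = 1"
    by (metis of_real_1 of_real_mult)
  then show "coef (radial_measure n) (gauss_fun n \<nu> p) f
        = complex_of_real (p powr (- \<nu> - 1)) * coef (radial_measure n) (gauss_fun n \<nu> (1 / p)) g"
    using *[rule_format, of "1 / p"] p by (simp flip: mult.assoc)
qed auto

lemma coef_lincomb:
  assumes "f \<in> L2 M" "g \<in> L2 M" "e \<in> L2R M"
  shows "coef M e (\<lambda>x. f x + c * g x) = coef M e f + c * coef M e g"
proof -
  have "coef M e (\<lambda>x. f x + c * g x) = (\<integral>x. f x * complex_of_real (e x) + c * (g x * complex_of_real (e x)) \<partial>M)"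
    unfolding coef_def by (simp add: distrib_right mult.assoc)
  also have "\<dots> = coef M e f + c * coef M e g"
    unfolding coef_def
    by (subst Bochner_Integration.integral_add)
      (auto intro!: coef_integrable assms Bochner_Integration.integrable_mult_right)
  finally show ?thesis .
qed

lemma hankel_pair_lincomb:
  assumes n: "n \<ge> 1" and \<nu>: "\<nu> \<ge> 0" and f: "hankel_pair n \<nu> f g" "hankel_pair n \<nu> f' g'"
  shows "hankel_pair n \<nu> (\<lambda>r. f r + c * f' r) (\<lambda>r. g r + c * g' r)"
  unfolding hankel_pair_def
proof (intro conjI allI impI)
  fix p :: real assume p: "p > 0"
  show "coef (radial_measure n) (gauss_fun n \<nu> p) (\<lambda>r. g r + c * g' r)
        = complex_of_real (p powr (- \<nu> - 1)) * coef (radial_measure n) (gauss_fun n \<nu> (1 / p)) (\<lambda>r. f r + c * f' r)"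
    using f p gauss_fun_L2R[OF n \<nu>, of p] gauss_fun_L2R[OF n \<nu>, of "1 / p"]
    by (simp add: coef_lincomb hankel_pair_def algebra_simps)
qed (use f in \<open>auto simp: hankel_pair_def intro!: L2_add L2_scale\<close>)

lemma hankel_pair_zero: "hankel_pair n \<nu> (\<lambda>r. 0) (\<lambda>r. 0)"
  by (simp add: hankel_pair_def L2_zero coef_def)

lemma hankel_pair_sum:
  assumes "n \<ge> 1" "\<nu> \<ge> 0" "\<And>i. i \<in> A \<Longrightarrow> hankel_pair n \<nu> (f i) (g i)"
  shows "hankel_pair n \<nu> (\<lambda>r. \<Sum>i\<in>A. c i * f i r) (\<lambda>r. \<Sum>i\<in>A. c i * g i r)"
  using assms(3)
proof (induction A rule: infinite_finite_induct)
  case (insert i A)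
  then have "hankel_pair n \<nu> (\<lambda>r. (\<Sum>i\<in>A. c i * f i r) + c i * f i r) (\<lambda>r. (\<Sum>i\<in>A. c i * g i r) + c i * g i r)"
    by (intro hankel_pair_lincomb[OF assms(1,2)]) auto
  then show ?case using insert by (simp add: add.commute)
qed (simp_all add: hankel_pair_zero)

lemma hankel_pair_cong_AE:
  assumes U: "hankel_pair n \<nu> f g" and f: "AE r in radial_measure n. f r = f' r" "f' \<in> borel_measurable borel"
    and g: "AE r in radial_measure n. g r = g' r" "g' \<in> borel_measurable borel"
  shows "hankel_pair n \<nu> f' g'"
proof -
  have fg: "f \<in> L2 (radial_measure n)" "g \<in> L2 (radial_measure n)" using U by (auto simp: hankel_pair_def)
  have "f' \<in> L2 (radial_measure n)" "g' \<in> L2 (radial_measure n)"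
    using L2_cong_AE[OF fg(1) f(1)] L2_cong_AE[OF fg(2) g(1)] f g by auto
  moreover have "coef (radial_measure n) (gauss_fun n \<nu> p) f' = coef (radial_measure n) (gauss_fun n \<nu> p) f"
    "coef (radial_measure n) (gauss_fun n \<nu> p) g' = coef (radial_measure n) (gauss_fun n \<nu> p) g" for p
    using f g L2_measurable[OF fg(1)] L2_measurable[OF fg(2)]
    by (auto intro!: coef_cong_AE elim: eventually_mono)
  ultimately show ?thesis using U by (simp add: hankel_pair_def)
qed

text \<open>The difference of two transforms of f has only vanishing Gaussian moments.\<close>

lemma hankel_pair_unique:
  assumes n: "n \<ge> 1" and \<nu>: "\<nu> \<ge> 0" and U: "hankel_pair n \<nu> f g" "hankel_pair n \<nu> f h"
  shows "AE r in radial_measure n. g r = h r"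
proof -
  have gh: "g \<in> L2 (radial_measure n)" "h \<in> L2 (radial_measure n)" using U by (auto simp: hankel_pair_def)
  have "AE r in radial_measure n. g r - h r = 0"
  proof (rule gauss_moments_unique)
    fix p :: real assume p: "p > 0"
    show "integrable (radial_measure n) (\<lambda>r. (g r - h r) * complex_of_real (gauss_fun n \<nu> p r))"
      by (rule coef_integrable[OF L2_diff[OF gh] gauss_fun_L2R[OF n \<nu> p]])
    show "coef (radial_measure n) (gauss_fun n \<nu> p) (\<lambda>r. g r - h r) = 0"
      using coef_lincomb[OF gh gauss_fun_L2R[OF n \<nu> p], of "-1"] U p by (simp add: hankel_pair_def)
  qed (use L2_measurable[OF L2_diff[OF gh]] in simp)
  then show ?thesis by eventually_elim simp
qed

lemma L2norm_orthonormal_sum: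
  assumes e: "orthonormal_or_zero M e" and A: "finite A"
  shows "(L2norm M (\<lambda>x. \<Sum>i\<in>A. a i * complex_of_real (e i x)))\<^sup>2 = (\<Sum>i\<in>A. (cmod (a i))\<^sup>2 * rip M (e i) (e i))"
  using A
proof (induction A)
  case (insert k A)
  have eL: "e i \<in> L2R M" for i using e by (simp add: orthonormal_or_zero_def)
  then have eC: "(\<lambda>x. complex_of_real (e i x)) \<in> L2 M" for i by (simp add: L2R_def)
  let ?S = "\<lambda>x. \<Sum>i\<in>A. a i * complex_of_real (e i x)"
  have S: "?S \<in> L2 M" by (intro L2_sum L2_scale eC)
  have "coef M (e k) ?S = (\<integral>x. (\<Sum>i\<in>A. a i * complex_of_real (e i x * e k x)) \<partial>M)"
    unfolding coef_def by (simp add: sum_distrib_right mult.assoc)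
  also have "\<dots> = (\<Sum>i\<in>A. a i * complex_of_real (rip M (e i) (e k)))"
    unfolding rip_def
    by (subst Bochner_Integration.integral_sum)
      (auto intro!: Bochner_Integration.integrable_mult_right integrable_of_real L2R_mult_integrable eL simp del: of_real_mult)
  also have "\<dots> = 0"
  proof (intro sum.neutral ballI)
    fix i assume "i \<in> A"
    then have "i \<noteq> k" using insert by blast
    then show "a i * complex_of_real (rip M (e i) (e k)) = 0" using e by (simp add: orthonormal_or_zero_def)
  qed
  finally have c: "coef M (e k) ?S = 0" .
  have "(L2norm M (\<lambda>x. \<Sum>i\<in>insert k A. a i * complex_of_real (e i x)))\<^sup>2
    = (L2norm M (\<lambda>x. ?S x - (- a k) * complex_of_real (e k x)))\<^sup>2"
    using insert by (simp add: add.commute)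
  also have "\<dots> = (L2norm M ?S)\<^sup>2 + (cmod (a k))\<^sup>2 * rip M (e k) (e k)"
    by (subst L2norm_sub_scale[OF S eL]) (simp add: c)
  finally show ?case using insert by simp
qed (simp add: L2norm_def)

text \<open>
  Gram-Schmidt applied to the functions \<open>gauss_fun\<close> gives an orthonormal basis whose images are again
  orthonormal, and \<open>f\<close> is expanded in it.
\<close>

lemma hankel_pair_exists_le:
  assumes n: "n \<ge> 1" and \<nu>: "\<nu> \<ge> 0" and f: "f \<in> L2 (radial_measure n)"
  shows "\<exists>g. hankel_pair n \<nu> f g \<and> nsq (radial_measure n) g \<le> nsq (radial_measure n) f"
proof -
  let ?M = "radial_measure n"
  let ?\<phi> = "\<lambda>p. gauss_fun n \<nu> p"
  note \<phi> = gauss_fun_L2R[OF n \<nu>]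
  \<comment> \<open>Real functions u with a partner w that is their transform and satisfies the
    adjoint relation against every pair, not only against Gaussians. This is a linear space
    containing the Gaussians, so Gram-Schmidt with the one-point grading stays inside it.\<close>
  define V where "V (l::unit) = {u. \<exists>w. u \<in> L2R ?M \<and> w \<in> L2R ?M \<and>
    hankel_pair n \<nu> (\<lambda>r. complex_of_real (u r)) (\<lambda>r. complex_of_real (w r)) \<and>
    (\<forall>f g. hankel_pair n \<nu> f g \<longrightarrow> coef ?M w g = coef ?M u f)}" for l
  define e where "e = gram_schmidt ?M (\<lambda>i. ?\<phi> (real i + 1))"
  have coefR: "coef ?M v (\<lambda>r. complex_of_real (u r)) = complex_of_real (rip ?M u v)" for u v
    by (simp add: coef_def rip_def flip: of_real_mult)
  have rip\<phi>: "rip ?M (?\<phi> p) (?\<phi> q) = Gamma (\<nu> + 1) / (2 * ((p + q) / 2) powr (\<nu> + 1))" if "p > 0" "q > 0" for p q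
    using gauss_fun_product[OF n \<nu> that] by (simp add: rip_def has_bochner_integral_iff)
  have \<phi>V: "?\<phi> p \<in> V l" if p: "p > 0" for p l
  proof -
    define w where "w r = p powr (- \<nu> - 1) * ?\<phi> (1 / p) r" for r
    have w: "w \<in> L2R ?M" unfolding w_def by (intro L2R_scale \<phi>) (use p in simp)
    have coefw: "coef ?M w g = complex_of_real (p powr (- \<nu> - 1)) * coef ?M (?\<phi> (1 / p)) g" for g
      by (simp add: coef_def w_def mult_ac flip: Bochner_Integration.integral_mult_right_zero)
    have "hankel_pair n \<nu> (\<lambda>r. complex_of_real (?\<phi> p r)) (\<lambda>r. complex_of_real (w r))"
      unfolding hankel_pair_def
    proof (intro conjI allI impI)
      fix q :: real assume q: "q > 0"
      have "rip ?M w (?\<phi> q) = p powr (- \<nu> - 1) * rip ?M (?\<phi> (1 / p)) (?\<phi> q)"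
        by (simp add: rip_def w_def mult.assoc)
      also have "\<dots> = q powr (- \<nu> - 1) * rip ?M (?\<phi> p) (?\<phi> (1 / q))"
      proof -
        have 1: "x powr (- \<nu> - 1) = 1 / x powr (\<nu> + 1)" for x
          using powr_minus_divide[of x "\<nu> + 1"] by simp
        \<comment> \<open>Both sides are powers of (1 + p q)/2. This symmetry in p and q is the
          compatibility of the transform with the Gram matrix of the Gaussians.\<close>
        have "p powr (\<nu> + 1) * ((1 / p + q) / 2) powr (\<nu> + 1) = q powr (\<nu> + 1) * ((p + 1 / q) / 2) powr (\<nu> + 1)"
        proof -
          have "p * ((1 / p + q) / 2) = q * ((p + 1 / q) / 2)" using p q by (simp add: field_simps)
          then show ?thesis using p q by (simp add: powr_mult[symmetric])
        qed
        then show ?thesis using p q by (simp add: rip\<phi> 1 mult_ac)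
      qed
      finally show "coef ?M (?\<phi> q) (\<lambda>r. complex_of_real (w r))
        = complex_of_real (q powr (- \<nu> - 1)) * coef ?M (?\<phi> (1 / q)) (\<lambda>r. complex_of_real (?\<phi> p r))"
        unfolding coefR by (simp flip: of_real_mult)
    qed (use \<phi>[OF p] w in \<open>auto simp: L2R_def\<close>)
    moreover have "coef ?M w g = coef ?M (?\<phi> p) f" if "hankel_pair n \<nu> f g" for f g
      using hankel_pair_sym[OF that] p unfolding coefw by (simp add: hankel_pair_def)
    ultimately show ?thesis using \<phi>[OF p] w by (auto simp: V_def)
  qed
  have "e i \<in> V ()" for i
    unfolding e_def
  proof (rule gram_schmidt_graded[where V=V and deg="\<lambda>_. ()"])
    show "(\<lambda>x. 0) \<in> V l" for l
      by (auto simp: V_def coef_def L2R_zero hankel_pair_zero intro!: exI[of _ "\<lambda>x. 0"])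
    show "(\<lambda>x. u x + c * w x) \<in> V l" if uw: "u \<in> V l" "w \<in> V l" for l u w c
    proof -
      obtain u' where u: "u \<in> L2R ?M" "u' \<in> L2R ?M" "hankel_pair n \<nu> (\<lambda>r. complex_of_real (u r)) (\<lambda>r. complex_of_real (u' r))"
        "\<And>f g. hankel_pair n \<nu> f g \<Longrightarrow> coef ?M u' g = coef ?M u f" using uw(1) by (auto simp: V_def)
      obtain w' where w: "w \<in> L2R ?M" "w' \<in> L2R ?M" "hankel_pair n \<nu> (\<lambda>r. complex_of_real (w r)) (\<lambda>r. complex_of_real (w' r))"
        "\<And>f g. hankel_pair n \<nu> f g \<Longrightarrow> coef ?M w' g = coef ?M w f" using uw(2) by (auto simp: V_def)
      have lin: "coef ?M (\<lambda>x. a x + c * b x) f = coef ?M a f + complex_of_real c * coef ?M b f"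
        if "a \<in> L2R ?M" "b \<in> L2R ?M" "f \<in> L2 ?M" for a b f
      proof -
        have "coef ?M (\<lambda>x. a x + c * b x) f = (\<integral>x. f x * complex_of_real (a x) + complex_of_real c * (f x * complex_of_real (b x)) \<partial>?M)"
          unfolding coef_def by (simp add: algebra_simps)
        also have "\<dots> = coef ?M a f + complex_of_real c * coef ?M b f"
          unfolding coef_def
          by (subst Bochner_Integration.integral_add)
            (auto intro!: coef_integrable that Bochner_Integration.integrable_mult_right)
        finally show ?thesis .
      qed
      have "hankel_pair n \<nu> (\<lambda>r. complex_of_real (u r + c * w r)) (\<lambda>r. complex_of_real (u' r + c * w' r))"
        using hankel_pair_lincomb[OF n \<nu> u(3) w(3), of "complex_of_real c"] by simp
      moreover have "coef ?M (\<lambda>x. u' x + c * w' x) g = coef ?M (\<lambda>x. u x + c * w x) f" if U: "hankel_pair n \<nu> f g" for f g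
      proof -
        have fg: "f \<in> L2 ?M" "g \<in> L2 ?M" using U by (auto simp: hankel_pair_def)
        show ?thesis
          by (simp add: lin[OF u(2) w(2) fg(2)] lin[OF u(1) w(1) fg(1)] u(4)[OF U] w(4)[OF U])
      qed
      ultimately show ?thesis using u w by (auto simp: V_def intro!: L2R_add L2R_scale exI[of _ "\<lambda>x. u' x + c * w' x"])
    qed
  qed (auto intro: \<phi>V)
  then have "\<forall>i. \<exists>w. e i \<in> L2R ?M \<and> w \<in> L2R ?M \<and>
    hankel_pair n \<nu> (\<lambda>r. complex_of_real (e i r)) (\<lambda>r. complex_of_real (w r)) \<and>
    (\<forall>f g. hankel_pair n \<nu> f g \<longrightarrow> coef ?M w g = coef ?M (e i) f)"
    by (auto simp: V_def)
  then obtain w where w: "\<And>i. w i \<in> L2R ?M"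
    "\<And>i. hankel_pair n \<nu> (\<lambda>r. complex_of_real (e i r)) (\<lambda>r. complex_of_real (w i r))"
    "\<And>i f g. hankel_pair n \<nu> f g \<Longrightarrow> coef ?M (w i) g = coef ?M (e i) f" by metis
  have e: "orthonormal_or_zero ?M e"
    unfolding e_def by (intro gram_schmidt_orthonormal \<phi>) simp
  \<comment> \<open>The adjoint relation of e j, applied to the pair consisting of e i and w i,
    shows that the partners have the same inner products.\<close>
  have rw: "rip ?M (w i) (w j) = rip ?M (e i) (e j)" for i j
    using w(3)[OF w(2)[of i], of j] unfolding coefR by simp
  have ow: "orthonormal_or_zero ?M w"
    using e w(1) unfolding orthonormal_or_zero_def rw by blast
  have total: "AE x in ?M. h x = 0" if h: "h \<in> L2 ?M" "\<And>i. coef ?M (e i) h = 0" for h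
  proof -
    have nat0: "coef ?M (?\<phi> (real i + 1)) h = 0" for i
      by (rule gram_schmidt_total[of "\<lambda>i. ?\<phi> (real i + 1)"]) (use \<phi> h in \<open>auto simp: e_def\<close>)
    show ?thesis
    proof (rule gauss_moments_unique_nat[OF L2_measurable[OF h(1)]])
      show "integrable ?M (\<lambda>r. h r * complex_of_real (?\<phi> (real i + 1) r))" for i
        by (intro coef_integrable h \<phi>) simp
    qed (rule nat0)
  qed
  define S where "S N x = (\<Sum>i<N. coef ?M (e i) f * complex_of_real (e i x))" for N x
  define S' where "S' N x = (\<Sum>i<N. coef ?M (e i) f * complex_of_real (w i x))" for N x
  have U: "hankel_pair n \<nu> (S N) (S' N)" for N
    unfolding S_def S'_def by (intro hankel_pair_sum n \<nu> w(2))
  then have SL: "S N \<in> L2 ?M" "S' N \<in> L2 ?M" for N by (auto simp: hankel_pair_def)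
  have Slim: "L2_tendsto ?M S f sequentially"
    using parseval(1)[OF e f total] unfolding S_def[abs_def] .
  \<comment> \<open>The transform is isometric on finite combinations, so Cauchy partial sums of f
    have Cauchy images. The sequence \<open>a\<close> merges the two cutoffs and covers m < k and k
    < m at once.\<close>
  have nd: "nsq ?M (\<lambda>x. S' m x - S' k x) = nsq ?M (\<lambda>x. S m x - S k x)" for m k
  proof -
    define a where "a i = ((if i < m then 1 else 0) - (if i < k then 1 else 0)) * coef ?M (e i) f" for i
    have sums: "(\<Sum>i<m. coef ?M (e i) f * complex_of_real (v i x)) - (\<Sum>i<k. coef ?M (e i) f * complex_of_real (v i x))
      = (\<Sum>i<max m k. a i * complex_of_real (v i x))" for v x
    proof -
      have *: "(\<Sum>i<m. coef ?M (e i) f * complex_of_real (v i x)) = (\<Sum>i<max m k. (if i < m then 1 else 0) * coef ?M (e i) f * complex_of_real (v i x))" for m k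
        by (rule sum.mono_neutral_cong_left) auto
      show ?thesis
        unfolding *[of m k] *[of k m] max.commute[of k m] sum_subtractf[symmetric] a_def
        by (rule sum.cong) (auto simp: algebra_simps)
    qed
    show ?thesis
      unfolding nsq_eq_L2norm[OF L2_diff[OF SL(1) SL(1)]] nsq_eq_L2norm[OF L2_diff[OF SL(2) SL(2)]]
      unfolding S_def S'_def sums by (simp add: L2norm_orthonormal_sum[OF e] L2norm_orthonormal_sum[OF ow] rw)
  qed
  have "\<exists>g\<in>L2 ?M. L2_tendsto ?M S' g sequentially"
  proof (rule L2_complete[OF SL(2)])
    fix d :: real assume d: "d > 0"
    have "\<forall>\<^sub>F k in sequentially. nsq ?M (\<lambda>x. S k x - f x) < ennreal (d / 4)"
      using Slim unfolding L2_tendsto_nsq by (rule order_tendstoD) (use d in simp)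
    then obtain N where N: "\<And>k. k \<ge> N \<Longrightarrow> nsq ?M (\<lambda>x. S k x - f x) < ennreal (d / 4)"
      unfolding eventually_sequentially by blast
    show "\<exists>N. \<forall>m\<ge>N. \<forall>k\<ge>N. nsq ?M (\<lambda>x. S' m x - S' k x) \<le> ennreal d"
    proof (intro exI[of _ N] allI impI)
      fix m k assume mk: "m \<ge> N" "k \<ge> N"
      have "nsq ?M (\<lambda>x. S m x - S k x) \<le> 2 * nsq ?M (\<lambda>x. S m x - f x) + 2 * nsq ?M (\<lambda>x. f x - S k x)"
        using nsq_add_le[of "\<lambda>x. S m x - f x" ?M "\<lambda>x. f x - S k x"] L2_measurable[OF L2_diff[OF SL(1) f]]
          L2_measurable[OF L2_diff[OF f SL(1)]] by simp
      also have "\<dots> \<le> 2 * ennreal (d / 4) + 2 * ennreal (d / 4)"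
        using N[OF mk(1)] N[OF mk(2)] unfolding nsq_diff_commute[of ?M f]
        by (intro add_mono mult_left_mono) (auto intro: less_imp_le)
      also have "2 * ennreal (d / 4) + 2 * ennreal (d / 4) = ennreal d"
      proof -
        have "2 * ennreal (d / 4) = ennreal (d / 2)"
          using d ennreal_mult[of 2 "d / 4"] by simp
        then show ?thesis using d by (simp add: ennreal_plus[symmetric] del: ennreal_plus)
      qed
      finally show "nsq ?M (\<lambda>x. S' m x - S' k x) \<le> ennreal d" unfolding nd .
    qed
  qed
  then obtain g where g: "g \<in> L2 ?M" "L2_tendsto ?M S' g sequentially" by blast
  have "hankel_pair n \<nu> f g"
    unfolding hankel_pair_def
  proof (intro conjI allI impI f g)
    fix p :: real assume p: "p > 0"
    have "(\<lambda>k. coef ?M (?\<phi> p) (S' k)) \<longlonglongrightarrow> coef ?M (?\<phi> p) g"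
      by (rule coef_limit[OF SL(2) g(1) \<phi>[OF p] g(2)])
    moreover have "(\<lambda>k. complex_of_real (p powr (- \<nu> - 1)) * coef ?M (?\<phi> (1 / p)) (S k))
      \<longlonglongrightarrow> complex_of_real (p powr (- \<nu> - 1)) * coef ?M (?\<phi> (1 / p)) f"
      by (intro tendsto_mult tendsto_const coef_limit[OF SL(1) f \<phi> Slim]) (use p in simp)
    moreover have "coef ?M (?\<phi> p) (S' k) = complex_of_real (p powr (- \<nu> - 1)) * coef ?M (?\<phi> (1 / p)) (S k)" for k
      using U[of k] p by (simp add: hankel_pair_def)
    ultimately show "coef ?M (?\<phi> p) g = complex_of_real (p powr (- \<nu> - 1)) * coef ?M (?\<phi> (1 / p)) f"
      using LIMSEQ_unique by simp
  qed
  moreover have "nsq ?M g \<le> nsq ?M f"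
  proof -
    have "nsq ?M g \<le> liminf (\<lambda>k. nsq ?M (S' k))"
      using weighted_nsq_le_liminf[OF _ _ _ g(2), of "\<lambda>x. 1"] L2_measurable[OF SL(2)] L2_measurable[OF g(1)]
      by (simp add: nsq_def)
    also have "\<dots> \<le> nsq ?M f"
    proof (rule Liminf_le[OF sequentially_bot], rule always_eventually, rule allI)
      fix k
      have "nsq ?M (S' k) = nsq ?M (S k)"
        using nd[of k 0] by (simp add: S_def[abs_def] S'_def[abs_def])
      also have "\<dots> = ennreal (\<Sum>i<k. (cmod (coef ?M (e i) f))\<^sup>2 * rip ?M (e i) (e i))"
        unfolding nsq_eq_L2norm[OF SL(1)] unfolding S_def by (simp add: L2norm_orthonormal_sum[OF e])
      also have "\<dots> \<le> ennreal ((L2norm ?M f)\<^sup>2)"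
      proof (rule ennreal_leI)
        have "(\<Sum>i<k. (cmod (coef ?M (e i) f))\<^sup>2 * rip ?M (e i) (e i)) \<le> (\<Sum>i<k. (cmod (coef ?M (e i) f))\<^sup>2)"
        proof (rule sum_mono)
          fix i
          have "rip ?M (e i) (e i) = 0 \<or> rip ?M (e i) (e i) = 1" using e by (simp add: orthonormal_or_zero_def)
          then show "(cmod (coef ?M (e i) f))\<^sup>2 * rip ?M (e i) (e i) \<le> (cmod (coef ?M (e i) f))\<^sup>2" by auto
        qed
        also have "\<dots> \<le> (L2norm ?M f)\<^sup>2"
          using bessel_identity(3)[OF e f, of k] by (smt (verit) zero_le_power2)
        finally show "(\<Sum>i<k. (cmod (coef ?M (e i) f))\<^sup>2 * rip ?M (e i) (e i)) \<le> (L2norm ?M f)\<^sup>2" .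
      qed
      finally show "nsq ?M (S' k) \<le> nsq ?M f" unfolding nsq_eq_L2norm[OF f] .
    qed
    finally show ?thesis .
  qed
  ultimately show ?thesis by blast
qed

text \<open>Uniqueness extends the inequality of the constructed transform to every pair, and
  symmetry gives the reverse inequality.\<close>

lemma hankel_pair_isometry:
  assumes n: "n \<ge> 1" and \<nu>: "\<nu> \<ge> 0" and U: "hankel_pair n \<nu> f g"
  shows "nsq (radial_measure n) g = nsq (radial_measure n) f"
proof -
  have *: "nsq (radial_measure n) g \<le> nsq (radial_measure n) f" if U: "hankel_pair n \<nu> f g" for f g
  proof -
    have "f \<in> L2 (radial_measure n)" using U by (simp add: hankel_pair_def)
    then obtain h where "hankel_pair n \<nu> f h" "nsq (radial_measure n) h \<le> nsq (radial_measure n) f"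
      using hankel_pair_exists_le[OF n \<nu>] by blast
    with hankel_pair_unique[OF n \<nu> U this(1)] show ?thesis by (simp add: nsq_cong_AE)
  qed
  show ?thesis by (intro antisym * U hankel_pair_sym)
qed

lemma hankel_pair_exists:
  "n \<ge> 1 \<Longrightarrow> \<nu> \<ge> 0 \<Longrightarrow> f \<in> L2 (radial_measure n) \<Longrightarrow> \<exists>g. hankel_pair n \<nu> f g"
  using hankel_pair_exists_le by blast

lemma hankel_integral_measurable [measurable]:
  assumes [measurable]: "f \<in> borel_measurable borel"
  shows "hankel_integral n \<nu> f \<in> borel_measurable borel"
proof -
  interpret sigma_finite_measure "radial_measure n" by (rule sigma_finite_radial_measure)
  show ?thesis unfolding hankel_integral_kernel[abs_def] by measurable
qed

text \<open>The absolute bound on the kernel against a Gaussian grows like exp(r^2/(2p)), so Fubini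
  needs f to vanish beyond some R. For such f, exchanging integrals gives the adjoint relation for
  the integral itself.\<close>

lemma hankel_pair_integral:
  assumes n: "n \<ge> 1" and \<nu>: "\<nu> \<ge> 0" and f: "f \<in> L2 (radial_measure n)" and supp: "\<And>r. r > R \<Longrightarrow> f r = 0"
  shows "hankel_pair n \<nu> f (hankel_integral n \<nu> f)"
    and "AE \<rho> in radial_measure n. integrable (radial_measure n) (\<lambda>r. complex_of_real (hankel_kernel n \<nu> r \<rho>) * f r)"
proof -
  let ?M = "radial_measure n"
  let ?\<phi> = "\<lambda>p. gauss_fun n \<nu> p"
  note \<phi> = gauss_fun_L2R[OF n \<nu>]
  interpret sf: sigma_finite_measure ?M by (rule sigma_finite_radial_measure)
  interpret pr: pair_sigma_finite ?M ?M ..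
  have [measurable]: "f \<in> borel_measurable borel" using L2_measurable[OF f] by simp
  have int2: "integrable (?M \<Otimes>\<^sub>M ?M) (\<lambda>(\<rho>, r). complex_of_real (hankel_kernel n \<nu> r \<rho>) * f r * complex_of_real (?\<phi> p \<rho>))"
    if p: "p > 0" for p
  proof (rule integrableI_bounded)
    \<comment> \<open>Splits r^2/(2p) as (1/(2p) + 1/2) r^2 - r^2/2: the first part is bounded for r
      up to R, the second supplies the Gaussian with p = 1, whose product with f is
      integrable.\<close>
    define C where "C = exp ((1 / (2 * p) + 1 / 2) * R\<^sup>2)"
    have "(\<integral>\<^sup>+x. ennreal (norm (case x of (\<rho>, r) \<Rightarrow> complex_of_real (hankel_kernel n \<nu> r \<rho>) * f r * complex_of_real (?\<phi> p \<rho>))) \<partial>(?M \<Otimes>\<^sub>M ?M))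
      = (\<integral>\<^sup>+r. (\<integral>\<^sup>+\<rho>. ennreal (norm (complex_of_real (hankel_kernel n \<nu> r \<rho>) * f r * complex_of_real (?\<phi> p \<rho>))) \<partial>?M) \<partial>?M)"
      by (subst pr.nn_integral_snd[symmetric]) (auto simp: case_prod_beta)
    also have "\<dots> = (\<integral>\<^sup>+r. ennreal (cmod (f r)) * (\<integral>\<^sup>+\<rho>. ennreal \<bar>hankel_kernel n \<nu> \<rho> r * ?\<phi> p \<rho>\<bar> \<partial>?M) \<partial>?M)"
      by (intro nn_integral_cong, subst nn_integral_cmult[symmetric])
        (auto simp: norm_mult abs_mult ennreal_mult[symmetric] hankel_kernel_commute[of n \<nu>] mult_ac intro!: nn_integral_cong)
    also have "\<dots> \<le> (\<integral>\<^sup>+r. ennreal (p powr (- \<nu> - 1) * C) * ennreal (cmod (f r * complex_of_real (?\<phi> 1 r))) \<partial>?M)"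
    proof (rule nn_integral_mono_AE, use AE_radial_pos[of n] in eventually_elim)
      fix r :: real assume r: "r > 0"
      show "ennreal (cmod (f r)) * (\<integral>\<^sup>+\<rho>. ennreal \<bar>hankel_kernel n \<nu> \<rho> r * ?\<phi> p \<rho>\<bar> \<partial>?M)
        \<le> ennreal (p powr (- \<nu> - 1) * C) * ennreal (cmod (f r * complex_of_real (?\<phi> 1 r)))"
      proof (cases "r \<le> R")
        case True
        have "ennreal (cmod (f r)) * (\<integral>\<^sup>+\<rho>. ennreal \<bar>hankel_kernel n \<nu> \<rho> r * ?\<phi> p \<rho>\<bar> \<partial>?M)
          \<le> ennreal (cmod (f r)) * ennreal (p powr (- \<nu> - 1) * (r powr (\<nu> - lam n) * exp (r\<^sup>2 / (2 * p))))"
          by (intro mult_left_mono hankel_gauss(2) n \<nu> r p) simp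
        also have "\<dots> = ennreal (cmod (f r) * (p powr (- \<nu> - 1) * (r powr (\<nu> - lam n) * exp (r\<^sup>2 / (2 * p)))))"
          by (simp add: ennreal_mult)
        also have "\<dots> \<le> ennreal ((p powr (- \<nu> - 1) * C) * cmod (f r * complex_of_real (?\<phi> 1 r)))"
        proof (rule ennreal_leI)
          have "r\<^sup>2 \<le> R\<^sup>2" using True r by (intro power_mono) auto
          have "exp (r\<^sup>2 / (2 * p)) = exp ((1 / (2 * p) + 1 / 2) * r\<^sup>2) * exp (- (1 / 2) * r\<^sup>2)"
            by (simp add: exp_add[symmetric] algebra_simps)
          also have "\<dots> \<le> C * exp (- (1 / 2) * r\<^sup>2)"
            unfolding C_def using \<open>r\<^sup>2 \<le> R\<^sup>2\<close> p by (intro mult_right_mono) (auto intro!: mult_left_mono)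
          finally have "cmod (f r) * (p powr (- \<nu> - 1) * (r powr (\<nu> - lam n) * exp (r\<^sup>2 / (2 * p))))
            \<le> cmod (f r) * (p powr (- \<nu> - 1) * (r powr (\<nu> - lam n) * (C * exp (- (1 / 2) * r\<^sup>2))))"
            by (intro mult_left_mono) auto
          then show "cmod (f r) * (p powr (- \<nu> - 1) * (r powr (\<nu> - lam n) * exp (r\<^sup>2 / (2 * p))))
            \<le> (p powr (- \<nu> - 1) * C) * cmod (f r * complex_of_real (?\<phi> 1 r))"
            by (simp add: gauss_fun_def norm_mult abs_mult mult_ac)
        qed
        finally show ?thesis by (simp add: ennreal_mult C_def)
      qed (simp add: supp)
    qed
    also have "\<dots> = ennreal (p powr (- \<nu> - 1) * C) * (\<integral>\<^sup>+r. ennreal (cmod (f r * complex_of_real (?\<phi> 1 r))) \<partial>?M)"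
      by (rule nn_integral_cmult) measurable
    also have "\<dots> < \<infinity>"
      using coef_integrable[OF f \<phi>[of 1]] by (auto simp: integrable_iff_bounded ennreal_mult_less_top)
    finally show "(\<integral>\<^sup>+x. ennreal (norm (case x of (\<rho>, r) \<Rightarrow> complex_of_real (hankel_kernel n \<nu> r \<rho>) * f r * complex_of_real (?\<phi> p \<rho>))) \<partial>(?M \<Otimes>\<^sub>M ?M)) < \<infinity>" .
  qed measurable
  have inner: "(\<integral>r. complex_of_real (hankel_kernel n \<nu> r \<rho>) * f r * complex_of_real (?\<phi> p \<rho>) \<partial>?M)
    = hankel_integral n \<nu> f \<rho> * complex_of_real (?\<phi> p \<rho>)" for \<rho> p
    unfolding hankel_integral_kernel by simp
  have int1: "integrable ?M (\<lambda>\<rho>. hankel_integral n \<nu> f \<rho> * complex_of_real (?\<phi> p \<rho>))" if "p > 0" for p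
    using pr.integrable_fst'[OF int2[OF that]] unfolding prod.case inner .
  have eq: "coef ?M (?\<phi> p) (hankel_integral n \<nu> f) = complex_of_real (p powr (- \<nu> - 1)) * coef ?M (?\<phi> (1 / p)) f" if p: "p > 0" for p
  proof -
    have "coef ?M (?\<phi> p) (hankel_integral n \<nu> f)
      = (\<integral>\<rho>. (\<integral>r. complex_of_real (hankel_kernel n \<nu> r \<rho>) * f r * complex_of_real (?\<phi> p \<rho>) \<partial>?M) \<partial>?M)"
      unfolding inner coef_def ..
    also have "\<dots> = (\<integral>r. (\<integral>\<rho>. complex_of_real (hankel_kernel n \<nu> r \<rho>) * f r * complex_of_real (?\<phi> p \<rho>) \<partial>?M) \<partial>?M)"
      by (rule pr.Fubini_integral[OF int2[OF p], symmetric])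
    also have "\<dots> = (\<integral>r. complex_of_real (p powr (- \<nu> - 1)) * (f r * complex_of_real (?\<phi> (1 / p) r)) \<partial>?M)"
    proof (rule integral_cong_AE)
      show "AE r in ?M. (\<integral>\<rho>. complex_of_real (hankel_kernel n \<nu> r \<rho>) * f r * complex_of_real (?\<phi> p \<rho>) \<partial>?M)
        = complex_of_real (p powr (- \<nu> - 1)) * (f r * complex_of_real (?\<phi> (1 / p) r))"
        using AE_radial_pos[of n]
      proof eventually_elim
        case (elim r)
        have "(\<integral>\<rho>. complex_of_real (hankel_kernel n \<nu> r \<rho>) * f r * complex_of_real (?\<phi> p \<rho>) \<partial>?M)
          = (\<integral>\<rho>. f r * complex_of_real (hankel_kernel n \<nu> \<rho> r * ?\<phi> p \<rho>) \<partial>?M)"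
          by (simp add: hankel_kernel_commute[of n \<nu> r] mult_ac)
        also have "\<dots> = f r * complex_of_real (p powr (- \<nu> - 1) * ?\<phi> (1 / p) r)"
          using hankel_gauss(1)[OF n \<nu> elim p] by (simp add: has_bochner_integral_iff del: of_real_mult)
        finally show ?case by simp
      qed
    qed measurable
    finally show ?thesis by (simp add: coef_def)
  qed
  \<comment> \<open>Square integrability of the integral is not known yet. It is compared with the
    transform g that exists abstractly; moment uniqueness asks only for integrability against
    Gaussians.\<close>
  obtain g where g: "hankel_pair n \<nu> f g" using hankel_pair_exists[OF n \<nu> f] by blast
  have gL: "g \<in> L2 ?M" using g by (simp add: hankel_pair_def)
  have "AE \<rho> in ?M. g \<rho> - hankel_integral n \<nu> f \<rho> = 0"
  proof (rule gauss_moments_unique)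
    fix p :: real assume p: "p > 0"
    show "integrable ?M (\<lambda>r. (g r - hankel_integral n \<nu> f r) * complex_of_real (?\<phi> p r))"
      unfolding left_diff_distrib
      by (intro Bochner_Integration.integrable_diff coef_integrable gL \<phi> int1 p)
    have "coef ?M (?\<phi> p) (\<lambda>r. g r - hankel_integral n \<nu> f r) = coef ?M (?\<phi> p) g - coef ?M (?\<phi> p) (hankel_integral n \<nu> f)"
      unfolding coef_def left_diff_distrib
      by (intro Bochner_Integration.integral_diff coef_integrable gL \<phi> int1 p)
    then show "coef ?M (?\<phi> p) (\<lambda>r. g r - hankel_integral n \<nu> f r) = 0"
      using g p eq[OF p] by (simp add: hankel_pair_def)
  qed (use L2_measurable[OF gL] in measurable)
  then have "AE \<rho> in ?M. g \<rho> = hankel_integral n \<nu> f \<rho>" by eventually_elim simp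
  then show "hankel_pair n \<nu> f (hankel_integral n \<nu> f)"
    by (intro hankel_pair_cong_AE[OF g]) auto
  \<comment> \<open>Fubini gives a.e. integrability of the slices with a Gaussian factor in \<rho>,
    which is a nonzero constant on each slice and can be divided out.\<close>
  have "AE \<rho> in ?M. integrable ?M (\<lambda>r. complex_of_real (hankel_kernel n \<nu> r \<rho>) * f r * complex_of_real (?\<phi> 1 \<rho>))"
    using pr.AE_integrable_fst'[OF int2[of 1]] by simp
  with AE_radial_pos[of n]
  show "AE \<rho> in ?M. integrable ?M (\<lambda>r. complex_of_real (hankel_kernel n \<nu> r \<rho>) * f r)"
  proof eventually_elim
    case (elim \<rho>)
    then have "?\<phi> 1 \<rho> \<noteq> 0" by (simp add: gauss_fun_def)
    then show ?case
      using Bochner_Integration.integrable_mult_left[of "1 / complex_of_real (?\<phi> 1 \<rho>)", OF elim(2)] by simp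
  qed
qed

lemma nsq_indicator_tendsto_0:
  assumes f: "f \<in> L2 M" and [measurable]: "\<And>k::nat. A k \<in> sets M"
    and ev: "AE x in M. \<forall>\<^sub>F k in sequentially. x \<notin> A k"
  shows "(\<lambda>k. nsq M (\<lambda>x. indicator (A k) x * f x)) \<longlonglongrightarrow> 0"
proof -
  have [measurable]: "f \<in> borel_measurable M" using f by (rule L2_measurable)
  have "(\<lambda>k. nsq M (\<lambda>x. indicator (A k) x * f x)) \<longlonglongrightarrow> (\<integral>\<^sup>+x. 0 \<partial>M)"
    unfolding nsq_def
  proof (rule nn_integral_dominated_convergence[where w="\<lambda>x. ennreal ((cmod (f x))\<^sup>2)"])
    show "AE x in M. (\<lambda>k. ennreal ((cmod (indicator (A k) x * f x))\<^sup>2)) \<longlonglongrightarrow> 0"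
      using ev
    proof eventually_elim
      case (elim x)
      then have "\<forall>\<^sub>F k in sequentially. ennreal ((cmod (indicator (A k) x * f x))\<^sup>2) = 0"
        by eventually_elim simp
      then show ?case by (rule tendsto_eventually)
    qed
    show "(\<integral>\<^sup>+x. ennreal ((cmod (f x))\<^sup>2) \<partial>M) < \<infinity>" using f by (simp add: L2_iff_nsq nsq_def)
  qed (auto simp: indicator_def norm_mult)
  then show ?thesis by simp
qed

text \<open>By isometry the error of the transform of the truncated function has the norm of the
  discarded tail of f.\<close>

lemma hankel_pair_imp_hankel:
  assumes n: "n \<ge> 1" and \<nu>: "\<nu> \<ge> 0" and U: "hankel_pair n \<nu> f g"
  shows "hankel n \<nu> f g"
  unfolding hankel_def
proof (intro conjI)
  let ?M = "radial_measure n"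
  show f: "f \<in> L2 ?M" and g: "g \<in> L2 ?M" using U by (auto simp: hankel_pair_def)
  define fR where "fR R r = indicator {..R} r * f r" for R r
  have fR: "fR R \<in> L2 ?M" for R
    unfolding fR_def by (rule L2_bounded_mult[OF f, where B=1]) (auto simp: indicator_def)
  have UR: "hankel_pair n \<nu> (fR R) (hankel_integral n \<nu> (fR R))" for R
    by (rule hankel_pair_integral(1)[OF n \<nu> fR, of R]) (simp add: fR_def)
  have nd: "nsq ?M (\<lambda>r. hankel_integral n \<nu> (fR R) r - g r) = nsq ?M (\<lambda>r. indicator {R<..} r * f r)" for R
  proof -
    have "nsq ?M (\<lambda>r. g r - hankel_integral n \<nu> (fR R) r) = nsq ?M (\<lambda>r. f r - fR R r)"
      using hankel_pair_isometry[OF n \<nu> hankel_pair_lincomb[OF n \<nu> U UR[of R], of "-1"]] by simp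
    also have "(\<lambda>r. f r - fR R r) = (\<lambda>r. indicator {R<..} r * f r)"
      by (auto simp: fR_def indicator_def fun_eq_iff)
    finally show ?thesis by (simp add: nsq_diff_commute[of _ g])
  qed
  show "L2_tendsto ?M (\<lambda>R. hankel_integral n \<nu> (\<lambda>r. indicator {..R} r * f r)) g at_top"
    unfolding L2_tendsto_nsq fR_def[symmetric] nd
  \<comment> \<open>Dominated convergence works along sequences, so the real cutoff is tested on
    arbitrary sequences tending to infinity.\<close>
  proof (rule tendsto_at_topI_sequentially)
    fix X :: "nat \<Rightarrow> real" assume X: "filterlim X at_top sequentially"
    show "(\<lambda>k. nsq ?M (\<lambda>r. indicator {X k<..} r * f r)) \<longlonglongrightarrow> 0"
    proof (rule nsq_indicator_tendsto_0[OF f])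
      show "AE x in ?M. \<forall>\<^sub>F k in sequentially. x \<notin> {X k<..}"
      proof (rule AE_I2)
        fix x
        have "\<forall>\<^sub>F k in sequentially. x \<le> X k"
          using X by (simp add: filterlim_at_top)
        then show "\<forall>\<^sub>F k in sequentially. x \<notin> {X k<..}" by eventually_elim simp
      qed
    qed simp
  qed
qed

text \<open>Existence of a pair and uniqueness of limits in mean give the converse. From here on the
  limit definition is replaced by the adjoint relation.\<close>

lemma hankel_iff_pair:
  assumes n: "n \<ge> 1" and \<nu>: "\<nu> \<ge> 0"
  shows "hankel n \<nu> f g \<longleftrightarrow> hankel_pair n \<nu> f g"
proof
  assume h: "hankel n \<nu> f g"
  then have f: "f \<in> L2 (radial_measure n)" and g: "g \<in> L2 (radial_measure n)" by (auto simp: hankel_def)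
  have [measurable]: "f \<in> borel_measurable borel" "g \<in> borel_measurable borel"
    using L2_measurable[OF f] L2_measurable[OF g] by auto
  obtain g' where U: "hankel_pair n \<nu> f g'" using hankel_pair_exists[OF n \<nu> f] by blast
  then have [measurable]: "g' \<in> borel_measurable borel" using L2_measurable[of g'] by (auto simp: hankel_pair_def)
  have "AE r in radial_measure n. g' r = g r"
    using h hankel_pair_imp_hankel[OF n \<nu> U] unfolding hankel_def
    by (intro nsq_limit_unique[where K=at_top and F="\<lambda>R. hankel_integral n \<nu> (\<lambda>r. indicator {..R} r * f r)"]) auto
  then show "hankel_pair n \<nu> f g"
    by (intro hankel_pair_cong_AE[OF U]) auto
qed (rule hankel_pair_imp_hankel[OF n \<nu>])

section \<open>A Plancherel inequality in time\<close>

text \<open>The characteristic function of the standard normal distribution, rescaled by y =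
  \<sigma> t.\<close>

lemma fourier_gauss:
  assumes \<sigma>: "\<sigma> > 0"
  shows "(\<integral>t. complex_of_real (exp (- \<sigma>\<^sup>2 * t\<^sup>2 / 2)) * exp (- \<i> * complex_of_real t * complex_of_real x) \<partial>lborel)
    = complex_of_real (2 * pi * normal_density 0 \<sigma> x)"
proof -
  have "(\<integral>y. std_normal_density y *\<^sub>R iexp (u * y) \<partial>lborel) = complex_of_real (exp (- u\<^sup>2 / 2))" for u
    using fun_cong[OF char_std_normal_distribution, of u]
    unfolding char_def by (subst (asm) integral_density) (auto simp: normal_density_nonneg)
  from this[of "- x / \<sigma>"]
  have "complex_of_real (exp (- (x / \<sigma>)\<^sup>2 / 2)) = (\<integral>y. std_normal_density y *\<^sub>R iexp (- x / \<sigma> * y) \<partial>lborel)"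
    by simp
  also have "\<dots> = \<bar>\<sigma>\<bar> *\<^sub>R (\<integral>t. std_normal_density (0 + \<sigma> * t) *\<^sub>R iexp (- x / \<sigma> * (0 + \<sigma> * t)) \<partial>lborel)"
    by (rule lborel_integral_real_affine) (use \<sigma> in simp)
  also have "(\<lambda>t. std_normal_density (0 + \<sigma> * t) *\<^sub>R iexp (- x / \<sigma> * (0 + \<sigma> * t)))
    = (\<lambda>t. complex_of_real (1 / sqrt (2 * pi)) * (complex_of_real (exp (- \<sigma>\<^sup>2 * t\<^sup>2 / 2)) * exp (- \<i> * complex_of_real t * complex_of_real x)))"
    using \<sigma> by (auto simp: fun_eq_iff std_normal_density_def scaleR_conv_of_real power_mult_distrib mult_ac)
  finally have "complex_of_real (exp (- (x / \<sigma>)\<^sup>2 / 2)) = complex_of_real (\<sigma> / sqrt (2 * pi)) *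
     (\<integral>t. complex_of_real (exp (- \<sigma>\<^sup>2 * t\<^sup>2 / 2)) * exp (- \<i> * complex_of_real t * complex_of_real x) \<partial>lborel)"
    using \<sigma> by (simp add: scaleR_conv_of_real)
  then have "(\<integral>t. complex_of_real (exp (- \<sigma>\<^sup>2 * t\<^sup>2 / 2)) * exp (- \<i> * complex_of_real t * complex_of_real x) \<partial>lborel)
    = complex_of_real (sqrt (2 * pi) / \<sigma> * exp (- (x / \<sigma>)\<^sup>2 / 2))"
    using \<sigma> by (simp add: field_simps)
  also have "sqrt (2 * pi) / \<sigma> * exp (- (x / \<sigma>)\<^sup>2 / 2) = 2 * pi * normal_density 0 \<sigma> x"
  proof -
    have "sqrt (2 * pi * \<sigma>\<^sup>2) = sqrt (2 * pi) * \<sigma>" using \<sigma> by (simp add: real_sqrt_mult)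
    moreover have "2 * pi = sqrt (2 * pi) * sqrt (2 * pi)" by simp
    moreover have "sqrt (2 * pi) > 0" by simp
    ultimately have "2 * pi / sqrt (2 * pi * \<sigma>\<^sup>2) = sqrt (2 * pi) / \<sigma>"
      by (metis mult_divide_mult_cancel_left order_less_irrefl)
    moreover have "2 * pi * normal_density 0 \<sigma> x = (2 * pi / sqrt (2 * pi * \<sigma>\<^sup>2)) * exp (- (x / \<sigma>)\<^sup>2 / 2)"
      by (simp add: normal_density_def power_divide mult.commute[of 2])
    ultimately show ?thesis by simp
  qed
  finally show ?thesis .
qed

lemma nn_integral_normal_density: "\<sigma> > 0 \<Longrightarrow> (\<integral>\<^sup>+x. ennreal (normal_density \<mu> \<sigma> x) \<partial>lborel) = 1"
  using prob_space.emeasure_space_1[OF prob_space_normal_density[of \<sigma> \<mu>]]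
  by (simp add: emeasure_density)

lemma normal_density_commute: "normal_density x \<sigma> y = normal_density y \<sigma> x"
  by (simp add: normal_density_def power2_commute)

lemma cnj_measurable [measurable]: "cnj \<in> borel_measurable borel"
  by (intro borel_measurable_continuous_onI continuous_intros)

lemma normal_density_measurable2 [measurable]:
  assumes [measurable]: "f \<in> borel_measurable M" "g \<in> borel_measurable M"
  shows "(\<lambda>x. normal_density (f x) \<sigma> (g x)) \<in> borel_measurable M"
  unfolding normal_density_def by measurable

lemma cnj_integral: "cnj (\<integral>x. f x \<partial>M) = (\<integral>x. cnj (f x) \<partial>M)"
  by simp

lemma norm_integral_le_nn:
  fixes f :: "'a \<Rightarrow> 'b::{banach,second_countable_topology}"
  shows "ennreal (norm (\<integral>x. f x \<partial>M)) \<le> (\<integral>\<^sup>+x. ennreal (norm (f x)) \<partial>M)"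
  by (cases "integrable M f") (auto simp: integral_norm_bound_ennreal not_integrable_integral_eq)

lemma (in pair_sigma_finite) integrable_mult_fst_snd:
  fixes a b :: "_ \<Rightarrow> real"
  assumes a: "integrable M1 a" and b: "integrable M2 b"
  shows "integrable (M1 \<Otimes>\<^sub>M M2) (\<lambda>(x, y). a x * b y)"
proof (rule Fubini_integrable)
  have [measurable]: "a \<in> borel_measurable M1" "b \<in> borel_measurable M2" using a b by auto
  show "(\<lambda>(x, y). a x * b y) \<in> borel_measurable (M1 \<Otimes>\<^sub>M M2)" by measurable
  show "integrable M1 (\<lambda>x. \<integral>y. norm (case (x, y) of (x, y) \<Rightarrow> a x * b y) \<partial>M2)"
    using a by (simp add: abs_mult)
  show "AE x in M1. integrable M2 (\<lambda>y. case (x, y) of (x, y) \<Rightarrow> a x * b y)"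
    using b by simp
qed

text \<open>The Gaussian factor in t makes Fubini legitimate, and the t-integral becomes 2 pi times
  a normal density in s - s'. Schur's test finishes: 2 |g s| |g s'| is at most the sum of the
  squares, and the density has mass 1 in either variable.\<close>

lemma gauss_regularized_plancherel:
  fixes g :: "real \<Rightarrow> complex"
  assumes g: "integrable lborel g" and \<sigma>: "\<sigma> > 0"
  defines "G \<equiv> \<lambda>t. \<integral>s. exp (- \<i> * complex_of_real t * complex_of_real s) * g s \<partial>lborel"
  shows "(\<integral>\<^sup>+t. ennreal (exp (- \<sigma>\<^sup>2 * t\<^sup>2 / 2) * (cmod (G t))\<^sup>2) \<partial>lborel) \<le> ennreal (2 * pi) * nsq lborel g"
proof -
  let ?h = "\<lambda>t. exp (- \<sigma>\<^sup>2 * t\<^sup>2 / 2) :: real"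
  let ?e = "\<lambda>t s. exp (- \<i> * complex_of_real t * complex_of_real s)"
  have [measurable]: "g \<in> borel_measurable borel" using borel_measurable_integrable[OF g] by simp
  have [measurable]: "G \<in> borel_measurable borel" unfolding G_def by measurable
  have ne: "cmod (?e t s) = 1" for t s by (simp add: norm_exp_eq_Re)
  have hi: "integrable lborel ?h"
  proof -
    have "?h t = sqrt (2 * pi) / \<sigma> * normal_density 0 (1 / \<sigma>) t" for t
      using \<sigma> by (simp add: normal_density_def real_sqrt_divide real_sqrt_mult power_divide field_simps)
    then show ?thesis using integrable_normal_density[of "1 / \<sigma>" 0] \<sigma> by simp
  qed
  define B where "B = (\<integral>s. cmod (g s) \<partial>lborel)"
  have GB: "cmod (G t) \<le> B" for t
    unfolding G_def B_def using integral_norm_bound[of lborel "\<lambda>s. ?e t s * g s"] by (simp add: norm_mult ne)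
  have B0: "B \<ge> 0" by (simp add: B_def)
  \<comment> \<open>One integrability statement for both uses of Fubini: first with the bounded
    factor cnj G, then with the exponential at a fixed frequency.\<close>
  have igi: "integrable (lborel \<Otimes>\<^sub>M lborel) (\<lambda>(t, s). complex_of_real (?h t) * c t * (f t s * g' s))"
    if [measurable]: "c \<in> borel_measurable borel" "case_prod f \<in> borel_measurable (borel \<Otimes>\<^sub>M borel)" and c: "\<And>t. cmod (c t) \<le> K" "K \<ge> 0" and f: "\<And>t s. cmod (f t s) = 1"
      and g': "integrable lborel g'" for c f K g'
  proof (rule Bochner_Integration.integrable_bound)
    show "integrable (lborel \<Otimes>\<^sub>M lborel) (\<lambda>x. (K * ?h (fst x)) * cmod (g' (snd x)))"
      using lborel_pair.integrable_mult_fst_snd[of "\<lambda>t. K * ?h t" "\<lambda>s. cmod (g' s)"] hi g'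
      by (simp only: split_beta' Bochner_Integration.integrable_mult_right integrable_norm)
    have [measurable]: "g' \<in> borel_measurable borel" using borel_measurable_integrable[OF g'] by simp
    have [measurable]: "(\<lambda>x. f (fst x) (snd x)) \<in> borel_measurable (borel \<Otimes>\<^sub>M borel)"
      using that(2) unfolding case_prod_unfold .
    show "(\<lambda>(t, s). complex_of_real (?h t) * c t * (f t s * g' s)) \<in> borel_measurable (lborel \<Otimes>\<^sub>M lborel)"
      unfolding split_beta' by measurable 
    show "AE x in lborel \<Otimes>\<^sub>M lborel. norm (case x of (t, s) \<Rightarrow> complex_of_real (?h t) * c t * (f t s * g' s))
       \<le> norm (K * ?h (fst x) * cmod (g' (snd x)))"
      using c by (intro AE_I2) (auto simp: norm_mult f abs_mult mult_right_mono mult_left_mono mult.commute split: prod.split)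
  qed
  define Q where "Q s = (\<integral>t. complex_of_real (?h t) * ?e t s * cnj (G t) \<partial>lborel)" for s
  have I1: "integrable (lborel \<Otimes>\<^sub>M lborel) (\<lambda>(t, s). complex_of_real (?h t) * cnj (G t) * (?e t s * g s))"
  proof (rule igi[OF _ _ _ B0])
    show "(\<lambda>t. cnj (G t)) \<in> borel_measurable borel" by measurable
  qed (use GB g ne in auto)
  have hG: "integrable lborel (\<lambda>t. ?h t * (cmod (G t))\<^sup>2)"
  proof (rule Bochner_Integration.integrable_bound)
    show "integrable lborel (\<lambda>t. ?h t * B\<^sup>2)" using hi by simp
    show "AE t in lborel. norm (?h t * (cmod (G t))\<^sup>2) \<le> norm (?h t * B\<^sup>2)"
      using GB by (intro AE_I2) (auto simp: abs_mult intro!: mult_left_mono power_mono)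
  qed measurable
  have "complex_of_real (\<integral>t. ?h t * (cmod (G t))\<^sup>2 \<partial>lborel)
    = (\<integral>t. complex_of_real (?h t * (cmod (G t))\<^sup>2) \<partial>lborel)" by (rule integral_complex_of_real[symmetric])
  also have "\<dots> = (\<integral>t. (\<integral>s. complex_of_real (?h t) * cnj (G t) * (?e t s * g s) \<partial>lborel) \<partial>lborel)"
  proof (rule Bochner_Integration.integral_cong[OF refl])
    fix t
    have "(\<integral>s. complex_of_real (?h t) * cnj (G t) * (?e t s * g s) \<partial>lborel) = complex_of_real (?h t) * (cnj (G t) * G t)"
      unfolding G_def by simp
    also have "cnj (G t) * G t = complex_of_real ((cmod (G t))\<^sup>2)"
      by (metis complex_norm_square mult.commute)
    finally show "complex_of_real (?h t * (cmod (G t))\<^sup>2) = (\<integral>s. complex_of_real (?h t) * cnj (G t) * (?e t s * g s) \<partial>lborel)"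
      by (simp add: mult.assoc)
  qed
  also have "\<dots> = (\<integral>s. (\<integral>t. complex_of_real (?h t) * cnj (G t) * (?e t s * g s) \<partial>lborel) \<partial>lborel)"
    by (rule lborel_pair.Fubini_integral[OF I1, symmetric])
  also have "\<dots> = (\<integral>s. Q s * g s \<partial>lborel)"
    unfolding Q_def by (intro Bochner_Integration.integral_cong refl)
      (simp add: mult_ac flip: Bochner_Integration.integral_mult_left_zero)
  finally have eq: "complex_of_real (\<integral>t. ?h t * (cmod (G t))\<^sup>2 \<partial>lborel) = (\<integral>s. Q s * g s \<partial>lborel)" .
  have Q: "Q s = (\<integral>s'. cnj (g s') * complex_of_real (2 * pi * normal_density s \<sigma> s') \<partial>lborel)" for s
  proof -
    have I2: "integrable (lborel \<Otimes>\<^sub>M lborel) (\<lambda>(t, s'). complex_of_real (?h t) * ?e t s * (cnj (?e t s') * cnj (g s')))"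
      by (rule igi[OF _ _ _ zero_le_one]) (use g ne in \<open>auto simp: complex_mod_cnj\<close>)
    have "Q s = (\<integral>t. (\<integral>s'. complex_of_real (?h t) * ?e t s * (cnj (?e t s') * cnj (g s')) \<partial>lborel) \<partial>lborel)"
      unfolding Q_def G_def cnj_integral
      by (simp only: complex_cnj_mult Bochner_Integration.integral_mult_right_zero)
    also have "\<dots> = (\<integral>s'. (\<integral>t. complex_of_real (?h t) * ?e t s * (cnj (?e t s') * cnj (g s')) \<partial>lborel) \<partial>lborel)"
      by (rule lborel_pair.Fubini_integral[OF I2, symmetric])
    also have "\<dots> = (\<integral>s'. cnj (g s') * complex_of_real (2 * pi * normal_density s \<sigma> s') \<partial>lborel)"
    proof (rule Bochner_Integration.integral_cong[OF refl])
      fix s'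
      have "?e t s * cnj (?e t s') = ?e t (s - s')" for t
        by (simp add: exp_cnj exp_add[symmetric] algebra_simps)
      moreover have "complex_of_real (?h t) * ?e t s * (cnj (?e t s') * cnj (g s'))
        = cnj (g s') * (complex_of_real (?h t) * (?e t s * cnj (?e t s')))" for t
        by (simp only: mult_ac)
      ultimately have "complex_of_real (?h t) * ?e t s * (cnj (?e t s') * cnj (g s')) = cnj (g s') * (complex_of_real (?h t) * ?e t (s - s'))" for t
        by (simp only:)
      then have "(\<integral>t. complex_of_real (?h t) * ?e t s * (cnj (?e t s') * cnj (g s')) \<partial>lborel)
        = cnj (g s') * (\<integral>t. complex_of_real (?h t) * ?e t (s - s') \<partial>lborel)"
        by (simp only: Bochner_Integration.integral_mult_right_zero)
      also have "(\<integral>t. complex_of_real (?h t) * ?e t (s - s') \<partial>lborel) = complex_of_real (2 * pi * normal_density 0 \<sigma> (s - s'))"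
        by (rule fourier_gauss[OF \<sigma>])
      also have "normal_density 0 \<sigma> (s - s') = normal_density s \<sigma> s'"
        by (simp add: normal_density_def power2_commute)
      finally show "(\<integral>t. complex_of_real (?h t) * ?e t s * (cnj (?e t s') * cnj (g s')) \<partial>lborel)
        = cnj (g s') * complex_of_real (2 * pi * normal_density s \<sigma> s')" .
    qed
    finally show ?thesis .
  qed
  have "(\<integral>\<^sup>+t. ennreal (?h t * (cmod (G t))\<^sup>2) \<partial>lborel) = ennreal (\<integral>t. ?h t * (cmod (G t))\<^sup>2 \<partial>lborel)"
    by (rule nn_integral_eq_integral[OF hG]) simp
  also have "\<dots> = ennreal (cmod (\<integral>s. Q s * g s \<partial>lborel))"
    unfolding eq[symmetric] norm_of_real by (subst abs_of_nonneg) auto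
  also have "\<dots> \<le> (\<integral>\<^sup>+s. ennreal (cmod (Q s * g s)) \<partial>lborel)" by (rule norm_integral_le_nn)
  also have "\<dots> \<le> (\<integral>\<^sup>+s. (\<integral>\<^sup>+s'. ennreal (pi * (cmod (g s))\<^sup>2) * ennreal (normal_density s \<sigma> s') +
      ennreal (pi * (cmod (g s'))\<^sup>2) * ennreal (normal_density s \<sigma> s') \<partial>lborel) \<partial>lborel)"
  proof (rule nn_integral_mono)
    fix s
    have "ennreal (cmod (Q s * g s)) = ennreal (cmod (Q s)) * ennreal (cmod (g s))"
      by (simp add: norm_mult ennreal_mult)
    also have "\<dots> \<le> (\<integral>\<^sup>+s'. ennreal (cmod (cnj (g s') * complex_of_real (2 * pi * normal_density s \<sigma> s'))) \<partial>lborel) * ennreal (cmod (g s))"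
      unfolding Q by (intro mult_right_mono norm_integral_le_nn) simp
    also have "\<dots> = (\<integral>\<^sup>+s'. ennreal (cmod (cnj (g s') * complex_of_real (2 * pi * normal_density s \<sigma> s'))) * ennreal (cmod (g s)) \<partial>lborel)"
      by (rule nn_integral_multc[symmetric]) measurable
    also have "\<dots> \<le> (\<integral>\<^sup>+s'. ennreal (pi * (cmod (g s))\<^sup>2) * ennreal (normal_density s \<sigma> s') +
      ennreal (pi * (cmod (g s'))\<^sup>2) * ennreal (normal_density s \<sigma> s') \<partial>lborel)"
    proof (rule nn_integral_mono)
      fix s'
      have nd: "normal_density s \<sigma> s' \<ge> 0" using normal_density_nonneg by blast
      have "2 * cmod (g s) * cmod (g s') \<le> (cmod (g s))\<^sup>2 + (cmod (g s'))\<^sup>2" by (rule sum_squares_bound)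
      then have "(2 * cmod (g s) * cmod (g s')) * (pi * normal_density s \<sigma> s') \<le> ((cmod (g s))\<^sup>2 + (cmod (g s'))\<^sup>2) * (pi * normal_density s \<sigma> s')"
        using nd by (intro mult_right_mono) auto
      then have "cmod (cnj (g s') * complex_of_real (2 * pi * normal_density s \<sigma> s')) * cmod (g s)
        \<le> pi * (cmod (g s))\<^sup>2 * normal_density s \<sigma> s' + pi * (cmod (g s'))\<^sup>2 * normal_density s \<sigma> s'"
        using nd by (simp add: norm_mult algebra_simps)
      then show "ennreal (cmod (cnj (g s') * complex_of_real (2 * pi * normal_density s \<sigma> s'))) * ennreal (cmod (g s))
        \<le> ennreal (pi * (cmod (g s))\<^sup>2) * ennreal (normal_density s \<sigma> s') + ennreal (pi * (cmod (g s'))\<^sup>2) * ennreal (normal_density s \<sigma> s')"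
        using nd by (simp add: ennreal_mult[symmetric] ennreal_plus[symmetric] del: ennreal_plus)
    qed
    finally show "ennreal (cmod (Q s * g s)) \<le> (\<integral>\<^sup>+s'. ennreal (pi * (cmod (g s))\<^sup>2) * ennreal (normal_density s \<sigma> s') +
      ennreal (pi * (cmod (g s'))\<^sup>2) * ennreal (normal_density s \<sigma> s') \<partial>lborel)" .
  qed
  also have "\<dots> = (\<integral>\<^sup>+s. (\<integral>\<^sup>+s'. ennreal (pi * (cmod (g s))\<^sup>2) * ennreal (normal_density s \<sigma> s') \<partial>lborel) \<partial>lborel)
     + (\<integral>\<^sup>+s. (\<integral>\<^sup>+s'. ennreal (pi * (cmod (g s'))\<^sup>2) * ennreal (normal_density s \<sigma> s') \<partial>lborel) \<partial>lborel)"
  proof -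
    have "(\<integral>\<^sup>+s. (\<integral>\<^sup>+s'. ennreal (pi * (cmod (g s))\<^sup>2) * ennreal (normal_density s \<sigma> s') +
      ennreal (pi * (cmod (g s'))\<^sup>2) * ennreal (normal_density s \<sigma> s') \<partial>lborel) \<partial>lborel)
      = (\<integral>\<^sup>+s. (\<integral>\<^sup>+s'. ennreal (pi * (cmod (g s))\<^sup>2) * ennreal (normal_density s \<sigma> s') \<partial>lborel) +
         (\<integral>\<^sup>+s'. ennreal (pi * (cmod (g s'))\<^sup>2) * ennreal (normal_density s \<sigma> s') \<partial>lborel) \<partial>lborel)"
      by (intro nn_integral_cong nn_integral_add) measurable
    also have "\<dots> = (\<integral>\<^sup>+s. (\<integral>\<^sup>+s'. ennreal (pi * (cmod (g s))\<^sup>2) * ennreal (normal_density s \<sigma> s') \<partial>lborel) \<partial>lborel)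
     + (\<integral>\<^sup>+s. (\<integral>\<^sup>+s'. ennreal (pi * (cmod (g s'))\<^sup>2) * ennreal (normal_density s \<sigma> s') \<partial>lborel) \<partial>lborel)"
      by (rule nn_integral_add) measurable
    finally show ?thesis .
  qed
  also have "(\<integral>\<^sup>+s. (\<integral>\<^sup>+s'. ennreal (pi * (cmod (g s'))\<^sup>2) * ennreal (normal_density s \<sigma> s') \<partial>lborel) \<partial>lborel)
    = (\<integral>\<^sup>+s'. (\<integral>\<^sup>+s. ennreal (pi * (cmod (g s'))\<^sup>2) * ennreal (normal_density s \<sigma> s') \<partial>lborel) \<partial>lborel)"
    by (rule lborel_pair.Fubini') measurable
  also have "\<dots> = (\<integral>\<^sup>+s. (\<integral>\<^sup>+s'. ennreal (pi * (cmod (g s))\<^sup>2) * ennreal (normal_density s \<sigma> s') \<partial>lborel) \<partial>lborel)"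
    by (subst (1) normal_density_commute, rule refl)
  also have "(\<integral>\<^sup>+s. (\<integral>\<^sup>+s'. ennreal (pi * (cmod (g s))\<^sup>2) * ennreal (normal_density s \<sigma> s') \<partial>lborel) \<partial>lborel)
    = ennreal pi * nsq lborel g"
    unfolding nsq_def
    by (subst nn_integral_cmult, measurable) (simp add: nn_integral_normal_density[OF \<sigma>] ennreal_mult nn_integral_cmult)
  also have "ennreal pi * nsq lborel g + ennreal pi * nsq lborel g = ennreal (2 * pi) * nsq lborel g"
    by (simp add: ennreal_plus[symmetric] distrib_right[symmetric] del: ennreal_plus)
  finally show ?thesis .
qed

text \<open>The regularisation is removed by Fatou along \<sigma> = 1/(k+1).\<close>

theorem plancherel_le:
  fixes g :: "real \<Rightarrow> complex"
  assumes g: "integrable lborel g"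
  shows "nsq lborel (\<lambda>t. \<integral>s. exp (- \<i> * complex_of_real t * complex_of_real s) * g s \<partial>lborel)
    \<le> ennreal (2 * pi) * nsq lborel g"
proof -
  define G where "G t = (\<integral>s. exp (- \<i> * complex_of_real t * complex_of_real s) * g s \<partial>lborel)" for t
  have [measurable]: "g \<in> borel_measurable borel" using borel_measurable_integrable[OF g] by simp
  have [measurable]: "G \<in> borel_measurable borel" unfolding G_def by measurable
  let ?u = "\<lambda>k t. ennreal (exp (- (1 / real (Suc k))\<^sup>2 * t\<^sup>2 / 2) * (cmod (G t))\<^sup>2)"
  have "nsq lborel G = (\<integral>\<^sup>+t. liminf (\<lambda>k. ?u k t) \<partial>lborel)"
    unfolding nsq_def
  proof (rule nn_integral_cong)
    fix t
    have "(\<lambda>k. 1 / real (Suc k)) \<longlonglongrightarrow> 0"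
      using LIMSEQ_inverse_real_of_nat by (simp add: inverse_eq_divide)
    then have "(\<lambda>k. exp (- (1 / real (Suc k))\<^sup>2 * t\<^sup>2 / 2) * (cmod (G t))\<^sup>2) \<longlonglongrightarrow> exp (- 0\<^sup>2 * t\<^sup>2 / 2) * (cmod (G t))\<^sup>2"
      by (intro tendsto_intros) auto
    then have "(\<lambda>k. ?u k t) \<longlonglongrightarrow> ennreal ((cmod (G t))\<^sup>2)"
      by (intro tendsto_ennrealI) simp
    from lim_imp_Liminf[OF _ this] show "ennreal ((cmod (G t))\<^sup>2) = liminf (\<lambda>k. ?u k t)" by simp
  qed
  also have "\<dots> \<le> liminf (\<lambda>k. \<integral>\<^sup>+t. ?u k t \<partial>lborel)"
    by (intro nn_integral_liminf) measurable
  also have "\<dots> \<le> ennreal (2 * pi) * nsq lborel g"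
    unfolding G_def
    by (intro Liminf_le[OF sequentially_bot] always_eventually allI gauss_regularized_plancherel g) simp
  finally show ?thesis unfolding G_def .
qed

text \<open>The substitution s = \<rho>^2 turns \<rho>^(n-1) d\<rho> into s^((n-2)/2) ds / 2; for n
  at least 2 the exponent n - 2 is a genuine difference of natural numbers.\<close>

lemma radial_measure_eq_distr:
  assumes n: "n \<ge> 2"
  shows "radial_measure n = distr (density lborel (\<lambda>s. ennreal (indicator {0<..} s * sqrt s ^ (n - 2) / 2))) borel sqrt"
proof (rule measure_eqI)
  fix A assume "A \<in> sets (radial_measure n)"
  then have [measurable]: "A \<in> sets borel" by simp
  have [measurable]: "sqrt -` A \<in> sets borel" using measurable_sets[of sqrt borel borel A] by simp
  have "emeasure (radial_measure n) A = (\<integral>\<^sup>+r. indicator A r \<partial>radial_measure n)" by simp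
  also have "\<dots> = (\<integral>\<^sup>+r. (indicator A r * ennreal (r ^ (n - 1))) * indicator {0<..} r \<partial>lborel)"
    by (subst nn_integral_radial) auto
  also have "\<dots> = (\<integral>\<^sup>+x. (indicator A (1 * x powr (1/2)) * ennreal ((1 * x powr (1/2)) ^ (n - 1))) *
      ennreal (1 * \<bar>1/2\<bar> * x powr (1/2 - 1)) * indicator {0<..} x \<partial>lborel)"
    by (rule nn_integral_power_substitution) auto
  also have "\<dots> = (\<integral>\<^sup>+x. ennreal (indicator {0<..} x * sqrt x ^ (n - 2) / 2) * indicator (sqrt -` A) x \<partial>lborel)"
  proof (rule nn_integral_cong)
    fix x :: real
    show "(indicator A (1 * x powr (1/2)) * ennreal ((1 * x powr (1/2)) ^ (n - 1))) *
      ennreal (1 * \<bar>1/2\<bar> * x powr (1/2 - 1)) * indicator {0<..} x = ennreal (indicator {0<..} x * sqrt x ^ (n - 2) / 2) * indicator (sqrt -` A) x"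
    proof (cases "x > 0")
      case True
      have 1: "x powr (1/2 - 1) = 1 / sqrt x"
        using True by (simp add: powr_minus_divide powr_half_sqrt)
      have "sqrt x ^ (n - 1) = sqrt x ^ (n - 2) * sqrt x"
      proof -
        have "n - 1 = Suc (n - 2)" using n by simp
        then show ?thesis by (simp only: power_Suc mult.commute)
      qed
      then have "sqrt x ^ (n - 1) * (1 * \<bar>1/2\<bar> * (1 / sqrt x)) = sqrt x ^ (n - 2) / 2"
        using True by simp
      then show ?thesis
        using True unfolding 1 by (auto simp: powr_half_sqrt indicator_def ennreal_mult[symmetric])
    qed simp
  qed
  also have "\<dots> = emeasure (distr (density lborel (\<lambda>s. ennreal (indicator {0<..} s * sqrt s ^ (n - 2) / 2))) borel sqrt) A"
    by (subst emeasure_distr, simp, simp, subst emeasure_density) auto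
  finally show "emeasure (radial_measure n) A = emeasure (distr (density lborel (\<lambda>s. ennreal (indicator {0<..} s * sqrt s ^ (n - 2) / 2))) borel sqrt) A" .
qed simp

text \<open>The density enters squared on the frequency side. One copy restores the radial measure,
  the other is the weight \<rho>^(n-2) with a factor 1/2, which turns 2 pi into pi.\<close>

lemma plancherel_radial_le:
  fixes h :: "real \<Rightarrow> complex"
  assumes n: "n \<ge> 2" and h: "integrable (radial_measure n) h"
  shows "nsq lborel (\<lambda>t. \<integral>\<rho>. exp (- \<i> * complex_of_real t * complex_of_real (\<rho>\<^sup>2)) * h \<rho> \<partial>radial_measure n)
    \<le> ennreal pi * (\<integral>\<^sup>+\<rho>. ennreal (\<rho> ^ (n - 2) * (cmod (h \<rho>))\<^sup>2) \<partial>radial_measure n)"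
proof -
  define v where "v s = indicator {0<..} s * sqrt s ^ (n - 2) / 2" for s
  define g where "g s = v s *\<^sub>R h (sqrt s)" for s
  have [measurable]: "h \<in> borel_measurable borel" using borel_measurable_integrable[OF h] by simp
  have [measurable]: "v \<in> borel_measurable borel" unfolding v_def by measurable
  have v0: "v s \<ge> 0" for s by (cases "s > 0") (auto simp: v_def)
  have R: "radial_measure n = distr (density lborel (\<lambda>s. ennreal (v s))) borel sqrt"
    unfolding v_def by (rule radial_measure_eq_distr[OF n])
  have g: "integrable lborel g"
    using h unfolding R g_def by (subst (asm) integrable_distr_eq) (auto simp: integrable_density v0)
  have eq: "(\<integral>\<rho>. exp (- \<i> * complex_of_real t * complex_of_real (\<rho>\<^sup>2)) * h \<rho> \<partial>radial_measure n)
    = (\<integral>s. exp (- \<i> * complex_of_real t * complex_of_real s) * g s \<partial>lborel)" for t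
  proof -
    have "(\<integral>\<rho>. exp (- \<i> * complex_of_real t * complex_of_real (\<rho>\<^sup>2)) * h \<rho> \<partial>radial_measure n)
      = (\<integral>s. exp (- \<i> * complex_of_real t * complex_of_real ((sqrt s)\<^sup>2)) * h (sqrt s) \<partial>density lborel (\<lambda>s. ennreal (v s)))"
      unfolding R by (rule integral_distr) measurable
    also have "\<dots> = (\<integral>s. v s *\<^sub>R (exp (- \<i> * complex_of_real t * complex_of_real ((sqrt s)\<^sup>2)) * h (sqrt s)) \<partial>lborel)"
      by (rule integral_density) (auto simp: v0)
    also have "\<dots> = (\<integral>s. exp (- \<i> * complex_of_real t * complex_of_real s) * g s \<partial>lborel)"
    proof (rule Bochner_Integration.integral_cong[OF refl])
      fix s
      show "v s *\<^sub>R (exp (- \<i> * complex_of_real t * complex_of_real ((sqrt s)\<^sup>2)) * h (sqrt s)) = exp (- \<i> * complex_of_real t * complex_of_real s) * g s"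
        by (cases "s > 0") (auto simp: v_def g_def)
    qed
    finally show ?thesis .
  qed
  have "nsq lborel (\<lambda>t. \<integral>\<rho>. exp (- \<i> * complex_of_real t * complex_of_real (\<rho>\<^sup>2)) * h \<rho> \<partial>radial_measure n) \<le> ennreal (2 * pi) * nsq lborel g"
    unfolding eq by (rule plancherel_le[OF g])
  also have "nsq lborel g = (\<integral>\<^sup>+s. ennreal (1/2) * (ennreal (v s) * ennreal (sqrt s ^ (n - 2) * (cmod (h (sqrt s)))\<^sup>2)) \<partial>lborel)"
    unfolding nsq_def
  proof (rule nn_integral_cong)
    fix s :: real
    show "ennreal ((cmod (g s))\<^sup>2) = ennreal (1/2) * (ennreal (v s) * ennreal (sqrt s ^ (n - 2) * (cmod (h (sqrt s)))\<^sup>2))"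
    proof (cases "s > 0")
      case True
      then have "(cmod (g s))\<^sup>2 = 1/2 * (v s * (sqrt s ^ (n - 2) * (cmod (h (sqrt s)))\<^sup>2))"
        by (simp add: g_def v_def power_mult_distrib power2_eq_square)
      then show ?thesis using True v0[of s] by (simp add: ennreal_mult[symmetric] del: ennreal_half)
    qed (simp add: g_def v_def)
  qed
  also have "\<dots> = ennreal (1/2) * (\<integral>\<^sup>+s. ennreal (v s) * ennreal (sqrt s ^ (n - 2) * (cmod (h (sqrt s)))\<^sup>2) \<partial>lborel)"
    by (rule nn_integral_cmult) measurable
  also have "(\<integral>\<^sup>+s. ennreal (v s) * ennreal (sqrt s ^ (n - 2) * (cmod (h (sqrt s)))\<^sup>2) \<partial>lborel)
    = (\<integral>\<^sup>+\<rho>. ennreal (\<rho> ^ (n - 2) * (cmod (h \<rho>))\<^sup>2) \<partial>radial_measure n)"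
    unfolding R by (subst nn_integral_distr, simp, simp, subst nn_integral_density) auto
  also have "ennreal (2 * pi) * (ennreal (1/2) * X) = ennreal pi * X" for X
    by (simp add: mult.assoc[symmetric] ennreal_mult[symmetric] del: ennreal_half)
  finally show ?thesis .
qed

section \<open>Harmonic polynomials\<close>

text \<open>Differentiation along a line, in the same form as inside \<open>laplacian\<close>, so
  that the complex operator splits into real and imaginary parts with no regularity
  argument.\<close>

definition pdiff :: "'a::real_normed_vector \<Rightarrow> ('a \<Rightarrow> real) \<Rightarrow> 'a \<Rightarrow> real" where
  "pdiff b p x = vector_derivative (\<lambda>t. p (x + t *\<^sub>R b)) (at 0)"

definition rlaplacian :: "('a::euclidean_space \<Rightarrow> real) \<Rightarrow> 'a \<Rightarrow> real" where
  "rlaplacian p x = (\<Sum>b\<in>Basis. pdiff b (pdiff b p) x)"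

lemmas rpoly_linear = real_polynomial_function.intros(1)
lemmas rpoly_const = real_polynomial_function.intros(2)
lemmas rpoly_add = real_polynomial_function.intros(3)
lemmas rpoly_mult = real_polynomial_function.intros(4)

text \<open>A single polynomial q gives the derivative at every point of every parallel line;
  therefore derivatives are again polynomials and can be differentiated further.\<close>

lemma real_polynomial_function_directional:
  assumes "real_polynomial_function p"
  shows "\<exists>q. real_polynomial_function q \<and> (\<forall>x s. ((\<lambda>t. p (x + t *\<^sub>R b)) has_real_derivative q (x + s *\<^sub>R b)) (at s))"
  using assms
proof (induction p)
  case (linear f)
  interpret f: bounded_linear f by (rule linear)
  have "((\<lambda>t. f (x + t *\<^sub>R b)) has_real_derivative f b) (at s)" for x s
    by (auto simp: f.add f.scaleR intro!: derivative_eq_intros)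
  then show ?case by (intro exI[of _ "\<lambda>x. f b"]) auto
next
  case (const c)
  show ?case by (intro exI[of _ "\<lambda>x. 0"]) auto
next
  case (add f g)
  then obtain f' g' where "real_polynomial_function f'" "real_polynomial_function g'"
    "\<And>x s. ((\<lambda>t. f (x + t *\<^sub>R b)) has_real_derivative f' (x + s *\<^sub>R b)) (at s)"
    "\<And>x s. ((\<lambda>t. g (x + t *\<^sub>R b)) has_real_derivative g' (x + s *\<^sub>R b)) (at s)" by blast
  then show ?case by (intro exI[of _ "\<lambda>x. f' x + g' x"]) (auto intro!: DERIV_add)
next
  case (mult f g)
  then obtain f' g' where fg: "real_polynomial_function f'" "real_polynomial_function g'"
    "\<And>x s. ((\<lambda>t. f (x + t *\<^sub>R b)) has_real_derivative f' (x + s *\<^sub>R b)) (at s)"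
    "\<And>x s. ((\<lambda>t. g (x + t *\<^sub>R b)) has_real_derivative g' (x + s *\<^sub>R b)) (at s)" by blast
  show ?case
    using mult.hyps fg(1,2) by (intro exI[of _ "\<lambda>x. f x * g' x + f' x * g x"])
      (auto intro!: derivative_eq_intros fg(3,4) rpoly_add rpoly_mult)
qed

lemma
  assumes "real_polynomial_function p"
  shows pdiff_polynomial: "real_polynomial_function (pdiff b p)"
    and pdiff_derivative: "((\<lambda>t. p (x + t *\<^sub>R b)) has_real_derivative pdiff b p (x + s *\<^sub>R b)) (at s)"
proof -
  obtain q where q: "real_polynomial_function q"
    "\<And>x s. ((\<lambda>t. p (x + t *\<^sub>R b)) has_real_derivative q (x + s *\<^sub>R b)) (at s)"
    using real_polynomial_function_directional[OF assms] by blast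
  have "pdiff b p x = q x" for x
    unfolding pdiff_def using q(2)[of x 0]
    by (simp add: has_real_derivative_iff_has_vector_derivative vector_derivative_at)
  then have "pdiff b p = q" by (rule ext)
  with q show "real_polynomial_function (pdiff b p)"
    "((\<lambda>t. p (x + t *\<^sub>R b)) has_real_derivative pdiff b p (x + s *\<^sub>R b)) (at s)" by auto
qed

lemma pdiff_eqI:
  assumes "((\<lambda>t. p (x + t *\<^sub>R b)) has_real_derivative d) (at 0)"
  shows "pdiff b p x = d"
  unfolding pdiff_def using assms
  by (simp add: has_real_derivative_iff_has_vector_derivative vector_derivative_at)

lemma pdiff_derivative0: "real_polynomial_function p \<Longrightarrow> ((\<lambda>t. p (x + t *\<^sub>R b)) has_real_derivative pdiff b p x) (at 0)"
  using pdiff_derivative[of p x b 0] by simp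

lemma pdiff_add:
  "real_polynomial_function p \<Longrightarrow> real_polynomial_function q \<Longrightarrow> pdiff b (\<lambda>x. p x + q x) x = pdiff b p x + pdiff b q x"
  by (intro pdiff_eqI DERIV_add pdiff_derivative0)

lemma pdiff_mult:
  "real_polynomial_function p \<Longrightarrow> real_polynomial_function q \<Longrightarrow>
    pdiff b (\<lambda>x. p x * q x) x = p x * pdiff b q x + pdiff b p x * q x"
  by (rule pdiff_eqI, rule derivative_eq_intros, rule pdiff_derivative0, assumption, rule pdiff_derivative0) auto

lemma pdiff_const: "pdiff b (\<lambda>x. c) x = 0"
  by (rule pdiff_eqI) auto

lemma pdiff_const_fun: "pdiff b (\<lambda>x. c) = (\<lambda>x. 0)"
  by (rule ext) (rule pdiff_const)

lemma pdiff_cmult: "real_polynomial_function p \<Longrightarrow> pdiff b (\<lambda>x. c * p x) x = c * pdiff b p x"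
  by (simp add: pdiff_mult pdiff_const rpoly_const)

lemma pdiff_sum:
  "(\<And>i. i \<in> I \<Longrightarrow> real_polynomial_function (p i)) \<Longrightarrow> finite I \<Longrightarrow>
    pdiff b (\<lambda>x. \<Sum>i\<in>I. p i x) x = (\<Sum>i\<in>I. pdiff b (p i) x)"
  by (rule pdiff_eqI, rule derivative_eq_intros, rule pdiff_derivative0) auto

text \<open>Linearity in the direction, by induction over the construction of polynomials; it is
  needed for the direction v = x in Euler's identity.\<close>

lemma pdiff_direction:
  fixes p :: "'a::euclidean_space \<Rightarrow> real"
  assumes "real_polynomial_function p"
  shows "pdiff v p x = (\<Sum>b\<in>Basis. (v \<bullet> b) * pdiff b p x)"
  using assms
proof (induction p)
  case (linear f)
  interpret f: bounded_linear f by (rule linear)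
  have *: "pdiff b f x = f b" for b
    by (rule pdiff_eqI) (auto simp: f.add f.scaleR intro!: derivative_eq_intros)
  have "f v = f (\<Sum>b\<in>Basis. (v \<bullet> b) *\<^sub>R b)" by (simp add: euclidean_representation)
  also have "\<dots> = (\<Sum>b\<in>Basis. (v \<bullet> b) * f b)" by (simp add: f.sum f.scaleR)
  finally show ?case by (simp add: *)
next
  case (const c)
  show ?case by (simp add: pdiff_const)
next
  case (add f g)
  then show ?case by (simp add: pdiff_add sum.distrib algebra_simps)
next
  case (mult f g)
  then show ?case by (simp add: pdiff_mult sum.distrib sum_distrib_left sum_distrib_right algebra_simps)
qed

section \<open>Homogeneous polynomials and Euler's identity\<close>

definition homogeneous :: "nat \<Rightarrow> ('a::real_vector \<Rightarrow> real) \<Rightarrow> bool" where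
  "homogeneous k p \<longleftrightarrow> (\<forall>c x. p (c *\<^sub>R x) = c ^ k * p x)"

text \<open>Both sides are the derivative at t = 0 of p(x + t x) = (1 + t)^k p(x).\<close>

lemma euler_homogeneous:
  fixes p :: "'a::euclidean_space \<Rightarrow> real"
  assumes p: "real_polynomial_function p" and hom: "homogeneous k p"
  shows "(\<Sum>b\<in>Basis. (x \<bullet> b) * pdiff b p x) = real k * p x"
proof -
  have "((\<lambda>t. (1 + t) ^ k * p x) has_real_derivative real k * p x) (at 0)"
    by (auto intro!: derivative_eq_intros)
  also have "(\<lambda>t. (1 + t) ^ k * p x) = (\<lambda>t. p (x + t *\<^sub>R x))"
    using hom by (auto simp: homogeneous_def fun_eq_iff scaleR_left_distrib[symmetric, of 1, simplified] simp flip: scaleR_left_distrib)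
  finally have "pdiff x p x = real k * p x" by (rule pdiff_eqI)
  then show ?thesis using pdiff_direction[OF p, of x x] by simp
qed

lemma rlaplacian_polynomial: "real_polynomial_function p \<Longrightarrow> real_polynomial_function (rlaplacian p)"
  unfolding rlaplacian_def[abs_def] by (intro real_polynomial_function_sum pdiff_polynomial finite_Basis)

lemma rlaplacian_sum:
  assumes p: "\<And>i. i \<in> I \<Longrightarrow> real_polynomial_function (p i)" and I: "finite I"
  shows "rlaplacian (\<lambda>x. \<Sum>i\<in>I. p i x) x = (\<Sum>i\<in>I. rlaplacian (p i) x)"
proof -
  have "pdiff b (\<lambda>x. \<Sum>i\<in>I. p i x) = (\<lambda>x. \<Sum>i\<in>I. pdiff b (p i) x)" for b
    using p I by (intro ext pdiff_sum)
  then have "rlaplacian (\<lambda>x. \<Sum>i\<in>I. p i x) x = (\<Sum>b\<in>Basis. \<Sum>i\<in>I. pdiff b (pdiff b (p i)) x)"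
    unfolding rlaplacian_def by (simp add: pdiff_sum pdiff_polynomial p I)
  also have "\<dots> = (\<Sum>i\<in>I. rlaplacian (p i) x)"
    unfolding rlaplacian_def by (rule sum.swap)
  finally show ?thesis .
qed

lemma rlaplacian_lincomb:
  assumes p: "real_polynomial_function p" "real_polynomial_function q"
  shows "rlaplacian (\<lambda>x. p x + c * q x) x = rlaplacian p x + c * rlaplacian q x"
proof -
  have cq: "real_polynomial_function (\<lambda>x. c * q x)" if "real_polynomial_function q" for q :: "'a \<Rightarrow> real"
    using that by (intro rpoly_mult rpoly_const)
  have "pdiff b (\<lambda>x. p x + c * q x) = (\<lambda>x. pdiff b p x + c * pdiff b q x)" for b
    using p by (simp add: fun_eq_iff pdiff_add pdiff_cmult cq)
  then show ?thesis
    unfolding rlaplacian_def using p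
    by (simp add: pdiff_add pdiff_cmult cq pdiff_polynomial sum.distrib sum_distrib_left)
qed

lemma rlaplacian_mult:
  assumes p: "real_polynomial_function p" "real_polynomial_function q"
  shows "rlaplacian (\<lambda>x. p x * q x) x = p x * rlaplacian q x + 2 * (\<Sum>b\<in>Basis. pdiff b p x * pdiff b q x) + rlaplacian p x * q x"
proof -
  have "pdiff b (\<lambda>x. p x * q x) = (\<lambda>x. p x * pdiff b q x + pdiff b p x * q x)" for b
    using p by (simp add: fun_eq_iff pdiff_mult)
  then have "rlaplacian (\<lambda>x. p x * q x) x = (\<Sum>b\<in>Basis. p x * pdiff b (pdiff b q) x + 2 * (pdiff b p x * pdiff b q x) + pdiff b (pdiff b p) x * q x)"
    unfolding rlaplacian_def using p
    by (intro sum.cong) (simp_all add: pdiff_add pdiff_mult pdiff_polynomial rpoly_mult)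
  then show ?thesis
    unfolding rlaplacian_def by (simp add: sum.distrib sum_distrib_left sum_distrib_right)
qed

lemma inner_self_polynomial: "real_polynomial_function (\<lambda>x::'a::euclidean_space. x \<bullet> x)"
proof -
  have "real_polynomial_function (\<lambda>x::'a. \<Sum>b\<in>Basis. (x \<bullet> b) * (x \<bullet> b))"
    by (intro real_polynomial_function_sum finite_Basis rpoly_mult rpoly_linear bounded_linear_inner_left)
  then show ?thesis by (simp flip: euclidean_inner)
qed

lemma pdiff_inner_self: "pdiff b (\<lambda>x. x \<bullet> x) x = 2 * (x \<bullet> b)"
proof (rule pdiff_eqI)
  have "((\<lambda>t. x \<bullet> x + 2 * t * (x \<bullet> b) + t\<^sup>2 * (b \<bullet> b)) has_real_derivative 2 * (x \<bullet> b)) (at 0)"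
    by (auto intro!: derivative_eq_intros)
  then show "((\<lambda>t. (x + t *\<^sub>R b) \<bullet> (x + t *\<^sub>R b)) has_real_derivative 2 * (x \<bullet> b)) (at 0)"
    by (simp add: inner_add_left inner_add_right inner_commute[of b x] power2_eq_square algebra_simps)
qed

lemma rlaplacian_inner_self: "rlaplacian (\<lambda>x::'a::euclidean_space. x \<bullet> x) x = 2 * real DIM('a)"
proof -
  have "pdiff b (\<lambda>x::'a. x \<bullet> x) = (\<lambda>x. 2 * (x \<bullet> b))" for b by (rule ext) (rule pdiff_inner_self)
  moreover have "pdiff b (\<lambda>x::'a. 2 * (x \<bullet> b)) x = 2" if "b \<in> Basis" for b
    using that by (intro pdiff_eqI) (auto simp: inner_add_left intro!: derivative_eq_intros)
  ultimately show ?thesis unfolding rlaplacian_def by simp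
qed

text \<open>The mixed term of the product rule is 4 times the Euler derivative of g, hence 4 m g;
  the Laplacian of the squared norm contributes twice the dimension.\<close>

lemma rlaplacian_inner_self_mult:
  fixes g :: "'a::euclidean_space \<Rightarrow> real"
  assumes g: "real_polynomial_function g" "homogeneous m g"
  shows "rlaplacian (\<lambda>x. (x \<bullet> x) * g x) x = (x \<bullet> x) * rlaplacian g x + (4 * real m + 2 * real DIM('a)) * g x"
proof -
  have "(\<Sum>b\<in>Basis. pdiff b (\<lambda>x. x \<bullet> x) x * pdiff b g x) = 2 * (\<Sum>b\<in>Basis. (x \<bullet> b) * pdiff b g x)"
    by (simp add: pdiff_inner_self sum_distrib_left mult.assoc)
  also have "\<dots> = 2 * (real m * g x)" by (simp only: euler_homogeneous[OF g])
  finally show ?thesis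
    by (subst rlaplacian_mult[OF inner_self_polynomial g(1)])
      (simp add: rlaplacian_inner_self algebra_simps)
qed

lemma homogeneous_mult: "homogeneous k p \<Longrightarrow> homogeneous l q \<Longrightarrow> homogeneous (k + l) (\<lambda>x. p x * q x)"
  by (simp add: homogeneous_def power_add)

lemma homogeneous_lincomb: "homogeneous k p \<Longrightarrow> homogeneous k q \<Longrightarrow> homogeneous k (\<lambda>x. p x + c * q x)"
  by (simp add: homogeneous_def algebra_simps)

lemma homogeneous_zero: "homogeneous k (\<lambda>x. 0)"
  by (simp add: homogeneous_def)

lemma homogeneous_sum: "(\<And>i. i \<in> I \<Longrightarrow> homogeneous k (p i)) \<Longrightarrow> homogeneous k (\<lambda>x. \<Sum>i\<in>I. p i x)"
  by (simp add: homogeneous_def sum_distrib_left)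

lemma homogeneous_inner_self_power: "homogeneous (2 * j) (\<lambda>x::'a::real_inner. (x \<bullet> x) ^ j)"
  by (simp add: homogeneous_def power_mult_distrib power_mult power2_eq_square flip: mult.assoc)

lemma continuous_polynomial: "real_polynomial_function p \<Longrightarrow> continuous_on S p"
  by (simp add: continuous_on_polymonial_function real_polynomial_function_eq)

text \<open>The factor c^2 stays on the left, so that the identity holds for c = 0 and for degrees
  below 2, where k - 2 would be truncated.\<close>

lemma rlaplacian_scaled:
  fixes p :: "'a::euclidean_space \<Rightarrow> real"
  assumes p: "real_polynomial_function p" and hom: "homogeneous k p"
  shows "c\<^sup>2 * rlaplacian p (c *\<^sub>R x) = c ^ k * rlaplacian p x"
proof -
  have 1: "c * pdiff b p (c *\<^sub>R x) = c ^ k * pdiff b p x" for b x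
  proof -
    have "((\<lambda>t. p (c *\<^sub>R x + (c * t) *\<^sub>R b)) has_real_derivative pdiff b p (c *\<^sub>R x) * c) (at 0)"
      by (rule DERIV_chain'[where f="\<lambda>t. c * t" and g="\<lambda>t. p (c *\<^sub>R x + t *\<^sub>R b)"])
        (use pdiff_derivative0[OF p, of "c *\<^sub>R x" b] in \<open>auto intro!: derivative_eq_intros\<close>)
    moreover have "p (c *\<^sub>R x + (c * t) *\<^sub>R b) = c ^ k * p (x + t *\<^sub>R b)" for t
      using hom[unfolded homogeneous_def, rule_format, of c "x + t *\<^sub>R b"] by (simp add: scaleR_right_distrib)
    ultimately have "((\<lambda>t. c ^ k * p (x + t *\<^sub>R b)) has_real_derivative pdiff b p (c *\<^sub>R x) * c) (at 0)" by simp
    moreover have "((\<lambda>t. c ^ k * p (x + t *\<^sub>R b)) has_real_derivative c ^ k * pdiff b p x) (at 0)"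
      by (intro DERIV_cmult pdiff_derivative0 p)
    ultimately have "pdiff b p (c *\<^sub>R x) * c = c ^ k * pdiff b p x" by (rule DERIV_unique)
    then show ?thesis by (simp only: mult.commute)
  qed
  have 2: "c * (c * pdiff b (pdiff b p) (c *\<^sub>R x)) = c ^ k * pdiff b (pdiff b p) x" for b
  proof -
    note pp = pdiff_polynomial[OF p, of b]
    have "((\<lambda>t. c * pdiff b p (c *\<^sub>R x + (c * t) *\<^sub>R b)) has_real_derivative c * (pdiff b (pdiff b p) (c *\<^sub>R x) * c)) (at 0)"
      by (intro DERIV_cmult, rule DERIV_chain'[where f="\<lambda>t. c * t" and g="\<lambda>t. pdiff b p (c *\<^sub>R x + t *\<^sub>R b)"])
        (use pdiff_derivative0[OF pp, of "c *\<^sub>R x" b] in \<open>auto intro!: derivative_eq_intros\<close>)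
    moreover have "c * pdiff b p (c *\<^sub>R x + (c * t) *\<^sub>R b) = c ^ k * pdiff b p (x + t *\<^sub>R b)" for t
      using 1[of b "x + t *\<^sub>R b"] by (simp add: scaleR_right_distrib)
    ultimately have "((\<lambda>t. c ^ k * pdiff b p (x + t *\<^sub>R b)) has_real_derivative c * (pdiff b (pdiff b p) (c *\<^sub>R x) * c)) (at 0)" by simp
    moreover have "((\<lambda>t. c ^ k * pdiff b p (x + t *\<^sub>R b)) has_real_derivative c ^ k * pdiff b (pdiff b p) x) (at 0)"
      by (intro DERIV_cmult pdiff_derivative0 pp)
    ultimately have "c * (pdiff b (pdiff b p) (c *\<^sub>R x) * c) = c ^ k * pdiff b (pdiff b p) x" by (rule DERIV_unique)
    then show ?thesis by (simp only: mult.commute)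
  qed
  have "c\<^sup>2 * rlaplacian p (c *\<^sub>R x) = (\<Sum>b\<in>Basis. c * (c * pdiff b (pdiff b p) (c *\<^sub>R x)))"
    by (simp add: rlaplacian_def sum_distrib_left power2_eq_square mult.assoc)
  also have "\<dots> = c ^ k * rlaplacian p x"
    unfolding 2 by (simp add: rlaplacian_def sum_distrib_left)
  finally show ?thesis .
qed

lemma continuous_eq_at_0:
  fixes f g :: "real \<Rightarrow> real"
  assumes f: "continuous_on UNIV f" and g: "continuous_on UNIV g" and eq: "\<And>c. c \<noteq> 0 \<Longrightarrow> f c = g c"
  shows "f 0 = g 0"
proof -
  have "(f \<longlongrightarrow> f 0) (at 0)" "(g \<longlongrightarrow> g 0) (at 0)"
    using f g by (auto simp: continuous_on_def)
  moreover have "\<forall>\<^sub>F c in at 0. f c = g c"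
    unfolding eventually_at_filter by (simp add: eq)
  ultimately have "(g \<longlongrightarrow> f 0) (at 0)" "(g \<longlongrightarrow> g 0) (at 0)"
    using Lim_transform_eventually by blast+
  then show ?thesis by (rule tendsto_unique[OF at_neq_bot])
qed

text \<open>Division by a power of c settles c different from 0, and continuity fills in c = 0. In
  degree below 2 the same limit c -> 0 forces the Laplacian to vanish.\<close>

lemma rlaplacian_homogeneous:
  fixes p :: "'a::euclidean_space \<Rightarrow> real"
  assumes p: "real_polynomial_function p" and hom: "homogeneous k p"
  shows "k \<ge> 2 \<Longrightarrow> homogeneous (k - 2) (rlaplacian p)" and "k < 2 \<Longrightarrow> rlaplacian p x = 0"
proof -
  have cont: "continuous_on UNIV (\<lambda>c. rlaplacian p (c *\<^sub>R x))" for x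
    by (rule continuous_on_compose2[OF continuous_polynomial[OF rlaplacian_polynomial[OF p], of UNIV]])
      (auto intro!: continuous_intros)
  show "homogeneous (k - 2) (rlaplacian p)" if k: "k \<ge> 2"
    unfolding homogeneous_def
  proof (intro allI)
    fix c x
    have ne: "rlaplacian p (c *\<^sub>R x) = c ^ (k - 2) * rlaplacian p x" if "c \<noteq> 0" for c
    proof -
      have "c ^ k = c\<^sup>2 * c ^ (k - 2)" using k by (metis le_add_diff_inverse power_add)
      then show ?thesis using rlaplacian_scaled[OF p hom, of c x] that by simp
    qed
    have "rlaplacian p (0 *\<^sub>R x) = 0 ^ (k - 2) * rlaplacian p x"
      by (rule continuous_eq_at_0[OF cont _ ne]) (auto intro!: continuous_intros)
    with ne show "rlaplacian p (c *\<^sub>R x) = c ^ (k - 2) * rlaplacian p x" by (cases "c = 0") auto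
  qed
  show "rlaplacian p x = 0" if k: "k < 2"
  proof -
    have "c ^ (2 - k) * rlaplacian p (c *\<^sub>R x) = rlaplacian p x" if "c \<noteq> 0" for c
    proof -
      have "c\<^sup>2 = c ^ k * c ^ (2 - k)" using k by (simp flip: power_add)
      then show ?thesis using rlaplacian_scaled[OF p hom, of c x] that by (simp add: mult.assoc)
    qed
    then have "0 ^ (2 - k) * rlaplacian p (0 *\<^sub>R x) = rlaplacian p x"
      by (intro continuous_eq_at_0[where f="\<lambda>c. c ^ (2 - k) * rlaplacian p (c *\<^sub>R x)" and g="\<lambda>c. rlaplacian p x"])
        (auto intro!: continuous_intros cont)
    moreover have "(0::real) ^ (2 - k) = 0" using k by (subst power_0_left) simp
    ultimately show ?thesis by simp
  qed
qed

section \<open>Real harmonic polynomials and the Fischer decomposition\<close>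

definition rharmonic :: "nat \<Rightarrow> ('a::euclidean_space \<Rightarrow> real) set" where
  "rharmonic k = {h. real_polynomial_function h \<and> homogeneous k h \<and> (\<forall>x. rlaplacian h x = 0)}"

lemma rharmonic_zero: "(\<lambda>x. 0) \<in> rharmonic k"
  by (auto simp: rharmonic_def homogeneous_zero rlaplacian_def pdiff_const_fun intro: rpoly_const)

lemma rharmonic_lincomb: "u \<in> rharmonic k \<Longrightarrow> w \<in> rharmonic k \<Longrightarrow> (\<lambda>x. u x + c * w x) \<in> rharmonic k"
  by (auto simp: rharmonic_def homogeneous_lincomb rlaplacian_lincomb
      intro!: rpoly_add rpoly_mult rpoly_const)

text \<open>Each further factor of the squared norm adds a positive amount to the constant.
  Positivity is the point: the Laplacian can be inverted on such products by division.\<close>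

lemma rlaplacian_radial_power:
  fixes h :: "'a::euclidean_space \<Rightarrow> real"
  assumes h: "h \<in> rharmonic m"
  shows "\<exists>C>0. \<forall>x. rlaplacian (\<lambda>x. (x \<bullet> x) ^ Suc j * h x) x = C * ((x \<bullet> x) ^ j * h x)"
proof -
  have hp: "real_polynomial_function h" "homogeneous m h" "\<And>x. rlaplacian h x = 0"
    using h by (auto simp: rharmonic_def)
  define g where "g j x = (x \<bullet> x) ^ j * h x" for j x
  have g: "real_polynomial_function (g j)" "homogeneous (2 * j + m) (g j)" for j
    unfolding g_def
    by (intro rpoly_mult real_polynomial_function_power inner_self_polynomial hp)
      (intro homogeneous_mult homogeneous_inner_self_power hp)
  have step: "rlaplacian (g (Suc j)) x = (x \<bullet> x) * rlaplacian (g j) x + (4 * real (2 * j + m) + 2 * real DIM('a)) * g j x" for j x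
  proof -
    have "g (Suc j) = (\<lambda>x. (x \<bullet> x) * g j x)" by (simp add: g_def fun_eq_iff mult.assoc)
    then show ?thesis using rlaplacian_inner_self_mult[OF g(1)[of j] g(2)[of j], of x] by (simp only:)
  qed
  have "\<exists>C>0. \<forall>x. rlaplacian (g (Suc j)) x = C * g j x"
  proof (induction j)
    case 0
    have "g 0 = h" by (simp add: g_def fun_eq_iff)
    then show ?case using step[of 0] hp(3)
      by (intro exI[of _ "4 * real m + 2 * real DIM('a)"]) (auto intro: add_nonneg_pos)
  next
    case (Suc j)
    then obtain C where C: "C > 0" "\<And>x. rlaplacian (g (Suc j)) x = C * g j x" by blast
    have "rlaplacian (g (Suc (Suc j))) x = (C + 4 * real (2 * Suc j + m) + 2 * real DIM('a)) * g (Suc j) x" for x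
      unfolding step[of "Suc j"] C(2) by (simp add: g_def algebra_simps)
    moreover have "C + 4 * real (2 * Suc j + m) + 2 * real DIM('a) > 0" using C(1) by (auto intro!: add_pos_nonneg)
    ultimately show ?case by blast
  qed
  then show ?thesis by (simp add: g_def[abs_def])
qed

text \<open>Decompose the Laplacian of p by induction, lift each summand by one factor of the
  squared norm divided by its constant, and obtain q with the same Laplacian as p. Then p - q is
  harmonic and is the new leading term.\<close>

theorem harmonic_decomposition:
  fixes p :: "'a::euclidean_space \<Rightarrow> real"
  assumes "real_polynomial_function p" "homogeneous k p"
  shows "\<exists>h. (\<forall>j. h j \<in> rharmonic (k - 2 * j)) \<and> (\<forall>j. k < 2 * j \<longrightarrow> h j = (\<lambda>x. 0)) \<and>
    (\<forall>x. p x = (\<Sum>j\<le>k. (x \<bullet> x) ^ j * h j x))"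
  using assms
proof (induction k arbitrary: p rule: less_induct)
  case (less k)
  show ?case
  proof (cases "k < 2")
    case True
    define h where "h j = (if j = 0 then p else (\<lambda>x. 0))" for j :: nat
    have "h j \<in> rharmonic (k - 2 * j)" for j
      using less.prems rlaplacian_homogeneous(2)[OF less.prems True] rharmonic_zero
      by (auto simp: h_def rharmonic_def)
    moreover have "(\<Sum>j\<le>k. (x \<bullet> x) ^ j * h j x) = p x" for x
    proof -
      have "(\<Sum>j\<le>k. (x \<bullet> x) ^ j * h j x) = (\<Sum>j\<in>{0}. (x \<bullet> x) ^ j * h j x)"
        by (rule sum.mono_neutral_right) (auto simp: h_def)
      then show ?thesis by (simp add: h_def)
    qed
    ultimately show ?thesis by (intro exI[of _ h]) (auto simp: h_def)
  next
    case False
    then have k: "k \<ge> 2" by simp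
    obtain h where h: "\<And>j. h j \<in> rharmonic (k - 2 - 2 * j)" "\<And>j. k - 2 < 2 * j \<Longrightarrow> h j = (\<lambda>x. 0)"
      "\<And>x. rlaplacian p x = (\<Sum>j\<le>k - 2. (x \<bullet> x) ^ j * h j x)"
      using less.IH[of "k - 2" "rlaplacian p"] k rlaplacian_polynomial[OF less.prems(1)] rlaplacian_homogeneous(1)[OF less.prems k]
      by auto
    obtain C where C: "\<And>j. C j > 0" "\<And>j x. rlaplacian (\<lambda>x. (x \<bullet> x) ^ Suc j * h j x) x = C j * ((x \<bullet> x) ^ j * h j x)"
    proof -
      have "\<forall>j. \<exists>C. C > 0 \<and> (\<forall>x. rlaplacian (\<lambda>x. (x \<bullet> x) ^ Suc j * h j x) x = C * ((x \<bullet> x) ^ j * h j x))"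
        by (rule allI) (rule rlaplacian_radial_power[OF h(1)])
      from choice[OF this] show ?thesis using that by blast
    qed
    define h' where "h' j x = (1 / C j) * h j x" for j x
    have h': "h' j \<in> rharmonic (k - 2 - 2 * j)" for j
      using rharmonic_lincomb[OF rharmonic_zero h(1)[of j], of "1 / C j"] by (simp add: h'_def[abs_def])
    have hp: "real_polynomial_function (h j)" for j using h(1) by (auto simp: rharmonic_def)
    have tp: "real_polynomial_function (\<lambda>x. (x \<bullet> x) ^ Suc j * h j x)" for j
      by (intro rpoly_mult real_polynomial_function_power inner_self_polynomial hp)
    have tp': "real_polynomial_function (\<lambda>x. (x \<bullet> x) ^ Suc j * h' j x)" for j
      using h'[of j] by (intro rpoly_mult real_polynomial_function_power inner_self_polynomial) (auto simp: rharmonic_def)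
    define q where "q x = (\<Sum>j\<le>k - 2. (x \<bullet> x) ^ Suc j * h' j x)" for x
    have qp: "real_polynomial_function q"
      unfolding q_def by (intro real_polynomial_function_sum tp') simp
    have qhom: "homogeneous k q"
      unfolding q_def
    proof (rule homogeneous_sum)
      fix j
      show "homogeneous k (\<lambda>x. (x \<bullet> x) ^ Suc j * h' j x)"
      \<comment> \<open>For these j the truncated subtraction reports degree 0 and homogeneity of
        degree k would fail; such summands are zero by the second clause of the induction
        hypothesis.\<close>
      proof (cases "k - 2 < 2 * j")
        case True
        then show ?thesis using h(2) by (simp add: h'_def homogeneous_zero)
      next
        case False
        then have e: "2 * Suc j + (k - 2 - 2 * j) = k" using k by simp
        have "homogeneous (k - 2 - 2 * j) (h' j)" using h'[of j] by (simp add: rharmonic_def)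
        from homogeneous_mult[OF homogeneous_inner_self_power this, of "Suc j"]
        show ?thesis unfolding e .
      qed
    qed
    have lapq: "rlaplacian q x = rlaplacian p x" for x
    proof -
      have "rlaplacian q x = (\<Sum>j\<le>k - 2. rlaplacian (\<lambda>x. (x \<bullet> x) ^ Suc j * h' j x) x)"
        unfolding q_def by (rule rlaplacian_sum[OF tp']) auto
      also have "\<dots> = (\<Sum>j\<le>k - 2. (x \<bullet> x) ^ j * h j x)"
      proof (rule sum.cong[OF refl])
        fix j
        have "rlaplacian (\<lambda>x. 0 + (1 / C j) * ((x \<bullet> x) ^ Suc j * h j x)) x = rlaplacian (\<lambda>x. 0) x + (1 / C j) * rlaplacian (\<lambda>x. (x \<bullet> x) ^ Suc j * h j x) x"
          by (rule rlaplacian_lincomb[OF rpoly_const tp])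
        also have "\<dots> = (x \<bullet> x) ^ j * h j x"
          using C(1)[of j] unfolding C(2) by (simp add: rlaplacian_def pdiff_const_fun)
        finally show "rlaplacian (\<lambda>x. (x \<bullet> x) ^ Suc j * h' j x) x = (x \<bullet> x) ^ j * h j x"
          by (simp add: h'_def[abs_def] mult.left_commute del: power_Suc)
      qed
      finally show ?thesis by (simp add: h(3))
    qed
    \<comment> \<open>Lifting moves index j to j + 1, which frees index 0 for the harmonic remainder
      p - q.\<close>
    define H where "H j = (case j of 0 \<Rightarrow> (\<lambda>x. p x + (-1) * q x) | Suc j \<Rightarrow> h' j)" for j
    have "H j \<in> rharmonic (k - 2 * j)" for j
    proof (cases j)
      case 0
      have "(\<lambda>x. p x + (-1) * q x) \<in> rharmonic k"
        using less.prems qp qhom rlaplacian_lincomb[OF less.prems(1) qp, of "-1"] lapq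
        unfolding rharmonic_def mem_Collect_eq
        by (intro conjI rpoly_add rpoly_mult rpoly_const homogeneous_lincomb)
          auto
      then show ?thesis using 0 by (simp add: H_def)
    next
      case (Suc i)
      then show ?thesis using h'[of i] by (simp add: H_def algebra_simps)
    qed
    moreover have "H j = (\<lambda>x. 0)" if "k < 2 * j" for j
      using that k h(2)[of "j - 1"] by (cases j) (auto simp: H_def h'_def fun_eq_iff)
    moreover have "p x = (\<Sum>j\<le>k. (x \<bullet> x) ^ j * H j x)" for x
    proof -
      obtain k' where k': "k = Suc k'" using k by (cases k) auto
      have "(\<Sum>j\<le>k. (x \<bullet> x) ^ j * H j x) = (p x - q x) + (\<Sum>j\<le>k'. (x \<bullet> x) ^ Suc j * h' j x)"
        unfolding k' by (subst sum.atMost_Suc_shift) (simp add: H_def)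
      also have "(\<Sum>j\<le>k'. (x \<bullet> x) ^ Suc j * h' j x) = q x"
        unfolding q_def
      proof (rule sum.mono_neutral_right)
        show "\<forall>i\<in>{..k'} - {..k - 2}. (x \<bullet> x) ^ Suc i * h' i x = 0"
          using h(2) by (auto simp: h'_def)
      qed (use k' in auto)
      finally show ?thesis by simp
    qed
    ultimately show ?thesis by (intro exI[of _ H]) blast
  qed
qed

text \<open>Stated for every rate e so that the induction can give e/2 to each factor of a
  product.\<close>

lemma polynomial_exp_bound:
  fixes p :: "'a::euclidean_space \<Rightarrow> real"
  assumes "real_polynomial_function p"
  shows "\<forall>e>0. \<exists>C\<ge>0. \<forall>x. \<bar>p x\<bar> \<le> C * exp (e * (norm x)\<^sup>2)"
  using assms
proof (induction p)
  case (linear f)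
  show ?case
  proof (intro allI impI)
    fix e :: real assume e: "e > 0"
    obtain K where K: "K > 0" "\<And>x. \<bar>f x\<bar> \<le> norm x * K"
      using bounded_linear.pos_bounded[OF linear] by auto
    \<comment> \<open>With M and M e both at least 1, the norm is at most 1 + |x|^2, hence at most M
      (1 + e |x|^2), and so at most M exp(e |x|^2).\<close>
    define M where "M = max 1 (1 / e)"
    have M: "M \<ge> 1" "M * e \<ge> 1" using e by (auto simp: M_def max_def field_simps)
    have "\<bar>f x\<bar> \<le> (K * M) * exp (e * (norm x)\<^sup>2)" for x
    proof -
      have "norm x \<le> 1 + (norm x)\<^sup>2"
        using sum_squares_bound[of 1 "norm x"] norm_ge_zero[of x] unfolding power_one mult_1_right by linarith
      also have "\<dots> \<le> M + (M * e) * (norm x)\<^sup>2"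
        using M(1) mult_right_mono[OF M(2), of "(norm x)\<^sup>2"] by (intro add_mono) simp_all
      also have "\<dots> = M * (1 + e * (norm x)\<^sup>2)" by (simp add: algebra_simps)
      also have "\<dots> \<le> M * exp (e * (norm x)\<^sup>2)" using M by (intro mult_left_mono exp_ge_add_one_self) auto
      finally have n: "norm x \<le> M * exp (e * (norm x)\<^sup>2)" .
      have "\<bar>f x\<bar> \<le> norm x * K" by (rule K(2))
      also have "\<dots> \<le> (M * exp (e * (norm x)\<^sup>2)) * K" using n K(1) by (intro mult_right_mono) auto
      finally show ?thesis by (simp add: mult_ac)
    qed
    then show "\<exists>C\<ge>0. \<forall>x. \<bar>f x\<bar> \<le> C * exp (e * (norm x)\<^sup>2)"
      using K M by (intro exI[of _ "K * M"]) auto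
  qed
next
  case (const c)
  show ?case
  proof (intro allI impI exI[of _ "\<bar>c\<bar>"] conjI)
    fix e :: real and x :: 'a assume "e > 0"
    then have "1 \<le> exp (e * (norm x)\<^sup>2)" by simp
    then show "\<bar>c\<bar> \<le> \<bar>c\<bar> * exp (e * (norm x)\<^sup>2)" using mult_left_mono[of 1 "exp (e * (norm x)\<^sup>2)" "\<bar>c\<bar>"] by simp
  qed simp
next
  case (add f g)
  show ?case
  proof (intro allI impI)
    fix e :: real assume e: "e > 0"
    obtain C D where "C \<ge> 0" "\<And>x. \<bar>f x\<bar> \<le> C * exp (e * (norm x)\<^sup>2)" "D \<ge> 0" "\<And>x. \<bar>g x\<bar> \<le> D * exp (e * (norm x)\<^sup>2)"
      using add.IH e by blast
    then show "\<exists>C\<ge>0. \<forall>x. \<bar>f x + g x\<bar> \<le> C * exp (e * (norm x)\<^sup>2)"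
      by (intro exI[of _ "C + D"]) (auto simp: distrib_right intro!: order_trans[OF abs_triangle_ineq] add_mono)
  qed
next
  case (mult f g)
  show ?case
  proof (intro allI impI)
    fix e :: real assume "e > 0"
    then have e: "e / 2 > 0" by simp
    obtain C where C: "C \<ge> 0" "\<And>x. \<bar>f x\<bar> \<le> C * exp (e / 2 * (norm x)\<^sup>2)" using mult.IH(1) e by blast
    obtain D where D: "D \<ge> 0" "\<And>x. \<bar>g x\<bar> \<le> D * exp (e / 2 * (norm x)\<^sup>2)" using mult.IH(2) e by blast
    have "\<bar>f x * g x\<bar> \<le> (C * D) * exp (e * (norm x)\<^sup>2)" for x
    proof -
      have "\<bar>f x * g x\<bar> \<le> (C * exp (e / 2 * (norm x)\<^sup>2)) * (D * exp (e / 2 * (norm x)\<^sup>2))"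
        unfolding abs_mult using C D by (intro mult_mono) auto
      also have "\<dots> = (C * D) * (exp (e / 2 * (norm x)\<^sup>2) * exp (e / 2 * (norm x)\<^sup>2))" by simp
      also have "exp (e / 2 * (norm x)\<^sup>2) * exp (e / 2 * (norm x)\<^sup>2) = exp (e * (norm x)\<^sup>2)"
        unfolding exp_add[symmetric] by simp
      finally show ?thesis .
    qed
    then show "\<exists>C\<ge>0. \<forall>x. \<bar>f x * g x\<bar> \<le> C * exp (e * (norm x)\<^sup>2)"
      using C D by (intro exI[of _ "C * D"]) auto
  qed
qed

lemma integrable_gaussian:
  assumes a: "a > (0::real)"
  shows "integrable lborel (\<lambda>x::'a::euclidean_space. exp (- a * (norm x)\<^sup>2))"
proof (rule integrableI_nonneg)
  have eq: "exp (- a * (norm x)\<^sup>2) = (\<Prod>b\<in>Basis. exp (- a * (x \<bullet> b)\<^sup>2))" for x :: 'a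
  proof -
    have "(norm x)\<^sup>2 = (\<Sum>b\<in>Basis. (x \<bullet> b)\<^sup>2)"
      unfolding power2_norm_eq_inner euclidean_inner[of x x] by (simp add: power2_eq_square)
    then show ?thesis by (simp add: sum_distrib_left exp_sum[symmetric] flip: sum_negf)
  qed
  have one: "(\<integral>\<^sup>+t. ennreal (exp (- a * (t::real)\<^sup>2)) \<partial>lborel) < \<infinity>"
  proof -
    define \<sigma> where "\<sigma> = sqrt (1 / (2 * a))"
    have \<sigma>: "\<sigma> > 0" "\<sigma>\<^sup>2 = 1 / (2 * a)" using a by (auto simp: \<sigma>_def)
    have "exp (- a * t\<^sup>2) = sqrt (2 * pi * \<sigma>\<^sup>2) * normal_density 0 \<sigma> t" for t
    proof -
      have "- a * t\<^sup>2 = - t\<^sup>2 / (2 * \<sigma>\<^sup>2)" using a by (simp add: \<sigma>(2))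
      then show ?thesis using \<sigma>(1) by (simp add: normal_density_def)
    qed
    then have "integrable lborel (\<lambda>t::real. exp (- a * t\<^sup>2))"
      using integrable_normal_density[OF \<sigma>(1), of 0] by simp
    then show ?thesis by (simp add: integrable_iff_bounded)
  qed
  have "(\<integral>\<^sup>+x. ennreal (exp (- a * (norm (x::'a))\<^sup>2)) \<partial>lborel) = (\<integral>\<^sup>+x. (\<Prod>b\<in>Basis. ennreal (exp (- a * ((x::'a) \<bullet> b)\<^sup>2))) \<partial>lborel)"
    by (subst prod_ennreal) (simp_all only: eq exp_ge_zero)
  also have "\<dots> = (\<Prod>b\<in>(Basis::'a set). (\<integral>\<^sup>+t. ennreal (exp (- a * (t::real)\<^sup>2)) \<partial>lborel))"
    by (rule nn_integral_lborel_prod[where f="\<lambda>b t. ennreal (exp (- a * t\<^sup>2))"]) auto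
  also have "\<dots> < \<infinity>" using one by (simp add: power_less_top_ennreal)
  finally show "(\<integral>\<^sup>+x. ennreal (exp (- a * (norm (x::'a))\<^sup>2)) \<partial>lborel) < \<infinity>" .
qed auto

lemma polynomial_measurable:
  "real_polynomial_function p \<Longrightarrow> (p :: 'a::euclidean_space \<Rightarrow> real) \<in> borel_measurable borel"
  by (intro borel_measurable_continuous_onI continuous_polynomial)

section \<open>Gaussian integration by parts and orthogonality of degrees\<close>

definition gauss_weight :: "'a::real_normed_vector \<Rightarrow> real" where
  "gauss_weight x = exp (- (norm x)\<^sup>2 / 2)"

lemma gauss_weight_measurable [measurable]: "(gauss_weight :: 'a::euclidean_space \<Rightarrow> real) \<in> borel_measurable borel"
  unfolding gauss_weight_def[abs_def] by measurable

lemma integrable_polynomial_gauss: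
  fixes p :: "'a::euclidean_space \<Rightarrow> real"
  assumes p: "real_polynomial_function p"
  shows "integrable lborel (\<lambda>x. p x * gauss_weight x)"
proof -
  \<comment> \<open>The rate 1/4 uses up half of the exponent 1/2 of the weight and leaves an
    integrable Gaussian.\<close>
  obtain C where C: "C \<ge> 0" "\<And>x. \<bar>p x\<bar> \<le> C * exp (1 / 4 * (norm x)\<^sup>2)"
    using polynomial_exp_bound[OF p, rule_format, of "1/4"] by auto
  note [measurable] = polynomial_measurable[OF p]
  show ?thesis
  proof (rule Bochner_Integration.integrable_bound)
    show "integrable lborel (\<lambda>x::'a. C * exp (- (1 / 4) * (norm x)\<^sup>2))"
      by (intro Bochner_Integration.integrable_mult_right integrable_gaussian) simp
    show "AE x in lborel. norm (p x * gauss_weight x) \<le> norm (C * exp (- (1 / 4) * (norm x)\<^sup>2))"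
    proof (rule AE_I2)
      fix x
      have "\<bar>p x\<bar> * gauss_weight x \<le> C * exp (1 / 4 * (norm x)\<^sup>2) * gauss_weight x"
        using C by (intro mult_right_mono) (auto simp: gauss_weight_def)
      also have "\<dots> = C * (exp (1 / 4 * (norm x)\<^sup>2) * gauss_weight x)" by simp
      also have "exp (1 / 4 * (norm x)\<^sup>2) * gauss_weight x = exp (- (1 / 4) * (norm x)\<^sup>2)"
        unfolding gauss_weight_def exp_add[symmetric] by simp
      finally show "norm (p x * gauss_weight x) \<le> norm (C * exp (- (1 / 4) * (norm x)\<^sup>2))"
        using C by (simp add: abs_mult gauss_weight_def)
    qed
  qed measurable
qed

text \<open>Translation invariance replaces the divergence theorem.\<close>

lemma integral_translation_derivative_eq_0:
  fixes h D :: "'a::euclidean_space \<Rightarrow> real"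
  assumes h: "integrable lborel h" and D: "integrable lborel D" "continuous_on UNIV D"
    and deriv: "\<And>x s. ((\<lambda>t. h (x + t *\<^sub>R b)) has_real_derivative D (x + s *\<^sub>R b)) (at s)"
  shows "(\<integral>x. D x \<partial>lborel) = 0"
proof -
  have [measurable]: "D \<in> borel_measurable borel" using D(2) by (rule borel_measurable_continuous_onI)
  have shift: "integrable lborel (\<lambda>x. f (x + c))" "(\<integral>x. f (x + c) \<partial>lborel) = (\<integral>x. f x \<partial>lborel)"
    if f: "integrable lborel f" for f :: "'a \<Rightarrow> real" and c
  proof -
    have [measurable]: "f \<in> borel_measurable borel" using borel_measurable_integrable[OF f] by simp
    have "distr lborel borel ((+) c) = (lborel :: 'a measure)" by (rule lborel_distr_plus)
    then show "integrable lborel (\<lambda>x. f (x + c))" "(\<integral>x. f (x + c) \<partial>lborel) = (\<integral>x. f x \<partial>lborel)"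
      using integrable_distr[of "(+) c" lborel borel f] integral_distr[of "(+) c" lborel borel f] f
      by (simp_all add: add.commute)
  qed
  have I: "integrable (lborel \<Otimes>\<^sub>M lborel) (\<lambda>(t, x). indicator {0..1::real} t * D (x + t *\<^sub>R b))"
  proof (rule lborel_pair.Fubini_integrable)
    have "(\<lambda>x. indicator {0..1} (fst x) * D (snd x + fst x *\<^sub>R b)) \<in> borel_measurable (borel \<Otimes>\<^sub>M borel)"
      by measurable
    then show "(\<lambda>(t, x). indicator {0..1::real} t * D (x + t *\<^sub>R b)) \<in> borel_measurable (lborel \<Otimes>\<^sub>M lborel)"
      by (simp add: case_prod_unfold borel_prod lborel_prod)
    have "(\<integral>y. norm (indicator {0..1} t * D (y + t *\<^sub>R b)) \<partial>lborel) = indicator {0..1} t * (\<integral>x. \<bar>D x\<bar> \<partial>lborel)" for t :: real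
      using shift(2)[OF integrable_norm[OF D(1)], of "t *\<^sub>R b"] by (simp add: abs_mult)
    then show "integrable lborel (\<lambda>t. \<integral>y. norm (case (t, y) of (t, x) \<Rightarrow> indicator {0..1} t * D (x + t *\<^sub>R b)) \<partial>lborel)"
      by simp
    show "AE t in lborel. integrable lborel (\<lambda>y. case (t, y) of (t, x) \<Rightarrow> indicator {0..1} t * D (x + t *\<^sub>R b))"
      using shift(1)[OF D(1)] by simp
  qed
  \<comment> \<open>Averaging D over a unit step in direction b gives a difference of translates of
    h, whose integrals cancel; the average does not change the integral of D.\<close>
  have ftc: "(\<integral>t. indicator {0..1} t * D (x + t *\<^sub>R b) \<partial>lborel) = h (x + b) - h x" for x
  proof -
    have "(\<integral>t. D (x + t *\<^sub>R b) * indicator {0..1} t \<partial>lborel) = h (x + 1 *\<^sub>R b) - h (x + 0 *\<^sub>R b)"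
    proof (rule integral_FTC_Icc_real)
      have "continuous_on UNIV (\<lambda>t. D (x + t *\<^sub>R b))"
        by (rule continuous_on_compose2[OF D(2)]) (auto intro!: continuous_intros)
      then show "isCont (\<lambda>t. D (x + t *\<^sub>R b)) t" for t by (simp add: continuous_on_eq_continuous_at)
    qed (use deriv in auto)
    then show ?thesis by (simp add: mult.commute)
  qed
  have "(\<integral>x. D x \<partial>lborel) = (\<integral>t. indicator {0..1::real} t * (\<integral>x. D x \<partial>lborel) \<partial>lborel)"
    by simp
  also have "\<dots> = (\<integral>t. (\<integral>x. indicator {0..1::real} t * D (x + t *\<^sub>R b) \<partial>lborel) \<partial>lborel)"
    by (intro Bochner_Integration.integral_cong refl) (simp add: shift(2)[OF D(1)])
  also have "\<dots> = (\<integral>x. (\<integral>t. indicator {0..1::real} t * D (x + t *\<^sub>R b) \<partial>lborel) \<partial>lborel)"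
    by (rule lborel_pair.Fubini_integral[OF I, symmetric])
  also have "\<dots> = (\<integral>x. h (x + b) \<partial>lborel) - (\<integral>x. h x \<partial>lborel)"
    unfolding ftc by (intro Bochner_Integration.integral_diff shift(1) h)
  also have "\<dots> = 0" using shift(2)[OF h] by simp
  finally show ?thesis .
qed

lemma gauss_weight_derivative:
  fixes x b :: "'a::euclidean_space"
  shows "((\<lambda>t. gauss_weight (x + t *\<^sub>R b)) has_real_derivative - ((x + s *\<^sub>R b) \<bullet> b) * gauss_weight (x + s *\<^sub>R b)) (at s)"
proof -
  have "((\<lambda>t. exp (- (x \<bullet> x + 2 * t * (x \<bullet> b) + t\<^sup>2 * (b \<bullet> b)) / 2)) has_real_derivative
    - ((x + s *\<^sub>R b) \<bullet> b) * exp (- (x \<bullet> x + 2 * s * (x \<bullet> b) + s\<^sup>2 * (b \<bullet> b)) / 2)) (at s)"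
    by (auto intro!: derivative_eq_intros simp: inner_add_left)
  moreover have "(norm (x + t *\<^sub>R b))\<^sup>2 = x \<bullet> x + 2 * t * (x \<bullet> b) + t\<^sup>2 * (b \<bullet> b)" for t
    unfolding power2_norm_eq_inner
    by (simp add: inner_add_left inner_add_right inner_commute[of b x] power2_eq_square algebra_simps)
  ultimately show ?thesis by (simp add: gauss_weight_def)
qed

lemma gauss_integration_by_parts:
  fixes F :: "'a::euclidean_space \<Rightarrow> real"
  assumes F: "real_polynomial_function F"
  shows "(\<integral>x. (pdiff b F x - (x \<bullet> b) * F x) * gauss_weight x \<partial>lborel) = 0"
proof (rule integral_translation_derivative_eq_0[where h="\<lambda>x. F x * gauss_weight x" and b=b])
  have P: "real_polynomial_function (\<lambda>x. pdiff b F x - (x \<bullet> b) * F x)"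
    by (intro real_polynomial_function_diff pdiff_polynomial F rpoly_mult rpoly_linear bounded_linear_inner_left)
  show "integrable lborel (\<lambda>x. F x * gauss_weight x)" by (rule integrable_polynomial_gauss[OF F])
  show "integrable lborel (\<lambda>x. (pdiff b F x - (x \<bullet> b) * F x) * gauss_weight x)"
    by (rule integrable_polynomial_gauss[OF P])
  show "continuous_on UNIV (\<lambda>x. (pdiff b F x - (x \<bullet> b) * F x) * gauss_weight x)"
    unfolding gauss_weight_def by (intro continuous_on_mult continuous_polynomial[OF P] continuous_intros) auto
  fix x s
  show "((\<lambda>t. F (x + t *\<^sub>R b) * gauss_weight (x + t *\<^sub>R b)) has_real_derivative
    (pdiff b F (x + s *\<^sub>R b) - ((x + s *\<^sub>R b) \<bullet> b) * F (x + s *\<^sub>R b)) * gauss_weight (x + s *\<^sub>R b)) (at s)"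
    by (rule derivative_eq_intros pdiff_derivative[OF F] gauss_weight_derivative refl)+ (simp add: algebra_simps)
qed

text \<open>Integration by parts, harmonicity of p and Euler's identity turn the weighted integral
  of grad p . grad q into k times that of p q. The left side is symmetric, so k and l give the same
  value, which must be 0.\<close>

lemma rharmonic_gauss_orthogonal:
  fixes p q :: "'a::euclidean_space \<Rightarrow> real"
  assumes p: "p \<in> rharmonic k" and q: "q \<in> rharmonic l" and ne: "k \<noteq> l"
  shows "(\<integral>x. p x * q x * gauss_weight x \<partial>lborel) = 0"
proof -
  have *: "(\<integral>x. (\<Sum>b\<in>Basis. pdiff b p x * pdiff b q x) * gauss_weight x \<partial>lborel) = real k * (\<integral>x. p x * q x * gauss_weight x \<partial>lborel)"
    if p: "p \<in> rharmonic k" and q: "q \<in> rharmonic l" for p q :: "'a \<Rightarrow> real" and k l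
  proof -
    have pp: "real_polynomial_function p" "homogeneous k p" "\<And>x. rlaplacian p x = 0" and qp: "real_polynomial_function q"
      using p q by (auto simp: rharmonic_def)
    have F: "real_polynomial_function (\<lambda>x. q x * pdiff b p x)" for b by (intro rpoly_mult pdiff_polynomial pp qp)
    have i: "integrable lborel (\<lambda>x. (pdiff b (\<lambda>x. q x * pdiff b p x) x - (x \<bullet> b) * (q x * pdiff b p x)) * gauss_weight x)" for b
      by (intro integrable_polynomial_gauss real_polynomial_function_diff pdiff_polynomial F rpoly_mult rpoly_linear bounded_linear_inner_left pp qp)
    have "0 = (\<Sum>b\<in>Basis. \<integral>x. (pdiff b (\<lambda>x. q x * pdiff b p x) x - (x \<bullet> b) * (q x * pdiff b p x)) * gauss_weight x \<partial>lborel)"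
      using gauss_integration_by_parts[OF F] by simp
    also have "\<dots> = (\<integral>x. (\<Sum>b\<in>Basis. (pdiff b (\<lambda>x. q x * pdiff b p x) x - (x \<bullet> b) * (q x * pdiff b p x)) * gauss_weight x) \<partial>lborel)"
      by (rule Bochner_Integration.integral_sum[symmetric]) (rule i)
    also have "\<dots> = (\<integral>x. (\<Sum>b\<in>Basis. pdiff b p x * pdiff b q x) * gauss_weight x - real k * (p x * q x * gauss_weight x) \<partial>lborel)"
    proof (rule Bochner_Integration.integral_cong[OF refl])
      fix x
      have "(\<Sum>b\<in>Basis. (pdiff b (\<lambda>x. q x * pdiff b p x) x - (x \<bullet> b) * (q x * pdiff b p x)) * gauss_weight x)
        = (q x * rlaplacian p x + (\<Sum>b\<in>Basis. pdiff b p x * pdiff b q x) - q x * (\<Sum>b\<in>Basis. (x \<bullet> b) * pdiff b p x)) * gauss_weight x"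
        by (simp add: pdiff_mult qp pp pdiff_polynomial rlaplacian_def sum_distrib_left sum_distrib_right sum_subtractf sum.distrib algebra_simps)
      also have "\<dots> = (\<Sum>b\<in>Basis. pdiff b p x * pdiff b q x) * gauss_weight x - real k * (p x * q x * gauss_weight x)"
        unfolding euler_homogeneous[OF pp(1,2)] pp(3) by (simp add: algebra_simps)
      finally show "(\<Sum>b\<in>Basis. (pdiff b (\<lambda>x. q x * pdiff b p x) x - (x \<bullet> b) * (q x * pdiff b p x)) * gauss_weight x)
        = (\<Sum>b\<in>Basis. pdiff b p x * pdiff b q x) * gauss_weight x - real k * (p x * q x * gauss_weight x)" .
    qed
    also have "\<dots> = (\<integral>x. (\<Sum>b\<in>Basis. pdiff b p x * pdiff b q x) * gauss_weight x \<partial>lborel) - real k * (\<integral>x. p x * q x * gauss_weight x \<partial>lborel)"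
      by (subst Bochner_Integration.integral_diff)
        (auto intro!: integrable_polynomial_gauss real_polynomial_function_sum pdiff_polynomial rpoly_mult pp qp)
    finally show ?thesis by simp
  qed
  have "real k * (\<integral>x. p x * q x * gauss_weight x \<partial>lborel) = real l * (\<integral>x. p x * q x * gauss_weight x \<partial>lborel)"
  proof -
    have "(\<integral>x. p x * q x * gauss_weight x \<partial>lborel) = (\<integral>x. q x * p x * gauss_weight x \<partial>lborel)"
      by (simp only: mult.commute[of "p _"])
    moreover have "(\<integral>x. (\<Sum>b\<in>Basis. pdiff b p x * pdiff b q x) * gauss_weight x \<partial>lborel)
      = (\<integral>x. (\<Sum>b\<in>Basis. pdiff b q x * pdiff b p x) * gauss_weight x \<partial>lborel)"
      by (simp only: mult.commute[of "pdiff _ p _"])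
    ultimately show ?thesis using *[OF p q] *[OF q p] by simp
  qed
  then show ?thesis using ne by simp
qed

section \<open>Polar coordinates\<close>

lemma sets_sphere_measure: "sets (sphere_measure :: (real ^ 'n) measure) = sets (restrict_space borel (sphere 0 1))"
  by (simp add: sphere_measure_def)

lemma measurable_sphere_ident: "(\<lambda>x. x) \<in> (sphere_measure :: (real ^ 'n) measure) \<rightarrow>\<^sub>M borel"
proof -
  have "(\<lambda>x. x) \<in> restrict_space borel (sphere (0 :: real ^ 'n) 1) \<rightarrow>\<^sub>M borel"
    by (rule measurable_restrict_space1) simp
  then show ?thesis by (subst measurable_cong_sets[OF sets_sphere_measure refl])
qed

lemma measurable_sphereI: "f \<in> borel_measurable borel \<Longrightarrow> f \<in> borel_measurable (sphere_measure :: (real ^ 'n) measure)"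
  using measurable_compose[OF measurable_sphere_ident] by blast

lemma finite_measure_sphere: "finite_measure (sphere_measure :: (real ^ 'n) measure)"
proof
  have "emeasure sphere_measure (sphere 0 1 :: (real ^ 'n) set)
    = of_nat CARD('n) * emeasure lborel {x \<in> ball 0 1 - {0} :: (real ^ 'n) set. x /\<^sub>R norm x \<in> sphere 0 1}"
    by (rule emeasure_sphere_measure) auto
  moreover have "emeasure lborel {x \<in> ball 0 1 - {0} :: (real ^ 'n) set. x /\<^sub>R norm x \<in> sphere 0 1} \<le> emeasure lborel (ball 0 1 :: (real ^ 'n) set)"
    by (rule emeasure_mono) auto
  moreover have "emeasure lborel (ball 0 1 :: (real ^ 'n) set) < \<infinity>"
    by (rule emeasure_bounded_finite) simp
  ultimately show "emeasure sphere_measure (space (sphere_measure :: (real ^ 'n) measure)) \<noteq> \<infinity>"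
    by (auto simp: space_sphere_measure ennreal_mult_eq_top_iff top_unique)
qed

text \<open>Dilation by R maps the truncated cone of radius 1 onto that of radius R and multiplies
  volume by R^n.\<close>

lemma cone_scaling:
  fixes B :: "(real ^ 'n) set"
  assumes B[measurable]: "B \<in> sets borel" and R: "R > 0"
  shows "emeasure lborel {x. x \<noteq> 0 \<and> norm x < R \<and> x /\<^sub>R norm x \<in> B}
    = ennreal (R ^ CARD('n)) * emeasure lborel {x. x \<noteq> 0 \<and> norm x < 1 \<and> x /\<^sub>R norm x \<in> B}"
proof -
  let ?S = "\<lambda>R. {x::real ^ 'n. x \<noteq> 0 \<and> norm x < R \<and> x /\<^sub>R norm x \<in> B}"
  have [measurable]: "?S R \<in> sets borel" for R by measurable
  have eq: "(\<lambda>x. 0 + R *\<^sub>R x) -` ?S R \<inter> space lborel = ?S 1"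
    using R by (auto simp: field_simps)
  have "emeasure lborel (?S R) = emeasure (density (distr lborel borel (\<lambda>x. 0 + R *\<^sub>R x)) (\<lambda>_. ennreal (\<bar>R\<bar> ^ DIM(real ^ 'n)))) (?S R)"
    using R by (subst lborel_affine[of R 0]) (simp_all add: ennreal_power)
  also have "\<dots> = ennreal (R ^ CARD('n)) * emeasure (distr lborel borel (\<lambda>x. 0 + R *\<^sub>R x)) (?S R)"
    using R by (subst emeasure_density) (auto simp: nn_integral_cmult_indicator)
  also have "emeasure (distr lborel borel (\<lambda>x. 0 + R *\<^sub>R x)) (?S R) = emeasure lborel (?S 1)"
    by (subst emeasure_distr, measurable) (simp only: eq)
  finally show ?thesis .
qed

lemma emeasure_radial_lessThan:
  assumes n: "n \<ge> 1" and R: "R > 0"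
  shows "of_nat n * emeasure (radial_measure n) {..<R} = ennreal (R ^ n)"
proof -
  have "emeasure (radial_measure n) {..<R} = (\<integral>\<^sup>+r. indicator {..<R} r \<partial>radial_measure n)" by simp
  also have "\<dots> = (\<integral>\<^sup>+r. ennreal (r ^ (n - 1) * indicator {0..R} r) \<partial>lborel)"
  proof (subst nn_integral_radial, simp, rule nn_integral_cong_AE)
    show "AE r in lborel. indicator {..<R} r * ennreal (r ^ (n - 1)) * indicator {0<..} r = ennreal (r ^ (n - 1) * indicator {0..R} r)"
      using AE_lborel_singleton[of 0] AE_lborel_singleton[of R]
      by eventually_elim (auto simp: indicator_def)
  qed
  also have "\<dots> = ennreal (R ^ n / real n)"
  proof (subst nn_integral_eq_integral)
    have i: "has_bochner_integral lborel (\<lambda>x. x ^ (n - 1) * indicator {0..R} x) (R ^ n / real n - 0 ^ n / real n)"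
    proof (rule has_bochner_integral_FTC_Icc_real)
      fix x
      show "((\<lambda>x. x ^ n / real n) has_real_derivative x ^ (n - 1)) (at x)"
        using n by (auto intro!: derivative_eq_intros)
    qed (use R in auto)
    then show "integrable lborel (\<lambda>x. x ^ (n - 1) * indicator {0..R} x)"
      "ennreal (\<integral>x. x ^ (n - 1) * indicator {0..R} x \<partial>lborel) = ennreal (R ^ n / real n)"
      using n by (auto simp: has_bochner_integral_iff power_0_left)
  qed (auto simp: indicator_def)
  finally show ?thesis
    using n R by (simp add: ennreal_of_nat_eq_real_of_nat ennreal_mult[symmetric])
qed

lemma emeasure_radial_nonpos:
  assumes "R \<le> 0" shows "emeasure (radial_measure n) {..<R} = 0"
proof -
  have "AE r in radial_measure n. \<not> r < R"
    using AE_radial_pos by eventually_elim (use assms in auto)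
  from emeasure_eq_0_AE[OF this] show ?thesis by (simp add: lessThan_def)
qed

text \<open>It is enough to compare rectangles. For a fixed angular set B both sides are measures in
  the radial set, and on half-lines they agree by scaling of cones.\<close>

lemma polar_pair_measure:
  "radial_measure CARD('n) \<Otimes>\<^sub>M sphere_measure
    = distr (restrict_space lborel (- {0})) (borel \<Otimes>\<^sub>M restrict_space borel (sphere 0 1)) (\<lambda>x :: real ^ 'n. (norm x, x /\<^sub>R norm x))"
  (is "_ = ?N")
proof (rule pair_measure_eqI)
  let ?n = "CARD('n)"
  let ?\<sigma> = "sphere_measure :: (real ^ 'n) measure"
  show "sigma_finite_measure (radial_measure ?n)" by (rule sigma_finite_radial_measure)
  show "sigma_finite_measure ?\<sigma>"
    using finite_measure_sphere by (rule finite_measure.axioms)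
  show "sets (radial_measure ?n \<Otimes>\<^sub>M ?\<sigma>) = sets ?N"
    by (simp add: sets_sphere_measure cong: sets_pair_measure_cong)
  have m: "(\<lambda>x :: real ^ 'n. (norm x, x /\<^sub>R norm x)) \<in> restrict_space lborel (- {0}) \<rightarrow>\<^sub>M borel \<Otimes>\<^sub>M restrict_space borel (sphere 0 1)"
  proof (rule measurable_Pair)
    show "norm \<in> restrict_space lborel (- {0}) \<rightarrow>\<^sub>M borel" by (rule measurable_restrict_space1) simp
    show "(\<lambda>x. x /\<^sub>R norm x) \<in> restrict_space lborel (- {0}) \<rightarrow>\<^sub>M restrict_space borel (sphere 0 1)"
      by (rule measurable_restrict_space3) (auto simp: sphere_def)
  qed
  fix A B assume "A \<in> sets (radial_measure ?n)" and B: "B \<in> sets ?\<sigma>"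
  then have A[measurable]: "A \<in> sets borel" by simp
  have Bs: "B \<subseteq> sphere 0 1" using sets.sets_into_space[OF B] by (simp add: space_sphere_measure)
  obtain B0 where "B0 \<in> sets borel" "B = sphere 0 1 \<inter> B0"
    using B by (auto simp: sets_sphere_measure sets_restrict_space)
  then have B[measurable]: "B \<in> sets borel" by simp
  define C where "C A = {x :: real ^ 'n. x \<noteq> 0 \<and> norm x \<in> A \<and> x /\<^sub>R norm x \<in> B}" for A
  have Cm: "C A \<in> sets borel" if [measurable]: "A \<in> sets borel" for A unfolding C_def by measurable
  have N: "emeasure ?N (A \<times> B) = emeasure lborel (C A)" if "A \<in> sets borel" for A
  proof -
    have AB: "A \<times> B \<in> sets (borel \<Otimes>\<^sub>M restrict_space borel (sphere 0 1))"
      using that B Bs by (intro pair_measureI) (auto simp: sets_restrict_space)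
    have "(\<lambda>x :: real ^ 'n. (norm x, x /\<^sub>R norm x)) -` (A \<times> B) \<inter> space (restrict_space lborel (- {0})) = C A"
      by (auto simp: C_def space_restrict_space)
    then have "emeasure ?N (A \<times> B) = emeasure (restrict_space lborel (- {0})) (C A)"
      by (simp only: emeasure_distr[OF m AB])
    also have "\<dots> = emeasure lborel (C A)"
      by (rule emeasure_restrict_space) (auto simp: C_def)
    finally show ?thesis .
  qed
  have \<sigma>B: "emeasure ?\<sigma> B = of_nat ?n * emeasure lborel {x. x \<noteq> 0 \<and> norm x < 1 \<and> x /\<^sub>R norm x \<in> B}"
  proof -
    have "{x \<in> ball 0 1 - {0}. x /\<^sub>R norm x \<in> B} = {x. x \<noteq> 0 \<and> norm x < 1 \<and> x /\<^sub>R norm x \<in> B}" by auto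
    then show ?thesis using emeasure_sphere_measure[OF B Bs] by (simp only:)
  qed
  have fin: "emeasure lborel {x. x \<noteq> 0 \<and> norm x < 1 \<and> x /\<^sub>R norm x \<in> B} < \<infinity>"
  proof -
    have "emeasure lborel {x. x \<noteq> 0 \<and> norm x < 1 \<and> x /\<^sub>R norm x \<in> B} \<le> emeasure lborel (ball 0 1 :: (real ^ 'n) set)"
      by (rule emeasure_mono) auto
    also have "\<dots> < \<infinity>" by (rule emeasure_bounded_finite) simp
    finally show ?thesis .
  qed
  \<comment> \<open>The two radial measures attached to B: the radial measure weighted by the
    surface of B, and the image under the norm of Lebesgue measure on the full cone over B.\<close>
  let ?M1 = "scale_measure (emeasure ?\<sigma> B) (radial_measure ?n)"
  let ?M2 = "distr (restrict_space lborel {x. x \<noteq> 0 \<and> x /\<^sub>R norm x \<in> B}) borel norm"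
  have S[measurable]: "{x :: real ^ 'n. x \<noteq> 0 \<and> x /\<^sub>R norm x \<in> B} \<in> sets borel" by measurable
  have M2: "emeasure ?M2 A = emeasure lborel (C A)" if "A \<in> sets borel" for A
  proof -
    have "emeasure ?M2 A = emeasure (restrict_space lborel {x. x \<noteq> 0 \<and> x /\<^sub>R norm x \<in> B}) (C A)"
      by (subst emeasure_distr[OF measurable_restrict_space1 that])
        (auto simp: C_def space_restrict_space intro!: arg_cong2[where f=emeasure])
    also have "\<dots> = emeasure lborel (C A)"
      by (rule emeasure_restrict_space) (auto simp: C_def)
    finally show ?thesis .
  qed
  have lt: "emeasure ?M1 {..<R} = emeasure ?M2 {..<R}" for R
  proof (cases "R > 0")
    case True
    have "emeasure ?M1 {..<R} = (of_nat ?n * emeasure (radial_measure ?n) {..<R}) * emeasure lborel {x. x \<noteq> 0 \<and> norm x < 1 \<and> x /\<^sub>R norm x \<in> B}"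
      by (simp add: \<sigma>B mult_ac)
    also have "\<dots> = ennreal (R ^ ?n) * emeasure lborel {x. x \<noteq> 0 \<and> norm x < 1 \<and> x /\<^sub>R norm x \<in> B}"
      by (subst emeasure_radial_lessThan[OF _ True]) (auto simp: Suc_le_eq)
    also have "\<dots> = emeasure ?M2 {..<R}"
      using cone_scaling[OF B True] by (subst M2) (simp_all add: C_def)
    finally show ?thesis .
  next
    case False
    then have "\<not> norm x < R" for x :: "real ^ 'n" using norm_ge_zero[of x] by linarith
    then have "C {..<R} = {}" by (simp add: C_def)
    moreover have "emeasure (radial_measure ?n) {..<R} = 0"
      using False by (intro emeasure_radial_nonpos) simp
    ultimately show ?thesis using M2[of "{..<R}"] by simp
  qed
  have borel: "sets (borel :: real measure) = sigma_sets UNIV (range (\<lambda>a. {..<a}))"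
  proof -
    have "(borel :: real measure) = sigma UNIV (range (\<lambda>a. {..<a}))"
      using borel_eq_lessThan[where 'a=real] unfolding eucl_lessThan .
    then have "sets (borel :: real measure) = sets (sigma UNIV (range (\<lambda>a. {..<a})))" by (rule arg_cong)
    then show ?thesis by (simp add: sets_measure_of)
  qed
  have "?M1 = ?M2"
  proof (rule measure_eqI_generator_eq[where E="range (\<lambda>a::real. {..<a})" and A="\<lambda>i. {..<real i}" and \<Omega>=UNIV])
    show "Int_stable (range (\<lambda>a::real. {..<a}))"
    proof -
      have "{..<a} \<inter> {..<b} = {..<min a b}" for a b :: real by auto
      then show ?thesis by (auto simp: Int_stable_def)
    qed
    show "(\<Union>i. {..<real i}) = UNIV" using reals_Archimedean2 by auto
    show "emeasure ?M1 {..<real i} \<noteq> \<infinity>" for i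
    proof (cases "i > 0")
      case True
      have "emeasure ?M1 {..<real i} = (of_nat ?n * emeasure (radial_measure ?n) {..<real i}) * emeasure lborel {x. x \<noteq> 0 \<and> norm x < 1 \<and> x /\<^sub>R norm x \<in> B}"
        by (simp add: \<sigma>B mult_ac)
      also have "\<dots> = ennreal (real i ^ ?n) * emeasure lborel {x. x \<noteq> 0 \<and> norm x < 1 \<and> x /\<^sub>R norm x \<in> B}"
        by (subst emeasure_radial_lessThan) (use True in \<open>auto simp: Suc_le_eq\<close>)
      also have "\<dots> < \<infinity>" using fin by (simp add: ennreal_mult_less_top)
      finally show ?thesis by simp
    next
      case False
      moreover have "emeasure (radial_measure ?n) {..<0} = 0"
        by (intro emeasure_radial_nonpos) simp
      ultimately show ?thesis by simp
    qed
  qed (use lt borel in \<open>auto\<close>)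
  then have "emeasure ?M1 A = emeasure ?M2 A" by simp
  then show "emeasure (radial_measure ?n) A * emeasure ?\<sigma> B = emeasure ?N (A \<times> B)"
    unfolding M2[OF A] N[OF A] by (simp add: mult.commute)
qed

lemma polar_map_measurable [measurable]:
  "(\<lambda>(r, \<omega>). r *\<^sub>R \<omega>) \<in> borel_measurable (radial_measure k \<Otimes>\<^sub>M (sphere_measure :: (real ^ 'n) measure))"
proof -
  have [measurable]: "snd \<in> borel_measurable (radial_measure k \<Otimes>\<^sub>M (sphere_measure :: (real ^ 'n) measure))"
    by (rule measurable_compose[OF measurable_snd measurable_sphere_ident])
  have [measurable]: "fst \<in> borel_measurable (radial_measure k \<Otimes>\<^sub>M (sphere_measure :: (real ^ 'n) measure))"
    using measurable_fst by (simp cong: measurable_cong_sets)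
  show ?thesis unfolding case_prod_unfold by measurable
qed

text \<open>Away from the origin, a null set, the polar map undoes the decomposition into norm and
  direction.\<close>

lemma lborel_polar:
  "(lborel :: (real ^ 'n) measure) = distr (radial_measure CARD('n) \<Otimes>\<^sub>M sphere_measure) borel (\<lambda>(r, \<omega>). r *\<^sub>R \<omega>)"
proof (rule measure_eqI)
  let ?R = "restrict_space lborel (- {0}) :: (real ^ 'n) measure"
  let ?m = "\<lambda>x :: real ^ 'n. (norm x, x /\<^sub>R norm x)"
  have m: "?m \<in> ?R \<rightarrow>\<^sub>M borel \<Otimes>\<^sub>M restrict_space borel (sphere 0 1)"
  proof (rule measurable_Pair)
    show "norm \<in> restrict_space lborel (- {0}) \<rightarrow>\<^sub>M borel" by (rule measurable_restrict_space1) simp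
    show "(\<lambda>x. x /\<^sub>R norm x) \<in> restrict_space lborel (- {0}) \<rightarrow>\<^sub>M restrict_space borel (sphere 0 1)"
      by (rule measurable_restrict_space3) (auto simp: sphere_def)
  qed
  fix A assume "A \<in> sets (lborel :: (real ^ 'n) measure)"
  then have A[measurable]: "A \<in> sets borel" by simp
  have p: "(\<lambda>(r, \<omega>). r *\<^sub>R \<omega>) \<in> borel \<Otimes>\<^sub>M restrict_space borel (sphere (0 :: real ^ 'n) 1) \<rightarrow>\<^sub>M borel"
    using polar_map_measurable[of "CARD('n)", where 'n='n] sets_sphere_measure[where 'n='n]
    by (simp cong: measurable_cong_sets sets_pair_measure_cong)
  have "emeasure (distr (radial_measure CARD('n) \<Otimes>\<^sub>M sphere_measure) borel (\<lambda>(r, \<omega>). r *\<^sub>R \<omega>)) A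
    = emeasure (distr ?R borel ((\<lambda>(r, \<omega>). r *\<^sub>R \<omega>) \<circ> ?m)) A"
    unfolding polar_pair_measure by (subst distr_distr[OF p m]) simp
  also have "\<dots> = emeasure ?R (A - {0})"
  proof (subst emeasure_distr)
    show "(\<lambda>(r, \<omega>). r *\<^sub>R \<omega>) \<circ> ?m \<in> borel_measurable ?R" using m p by (rule measurable_comp)
    have "((\<lambda>(r, \<omega>). r *\<^sub>R \<omega>) \<circ> ?m) -` A \<inter> space ?R = A - {0}"
      by (auto simp: space_restrict_space)
    then show "emeasure ?R (((\<lambda>(r, \<omega>). r *\<^sub>R \<omega>) \<circ> ?m) -` A \<inter> space ?R) = emeasure ?R (A - {0})" by simp
  qed simp
  also have "\<dots> = emeasure lborel (A - {0})" by (rule emeasure_restrict_space) auto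
  also have "\<dots> = emeasure lborel A"
    by (rule emeasure_Diff_null_set) (auto simp: null_sets_def)
  finally show "emeasure lborel A = emeasure (distr (radial_measure CARD('n) \<Otimes>\<^sub>M sphere_measure) borel (\<lambda>(r, \<omega>). r *\<^sub>R \<omega>)) A" ..
qed simp

lemma polar_compose_measurable:
  fixes f :: "real ^ 'n \<Rightarrow> 'b::topological_space"
  assumes "f \<in> borel_measurable borel"
  shows "(\<lambda>(r, \<omega>). f (r *\<^sub>R \<omega>)) \<in> borel_measurable (radial_measure k \<Otimes>\<^sub>M sphere_measure)"
  using measurable_compose[OF polar_map_measurable assms] by (simp add: case_prod_unfold)

lemma slice_measurable:
  fixes f :: "real ^ 'n \<Rightarrow> 'b::topological_space"
  assumes "f \<in> borel_measurable borel"
  shows "(\<lambda>\<omega>. f (r *\<^sub>R \<omega>)) \<in> borel_measurable sphere_measure"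
  by (rule measurable_sphereI) (use assms in measurable)

lemma nn_integral_polar:
  fixes f :: "real ^ 'n \<Rightarrow> ennreal"
  assumes [measurable]: "f \<in> borel_measurable borel"
  shows "(\<integral>\<^sup>+x. f x \<partial>lborel) = (\<integral>\<^sup>+r. (\<integral>\<^sup>+\<omega>. f (r *\<^sub>R \<omega>) \<partial>sphere_measure) \<partial>radial_measure CARD('n))"
proof -
  interpret finite_measure "sphere_measure :: (real ^ 'n) measure" by (rule finite_measure_sphere)
  have "(\<integral>\<^sup>+x. f x \<partial>lborel) = (\<integral>\<^sup>+z. (case z of (r, \<omega>) \<Rightarrow> f (r *\<^sub>R \<omega>)) \<partial>(radial_measure CARD('n) \<Otimes>\<^sub>M sphere_measure))"
    by (subst lborel_polar, subst nn_integral_distr) (auto simp: case_prod_unfold)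
  also have "\<dots> = (\<integral>\<^sup>+r. (\<integral>\<^sup>+\<omega>. f (r *\<^sub>R \<omega>) \<partial>sphere_measure) \<partial>radial_measure CARD('n))"
    using nn_integral_fst[OF polar_compose_measurable[of f "CARD('n)"]] by simp
  finally show ?thesis .
qed

lemma integral_polar:
  fixes f :: "real ^ 'n \<Rightarrow> real"
  assumes f: "integrable lborel f"
  shows "(\<integral>x. f x \<partial>lborel) = (\<integral>r. (\<integral>\<omega>. f (r *\<^sub>R \<omega>) \<partial>sphere_measure) \<partial>radial_measure CARD('n))"
proof -
  interpret S: finite_measure "sphere_measure :: (real ^ 'n) measure" by (rule finite_measure_sphere)
  interpret R: sigma_finite_measure "radial_measure CARD('n)" by (rule sigma_finite_radial_measure)
  interpret pair_sigma_finite "radial_measure CARD('n)" "sphere_measure :: (real ^ 'n) measure" ..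
  have [measurable]: "f \<in> borel_measurable borel" using borel_measurable_integrable[OF f] by simp
  have i: "integrable (radial_measure CARD('n) \<Otimes>\<^sub>M sphere_measure) (\<lambda>(r, \<omega>). f (r *\<^sub>R \<omega>))"
    using f by (subst (asm) lborel_polar, subst (asm) integrable_distr_eq) (auto simp: case_prod_unfold)
  have "(\<integral>x. f x \<partial>lborel) = (\<integral>z. (case z of (r, \<omega>) \<Rightarrow> f (r *\<^sub>R \<omega>)) \<partial>(radial_measure CARD('n) \<Otimes>\<^sub>M sphere_measure))"
    by (subst lborel_polar, subst integral_distr) (auto simp: case_prod_unfold)
  then show ?thesis using integral_fst'[OF i] by simp
qed

section \<open>An orthonormal basis of spherical harmonics\<close>

lemma continuous_sphere_bounded:
  fixes u :: "real ^ 'n \<Rightarrow> real"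
  assumes "continuous_on UNIV u"
  shows "\<exists>B. \<forall>x\<in>sphere 0 1. \<bar>u x\<bar> \<le> B"
proof -
  have "bounded (u ` sphere 0 1)"
    using assms by (intro compact_imp_bounded compact_continuous_image) (auto intro: continuous_on_subset)
  then show ?thesis unfolding bounded_iff by (auto simp del: abs_le_iff)
qed

lemma continuous_sphere_L2R:
  fixes u :: "real ^ 'n \<Rightarrow> real"
  assumes u: "continuous_on UNIV u"
  shows "u \<in> L2R sphere_measure"
proof -
  interpret finite_measure "sphere_measure :: (real ^ 'n) measure" by (rule finite_measure_sphere)
  have m: "u \<in> borel_measurable sphere_measure"
    by (rule measurable_sphereI) (rule borel_measurable_continuous_onI[OF u])
  obtain B where B: "\<And>x. x \<in> sphere 0 1 \<Longrightarrow> \<bar>u x\<bar> \<le> B" using continuous_sphere_bounded[OF u] by blast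
  have "integrable sphere_measure (\<lambda>x. (u x)\<^sup>2)"
  proof (rule integrable_const_bound[where B="B\<^sup>2"])
    show "AE x in sphere_measure. norm ((u x)\<^sup>2) \<le> B\<^sup>2"
      using B by (intro AE_I2) (auto simp: space_sphere_measure abs_le_square_iff[symmetric] power2_abs[of B] intro!: order_trans[OF _ abs_ge_self])
  qed (use m in measurable)
  with m show ?thesis by (simp add: L2R_iff)
qed

lemma rharmonic_continuous: "u \<in> rharmonic k \<Longrightarrow> continuous_on UNIV u"
  by (auto simp: rharmonic_def intro: continuous_polynomial)

lemma rharmonic_L2R: "u \<in> rharmonic k \<Longrightarrow> u \<in> L2R (sphere_measure :: (real ^ 'n) measure)"
  by (intro continuous_sphere_L2R rharmonic_continuous)

lemma has_bochner_integral_radial_power_gauss: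
  assumes n: "n \<ge> 1"
  shows "has_bochner_integral (radial_measure n) (\<lambda>r. r ^ m * exp (- r\<^sup>2 / 2))
    (Gamma ((real m + real n) / 2) / (2 * (1/2) powr ((real m + real n) / 2)))"
proof (subst has_bochner_integral_radial)
  have "indicator {0<..} r * (r ^ (n - 1) * (r ^ m * exp (- r\<^sup>2 / 2)))
    = indicator {0<..} r * (r powr (2 * ((real m + real n) / 2) - 1) * exp (- (1/2) * r\<^sup>2))" for r :: real
  proof (cases "r > 0")
    case True
    have "r ^ (n - 1) * r ^ m = r powr real ((n - 1) + m)"
      using True by (simp only: powr_realpow power_add)
    also have "real ((n - 1) + m) = 2 * ((real m + real n) / 2) - 1" using n by (simp add: of_nat_diff)
    finally show ?thesis using True by (simp add: mult.assoc[symmetric])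
  qed simp
  note * = this
  show "has_bochner_integral lborel (\<lambda>r. indicator {0<..} r * (r ^ (n - 1) * (r ^ m * exp (- r\<^sup>2 / 2))))
    (Gamma ((real m + real n) / 2) / (2 * (1/2) powr ((real m + real n) / 2)))"
    unfolding * by (rule has_bochner_integral_gauss_moment) (use n in auto)
qed measurable

text \<open>In polar coordinates the Gaussian-weighted integral factors into a strictly positive
  radial integral times the inner product on the sphere; the former can be cancelled.\<close>

lemma rharmonic_orthogonal:
  fixes u w :: "real ^ 'n \<Rightarrow> real"
  assumes u: "u \<in> rharmonic k" and w: "w \<in> rharmonic l" and ne: "k \<noteq> l"
  shows "rip sphere_measure u w = 0"
proof -
  let ?n = "CARD('n)"
  have up: "real_polynomial_function u" "homogeneous k u" and wp: "real_polynomial_function w" "homogeneous l w"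
    using u w by (auto simp: rharmonic_def)
  have n: "?n \<ge> 1" by (simp add: Suc_le_eq)
  have i: "integrable lborel (\<lambda>x. u x * w x * gauss_weight x)"
    by (intro integrable_polynomial_gauss rpoly_mult up wp)
  have "0 = (\<integral>x. u x * w x * gauss_weight x \<partial>lborel)"
    using rharmonic_gauss_orthogonal[OF u w ne] by simp
  also have "\<dots> = (\<integral>r. (\<integral>\<omega>. u (r *\<^sub>R \<omega>) * w (r *\<^sub>R \<omega>) * gauss_weight (r *\<^sub>R \<omega>) \<partial>sphere_measure) \<partial>radial_measure ?n)"
    by (rule integral_polar[OF i])
  also have "\<dots> = (\<integral>r. (r ^ (k + l) * exp (- r\<^sup>2 / 2)) * rip sphere_measure u w \<partial>radial_measure ?n)"
  proof (rule Bochner_Integration.integral_cong[OF refl])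
    fix r
    have "(\<integral>\<omega>. u (r *\<^sub>R \<omega>) * w (r *\<^sub>R \<omega>) * gauss_weight (r *\<^sub>R \<omega>) \<partial>sphere_measure)
      = (\<integral>\<omega>. (r ^ (k + l) * exp (- r\<^sup>2 / 2)) * (u \<omega> * w \<omega>) \<partial>sphere_measure)"
    proof (rule Bochner_Integration.integral_cong[OF refl])
      fix \<omega> :: "real ^ 'n" assume "\<omega> \<in> space sphere_measure"
      then have "norm \<omega> = 1" by (simp add: space_sphere_measure)
      then have "gauss_weight (r *\<^sub>R \<omega>) = exp (- r\<^sup>2 / 2)" by (simp add: gauss_weight_def)
      moreover have "u (r *\<^sub>R \<omega>) = r ^ k * u \<omega>" "w (r *\<^sub>R \<omega>) = r ^ l * w \<omega>"
        using up wp by (auto simp: homogeneous_def)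
      ultimately show "u (r *\<^sub>R \<omega>) * w (r *\<^sub>R \<omega>) * gauss_weight (r *\<^sub>R \<omega>) = (r ^ (k + l) * exp (- r\<^sup>2 / 2)) * (u \<omega> * w \<omega>)"
        by (simp add: power_add)
    qed
    then show "(\<integral>\<omega>. u (r *\<^sub>R \<omega>) * w (r *\<^sub>R \<omega>) * gauss_weight (r *\<^sub>R \<omega>) \<partial>sphere_measure) = (r ^ (k + l) * exp (- r\<^sup>2 / 2)) * rip sphere_measure u w"
      by (simp add: rip_def)
  qed
  also have "\<dots> = (\<integral>r. r ^ (k + l) * exp (- r\<^sup>2 / 2) \<partial>radial_measure ?n) * rip sphere_measure u w"
    by (rule Bochner_Integration.integral_mult_left_zero)
  finally have "(\<integral>r. r ^ (k + l) * exp (- r\<^sup>2 / 2) \<partial>radial_measure ?n) * rip sphere_measure u w = 0" ..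
  moreover have "(\<integral>r. r ^ (k + l) * exp (- r\<^sup>2 / 2) \<partial>radial_measure ?n) > 0"
    using has_bochner_integral_radial_power_gauss[OF n, of "k + l"] n
    by (simp add: has_bochner_integral_iff Gamma_real_pos add_nonneg_pos)
  ultimately show ?thesis by simp
qed

section \<open>Totality of harmonics on the sphere\<close>

definition monomial :: "('n \<Rightarrow> nat) \<Rightarrow> real ^ 'n::finite \<Rightarrow> real" where
  "monomial m x = (\<Prod>i\<in>UNIV. (x $ i) ^ m i)"

lemma component_polynomial: "real_polynomial_function (\<lambda>x::real ^ 'n. x $ i)"
  by (intro rpoly_linear bounded_linear_vec_nth)

lemma monomial_polynomial: "real_polynomial_function (monomial m :: real ^ 'n \<Rightarrow> real)"
  unfolding monomial_def[abs_def] by (intro real_polynomial_function_prod real_polynomial_function_power component_polynomial) simp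

lemma monomial_homogeneous: "homogeneous (\<Sum>i\<in>UNIV. m i) (monomial m)"
  by (simp add: homogeneous_def monomial_def power_mult_distrib prod.distrib power_sum)

lemma monomial_mult_component: "x $ i * monomial m x = monomial (m(i := Suc (m i))) x"
proof -
  have "monomial (m(i := Suc (m i))) x = (x $ i) ^ Suc (m i) * (\<Prod>j\<in>UNIV - {i}. (x $ j) ^ (m(i := Suc (m i))) j)"
    unfolding monomial_def by (subst prod.remove[of UNIV i]) auto
  also have "(\<Prod>j\<in>UNIV - {i}. (x $ j) ^ (m(i := Suc (m i))) j) = (\<Prod>j\<in>UNIV - {i}. (x $ j) ^ m j)"
    by (rule prod.cong) auto
  also have "(x $ i) ^ Suc (m i) * \<dots> = x $ i * monomial m x"
    unfolding monomial_def using prod.remove[of UNIV i "\<lambda>i. (x $ i) ^ m i"] by simp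
  finally show ?thesis ..
qed

text \<open>Polynomials are generated by linear functionals, constants, sums and products, and
  vanishing of coefficients is not preserved by products. The induction therefore runs over the
  multipliers g for which g times every monomial is orthogonal to f: this class is stable under
  multiplication by polynomials.\<close>

lemma monomial_moments_imp_polynomial_moments:
  fixes f :: "real ^ 'n \<Rightarrow> complex" and p :: "real ^ 'n \<Rightarrow> real"
  assumes f: "f \<in> L2 sphere_measure" and zero: "\<And>m. coef sphere_measure (monomial m) f = 0"
    and p: "real_polynomial_function p"
  shows "coef sphere_measure p f = 0"
proof -
  define G where "G = {g. continuous_on UNIV g \<and> (\<forall>m. coef sphere_measure (\<lambda>x. g x * monomial m x) f = 0)}"
  have cm: "continuous_on UNIV (monomial m :: real ^ 'n \<Rightarrow> real)" for m by (rule continuous_polynomial[OF monomial_polynomial])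
  have lin: "coef sphere_measure (\<lambda>x. a x + c * b x) f = coef sphere_measure a f + complex_of_real c * coef sphere_measure b f"
    if "continuous_on UNIV a" "continuous_on UNIV b" for a b c
  proof -
    have "coef sphere_measure (\<lambda>x. a x + c * b x) f = (\<integral>x. f x * complex_of_real (a x) + complex_of_real c * (f x * complex_of_real (b x)) \<partial>sphere_measure)"
      unfolding coef_def by (simp add: algebra_simps)
    also have "\<dots> = coef sphere_measure a f + complex_of_real c * coef sphere_measure b f"
      unfolding coef_def
      by (subst Bochner_Integration.integral_add)
        (auto intro!: coef_integrable f continuous_sphere_L2R that Bochner_Integration.integrable_mult_right)
    finally show ?thesis .
  qed
  have Glin: "(\<lambda>x. a x + c * b x) \<in> G" if "a \<in> G" "b \<in> G" for a b c
  proof -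
    have ab: "continuous_on UNIV a" "continuous_on UNIV b" using that by (auto simp: G_def)
    have "coef sphere_measure (\<lambda>x. (a x + c * b x) * monomial m x) f = 0" for m
    proof -
      have "(\<lambda>x. (a x + c * b x) * monomial m x) = (\<lambda>x. a x * monomial m x + c * (b x * monomial m x))"
        by (simp add: fun_eq_iff algebra_simps)
      then show ?thesis
        using lin[OF continuous_on_mult[OF ab(1) cm[of m]] continuous_on_mult[OF ab(2) cm[of m]], of c] that by (simp add: G_def)
    qed
    then show ?thesis using ab by (auto simp: G_def intro!: continuous_intros)
  qed
  have G0: "(\<lambda>x. 0) \<in> G" by (simp add: G_def coef_def)
  have comp: "(\<lambda>x. x $ i * g x) \<in> G" if g: "g \<in> G" for g i
  proof -
    have "coef sphere_measure (\<lambda>x. (x $ i * g x) * monomial m x) f = 0" for m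
    proof -
      have "(\<lambda>x. (x $ i * g x) * monomial m x) = (\<lambda>x. g x * monomial (m(i := Suc (m i))) x)"
        by (simp add: fun_eq_iff monomial_mult_component[symmetric] mult_ac)
      then show ?thesis using g by (simp add: G_def)
    qed
    then show ?thesis using g by (auto simp: G_def intro!: continuous_intros)
  qed
  have "\<forall>g\<in>G. (\<lambda>x. p x * g x) \<in> G"
    using p
  proof (induction p)
    case (linear h)
    interpret h: bounded_linear h by (rule linear)
    show ?case
    proof
      fix g assume g: "g \<in> G"
      have "(\<lambda>x. \<Sum>i\<in>I. h (axis i 1) * (x $ i * g x)) \<in> G" if "finite I" for I
        using that
      proof (induction I)
        case (insert i I)
        then show ?case using Glin[OF insert.IH comp[OF g, of i], of "h (axis i 1)"] by (simp add: add.commute)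
      qed (simp add: G0)
      then have "(\<lambda>x. \<Sum>i\<in>UNIV. h (axis i 1) * (x $ i * g x)) \<in> G" by simp
      moreover have "h x * g x = (\<Sum>i\<in>UNIV. h (axis i 1) * (x $ i * g x))" for x
      proof -
        have "h x = h (\<Sum>i\<in>UNIV. (x $ i) *\<^sub>R axis i 1)"
          using basis_expansion[of x] by (simp add: scalar_mult_eq_scaleR)
        also have "\<dots> = (\<Sum>i\<in>UNIV. x $ i * h (axis i 1))" by (simp add: h.sum h.scaleR)
        finally show ?thesis by (simp add: sum_distrib_left sum_distrib_right mult_ac)
      qed
      ultimately show "(\<lambda>x. h x * g x) \<in> G" by simp
    qed
  next
    case (const c)
    show ?case
    proof
      fix g assume "g \<in> G"
      from Glin[OF G0 this, of c] show "(\<lambda>x. c * g x) \<in> G" by simp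
    qed
  next
    case (add p q)
    show ?case
    proof
      fix g assume "g \<in> G"
      with add have "(\<lambda>x. p x * g x) \<in> G" "(\<lambda>x. q x * g x) \<in> G" by auto
      from Glin[OF this, of 1] show "(\<lambda>x. (p x + q x) * g x) \<in> G" by (simp add: distrib_right)
    qed
  next
    case (mult p q)
    show ?case
    proof
      fix g assume "g \<in> G"
      with mult.IH(2) have "(\<lambda>x. q x * g x) \<in> G" by (rule bspec)
      with mult.IH(1) have "(\<lambda>x. p x * (q x * g x)) \<in> G" by (rule bspec)
      then show "(\<lambda>x. (p x * q x) * g x) \<in> G" by (simp add: mult.assoc)
    qed
  qed
  moreover have "(\<lambda>x. 1) \<in> G" using zero by (simp add: G_def)
  ultimately have "(\<lambda>x. p x * 1) \<in> G" by (rule bspec)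
  then have "coef sphere_measure (\<lambda>x. p x * 1 * monomial (\<lambda>i. 0) x) f = 0" by (simp add: G_def)
  then show ?thesis by (simp add: monomial_def)
qed

lemma sphere_moments_unique:
  fixes f :: "real ^ 'n \<Rightarrow> complex"
  assumes f: "f \<in> L2 sphere_measure" and zero: "\<And>p. real_polynomial_function p \<Longrightarrow> coef sphere_measure p f = 0"
  shows "AE x in sphere_measure. f x = 0"
proof (rule AE_eq_0_if_moments_eq_0[where T="\<lambda>x. x" and K="sphere 0 1"])
  show "integrable sphere_measure f"
    using coef_integrable[OF f continuous_sphere_L2R[OF continuous_on_const[of _ 1]]] by simp
  show "(\<lambda>x. x) \<in> borel_measurable sphere_measure" by (rule measurable_sphere_ident)
  show "x \<in> sphere 0 1" if "x \<in> space sphere_measure" for x :: "real ^ 'n" using that by (simp add: space_sphere_measure)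
  show "(\<integral>x. f x * complex_of_real (p x) \<partial>sphere_measure) = 0" if "real_polynomial_function p" for p
    using zero[OF that] by (simp add: coef_def)
  fix A :: "(real ^ 'n) set" assume "A \<in> sets sphere_measure"
  then obtain B where B: "B \<in> sets borel" "A = sphere 0 1 \<inter> B" by (auto simp: sets_sphere_measure sets_restrict_space)
  then have "AE x in sphere_measure. x \<in> A \<longleftrightarrow> x \<in> B" by (intro AE_I2) (auto simp: space_sphere_measure)
  then show "\<exists>B\<in>sets borel. AE x in sphere_measure. x \<in> A \<longleftrightarrow> x \<in> B" using B by blast
qed simp

definition sphere_basis :: "(nat \<Rightarrow> nat) \<Rightarrow> (nat \<Rightarrow> real ^ 'n \<Rightarrow> real) \<Rightarrow> bool" where
  "sphere_basis dg Y \<longleftrightarrow> orthonormal_or_zero sphere_measure Y \<and> (\<forall>i. Y i \<in> rharmonic (dg i)) \<and>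
     (\<forall>h\<in>L2 sphere_measure. (\<forall>i. coef sphere_measure (Y i) h = 0) \<longrightarrow> (AE x in sphere_measure. h x = 0))"

text \<open>On the sphere the powers of x . x are 1, so every monomial is a sum of its harmonic
  parts. These parts form a countable family indexed by pairs (m, j); Gram-Schmidt keeps their
  degrees since different degrees are already orthogonal.\<close>

theorem sphere_basis_exists: "\<exists>dg Y. sphere_basis dg (Y :: nat \<Rightarrow> real ^ 'n \<Rightarrow> real)"
proof -
  have "\<forall>m. \<exists>h. (\<forall>j. h j \<in> rharmonic ((\<Sum>i\<in>UNIV. m i) - 2 * j)) \<and>
    (\<forall>x :: real ^ 'n. monomial m x = (\<Sum>j\<le>\<Sum>i\<in>UNIV. m i. (x \<bullet> x) ^ j * h j x))"
    using harmonic_decomposition[OF monomial_polynomial monomial_homogeneous] by blast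
  then obtain H where H: "\<And>m j. H m j \<in> rharmonic ((\<Sum>i\<in>UNIV. m i) - 2 * j)"
    "\<And>m x. monomial m (x :: real ^ 'n) = (\<Sum>j\<le>\<Sum>i\<in>UNIV. m i. (x \<bullet> x) ^ j * H m j x)" by metis
  define g where "g i = (case from_nat i of (m, j) \<Rightarrow> H m j)" for i :: nat
  define dg where "dg i = (case from_nat i :: ('n \<Rightarrow> nat) \<times> nat of (m, j) \<Rightarrow> (\<Sum>i\<in>UNIV. m i) - 2 * j)" for i :: nat
  have gV: "g i \<in> rharmonic (dg i)" for i
    using H(1) by (simp add: g_def dg_def split: prod.split)
  have gL: "g i \<in> L2R sphere_measure" for i by (rule rharmonic_L2R[OF gV])
  define Y where "Y = gram_schmidt sphere_measure g"
  have "orthonormal_or_zero sphere_measure Y" unfolding Y_def by (rule gram_schmidt_orthonormal[OF gL])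
  moreover have "Y i \<in> rharmonic (dg i)" for i
    unfolding Y_def
    by (rule gram_schmidt_graded[where V=rharmonic and deg=dg, OF gV rharmonic_zero rharmonic_lincomb rharmonic_orthogonal])
  moreover have "AE x in sphere_measure. h x = 0"
    if h: "h \<in> L2 sphere_measure" "\<And>i. coef sphere_measure (Y i) h = 0" for h
  proof (rule sphere_moments_unique[OF h(1)], rule monomial_moments_imp_polynomial_moments[OF h(1)])
    have cH: "coef sphere_measure (H m j) h = 0" for m j
    proof -
      have "g (to_nat (m, j)) = H m j" by (simp add: g_def)
      then show ?thesis using gram_schmidt_total[of g sphere_measure h "to_nat (m, j)"] gL h by (simp add: Y_def)
    qed
    fix m :: "'n \<Rightarrow> nat"
    have "coef sphere_measure (monomial m) h = (\<integral>x. (\<Sum>j\<le>\<Sum>i\<in>UNIV. m i. h x * complex_of_real (H m j x)) \<partial>sphere_measure)"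
      unfolding coef_def
    proof (rule Bochner_Integration.integral_cong[OF refl])
      fix x :: "real ^ 'n" assume "x \<in> space sphere_measure"
      then have "x \<bullet> x = 1" by (simp add: space_sphere_measure power2_norm_eq_inner[symmetric])
      then show "h x * complex_of_real (monomial m x) = (\<Sum>j\<le>\<Sum>i\<in>UNIV. m i. h x * complex_of_real (H m j x))"
        unfolding H(2) by (simp add: sum_distrib_left)
    qed
    also have "\<dots> = (\<Sum>j\<le>\<Sum>i\<in>UNIV. m i. coef sphere_measure (H m j) h)"
      unfolding coef_def
      by (rule Bochner_Integration.integral_sum) (intro coef_integrable h rharmonic_L2R[OF H(1)])
    finally show "coef sphere_measure (monomial m) h = 0" by (simp add: cH)
  qed
  ultimately show ?thesis unfolding sphere_basis_def by blast
qed

lemma coef_slice_measurable [measurable]: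
  fixes f :: "real ^ 'n \<Rightarrow> complex"
  assumes [measurable]: "f \<in> borel_measurable borel" "u \<in> borel_measurable borel"
  shows "(\<lambda>r. coef sphere_measure u (\<lambda>\<omega>. f (r *\<^sub>R \<omega>))) \<in> borel_measurable borel"
proof -
  interpret finite_measure "sphere_measure :: (real ^ 'n) measure" by (rule finite_measure_sphere)
  have "(\<lambda>(r, \<omega>). f (r *\<^sub>R \<omega>) * complex_of_real (u \<omega>)) \<in> borel_measurable (radial_measure 1 \<Otimes>\<^sub>M sphere_measure)"
  proof -
    have [measurable]: "(\<lambda>z. f (fst z *\<^sub>R snd z)) \<in> borel_measurable (radial_measure 1 \<Otimes>\<^sub>M (sphere_measure :: (real ^ 'n) measure))"
      using polar_compose_measurable[OF assms(1), of 1] by (simp add: case_prod_unfold)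
    have [measurable]: "(\<lambda>z. u (snd z)) \<in> borel_measurable (radial_measure 1 \<Otimes>\<^sub>M (sphere_measure :: (real ^ 'n) measure))"
      by (rule measurable_compose[OF measurable_snd measurable_sphereI[OF assms(2)]])
    show ?thesis unfolding case_prod_unfold by measurable
  qed
  from borel_measurable_lebesgue_integral[OF this] show ?thesis
    by (simp add: coef_def cong: measurable_cong_sets)
qed

text \<open>Parseval on almost every sphere, integrated over the radius. A radial weight is constant
  on spheres and passes through.\<close>

lemma polar_parseval:
  fixes f :: "real ^ 'n \<Rightarrow> complex" and v :: "real \<Rightarrow> ennreal"
  assumes Y: "sphere_basis dg Y" and f: "f \<in> L2 lborel" and [measurable]: "v \<in> borel_measurable borel"
  shows "(\<integral>\<^sup>+x. v (norm x) * ennreal ((cmod (f x))\<^sup>2) \<partial>lborel)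
    = (\<Sum>i. \<integral>\<^sup>+r. v r * ennreal ((cmod (coef sphere_measure (Y i) (\<lambda>\<omega>. f (r *\<^sub>R \<omega>))))\<^sup>2) \<partial>radial_measure CARD('n))"
    and "AE r in radial_measure CARD('n). (\<lambda>\<omega>. f (r *\<^sub>R \<omega>)) \<in> L2 sphere_measure"
proof -
  interpret finite_measure "sphere_measure :: (real ^ 'n) measure" by (rule finite_measure_sphere)
  let ?M = "radial_measure CARD('n)"
  have [measurable]: "f \<in> borel_measurable borel" using L2_measurable[OF f] by simp
  have Yc: "continuous_on UNIV (Y i)" for i
    using Y by (auto simp: sphere_basis_def intro: rharmonic_continuous)
  have [measurable]: "Y i \<in> borel_measurable borel" for i
    using Yc by (rule borel_measurable_continuous_onI)
  have sm: "(\<lambda>\<omega>. f (r *\<^sub>R \<omega>)) \<in> borel_measurable sphere_measure" for r by (rule slice_measurable) measurable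
  have "nsq lborel f = (\<integral>\<^sup>+r. nsq sphere_measure (\<lambda>\<omega>. f (r *\<^sub>R \<omega>)) \<partial>?M)"
    unfolding nsq_def by (rule nn_integral_polar) measurable
  then have fin: "(\<integral>\<^sup>+r. nsq sphere_measure (\<lambda>\<omega>. f (r *\<^sub>R \<omega>)) \<partial>?M) < \<infinity>"
    using f by (simp add: L2_iff_nsq)
  have nm: "(\<lambda>r. nsq sphere_measure (\<lambda>\<omega>. f (r *\<^sub>R \<omega>))) \<in> borel_measurable ?M"
  proof -
    have "(\<lambda>(r, \<omega>). ennreal ((cmod (f (r *\<^sub>R \<omega>)))\<^sup>2)) \<in> borel_measurable (?M \<Otimes>\<^sub>M sphere_measure)"
      by (rule polar_compose_measurable) measurable
    from borel_measurable_nn_integral[OF this] show ?thesis by (simp add: nsq_def)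
  qed
  have "AE r in ?M. nsq sphere_measure (\<lambda>\<omega>. f (r *\<^sub>R \<omega>)) \<noteq> \<infinity>"
    using nm fin by (intro nn_integral_PInf_AE) auto
  then show AE: "AE r in ?M. (\<lambda>\<omega>. f (r *\<^sub>R \<omega>)) \<in> L2 sphere_measure"
    by eventually_elim (simp add: L2_iff_nsq sm top.not_eq_extremum)
  have "(\<integral>\<^sup>+x. v (norm x) * ennreal ((cmod (f x))\<^sup>2) \<partial>lborel)
    = (\<integral>\<^sup>+r. (\<integral>\<^sup>+\<omega>. v (norm (r *\<^sub>R \<omega>)) * ennreal ((cmod (f (r *\<^sub>R \<omega>)))\<^sup>2) \<partial>sphere_measure) \<partial>?M)"
    by (rule nn_integral_polar) measurable
  also have "\<dots> = (\<integral>\<^sup>+r. (\<Sum>i. v r * ennreal ((cmod (coef sphere_measure (Y i) (\<lambda>\<omega>. f (r *\<^sub>R \<omega>))))\<^sup>2)) \<partial>?M)"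
  proof (rule nn_integral_cong_AE, use AE AE_radial_pos[of "CARD('n)"] in eventually_elim)
    case (elim r)
    have "(\<integral>\<^sup>+\<omega>. v (norm (r *\<^sub>R \<omega>)) * ennreal ((cmod (f (r *\<^sub>R \<omega>)))\<^sup>2) \<partial>sphere_measure)
      = (\<integral>\<^sup>+\<omega>. v r * ennreal ((cmod (f (r *\<^sub>R \<omega>)))\<^sup>2) \<partial>sphere_measure)"
      using elim(2) by (intro nn_integral_cong) (auto simp: space_sphere_measure)
    also have "\<dots> = v r * nsq sphere_measure (\<lambda>\<omega>. f (r *\<^sub>R \<omega>))"
      unfolding nsq_def using sm by (intro nn_integral_cmult) measurable
    also have "nsq sphere_measure (\<lambda>\<omega>. f (r *\<^sub>R \<omega>)) = (\<Sum>i. ennreal ((cmod (coef sphere_measure (Y i) (\<lambda>\<omega>. f (r *\<^sub>R \<omega>))))\<^sup>2))"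
      using Y by (intro parseval(3)[OF _ elim(1)]) (auto simp: sphere_basis_def)
    finally show ?case by simp
  qed
  also have "\<dots> = (\<Sum>i. \<integral>\<^sup>+r. v r * ennreal ((cmod (coef sphere_measure (Y i) (\<lambda>\<omega>. f (r *\<^sub>R \<omega>))))\<^sup>2) \<partial>?M)"
    by (rule nn_integral_suminf) measurable
  finally show "(\<integral>\<^sup>+x. v (norm x) * ennreal ((cmod (f x))\<^sup>2) \<partial>lborel)
    = (\<Sum>i. \<integral>\<^sup>+r. v r * ennreal ((cmod (coef sphere_measure (Y i) (\<lambda>\<omega>. f (r *\<^sub>R \<omega>))))\<^sup>2) \<partial>?M)" .
qed

section \<open>Complex harmonics in terms of real ones\<close>

lemma has_vector_derivative_Complex:
  assumes "(f has_real_derivative f') (at s)" "(g has_real_derivative g') (at s)"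
  shows "((\<lambda>t. Complex (f t) (g t)) has_vector_derivative Complex f' g') (at s)"
  unfolding Complex_eq using assms
  by (intro has_vector_derivative_add has_vector_derivative_mult_right has_vector_derivative_of_real)
    (simp_all add: has_real_derivative_iff_has_vector_derivative)

lemma laplacian_Complex:
  fixes u v :: "real ^ 'n \<Rightarrow> real"
  assumes u: "real_polynomial_function u" and v: "real_polynomial_function v"
  shows "laplacian (\<lambda>x. Complex (u x) (v x)) x = Complex (rlaplacian u x) (rlaplacian v x)"
proof -
  have 1: "vector_derivative (\<lambda>t. Complex (u (x + t *\<^sub>R b)) (v (x + t *\<^sub>R b))) (at s)
    = Complex (pdiff b u (x + s *\<^sub>R b)) (pdiff b v (x + s *\<^sub>R b))" for b s
    by (intro vector_derivative_at has_vector_derivative_Complex pdiff_derivative u v)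
  have "vector_derivative (\<lambda>s. Complex (pdiff b u (x + s *\<^sub>R b)) (pdiff b v (x + s *\<^sub>R b))) (at 0)
    = Complex (pdiff b (pdiff b u) x) (pdiff b (pdiff b v) x)" for b
    by (intro vector_derivative_at has_vector_derivative_Complex pdiff_derivative0 pdiff_polynomial u v)
  then show ?thesis
    unfolding laplacian_def 1 by (simp add: rlaplacian_def complex_eq_iff)
qed

lemma spherical_harmonic_Complex:
  fixes u v :: "real ^ 'n \<Rightarrow> real"
  assumes u: "u \<in> rharmonic l" and v: "v \<in> rharmonic l"
  shows "spherical_harmonic l (\<lambda>x. Complex (u x) (v x))"
  unfolding spherical_harmonic_def solid_harmonic_def
proof (intro exI[of _ "\<lambda>x. Complex (u x) (v x)"] conjI allI ballI refl)
  have uv: "real_polynomial_function u" "real_polynomial_function v" using u v by (auto simp: rharmonic_def)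
  show "polynomial_function (\<lambda>x. Complex (u x) (v x))"
    unfolding polynomial_function_def
  proof (intro allI impI)
    fix f :: "complex \<Rightarrow> real" assume "bounded_linear f"
    then interpret f: bounded_linear f .
    have "Complex a b = a *\<^sub>R 1 + b *\<^sub>R \<i>" for a b by (simp add: complex_eq_iff)
    then have "f \<circ> (\<lambda>x. Complex (u x) (v x)) = (\<lambda>x. u x * f 1 + v x * f \<i>)"
      by (simp add: fun_eq_iff f.add f.scaleR)
    then show "real_polynomial_function (f \<circ> (\<lambda>x. Complex (u x) (v x)))"
      using uv by (auto intro!: rpoly_add rpoly_mult rpoly_const)
  qed
  show "laplacian (\<lambda>x. Complex (u x) (v x)) x = 0" for x
    using u v by (subst laplacian_Complex[OF uv]) (simp add: rharmonic_def complex_eq_iff)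
  show "Complex (u (c *\<^sub>R x)) (v (c *\<^sub>R x)) = c ^ l *\<^sub>R Complex (u x) (v x)" for c x
    using u v by (simp add: rharmonic_def homogeneous_def complex_eq_iff)
qed

lemma spherical_harmonic_cases:
  fixes Z :: "real ^ 'n \<Rightarrow> complex"
  assumes "spherical_harmonic l Z"
  obtains u v where "u \<in> rharmonic l" "v \<in> rharmonic l" "\<And>\<omega>. \<omega> \<in> sphere 0 1 \<Longrightarrow> Z \<omega> = Complex (u \<omega>) (v \<omega>)"
proof -
  obtain p where p: "polynomial_function p" "\<And>c x. p (c *\<^sub>R x) = c ^ l *\<^sub>R p x" "\<And>x. laplacian p x = 0"
    "\<And>\<omega>. \<omega> \<in> sphere 0 1 \<Longrightarrow> Z \<omega> = p \<omega>"
    using assms by (auto simp: spherical_harmonic_def solid_harmonic_def)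
  have r: "real_polynomial_function (\<lambda>x. Re (p x))" "real_polynomial_function (\<lambda>x. Im (p x))"
    using p(1) bounded_linear_Re bounded_linear_Im by (auto simp: polynomial_function_def o_def)
  have "laplacian p x = Complex (rlaplacian (\<lambda>x. Re (p x)) x) (rlaplacian (\<lambda>x. Im (p x)) x)" for x
    using laplacian_Complex[OF r, of x] by simp
  then have "rlaplacian (\<lambda>x. Re (p x)) x = 0" "rlaplacian (\<lambda>x. Im (p x)) x = 0" for x
    using p(3)[of x] by (auto simp: complex_eq_iff)
  then have "(\<lambda>x. Re (p x)) \<in> rharmonic l" "(\<lambda>x. Im (p x)) \<in> rharmonic l"
    using r p(2) by (auto simp: rharmonic_def homogeneous_def)
  then show ?thesis using that[of "\<lambda>x. Re (p x)" "\<lambda>x. Im (p x)"] p(4) by simp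
qed

section \<open>The estimate on the core\<close>

text \<open>The substitution s = \<rho> r extracts all dependence on \<rho> as a power and leaves
  the Bessel integral.\<close>

lemma nn_integral_hankel_kernel_weighted:
  assumes n: "n \<ge> 1" and \<nu>: "\<nu> \<ge> 0" and \<mu>: "0 < \<mu>" "\<mu> < 2 * \<nu> + 1" and \<rho>: "\<rho> > 0"
  shows "(\<integral>\<^sup>+r. ennreal (r powr (- 1 - \<mu>)) * ennreal ((hankel_kernel n \<nu> \<rho> r)\<^sup>2) \<partial>radial_measure n)
    = ennreal (bessel_const \<mu> \<nu> * \<rho> powr (\<mu> - 1 - 2 * lam n))"
proof -
  have "(\<integral>\<^sup>+r. ennreal (r powr (- 1 - \<mu>)) * ennreal ((hankel_kernel n \<nu> \<rho> r)\<^sup>2) \<partial>radial_measure n)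
    = (\<integral>\<^sup>+r. ennreal (\<rho> powr (\<mu> - 1 - 2 * lam n)) * (ennreal ((\<rho> * r powr 1) powr (- \<mu>) * (Bessel_J \<nu> (\<rho> * r powr 1))\<^sup>2) *
        ennreal (\<rho> * \<bar>1\<bar> * r powr (1 - 1)) * indicator {0<..} r) \<partial>lborel)"
  proof (subst nn_integral_radial, measurable, rule nn_integral_cong)
    fix r :: real
    show "ennreal (r powr (- 1 - \<mu>)) * ennreal ((hankel_kernel n \<nu> \<rho> r)\<^sup>2) * ennreal (r ^ (n - 1)) * indicator {0<..} r
      = ennreal (\<rho> powr (\<mu> - 1 - 2 * lam n)) * (ennreal ((\<rho> * r powr 1) powr (- \<mu>) * (Bessel_J \<nu> (\<rho> * r powr 1))\<^sup>2) *
        ennreal (\<rho> * \<bar>1\<bar> * r powr (1 - 1)) * indicator {0<..} r)"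
    proof (cases "r > 0")
      case True
      have 1: "((\<rho> * r) powr (- lam n))\<^sup>2 = \<rho> powr (- 2 * lam n) * r powr (- 2 * lam n)"
        using True \<rho> by (simp add: powr_mult power_mult_distrib powr_power)
      have 2: "r powr (- 1 - \<mu>) * r powr (- 2 * lam n) * r powr (2 * lam n + 1) = r powr (- \<mu>)"
        by (simp add: powr_add[symmetric])
      have 3: "\<rho> powr (\<mu> - 1 - 2 * lam n) * \<rho> powr (- \<mu>) * \<rho> = \<rho> powr (- 2 * lam n)"
      proof -
        have "\<rho> powr (\<mu> - 1 - 2 * lam n) * \<rho> powr (- \<mu>) * \<rho> powr 1 = \<rho> powr (- 2 * lam n)"
          unfolding powr_add[symmetric] by simp
        then show ?thesis using \<rho> by simp
      qed
      have "r powr (- 1 - \<mu>) * (hankel_kernel n \<nu> \<rho> r)\<^sup>2 * r ^ (n - 1)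
        = (r powr (- 1 - \<mu>) * r powr (- 2 * lam n) * r powr (2 * lam n + 1)) * \<rho> powr (- 2 * lam n) * (Bessel_J \<nu> (\<rho> * r))\<^sup>2"
        unfolding hankel_kernel_def power_mult_distrib 1 powr_radial[OF True n] by (simp add: mult_ac)
      also have "\<dots> = \<rho> powr (\<mu> - 1 - 2 * lam n) * ((\<rho> powr (- \<mu>) * r powr (- \<mu>)) * (Bessel_J \<nu> (\<rho> * r))\<^sup>2 * \<rho>)"
        unfolding 2 3[symmetric] by (simp add: mult_ac)
      also have "\<rho> powr (- \<mu>) * r powr (- \<mu>) = (\<rho> * r) powr (- \<mu>)" using True \<rho> by (simp add: powr_mult)
      finally have "r powr (- 1 - \<mu>) * (hankel_kernel n \<nu> \<rho> r)\<^sup>2 * r ^ (n - 1)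
        = \<rho> powr (\<mu> - 1 - 2 * lam n) * ((\<rho> * r) powr (- \<mu>) * (Bessel_J \<nu> (\<rho> * r))\<^sup>2 * \<rho>)" .
      then show ?thesis using True \<rho> by (simp add: ennreal_mult[symmetric])
    qed simp
  qed
  also have "\<dots> = ennreal (\<rho> powr (\<mu> - 1 - 2 * lam n)) * (\<integral>\<^sup>+r. ennreal ((\<rho> * r powr 1) powr (- \<mu>) * (Bessel_J \<nu> (\<rho> * r powr 1))\<^sup>2) *
        ennreal (\<rho> * \<bar>1\<bar> * r powr (1 - 1)) * indicator {0<..} r \<partial>lborel)"
    by (rule nn_integral_cmult) measurable
  also have "(\<integral>\<^sup>+r. ennreal ((\<rho> * r powr 1) powr (- \<mu>) * (Bessel_J \<nu> (\<rho> * r powr 1))\<^sup>2) *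
        ennreal (\<rho> * \<bar>1\<bar> * r powr (1 - 1)) * indicator {0<..} r \<partial>lborel)
     = (\<integral>\<^sup>+s. ennreal (s powr (- \<mu>) * (Bessel_J \<nu> s)\<^sup>2) * indicator {0<..} s \<partial>lborel)"
    by (rule nn_integral_power_substitution[symmetric]) (use \<rho> in auto)
  also have "\<dots> = ennreal (bessel_const \<mu> \<nu>)" by (rule nn_integral_bessel_sq[OF \<nu> \<mu>])
  also have "ennreal (\<rho> powr (\<mu> - 1 - 2 * lam n)) * \<dots> = ennreal (bessel_const \<mu> \<nu> * \<rho> powr (\<mu> - 1 - 2 * lam n))"
    by (subst mult.commute) (simp only: ennreal_mult'' powr_ge_zero)
  finally show ?thesis .
qed

text \<open>The part of \<open>P\<^sub>a\<^sup>1\<^sup>/\<^sup>4\<^sup>-\<^sup>\<alpha> u(t)\<close> in one spherical mode, with frequencies cut off at \<open>k\<close>.\<close>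

definition truncated_mode :: "nat \<Rightarrow> real \<Rightarrow> (real \<Rightarrow> complex) \<Rightarrow> nat \<Rightarrow> real \<Rightarrow> real \<Rightarrow> complex" where
  "truncated_mode n \<nu> \<xi> k t r = hankel_integral n \<nu>
     (\<lambda>\<rho>. indicator {..real k} \<rho> * (exp (- \<i> * complex_of_real t * complex_of_real (\<rho>\<^sup>2)) * \<xi> \<rho>)) r"

lemma truncated_mode_measurable:
  assumes [measurable]: "\<xi> \<in> borel_measurable borel"
  shows "(\<lambda>(t, r). truncated_mode n \<nu> \<xi> k t r) \<in> borel_measurable (borel \<Otimes>\<^sub>M borel)"
proof -
  interpret sigma_finite_measure "radial_measure n" by (rule sigma_finite_radial_measure)
  show ?thesis unfolding truncated_mode_def hankel_integral_kernel case_prod_unfold by measurable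
qed

text \<open>Plancherel in t is used for fixed r, then the integral over r is done first. The
  exponents are balanced: the weights left in \<rho> cancel completely and the plain norm of \<psi>
  remains, with a bound free of the cutoff k.\<close>

lemma mode_estimate:
  assumes n: "n \<ge> 2" and \<nu>: "\<nu> \<ge> 0" and \<mu>: "0 < \<mu>" "\<mu> < 2 * \<nu> + 1"
    and \<psi>: "\<psi> \<in> borel_measurable borel" and \<xi>: "(\<lambda>\<rho>. complex_of_real (\<rho> powr ((1 - \<mu>) / 2)) * \<psi> \<rho>) \<in> L2 (radial_measure n)"
  shows "(\<integral>\<^sup>+t. (\<integral>\<^sup>+r. ennreal (r powr (- 1 - \<mu>)) *
      ennreal ((cmod (truncated_mode n \<nu> (\<lambda>\<rho>. complex_of_real (\<rho> powr ((1 - \<mu>) / 2)) * \<psi> \<rho>) k t r))\<^sup>2) \<partial>radial_measure n) \<partial>lborel)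
    \<le> ennreal (pi * bessel_const \<mu> \<nu>) * nsq (radial_measure n) \<psi>"
proof -
  let ?M = "radial_measure n"
  define \<xi>' where "\<xi>' \<rho> = complex_of_real (\<rho> powr ((1 - \<mu>) / 2)) * \<psi> \<rho>" for \<rho>
  have n1: "n \<ge> 1" using n by simp
  have \<xi>L: "\<xi>' \<in> L2 ?M" using \<xi> by (simp add: \<xi>'_def[abs_def])
  have [measurable]: "\<xi>' \<in> borel_measurable borel" "\<psi> \<in> borel_measurable borel" using L2_measurable[OF \<xi>L] \<psi> by auto
  interpret M: sigma_finite_measure ?M by (rule sigma_finite_radial_measure)
  interpret lM: pair_sigma_finite lborel ?M ..
  interpret MM: pair_sigma_finite ?M ?M ..
  let ?w = "truncated_mode n \<nu> \<xi>' k"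
  let ?v = "\<lambda>r. ennreal (r powr (- 1 - \<mu>))"
  let ?e = "\<lambda>t \<rho>. exp (- \<i> * complex_of_real t * complex_of_real (\<rho>\<^sup>2))"
  define h where "h r \<rho> = complex_of_real (hankel_kernel n \<nu> \<rho> r) * (indicator {..real k} \<rho> * \<xi>' \<rho>)" for r \<rho>
  have [measurable]: "(\<lambda>z. ?w (fst z) (snd z)) \<in> borel_measurable (borel \<Otimes>\<^sub>M borel)"
    using truncated_mode_measurable[of \<xi>' n \<nu> k] by (simp add: case_prod_unfold)
  have wr[measurable]: "(\<lambda>t. ?w t r) \<in> borel_measurable borel" for r
    unfolding truncated_mode_def hankel_integral_kernel by measurable
  have fL: "(\<lambda>\<rho>. indicator {..real k} \<rho> * \<xi>' \<rho>) \<in> L2 ?M"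
    by (rule L2_bounded_mult[OF \<xi>L, where B=1]) (auto simp: indicator_def)
  have w: "?w t r = (\<integral>\<rho>. ?e t \<rho> * h r \<rho> \<partial>?M)" for t r
    unfolding truncated_mode_def hankel_integral_kernel h_def by (simp add: mult_ac)
  \<comment> \<open>Plancherel in time needs the integrand to be absolutely integrable in \<rho>.
    This is known for almost every r, and thanks to the cutoff at k.\<close>
  have hi: "AE r in ?M. integrable ?M (h r)"
    using hankel_pair_integral(2)[OF n1 \<nu> fL, of "real k"] unfolding h_def[abs_def] by simp
  have "(\<integral>\<^sup>+t. (\<integral>\<^sup>+r. ?v r * ennreal ((cmod (?w t r))\<^sup>2) \<partial>?M) \<partial>lborel)
    = (\<integral>\<^sup>+r. (\<integral>\<^sup>+t. ?v r * ennreal ((cmod (?w t r))\<^sup>2) \<partial>lborel) \<partial>?M)"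
    by (rule lM.Fubini'[symmetric]) (simp add: case_prod_unfold, measurable)
  also have "\<dots> \<le> (\<integral>\<^sup>+r. ?v r * (ennreal pi * (\<integral>\<^sup>+\<rho>. ennreal (\<rho> ^ (n - 2) * (cmod (h r \<rho>))\<^sup>2) \<partial>?M)) \<partial>?M)"
  proof (rule nn_integral_mono_AE, use hi in eventually_elim)
    case (elim r)
    have "(\<integral>\<^sup>+t. ?v r * ennreal ((cmod (?w t r))\<^sup>2) \<partial>lborel) = ?v r * nsq lborel (\<lambda>t. \<integral>\<rho>. ?e t \<rho> * h r \<rho> \<partial>?M)"
      unfolding nsq_def w[symmetric] by (intro nn_integral_cmult) measurable
    also have "\<dots> \<le> ?v r * (ennreal pi * (\<integral>\<^sup>+\<rho>. ennreal (\<rho> ^ (n - 2) * (cmod (h r \<rho>))\<^sup>2) \<partial>?M))"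
      by (intro mult_left_mono plancherel_radial_le n elim) simp
    finally show ?case .
  qed
  also have "\<dots> \<le> (\<integral>\<^sup>+r. (\<integral>\<^sup>+\<rho>. ennreal pi * ennreal (\<rho> ^ (n - 2) * (cmod (\<xi>' \<rho>))\<^sup>2) * (?v r * ennreal ((hankel_kernel n \<nu> \<rho> r)\<^sup>2)) \<partial>?M) \<partial>?M)"
  proof (rule nn_integral_mono)
    fix r
    have "?v r * (ennreal pi * (\<integral>\<^sup>+\<rho>. ennreal (\<rho> ^ (n - 2) * (cmod (h r \<rho>))\<^sup>2) \<partial>?M))
      = (\<integral>\<^sup>+\<rho>. ?v r * ennreal pi * ennreal (\<rho> ^ (n - 2) * (cmod (h r \<rho>))\<^sup>2) \<partial>?M)"
      unfolding h_def by (subst nn_integral_cmult) (measurable, simp add: mult.assoc)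
    also have "\<dots> \<le> (\<integral>\<^sup>+\<rho>. ennreal pi * ennreal (\<rho> ^ (n - 2) * (cmod (\<xi>' \<rho>))\<^sup>2) * (?v r * ennreal ((hankel_kernel n \<nu> \<rho> r)\<^sup>2)) \<partial>?M)"
    proof (rule nn_integral_mono_AE, use AE_radial_pos[of n] in eventually_elim)
      case (elim \<rho>)
      have "\<rho> ^ (n - 2) * (cmod (h r \<rho>))\<^sup>2 \<le> (\<rho> ^ (n - 2) * (cmod (\<xi>' \<rho>))\<^sup>2) * (hankel_kernel n \<nu> \<rho> r)\<^sup>2"
        using elim by (auto simp: h_def norm_mult power_mult_distrib indicator_def mult_ac)
      then have "ennreal (\<rho> ^ (n - 2) * (cmod (h r \<rho>))\<^sup>2) \<le> ennreal (\<rho> ^ (n - 2) * (cmod (\<xi>' \<rho>))\<^sup>2) * ennreal ((hankel_kernel n \<nu> \<rho> r)\<^sup>2)"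
        using elim by (subst ennreal_mult[symmetric]) (auto intro: ennreal_leI)
      from mult_left_mono[OF this, of "?v r * ennreal pi"] show ?case by (simp add: mult_ac)
    qed
    finally show "?v r * (ennreal pi * (\<integral>\<^sup>+\<rho>. ennreal (\<rho> ^ (n - 2) * (cmod (h r \<rho>))\<^sup>2) \<partial>?M))
      \<le> (\<integral>\<^sup>+\<rho>. ennreal pi * ennreal (\<rho> ^ (n - 2) * (cmod (\<xi>' \<rho>))\<^sup>2) * (?v r * ennreal ((hankel_kernel n \<nu> \<rho> r)\<^sup>2)) \<partial>?M)" .
  qed
  also have "\<dots> = (\<integral>\<^sup>+\<rho>. (\<integral>\<^sup>+r. ennreal pi * ennreal (\<rho> ^ (n - 2) * (cmod (\<xi>' \<rho>))\<^sup>2) * (?v r * ennreal ((hankel_kernel n \<nu> \<rho> r)\<^sup>2)) \<partial>?M) \<partial>?M)"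
    by (rule MM.Fubini') (simp add: case_prod_unfold, measurable)
  also have "\<dots> = (\<integral>\<^sup>+\<rho>. ennreal (pi * bessel_const \<mu> \<nu>) * ennreal ((cmod (\<psi> \<rho>))\<^sup>2) \<partial>?M)"
  proof (rule nn_integral_cong_AE, use AE_radial_pos[of n] in eventually_elim)
    case (elim \<rho>)
    have K0: "bessel_const \<mu> \<nu> \<ge> 0"
      using \<mu> \<nu> by (auto simp: bessel_const_def intro!: mult_nonneg_nonneg divide_nonneg_nonneg Gamma_real_nonneg)
    have a: "\<rho> ^ (n - 2) = \<rho> powr (2 * lam n)"
    proof -
      have "\<rho> ^ (n - 2) = \<rho> powr real (n - 2)" by (rule powr_realpow[OF elim, symmetric])
      also have "real (n - 2) = 2 * lam n" using n by (simp add: lam_def of_nat_diff)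
      finally show ?thesis .
    qed
    have b: "(cmod (\<xi>' \<rho>))\<^sup>2 = \<rho> powr (1 - \<mu>) * (cmod (\<psi> \<rho>))\<^sup>2"
      by (simp add: \<xi>'_def norm_mult power_mult_distrib) (simp add: power2_eq_square powr_add[symmetric])
    \<comment> \<open>The three powers come from the frequency weight \<rho>^(n-2), from the power
      of the operator and from scaling of the kernel.\<close>
    have c: "\<rho> powr (2 * lam n) * \<rho> powr (1 - \<mu>) * \<rho> powr (\<mu> - 1 - 2 * lam n) = 1"
      unfolding powr_add[symmetric] using elim by simp
    have e: "\<rho> ^ (n - 2) * (cmod (\<xi>' \<rho>))\<^sup>2 * (bessel_const \<mu> \<nu> * \<rho> powr (\<mu> - 1 - 2 * lam n)) = bessel_const \<mu> \<nu> * (cmod (\<psi> \<rho>))\<^sup>2"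
    proof -
      have "\<rho> ^ (n - 2) * (cmod (\<xi>' \<rho>))\<^sup>2 * (bessel_const \<mu> \<nu> * \<rho> powr (\<mu> - 1 - 2 * lam n))
        = (\<rho> powr (2 * lam n) * \<rho> powr (1 - \<mu>) * \<rho> powr (\<mu> - 1 - 2 * lam n)) * (bessel_const \<mu> \<nu> * (cmod (\<psi> \<rho>))\<^sup>2)"
        unfolding a b by (simp only: mult_ac)
      then show ?thesis unfolding c by simp
    qed
    have "(\<integral>\<^sup>+r. ennreal pi * ennreal (\<rho> ^ (n - 2) * (cmod (\<xi>' \<rho>))\<^sup>2) * (?v r * ennreal ((hankel_kernel n \<nu> \<rho> r)\<^sup>2)) \<partial>?M)
      = ennreal pi * ennreal (\<rho> ^ (n - 2) * (cmod (\<xi>' \<rho>))\<^sup>2) * ennreal (bessel_const \<mu> \<nu> * \<rho> powr (\<mu> - 1 - 2 * lam n))"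
      by (subst nn_integral_cmult, measurable, subst nn_integral_hankel_kernel_weighted[OF n1 \<nu> \<mu> elim], rule refl)
    also have "\<dots> = ennreal pi * ennreal (\<rho> ^ (n - 2) * (cmod (\<xi>' \<rho>))\<^sup>2 * (bessel_const \<mu> \<nu> * \<rho> powr (\<mu> - 1 - 2 * lam n)))"
      using elim K0 by (simp add: ennreal_mult mult.assoc)
    also have "\<dots> = ennreal (pi * bessel_const \<mu> \<nu>) * ennreal ((cmod (\<psi> \<rho>))\<^sup>2)"
      unfolding e using K0 by (simp add: ennreal_mult mult.assoc)
    finally show ?case .
  qed
  also have "\<dots> = ennreal (pi * bessel_const \<mu> \<nu>) * nsq ?M \<psi>"
    unfolding nsq_def by (rule nn_integral_cmult) measurable
  finally show ?thesis unfolding \<xi>'_def[abs_def] .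
qed

lemma nu_nonneg:
  assumes "n \<ge> 2" "a \<ge> - (lam n)\<^sup>2" shows "nu n a l \<ge> 0"
proof -
  have "(lam n)\<^sup>2 \<le> (lam n + real l)\<^sup>2" using assms(1) by (intro power_mono) (auto simp: lam_def)
  then show ?thesis using assms(2) by (simp add: nu_def)
qed

lemma hankel_pair_measurable:
  assumes "hankel_pair n \<nu> f g"
  shows "f \<in> borel_measurable borel" "g \<in> borel_measurable borel"
proof -
  have "f \<in> L2 (radial_measure n)" "g \<in> L2 (radial_measure n)" using assms by (auto simp: hankel_pair_def)
  from this[THEN L2_measurable] show "f \<in> borel_measurable borel" "g \<in> borel_measurable borel" by auto
qed

lemma func_calc_iff_pair:
  fixes f :: "real ^ 'n \<Rightarrow> complex"
  assumes "CARD('n) \<ge> 2" "a \<ge> - (lam CARD('n))\<^sup>2"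
  shows "func_calc a F f g \<longleftrightarrow> f \<in> L2 lborel \<and> g \<in> L2 lborel \<and> (\<forall>l Z. spherical_harmonic l Z \<longrightarrow>
    (\<exists>\<psi>. hankel_pair CARD('n) (nu CARD('n) a l) (sph_coeff Z f) \<psi> \<and>
         hankel_pair CARD('n) (nu CARD('n) a l) (\<lambda>\<rho>. F (\<rho>\<^sup>2) * \<psi> \<rho>) (sph_coeff Z g)))"
  unfolding func_calc_def using assms by (simp add: hankel_iff_pair nu_nonneg)

lemma sph_coeff_of_real: "sph_coeff (\<lambda>\<omega>. complex_of_real (u \<omega>)) f r = coef sphere_measure u (\<lambda>\<omega>. f (r *\<^sub>R \<omega>))"
  by (simp add: sph_coeff_def coef_def)

lemma sphere_basis_spherical_harmonic:
  assumes "sphere_basis dg Y" shows "spherical_harmonic (dg i) (\<lambda>\<omega>. complex_of_real (Y i \<omega>))"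
  using spherical_harmonic_Complex[OF _ rharmonic_zero, of "Y i" "dg i"] assms
  by (simp add: sphere_basis_def complex_of_real_def)

lemma AE_lborel_real_ex: "(AE t::real in lborel. P t) \<Longrightarrow> \<exists>t. P t"
proof (rule ccontr)
  assume "AE t::real in lborel. P t" "\<nexists>t. P t"
  then have "AE t::real in lborel. False" by simp
  then have "emeasure lborel (UNIV :: real set) = 0" using AE_iff_measurable[of UNIV "lborel :: real measure" "\<lambda>_. False"] by simp
  then show False by simp
qed

text \<open>The witnesses for u(t) and for its image under the power of the operator are arbitrary
  at each t. Uniqueness of Hankel transforms ties them all to one profile \<psi> i per mode, taken
  from f; their truncated transforms are jointly measurable and can be integrated over time.\<close>

lemma core_estimate:
  fixes f :: "real ^ 'n \<Rightarrow> complex"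
  assumes n: "CARD('n) \<ge> 2" and a: "a \<ge> - (lam CARD('n))\<^sup>2"
    and \<alpha>: "0 < \<alpha>" "\<alpha> < 1 / 4 + nu CARD('n) a d / 2"
    and f: "f \<in> L2_ge d" and core: "smoothing_core a \<alpha> f G"
  shows "nsq lborel G \<le> ennreal (pi * bessel_const (4 * \<alpha>) (nu CARD('n) a d)) * nsq lborel f"
proof -
  let ?n = "CARD('n)"
  let ?M = "radial_measure ?n"
  let ?\<nu> = "nu ?n a"
  define \<mu> where "\<mu> = 4 * \<alpha>"
  have n1: "?n \<ge> 1" using n by simp
  note nn = nu_nonneg[OF n a] and fc = func_calc_iff_pair[OF n a]
  have \<mu>: "0 < \<mu>" "\<mu> < 2 * ?\<nu> d + 1" using \<alpha> by (auto simp: \<mu>_def)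
  define K where "K = pi * bessel_const \<mu> (?\<nu> d)"
  have lam: "lam ?n \<ge> 0" using n by (simp add: lam_def)
  have nu_mono: "?\<nu> d \<le> ?\<nu> l" if "d \<le> l" for l
    unfolding nu_def using that lam by (intro real_sqrt_le_mono add_right_mono power_mono) auto
  obtain dg and Y :: "nat \<Rightarrow> real ^ 'n \<Rightarrow> real" where Y: "sphere_basis dg Y" using sphere_basis_exists by blast
  let ?Y = "\<lambda>i \<omega>. complex_of_real (Y i \<omega>)"
  have fL: "f \<in> L2 lborel" using f by (simp add: L2_ge_def)
  obtain u where Gm: "G \<in> borel_measurable lborel" and u: "schroedinger_solution a f u"
    and w: "AE t in lborel. \<exists>w. P_power a (1 / 4 - \<alpha>) (u t) w \<and>
           (AE x in lborel. G (t, x) = complex_of_real (norm x powr (- 1 / 2 - 2 * \<alpha>)) * w x)"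
    using core by (auto simp: smoothing_core_def)
  have [measurable]: "G \<in> borel_measurable borel" using Gm by simp
  define c where "c i = sph_coeff (?Y i) f" for i
  let ?e = "\<lambda>t \<rho>. exp (- \<i> * complex_of_real t * complex_of_real (\<rho>\<^sup>2))"
  have S: "\<exists>\<psi>. hankel_pair ?n (?\<nu> (dg i)) (c i) \<psi> \<and> hankel_pair ?n (?\<nu> (dg i)) (\<lambda>\<rho>. ?e t \<rho> * \<psi> \<rho>) (sph_coeff (?Y i) (u t))" for i t
  proof -
    have "func_calc a (\<lambda>s. exp (- \<i> * complex_of_real t * complex_of_real s)) f (u t)"
      using u by (simp add: schroedinger_solution_def)
    then show ?thesis using sphere_basis_spherical_harmonic[OF Y, of i] unfolding fc c_def[abs_def] by blast
  qed
  have "\<forall>i. \<exists>\<psi>. hankel_pair ?n (?\<nu> (dg i)) (c i) \<psi>" using S by blast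
  from choice[OF this] obtain \<psi> where \<psi>: "\<And>i. hankel_pair ?n (?\<nu> (dg i)) (c i) (\<psi> i)" by blast
  have \<psi>L: "\<psi> i \<in> L2 ?M" and cL: "c i \<in> L2 ?M" for i using \<psi> by (auto simp: hankel_pair_def)
  have [measurable]: "\<psi> i \<in> borel_measurable borel" for i using L2_measurable[OF \<psi>L] by simp
  define \<xi> where "\<xi> i \<rho> = complex_of_real (\<rho> powr ((1 - \<mu>) / 2)) * \<psi> i \<rho>" for i \<rho>
  have [measurable]: "\<xi> i \<in> borel_measurable borel" for i unfolding \<xi>_def by measurable
  let ?w = "\<lambda>i. truncated_mode ?n (?\<nu> (dg i)) (\<xi> i)"
  let ?v = "\<lambda>r. ennreal (r powr (- 1 - \<mu>))"
  define A where "A i k t = (\<integral>\<^sup>+r. ?v r * ennreal ((cmod (?w i k t r))\<^sup>2) \<partial>?M)" for i k t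
  interpret M: sigma_finite_measure ?M by (rule sigma_finite_radial_measure)
  have wm: "(\<lambda>z. ?w i k (fst z) (snd z)) \<in> borel_measurable (borel \<Otimes>\<^sub>M borel)" for i k
    using truncated_mode_measurable[of "\<xi> i" ?n "?\<nu> (dg i)" k] by (simp add: case_prod_unfold)
  have Am[measurable]: "A i k \<in> borel_measurable borel" for i k
  proof -
    note [measurable] = wm
    have "(\<lambda>(t, r). ?v r * ennreal ((cmod (?w i k t r))\<^sup>2)) \<in> borel_measurable (borel \<Otimes>\<^sub>M ?M)"
      unfolding case_prod_unfold by measurable
    from M.borel_measurable_nn_integral[OF this] show ?thesis unfolding A_def by simp
  qed
  \<comment> \<open>At each admissible t: the spatial integral of G is bounded mode by mode by the
    truncated modes, using lower semicontinuity, and \<xi> i turns out to be square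
    integrable.\<close>
  have good: "(\<integral>\<^sup>+x. ennreal ((cmod (G (t, x)))\<^sup>2) \<partial>lborel) \<le> (\<Sum>i. liminf (\<lambda>k. A i k t)) \<and> (\<forall>i. \<xi> i \<in> L2 ?M)"
    if P: "P_power a (1 / 4 - \<alpha>) (u t) w" and G: "AE x in lborel. G (t, x) = complex_of_real (norm x powr (- 1 / 2 - 2 * \<alpha>)) * w x" for t w
  proof -
    have wL: "w \<in> L2 lborel" using P by (simp add: P_power_def func_calc_def)
    have mode: "hankel_pair ?n (?\<nu> (dg i)) (\<lambda>\<rho>. ?e t \<rho> * \<xi> i \<rho>) (sph_coeff (?Y i) w)" for i
    proof -
      obtain \<psi>' where \<psi>': "hankel_pair ?n (?\<nu> (dg i)) (c i) \<psi>'"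
        "hankel_pair ?n (?\<nu> (dg i)) (\<lambda>\<rho>. ?e t \<rho> * \<psi>' \<rho>) (sph_coeff (?Y i) (u t))" using S by blast
      obtain \<psi>'' where \<psi>'': "hankel_pair ?n (?\<nu> (dg i)) (sph_coeff (?Y i) (u t)) \<psi>''"
        "hankel_pair ?n (?\<nu> (dg i)) (\<lambda>\<rho>. complex_of_real ((\<rho>\<^sup>2) powr (1 / 4 - \<alpha>)) * \<psi>'' \<rho>) (sph_coeff (?Y i) w)"
        using P sphere_basis_spherical_harmonic[OF Y, of i]
        unfolding P_power_def fc by blast
      have 1: "AE \<rho> in ?M. \<psi>' \<rho> = \<psi> i \<rho>" by (rule hankel_pair_unique[OF n1 nn \<psi>'(1) \<psi>])
      have 2: "AE \<rho> in ?M. \<psi>'' \<rho> = ?e t \<rho> * \<psi>' \<rho>"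
        by (rule hankel_pair_unique[OF n1 nn \<psi>''(1) hankel_pair_sym[OF \<psi>'(2)]])
      have "sph_coeff (?Y i) w \<in> borel_measurable borel"
        by (rule hankel_pair_measurable[OF \<psi>''(2)])
      moreover have "AE \<rho> in ?M. complex_of_real ((\<rho>\<^sup>2) powr (1 / 4 - \<alpha>)) * \<psi>'' \<rho> = ?e t \<rho> * \<xi> i \<rho>"
        using 1 2 AE_radial_pos[of ?n]
      proof eventually_elim
        case (elim \<rho>)
        have "(\<rho>\<^sup>2) powr (1 / 4 - \<alpha>) = \<rho> powr (2 * (1 / 4 - \<alpha>))"
          using elim(3) powr_powr[of \<rho> 2 "1/4 - \<alpha>"] by (simp add: powr_numeral)
        also have "2 * (1 / 4 - \<alpha>) = (1 - \<mu>) / 2" by (simp add: \<mu>_def field_simps)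
        finally show ?case using elim by (simp add: \<xi>_def)
      qed
      ultimately show ?thesis
        by (intro hankel_pair_cong_AE[OF \<psi>''(2)]) auto
    qed
    \<comment> \<open>The function with the oscillating factor is square integrable as part of a
      pair; the inverse factor has modulus 1.\<close>
    have \<xi>L: "\<xi> i \<in> L2 ?M" for i
    proof -
      have "(\<lambda>\<rho>. ?e (- t) \<rho> * (?e t \<rho> * \<xi> i \<rho>)) \<in> L2 ?M"
        by (rule L2_bounded_mult[where B=1]) (use mode[of i] in \<open>auto simp: hankel_pair_def norm_exp_eq_Re\<close>)
      then show ?thesis by (simp add: mult.assoc[symmetric] exp_add[symmetric])
    qed
    have lim: "L2_tendsto ?M (\<lambda>k. ?w i k t) (sph_coeff (?Y i) w) sequentially" for i
    proof -
      have "L2_tendsto ?M (\<lambda>R. hankel_integral ?n (?\<nu> (dg i)) (\<lambda>r. indicator {..R} r * (?e t r * \<xi> i r))) (sph_coeff (?Y i) w) at_top"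
        using hankel_pair_imp_hankel[OF n1 nn mode] by (simp add: hankel_def)
      from filterlim_compose[OF this[unfolded L2_tendsto_nsq] filterlim_real_sequentially]
      show ?thesis unfolding L2_tendsto_nsq truncated_mode_def .
    qed
    have wtm[measurable]: "?w i k t \<in> borel_measurable borel" for i k
      unfolding truncated_mode_def[abs_def] by measurable
    have "(\<integral>\<^sup>+x. ennreal ((cmod (G (t, x)))\<^sup>2) \<partial>lborel) = (\<integral>\<^sup>+x. ?v (norm x) * ennreal ((cmod (w x))\<^sup>2) \<partial>lborel)"
    proof (rule nn_integral_cong_AE, use G in eventually_elim)
      case (elim x)
      have "(norm x powr (- 1 / 2 - 2 * \<alpha>))\<^sup>2 = norm x powr (- 1 - \<mu>)"
        by (simp add: power2_eq_square powr_add[symmetric] \<mu>_def)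
      then show ?case unfolding elim by (simp add: norm_mult power_mult_distrib ennreal_mult)
    qed
    also have "\<dots> = (\<Sum>i. \<integral>\<^sup>+r. ?v r * ennreal ((cmod (sph_coeff (?Y i) w r))\<^sup>2) \<partial>?M)"
      unfolding sph_coeff_of_real by (rule polar_parseval(1)[OF Y wL]) measurable
    also have "\<dots> \<le> (\<Sum>i. liminf (\<lambda>k. A i k t))"
    proof (intro suminf_le)
      fix i
      have "sph_coeff (?Y i) w \<in> borel_measurable borel"
        by (rule hankel_pair_measurable[OF mode])
      then show "(\<integral>\<^sup>+r. ?v r * ennreal ((cmod (sph_coeff (?Y i) w r))\<^sup>2) \<partial>?M) \<le> liminf (\<lambda>k. A i k t)"
        unfolding A_def by (intro weighted_nsq_le_liminf lim) auto
    qed auto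
    finally show ?thesis using \<xi>L by blast
  qed
  \<comment> \<open>\<xi> i does not depend on t, so a single admissible time is enough; one exists
    because the real line is not a null set.\<close>
  have \<xi>L: "\<xi> i \<in> L2 ?M" for i
    using AE_lborel_real_ex[OF w] good by blast
  have bound: "(\<integral>\<^sup>+t. A i k t \<partial>lborel) \<le> ennreal K * nsq ?M (c i)" for i k
  proof (cases "d \<le> dg i")
    case True
    have "(\<integral>\<^sup>+t. A i k t \<partial>lborel) \<le> ennreal (pi * bessel_const \<mu> (?\<nu> (dg i))) * nsq ?M (\<psi> i)"
      unfolding A_def \<xi>_def[abs_def]
      by (rule mode_estimate[OF n nn]) (use \<mu> nu_mono[OF True] \<xi>L[of i] in \<open>auto simp: \<xi>_def[abs_def]\<close>)
    also have "\<dots> \<le> ennreal K * nsq ?M (\<psi> i)"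
      unfolding K_def using bessel_const_antimono[OF \<mu> nu_mono[OF True]]
      by (intro mult_right_mono ennreal_leI mult_left_mono) auto
    also have "nsq ?M (\<psi> i) = nsq ?M (c i)" by (rule hankel_pair_isometry[OF n1 nn \<psi>])
    finally show ?thesis .
  next
    case False
    \<comment> \<open>For degrees below d the order may be too small for the Bessel integral to
      converge. Membership in \<open>L2_ge\<close> makes these modes vanish, and isometry carries
      this over to \<psi> i.\<close>
    have "AE r in lborel. r > 0 \<longrightarrow> (\<integral>\<omega>. f (r *\<^sub>R \<omega>) * ?Y i \<omega> \<partial>sphere_measure) = 0"
    proof -
      have "dg i < d" using False by simp
      then show ?thesis using f sphere_basis_spherical_harmonic[OF Y, of i] unfolding L2_ge_def by blast
    qed
    then have "AE r in lborel. r > 0 \<longrightarrow> c i r = 0"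
      by (simp add: c_def sph_coeff_of_real coef_def)
    moreover have [measurable]: "c i \<in> borel_measurable borel" using L2_measurable[OF cL] by simp
    ultimately have "AE r in ?M. c i r = 0" by (subst AE_radial_iff) auto
    then have "nsq ?M (c i) = 0" using L2_measurable[OF cL] by (subst nsq_eq_0_iff) auto
    then have "nsq ?M (\<psi> i) = 0" using hankel_pair_isometry[OF n1 nn \<psi>] by simp
    then have "AE \<rho> in ?M. \<psi> i \<rho> = 0" by (subst (asm) nsq_eq_0_iff) auto
    then have \<xi>0: "AE \<rho> in ?M. \<xi> i \<rho> = 0" by eventually_elim (simp add: \<xi>_def)
    have "?w i k t r = 0" for t r
    proof -
      have "?w i k t r = (\<integral>r. 0 \<partial>?M)"
        unfolding truncated_mode_def hankel_integral_kernel
        by (rule integral_cong_AE) (measurable, use \<xi>0 in eventually_elim, simp)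
      then show ?thesis by simp
    qed
    then show ?thesis by (simp add: A_def)
  qed
  have "nsq lborel G = (\<integral>\<^sup>+t. (\<integral>\<^sup>+x. ennreal ((cmod (G (t, x)))\<^sup>2) \<partial>lborel) \<partial>lborel)"
    unfolding nsq_def by (subst lborel.nn_integral_fst) (simp_all add: lborel_prod)
  also have "\<dots> \<le> (\<integral>\<^sup>+t. (\<Sum>i. liminf (\<lambda>k. A i k t)) \<partial>lborel)"
  proof (rule nn_integral_mono_AE, use w in eventually_elim)
    case (elim t)
    then show ?case using good by blast
  qed
  also have "\<dots> = (\<Sum>i. \<integral>\<^sup>+t. liminf (\<lambda>k. A i k t) \<partial>lborel)"
    by (rule nn_integral_suminf) measurable
  also have "\<dots> \<le> (\<Sum>i. ennreal K * nsq ?M (c i))"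
  proof (intro suminf_le)
    fix i
    have "(\<integral>\<^sup>+t. liminf (\<lambda>k. A i k t) \<partial>lborel) \<le> liminf (\<lambda>k. \<integral>\<^sup>+t. A i k t \<partial>lborel)"
      by (rule nn_integral_liminf) measurable
    also have "\<dots> \<le> ennreal K * nsq ?M (c i)"
      by (intro Liminf_le[OF sequentially_bot] always_eventually allI bound)
    finally show "(\<integral>\<^sup>+t. liminf (\<lambda>k. A i k t) \<partial>lborel) \<le> ennreal K * nsq ?M (c i)" .
  qed auto
  also have "\<dots> = ennreal K * (\<Sum>i. nsq ?M (c i))" by simp
  also have "(\<Sum>i. nsq ?M (c i)) = nsq lborel f"
    using polar_parseval(1)[OF Y fL, of "\<lambda>r. 1"] by (simp add: c_def sph_coeff_of_real[abs_def] nsq_def)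
  finally show ?thesis unfolding K_def \<mu>_def .
qed

section \<open>Components along real harmonics\<close>

definition slice_coef :: "(real ^ 'n \<Rightarrow> real) \<Rightarrow> (real ^ 'n \<Rightarrow> complex) \<Rightarrow> real \<Rightarrow> complex" where
  "slice_coef u f r = coef sphere_measure u (\<lambda>\<omega>. f (r *\<^sub>R \<omega>))"

lemma sph_coeff_slice_coef: "sph_coeff (\<lambda>\<omega>. complex_of_real (u \<omega>)) f = slice_coef u f"
  by (simp add: fun_eq_iff sph_coeff_of_real slice_coef_def)

lemma rharmonic_measurable [measurable_dest]: "u \<in> rharmonic l \<Longrightarrow> u \<in> borel_measurable borel"
  by (rule borel_measurable_continuous_onI) (rule rharmonic_continuous)

lemma slice_coef_measurable:
  fixes f :: "real ^ 'n \<Rightarrow> complex"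
  assumes "f \<in> L2 lborel" "u \<in> rharmonic l"
  shows "slice_coef u f \<in> borel_measurable borel"
proof -
  have [measurable]: "f \<in> borel_measurable borel" using L2_measurable[OF assms(1)] by simp
  have [measurable]: "u \<in> borel_measurable borel" using rharmonic_measurable[OF assms(2)] .
  show ?thesis unfolding slice_coef_def[abs_def] by measurable
qed

lemma AE_slice_L2:
  fixes f :: "real ^ 'n \<Rightarrow> complex"
  assumes "f \<in> L2 lborel"
  shows "AE r in radial_measure CARD('n). (\<lambda>\<omega>. f (r *\<^sub>R \<omega>)) \<in> L2 sphere_measure"
proof -
  obtain dg and Y :: "nat \<Rightarrow> real ^ 'n \<Rightarrow> real" where Y: "sphere_basis dg Y" using sphere_basis_exists by blast
  show ?thesis by (rule polar_parseval(2)[OF Y assms, of "\<lambda>_. 0"]) simp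
qed

text \<open>Valid only for almost every r: where a slice is not square integrable an integral may
  take its default value 0, and additivity can fail.\<close>

lemma slice_coef_lincomb:
  fixes f g :: "real ^ 'n \<Rightarrow> complex"
  assumes "f \<in> L2 lborel" "g \<in> L2 lborel" "u \<in> rharmonic l"
  shows "AE r in radial_measure CARD('n). slice_coef u (\<lambda>x. f x + c * g x) r = slice_coef u f r + c * slice_coef u g r"
  using AE_slice_L2[OF assms(1)] AE_slice_L2[OF assms(2)]
proof eventually_elim
  case (elim r)
  then show ?case unfolding slice_coef_def by (rule coef_lincomb) (rule rharmonic_L2R[OF assms(3)])
qed

text \<open>The factor -i in place of i comes from the conjugate on the harmonic in
  \<open>sph_coeff\<close>.\<close>

lemma sph_coeff_Complex:
  fixes f :: "real ^ 'n \<Rightarrow> complex"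
  assumes f: "f \<in> L2 lborel" and uv: "u \<in> rharmonic l" "v \<in> rharmonic l"
    and Z: "\<And>\<omega>. \<omega> \<in> sphere 0 1 \<Longrightarrow> Z \<omega> = Complex (u \<omega>) (v \<omega>)"
  shows "AE r in radial_measure CARD('n). sph_coeff Z f r = slice_coef u f r + (- \<i>) * slice_coef v f r"
    and "sph_coeff Z f \<in> borel_measurable borel"
proof -
  have [measurable]: "f \<in> borel_measurable borel" using L2_measurable[OF f] by simp
  have e: "sph_coeff Z f r = (\<integral>\<omega>. f (r *\<^sub>R \<omega>) * complex_of_real (u \<omega>) + (- \<i>) * (f (r *\<^sub>R \<omega>) * complex_of_real (v \<omega>)) \<partial>sphere_measure)" for r
    unfolding sph_coeff_def by (rule Bochner_Integration.integral_cong) (auto simp: space_sphere_measure Z Complex_eq algebra_simps)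
  show "AE r in radial_measure CARD('n). sph_coeff Z f r = slice_coef u f r + (- \<i>) * slice_coef v f r"
    using AE_slice_L2[OF f]
  proof eventually_elim
    case (elim r)
    have i: "integrable sphere_measure (\<lambda>\<omega>. f (r *\<^sub>R \<omega>) * complex_of_real (u \<omega>))"
      "integrable sphere_measure (\<lambda>\<omega>. f (r *\<^sub>R \<omega>) * complex_of_real (v \<omega>))"
      using coef_integrable[OF elim rharmonic_L2R] uv by auto
    show ?case unfolding e slice_coef_def coef_def
      by (subst Bochner_Integration.integral_add) (use i in auto)
  qed
  interpret finite_measure "sphere_measure :: (real ^ 'n) measure" by (rule finite_measure_sphere)
  let ?P = "radial_measure 1 \<Otimes>\<^sub>M (sphere_measure :: (real ^ 'n) measure)"
  have [measurable]: "(\<lambda>z. f (fst z *\<^sub>R snd z)) \<in> borel_measurable ?P"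
    using polar_compose_measurable[of f 1] by (simp add: case_prod_unfold)
  have [measurable]: "(\<lambda>z. u (snd z)) \<in> borel_measurable ?P" "(\<lambda>z. v (snd z)) \<in> borel_measurable ?P"
    using measurable_compose[OF measurable_snd measurable_sphereI[OF rharmonic_measurable[OF uv(1)]]]
      measurable_compose[OF measurable_snd measurable_sphereI[OF rharmonic_measurable[OF uv(2)]]] by auto
  have "(\<lambda>(r, \<omega>). f (r *\<^sub>R \<omega>) * complex_of_real (u \<omega>) + (- \<i>) * (f (r *\<^sub>R \<omega>) * complex_of_real (v \<omega>))) \<in> borel_measurable ?P"
    unfolding case_prod_unfold by measurable
  from borel_measurable_lebesgue_integral[OF this] show "sph_coeff Z f \<in> borel_measurable borel"
    by (simp add: e[abs_def] cong: measurable_cong_sets)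
qed

text \<open>Reduces the orthogonality conditions to real harmonics by splitting a complex one into
  real and imaginary parts.\<close>

lemma L2_ge_iff:
  fixes f :: "real ^ 'n \<Rightarrow> complex"
  shows "f \<in> L2_ge d \<longleftrightarrow> f \<in> L2 lborel \<and>
    (\<forall>l<d. \<forall>u\<in>rharmonic l. AE r in radial_measure CARD('n). slice_coef u f r = 0)"
proof -
  have iff: "(AE r in radial_measure CARD('n). h r = 0) \<longleftrightarrow> (AE r in lborel. r > 0 \<longrightarrow> h r = 0)"
    if [measurable]: "h \<in> borel_measurable borel" for h :: "real \<Rightarrow> complex"
    by (rule AE_radial_iff) measurable
  show ?thesis
  proof (intro iffI conjI allI impI ballI)
    fix l and u :: "real ^ 'n \<Rightarrow> real" assume f: "f \<in> L2_ge d" and l: "l < d" and u: "u \<in> rharmonic l"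
    have "spherical_harmonic l (\<lambda>\<omega>. complex_of_real (u \<omega>))"
      using spherical_harmonic_Complex[OF u rharmonic_zero] by (simp add: complex_of_real_def)
    then have "AE r in lborel. r > 0 \<longrightarrow> slice_coef u f r = 0"
      using f l unfolding L2_ge_def slice_coef_def coef_def by blast
    then show "AE r in radial_measure CARD('n). slice_coef u f r = 0"
      using iff[OF slice_coef_measurable[OF _ u]] f by (simp add: L2_ge_def)
  next
    assume R: "f \<in> L2 lborel \<and> (\<forall>l<d. \<forall>u\<in>rharmonic l. AE r in radial_measure CARD('n). slice_coef u f r = 0)"
    then have f: "f \<in> L2 lborel" by simp
    have "AE r in lborel. r > 0 \<longrightarrow> (\<integral>\<omega>. f (r *\<^sub>R \<omega>) * Z \<omega> \<partial>sphere_measure) = 0"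
      if l: "l < d" and Z: "spherical_harmonic l Z" for l Z
    proof -
      obtain u v where uv: "u \<in> rharmonic l" "v \<in> rharmonic l" and Zuv: "\<And>\<omega>. \<omega> \<in> sphere 0 1 \<Longrightarrow> Z \<omega> = Complex (u \<omega>) (v \<omega>)"
        using spherical_harmonic_cases[OF Z] by blast
      \<comment> \<open>\<open>L2_ge\<close> integrates against Z without conjugation, so the
        relevant component is the one along the conjugate of Z, whose imaginary part is -v.\<close>
      have v': "(\<lambda>x. - v x) \<in> rharmonic l"
        using rharmonic_lincomb[OF rharmonic_zero uv(2), of "-1"] by simp
      have *: "cnj (Z \<omega>) = Complex (u \<omega>) (- v \<omega>)" if "\<omega> \<in> sphere 0 1" for \<omega> using Zuv[OF that] by (simp add: complex_eq_iff)
      have S: "AE r in radial_measure CARD('n). sph_coeff (\<lambda>\<omega>. cnj (Z \<omega>)) f r = slice_coef u f r + (- \<i>) * slice_coef (\<lambda>x. - v x) f r"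
        "sph_coeff (\<lambda>\<omega>. cnj (Z \<omega>)) f \<in> borel_measurable borel"
        using * by (intro sph_coeff_Complex[OF f uv(1) v']; simp)+
      have "AE r in radial_measure CARD('n). slice_coef u f r = 0"
        "AE r in radial_measure CARD('n). slice_coef (\<lambda>x. - v x) f r = 0" using R l uv(1) v' by auto
      with S(1) have "AE r in radial_measure CARD('n). sph_coeff (\<lambda>\<omega>. cnj (Z \<omega>)) f r = 0"
        by eventually_elim simp
      then show ?thesis unfolding iff[OF S(2)] by (simp add: sph_coeff_def)
    qed
    then show "f \<in> L2_ge d" using f by (auto simp: L2_ge_def)
  qed (auto simp: L2_ge_def)
qed

text \<open>Transforms along u and v combine linearly to the transform along u + i v, since both
  have the same order. Measurability of F allows changing functions on null sets.\<close>

lemma func_calc_iff: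
  fixes f g :: "real ^ 'n \<Rightarrow> complex"
  assumes n: "CARD('n) \<ge> 2" and a: "a \<ge> - (lam CARD('n))\<^sup>2" and F: "F \<in> borel_measurable borel"
  shows "func_calc a F f g \<longleftrightarrow> f \<in> L2 lborel \<and> g \<in> L2 lborel \<and> (\<forall>l. \<forall>u\<in>rharmonic l.
    \<exists>\<psi>. hankel_pair CARD('n) (nu CARD('n) a l) (slice_coef u f) \<psi> \<and>
         hankel_pair CARD('n) (nu CARD('n) a l) (\<lambda>\<rho>. F (\<rho>\<^sup>2) * \<psi> \<rho>) (slice_coef u g))"
  (is "_ \<longleftrightarrow> _ \<and> _ \<and> ?R")
proof (intro iffI conjI allI ballI)
  fix l and u :: "real ^ 'n \<Rightarrow> real" assume c: "func_calc a F f g" and u: "u \<in> rharmonic l"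
  have "spherical_harmonic l (\<lambda>\<omega>. complex_of_real (u \<omega>))"
    using spherical_harmonic_Complex[OF u rharmonic_zero] by (simp add: complex_of_real_def)
  with c show "\<exists>\<psi>. hankel_pair CARD('n) (nu CARD('n) a l) (slice_coef u f) \<psi> \<and>
         hankel_pair CARD('n) (nu CARD('n) a l) (\<lambda>\<rho>. F (\<rho>\<^sup>2) * \<psi> \<rho>) (slice_coef u g)"
    unfolding func_calc_iff_pair[OF n a] sph_coeff_slice_coef[symmetric] by blast
next
  assume R: "f \<in> L2 lborel \<and> g \<in> L2 lborel \<and> ?R"
  have n1: "CARD('n) \<ge> 1" using n by simp
  show "func_calc a F f g"
    unfolding func_calc_iff_pair[OF n a]
  proof (intro conjI allI impI)
    fix l Z assume Z: "spherical_harmonic l (Z :: real ^ 'n \<Rightarrow> complex)"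
    let ?h = "hankel_pair CARD('n) (nu CARD('n) a l)"
    obtain u v where uv: "u \<in> rharmonic l" "v \<in> rharmonic l" and Zuv: "\<And>\<omega>. \<omega> \<in> sphere 0 1 \<Longrightarrow> Z \<omega> = Complex (u \<omega>) (v \<omega>)"
      using spherical_harmonic_cases[OF Z] by blast
    obtain \<psi> \<psi>' where 1: "?h (slice_coef u f) \<psi>" "?h (\<lambda>\<rho>. F (\<rho>\<^sup>2) * \<psi> \<rho>) (slice_coef u g)"
      and 2: "?h (slice_coef v f) \<psi>'" "?h (\<lambda>\<rho>. F (\<rho>\<^sup>2) * \<psi>' \<rho>) (slice_coef v g)"
      using R uv by blast
    let ?\<psi> = "\<lambda>\<rho>. \<psi> \<rho> + (- \<i>) * \<psi>' \<rho>"
    note [measurable] = hankel_pair_measurable(2)[OF 1(1)] hankel_pair_measurable(2)[OF 2(1)] F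
    have fg: "f \<in> L2 lborel" "g \<in> L2 lborel" using R by auto
    have "?h (\<lambda>r. slice_coef u f r + (- \<i>) * slice_coef v f r) ?\<psi>"
      by (rule hankel_pair_lincomb[OF n1 nu_nonneg[OF n a] 1(1) 2(1)])
    then have a1: "?h (sph_coeff Z f) ?\<psi>"
      by (rule hankel_pair_cong_AE) (use sph_coeff_Complex[OF fg(1) uv Zuv] in auto)
    have "?h (\<lambda>r. F (r\<^sup>2) * \<psi> r + (- \<i>) * (F (r\<^sup>2) * \<psi>' r)) (\<lambda>r. slice_coef u g r + (- \<i>) * slice_coef v g r)"
      by (rule hankel_pair_lincomb[OF n1 nu_nonneg[OF n a] 1(2) 2(2)])
    then have a2: "?h (\<lambda>\<rho>. F (\<rho>\<^sup>2) * ?\<psi> \<rho>) (sph_coeff Z g)"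
      by (rule hankel_pair_cong_AE) (use sph_coeff_Complex[OF fg(2) uv Zuv] in \<open>auto simp: algebra_simps\<close>)
    show "\<exists>\<psi>. ?h (sph_coeff Z f) \<psi> \<and> ?h (\<lambda>\<rho>. F (\<rho>\<^sup>2) * \<psi> \<rho>) (sph_coeff Z g)"
      using a1 a2 by blast
  qed (use R in auto)
qed (auto simp: func_calc_def)

lemma L2_ge_lincomb:
  fixes f g :: "real ^ 'n \<Rightarrow> complex"
  assumes "f \<in> L2_ge d" "g \<in> L2_ge d" shows "(\<lambda>x. f x + c * g x) \<in> L2_ge d"
  unfolding L2_ge_iff
proof (intro conjI allI impI ballI)
  have fg: "f \<in> L2 lborel" "g \<in> L2 lborel" using assms by (auto simp: L2_ge_def)
  then show "(\<lambda>x. f x + c * g x) \<in> L2 lborel" by (intro L2_add L2_scale)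
  fix l u assume l: "l < d" and u: "u \<in> (rharmonic l :: (real ^ 'n \<Rightarrow> real) set)"
  have "AE r in radial_measure CARD('n). slice_coef u f r = 0" "AE r in radial_measure CARD('n). slice_coef u g r = 0"
    using assms l u by (auto simp: L2_ge_iff)
  with slice_coef_lincomb[OF fg u, of c]
  show "AE r in radial_measure CARD('n). slice_coef u (\<lambda>x. f x + c * g x) r = 0"
    by eventually_elim simp
qed

text \<open>Linearity of the functional calculus as a relation; through it the estimate applies to
  differences of core elements.\<close>

lemma func_calc_lincomb:
  fixes f g f' g' :: "real ^ 'n \<Rightarrow> complex"
  assumes n: "CARD('n) \<ge> 2" and a: "a \<ge> - (lam CARD('n))\<^sup>2" and F[measurable]: "F \<in> borel_measurable borel"
    and 1: "func_calc a F f g" and 2: "func_calc a F f' g'"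
  shows "func_calc a F (\<lambda>x. f x + c * f' x) (\<lambda>x. g x + c * g' x)"
  unfolding func_calc_iff[OF n a F]
proof (intro conjI allI ballI)
  have L: "f \<in> L2 lborel" "g \<in> L2 lborel" "f' \<in> L2 lborel" "g' \<in> L2 lborel" using 1 2 by (auto simp: func_calc_def)
  show fL: "(\<lambda>x. f x + c * f' x) \<in> L2 lborel" by (rule L2_add[OF L(1) L2_scale[OF L(3)]])
  show gL: "(\<lambda>x. g x + c * g' x) \<in> L2 lborel" by (rule L2_add[OF L(2) L2_scale[OF L(4)]])
  fix l u assume u: "u \<in> (rharmonic l :: (real ^ 'n \<Rightarrow> real) set)"
  let ?h = "hankel_pair CARD('n) (nu CARD('n) a l)"
  have n1: "CARD('n) \<ge> 1" using n by simp
  obtain \<psi> where p1: "?h (slice_coef u f) \<psi>" "?h (\<lambda>\<rho>. F (\<rho>\<^sup>2) * \<psi> \<rho>) (slice_coef u g)"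
    using 1 u unfolding func_calc_iff[OF n a F] by blast
  obtain \<psi>' where p2: "?h (slice_coef u f') \<psi>'" "?h (\<lambda>\<rho>. F (\<rho>\<^sup>2) * \<psi>' \<rho>) (slice_coef u g')"
    using 2 u unfolding func_calc_iff[OF n a F] by blast
  let ?\<psi> = "\<lambda>\<rho>. \<psi> \<rho> + c * \<psi>' \<rho>"
  note [measurable] = hankel_pair_measurable(2)[OF p1(1)] hankel_pair_measurable(2)[OF p2(1)]
  have "?h (\<lambda>r. slice_coef u f r + c * slice_coef u f' r) ?\<psi>"
    by (rule hankel_pair_lincomb[OF n1 nu_nonneg[OF n a] p1(1) p2(1)])
  then have a1: "?h (slice_coef u (\<lambda>x. f x + c * f' x)) ?\<psi>"
  proof (rule hankel_pair_cong_AE)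
    show "AE r in radial_measure CARD('n). slice_coef u f r + c * slice_coef u f' r = slice_coef u (\<lambda>x. f x + c * f' x) r"
      using slice_coef_lincomb[OF L(1,3) u, of c] by eventually_elim simp
  qed (use slice_coef_measurable[OF fL u] in auto)
  have "?h (\<lambda>r. F (r\<^sup>2) * \<psi> r + c * (F (r\<^sup>2) * \<psi>' r)) (\<lambda>r. slice_coef u g r + c * slice_coef u g' r)"
    by (rule hankel_pair_lincomb[OF n1 nu_nonneg[OF n a] p1(2) p2(2)])
  then have a2: "?h (\<lambda>\<rho>. F (\<rho>\<^sup>2) * ?\<psi> \<rho>) (slice_coef u (\<lambda>x. g x + c * g' x))"
  proof (rule hankel_pair_cong_AE)
    show "AE r in radial_measure CARD('n). slice_coef u g r + c * slice_coef u g' r = slice_coef u (\<lambda>x. g x + c * g' x) r"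
      using slice_coef_lincomb[OF L(2,4) u, of c] by eventually_elim simp
  qed (use slice_coef_measurable[OF gL u] in \<open>auto simp: algebra_simps\<close>)
  show "\<exists>\<psi>. ?h (slice_coef u (\<lambda>x. f x + c * f' x)) \<psi> \<and> ?h (\<lambda>\<rho>. F (\<rho>\<^sup>2) * \<psi> \<rho>) (slice_coef u (\<lambda>x. g x + c * g' x))"
    using a1 a2 by blast
qed

lemma smoothing_core_lincomb:
  fixes f f' :: "real ^ 'n \<Rightarrow> complex"
  assumes n: "CARD('n) \<ge> 2" and a: "a \<ge> - (lam CARD('n))\<^sup>2"
    and 1: "smoothing_core a \<alpha> f G" and 2: "smoothing_core a \<alpha> f' G'"
  shows "smoothing_core a \<alpha> (\<lambda>x. f x + c * f' x) (\<lambda>p. G p + c * G' p)"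
proof -
  let ?v = "\<lambda>x::real ^ 'n. complex_of_real (norm x powr (- 1 / 2 - 2 * \<alpha>))"
  obtain u where u: "G \<in> borel_measurable lborel" "schroedinger_solution a f u"
    "AE t in lborel. \<exists>w. P_power a (1 / 4 - \<alpha>) (u t) w \<and> (AE x in lborel. G (t, x) = ?v x * w x)"
    using 1 unfolding smoothing_core_def by blast
  obtain u' where u': "G' \<in> borel_measurable lborel" "schroedinger_solution a f' u'"
    "AE t in lborel. \<exists>w. P_power a (1 / 4 - \<alpha>) (u' t) w \<and> (AE x in lborel. G' (t, x) = ?v x * w x)"
    using 2 unfolding smoothing_core_def by blast
  show ?thesis unfolding smoothing_core_def
  proof (intro conjI exI)
    show "(\<lambda>p. G p + c * G' p) \<in> borel_measurable lborel" using u(1) u'(1) by simp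
    show "schroedinger_solution a (\<lambda>x. f x + c * f' x) (\<lambda>t x. u t x + c * u' t x)"
      using u(2) u'(2) unfolding schroedinger_solution_def
      by (intro allI func_calc_lincomb[OF n a]) auto
    show "AE t in lborel. \<exists>w. P_power a (1 / 4 - \<alpha>) (\<lambda>x. u t x + c * u' t x) w \<and>
      (AE x in lborel. G (t, x) + c * G' (t, x) = ?v x * w x)"
      using u(3) u'(3)
    proof eventually_elim
      case (elim t)
      obtain w w' where w: "P_power a (1 / 4 - \<alpha>) (u t) w" "AE x in lborel. G (t, x) = ?v x * w x"
        and w': "P_power a (1 / 4 - \<alpha>) (u' t) w'" "AE x in lborel. G' (t, x) = ?v x * w' x" using elim by blast
      have "P_power a (1 / 4 - \<alpha>) (\<lambda>x. u t x + c * u' t x) (\<lambda>x. w x + c * w' x)"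
        using w(1) w'(1) unfolding P_power_def by (intro func_calc_lincomb[OF n a]) auto
      moreover have "AE x in lborel. G (t, x) + c * G' (t, x) = ?v x * (w x + c * w' x)"
        using w(2) w'(2) by eventually_elim (simp add: algebra_simps)
      ultimately show ?case by blast
    qed
  qed
qed

section \<open>Functions with finitely many modes\<close>

definition synth :: "nat \<Rightarrow> (nat \<Rightarrow> real ^ 'n \<Rightarrow> real) \<Rightarrow> (nat \<Rightarrow> real \<Rightarrow> complex) \<Rightarrow> real ^ 'n \<Rightarrow> complex" where
  "synth N Y b x = (\<Sum>i<N. complex_of_real (Y i (x /\<^sub>R norm x)) * b i (norm x))"

lemma synth_L2:
  fixes Y :: "nat \<Rightarrow> real ^ 'n \<Rightarrow> real"
  assumes Y: "\<And>i. Y i \<in> rharmonic (dg i)" and b: "\<And>i. b i \<in> L2 (radial_measure CARD('n))"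
  shows "synth N Y b \<in> L2 lborel"
  unfolding synth_def[abs_def]
proof (rule L2_sum)
  fix i
  have [measurable]: "Y i \<in> borel_measurable borel" "b i \<in> borel_measurable borel"
    using rharmonic_measurable[OF Y] L2_measurable[OF b] by auto
  have YL: "(\<lambda>\<omega>. complex_of_real (Y i \<omega>)) \<in> L2 sphere_measure"
    using rharmonic_L2R[OF Y, of i] by (simp add: L2R_def)
  have [measurable]: "(\<lambda>\<omega>. complex_of_real (Y i \<omega>)) \<in> borel_measurable sphere_measure"
    by (rule L2_measurable[OF YL])
  have "nsq lborel (\<lambda>x. complex_of_real (Y i (x /\<^sub>R norm x)) * b i (norm x))
    = (\<integral>\<^sup>+r. (\<integral>\<^sup>+\<omega>. ennreal ((cmod (complex_of_real (Y i ((r *\<^sub>R \<omega>) /\<^sub>R norm (r *\<^sub>R \<omega>))) * b i (norm (r *\<^sub>R \<omega>))))\<^sup>2) \<partial>sphere_measure) \<partial>radial_measure CARD('n))"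
    unfolding nsq_def by (rule nn_integral_polar) measurable
  also have "\<dots> = (\<integral>\<^sup>+r. nsq sphere_measure (\<lambda>\<omega>. complex_of_real (Y i \<omega>)) * ennreal ((cmod (b i r))\<^sup>2) \<partial>radial_measure CARD('n))"
  proof (rule nn_integral_cong_AE, use AE_radial_pos[of "CARD('n)"] in eventually_elim)
    case (elim r)
    have "(\<integral>\<^sup>+\<omega>. ennreal ((cmod (complex_of_real (Y i ((r *\<^sub>R \<omega>) /\<^sub>R norm (r *\<^sub>R \<omega>))) * b i (norm (r *\<^sub>R \<omega>))))\<^sup>2) \<partial>sphere_measure)
      = (\<integral>\<^sup>+\<omega>. ennreal ((cmod (complex_of_real (Y i \<omega>)))\<^sup>2) * ennreal ((cmod (b i r))\<^sup>2) \<partial>sphere_measure)"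
      using elim by (intro nn_integral_cong) (auto simp: space_sphere_measure norm_mult power_mult_distrib ennreal_mult)
    also have "\<dots> = nsq sphere_measure (\<lambda>\<omega>. complex_of_real (Y i \<omega>)) * ennreal ((cmod (b i r))\<^sup>2)"
      unfolding nsq_def by (rule nn_integral_multc) measurable
    finally show ?case .
  qed
  also have "\<dots> = nsq sphere_measure (\<lambda>\<omega>. complex_of_real (Y i \<omega>)) * nsq (radial_measure CARD('n)) (b i)"
    unfolding nsq_def[of "radial_measure CARD('n)"] by (rule nn_integral_cmult) measurable
  also have "\<dots> < \<infinity>" using YL b[of i] by (simp add: L2_iff_nsq ennreal_mult_less_top)
  finally show "(\<lambda>x. complex_of_real (Y i (x /\<^sub>R norm x)) * b i (norm x)) \<in> L2 lborel"
    unfolding L2_iff_nsq by simp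
qed

lemma slice_coef_synth:
  fixes Y :: "nat \<Rightarrow> real ^ 'n \<Rightarrow> real"
  assumes Y: "\<And>i. Y i \<in> rharmonic (dg i)" and u: "u \<in> rharmonic l" and r: "r > 0"
  shows "slice_coef u (synth N Y b) r = (\<Sum>i<N. complex_of_real (rip sphere_measure (Y i) u) * b i r)"
proof -
  have int: "integrable sphere_measure (\<lambda>\<omega>. Y i \<omega> * u \<omega>)" for i
    by (rule L2R_mult_integrable[OF rharmonic_L2R[OF Y] rharmonic_L2R[OF u]])
  have "slice_coef u (synth N Y b) r = (\<integral>\<omega>. (\<Sum>i<N. complex_of_real (Y i \<omega> * u \<omega>) * b i r) \<partial>sphere_measure)"
    unfolding slice_coef_def coef_def synth_def
    by (rule Bochner_Integration.integral_cong)
      (use r in \<open>auto simp: space_sphere_measure sum_distrib_left sum_distrib_right mult_ac\<close>)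
  also have "\<dots> = (\<Sum>i<N. \<integral>\<omega>. complex_of_real (Y i \<omega> * u \<omega>) * b i r \<partial>sphere_measure)"
    by (rule Bochner_Integration.integral_sum) (intro integrable_mult_left integrable_of_real int)
  also have "\<dots> = (\<Sum>i<N. complex_of_real (rip sphere_measure (Y i) u) * b i r)"
    by (intro sum.cong refl) (simp only: integral_mult_left_zero integral_complex_of_real rip_def)
  finally show ?thesis .
qed

text \<open>Only modes of the degree of u contribute, so that all remaining radial profiles are
  transformed with one and the same order.\<close>

lemma slice_coef_synth_degree:
  fixes Y :: "nat \<Rightarrow> real ^ 'n \<Rightarrow> real"
  assumes Y: "\<And>i. Y i \<in> rharmonic (dg i)" and u: "u \<in> rharmonic l" and r: "r > 0"
  shows "slice_coef u (synth N Y b) r = (\<Sum>i\<in>{i\<in>{..<N}. dg i = l}. complex_of_real (rip sphere_measure (Y i) u) * b i r)"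
  unfolding slice_coef_synth[OF Y u r]
  by (rule sum.mono_neutral_right) (auto simp: rharmonic_orthogonal[OF Y u])

lemma synth_L2_ge:
  fixes Y :: "nat \<Rightarrow> real ^ 'n \<Rightarrow> real"
  assumes Y: "\<And>i. Y i \<in> rharmonic (dg i)" and b: "\<And>i. b i \<in> L2 (radial_measure CARD('n))"
    and 0: "\<And>i. dg i < d \<Longrightarrow> b i = (\<lambda>r. 0)"
  shows "synth N Y b \<in> L2_ge d"
  unfolding L2_ge_iff
proof (intro conjI allI impI ballI synth_L2[OF Y b])
  fix l u assume "l < d" and u: "u \<in> (rharmonic l :: (real ^ 'n \<Rightarrow> real) set)"
  then show "AE r in radial_measure CARD('n). slice_coef u (synth N Y b) r = 0"
    using AE_radial_pos[of "CARD('n)"] by (auto elim!: eventually_mono simp: slice_coef_synth_degree[OF Y u] 0)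
qed

text \<open>Each component is a fixed linear combination of profiles of equal degree, and linearity
  of the transform of that order does the rest.\<close>

lemma func_calc_synth:
  fixes Y :: "nat \<Rightarrow> real ^ 'n \<Rightarrow> real"
  assumes n: "CARD('n) \<ge> 2" and a: "a \<ge> - (lam CARD('n))\<^sup>2" and F[measurable]: "F \<in> borel_measurable borel"
    and Y: "\<And>i. Y i \<in> rharmonic (dg i)"
    and b: "\<And>i. hankel_pair CARD('n) (nu CARD('n) a (dg i)) (b i) (\<eta> i)"
    and b': "\<And>i. hankel_pair CARD('n) (nu CARD('n) a (dg i)) (\<lambda>\<rho>. F (\<rho>\<^sup>2) * \<eta> i \<rho>) (b' i)"
  shows "func_calc a F (synth N Y b) (synth N Y b')"
  unfolding func_calc_iff[OF n a F]
proof (intro conjI allI ballI)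
  have bL: "b i \<in> L2 (radial_measure CARD('n))" "b' i \<in> L2 (radial_measure CARD('n))" for i
    using b[of i] b'[of i] by (auto simp: hankel_pair_def)
  show S: "synth N Y b \<in> L2 lborel" "synth N Y b' \<in> L2 lborel" using bL by (auto intro!: synth_L2[OF Y])
  have n1: "CARD('n) \<ge> 1" using n by simp
  fix l u assume u: "u \<in> (rharmonic l :: (real ^ 'n \<Rightarrow> real) set)"
  let ?h = "hankel_pair CARD('n) (nu CARD('n) a l)"
  let ?A = "{i\<in>{..<N}. dg i = l}" and ?c = "\<lambda>i. complex_of_real (rip sphere_measure (Y i) u)"
  note [measurable] = hankel_pair_measurable(2)[OF b]
  have bA: "i \<in> ?A \<Longrightarrow> ?h (b i) (\<eta> i)" "i \<in> ?A \<Longrightarrow> ?h (\<lambda>\<rho>. F (\<rho>\<^sup>2) * \<eta> i \<rho>) (b' i)" for i using b[of i] b'[of i] by auto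
  have "?h (\<lambda>r. \<Sum>i\<in>?A. ?c i * b i r) (\<lambda>r. \<Sum>i\<in>?A. ?c i * \<eta> i r)"
    by (rule hankel_pair_sum[OF n1 nu_nonneg[OF n a] bA(1)])
  then have 1: "?h (slice_coef u (synth N Y b)) (\<lambda>r. \<Sum>i\<in>?A. ?c i * \<eta> i r)"
  proof (rule hankel_pair_cong_AE)
    show "AE r in radial_measure CARD('n). (\<Sum>i\<in>?A. ?c i * b i r) = slice_coef u (synth N Y b) r"
      using AE_radial_pos[of "CARD('n)"] by eventually_elim (simp add: slice_coef_synth_degree[OF Y u])
  qed (use slice_coef_measurable[OF S(1) u] in auto)
  have "?h (\<lambda>r. \<Sum>i\<in>?A. ?c i * (F (r\<^sup>2) * \<eta> i r)) (\<lambda>r. \<Sum>i\<in>?A. ?c i * b' i r)"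
    by (rule hankel_pair_sum[OF n1 nu_nonneg[OF n a] bA(2)])
  then have 2: "?h (\<lambda>\<rho>. F (\<rho>\<^sup>2) * (\<Sum>i\<in>?A. ?c i * \<eta> i \<rho>)) (slice_coef u (synth N Y b'))"
  proof (rule hankel_pair_cong_AE)
    show "AE r in radial_measure CARD('n). (\<Sum>i\<in>?A. ?c i * b' i r) = slice_coef u (synth N Y b') r"
      using AE_radial_pos[of "CARD('n)"] by eventually_elim (simp add: slice_coef_synth_degree[OF Y u])
  qed (use slice_coef_measurable[OF S(2) u] in \<open>auto simp: sum_distrib_left mult_ac\<close>)
  show "\<exists>\<psi>. ?h (slice_coef u (synth N Y b)) \<psi> \<and> ?h (\<lambda>\<rho>. F (\<rho>\<^sup>2) * \<psi> \<rho>) (slice_coef u (synth N Y b'))"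
    using 1 2 by blast
qed

section \<open>Density of the core and conclusion\<close>

definition core_mode :: "nat \<Rightarrow> real \<Rightarrow> (real \<Rightarrow> complex) \<Rightarrow> (real \<Rightarrow> complex) \<Rightarrow> nat \<Rightarrow> real \<Rightarrow> complex" where
  "core_mode n \<nu> \<psi> m k = hankel_integral n \<nu> (\<lambda>\<rho>. m \<rho> * (indicator {1 / real (Suc k)..real (Suc k)} \<rho> * \<psi> \<rho>))"

text \<open>The frequency window is a compact part of the open half-line, so any multiplier
  continuous there is bounded on it. This admits powers of either sign.\<close>

lemma core_mode_pair:
  assumes n: "n \<ge> 1" and \<nu>: "\<nu> \<ge> 0" and \<psi>: "\<psi> \<in> L2 (radial_measure n)"
    and [measurable]: "m \<in> borel_measurable borel" and m: "continuous_on {0<..} m"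
  shows "hankel_pair n \<nu> (\<lambda>\<rho>. m \<rho> * (indicator {1 / real (Suc k)..real (Suc k)} \<rho> * \<psi> \<rho>)) (core_mode n \<nu> \<psi> m k)"
  unfolding core_mode_def
proof (rule hankel_pair_integral(1)[OF n \<nu>, where R="real (Suc k)"])
  let ?I = "{1 / real (Suc k)..real (Suc k)}"
  have "0 < x" if "x \<in> ?I" for x
  proof -
    have "0 < 1 / real (Suc k)" by simp
    also have "\<dots> \<le> x" using that by simp
    finally show ?thesis .
  qed
  then have "compact (m ` ?I)"
    by (intro compact_continuous_image continuous_on_subset[OF m]) auto
  then obtain B where B: "\<And>x. x \<in> ?I \<Longrightarrow> cmod (m x) \<le> B"
    using compact_imp_bounded by (fastforce simp: bounded_iff)
  have "(\<lambda>\<rho>. (m \<rho> * indicator ?I \<rho>) * \<psi> \<rho>) \<in> L2 (radial_measure n)"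
  proof (rule L2_bounded_mult[OF \<psi>])
    show "cmod (m x * indicator ?I x) \<le> max B 0" for x
      using B[of x] by (cases "x \<in> ?I") (auto simp del: atLeastAtMost_iff)
  qed measurable
  then show "(\<lambda>\<rho>. m \<rho> * (indicator ?I \<rho> * \<psi> \<rho>)) \<in> L2 (radial_measure n)"
    by (simp add: mult.assoc)
qed auto

lemma core_element:
  fixes Y :: "nat \<Rightarrow> real ^ 'n \<Rightarrow> real"
  assumes n: "CARD('n) \<ge> 2" and a: "a \<ge> - (lam CARD('n))\<^sup>2"
    and Y: "\<And>i. Y i \<in> rharmonic (dg i)" and \<psi>: "\<And>i. \<psi> i \<in> L2 (radial_measure CARD('n))"
  shows "\<exists>G. smoothing_core a \<alpha>
    (synth N Y (\<lambda>i. core_mode CARD('n) (nu CARD('n) a (dg i)) (\<psi> i) (\<lambda>_. 1) k)) G"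
proof -
  let ?M = "radial_measure CARD('n)"
  interpret sigma_finite_measure ?M by (rule sigma_finite_radial_measure)
  define md where "md i m = core_mode CARD('n) (nu CARD('n) a (dg i)) (\<psi> i) m k" for i m
  define e where "e t \<rho> = exp (- \<i> * complex_of_real t * complex_of_real (\<rho>\<^sup>2))" for t \<rho>
  define p where "p \<rho> = complex_of_real ((\<rho>\<^sup>2) powr (1 / 4 - \<alpha>))" for \<rho>
  let ?I = "\<lambda>\<rho>. indicator {1 / real (Suc k)..real (Suc k)} \<rho>"
  have n1: "CARD('n) \<ge> 1" using n by simp
  have [measurable]: "e t \<in> borel_measurable borel" "p \<in> borel_measurable borel" for t
    unfolding e_def p_def by measurable
  have [measurable]: "Y i \<in> borel_measurable borel" "\<psi> i \<in> borel_measurable borel" for i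
    using rharmonic_measurable[OF Y] L2_measurable[OF \<psi>] by auto
  have ec: "continuous_on {0<..} (e t)" for t unfolding e_def by (intro continuous_intros)
  have pc: "continuous_on {0<..} p" unfolding p_def by (intro continuous_intros) auto
  have pair: "hankel_pair CARD('n) (nu CARD('n) a (dg i)) (\<lambda>\<rho>. m \<rho> * (?I \<rho> * \<psi> i \<rho>)) (md i m)"
    if "m \<in> borel_measurable borel" "continuous_on {0<..} m" for i m
    unfolding md_def by (rule core_mode_pair[OF n1 nu_nonneg[OF n a] \<psi> that])
  \<comment> \<open>An explicit formula in t and x, so that joint measurability can be read
    off.\<close>
  define G where "G z = complex_of_real (norm (snd z) powr (- 1 / 2 - 2 * \<alpha>)) *
    synth N Y (\<lambda>i. md i (\<lambda>\<rho>. p \<rho> * e (fst z) \<rho>)) (snd z)" for z :: "real \<times> (real ^ 'n)"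
  have "smoothing_core a \<alpha> (synth N Y (\<lambda>i. md i (\<lambda>_. 1))) G"
    unfolding smoothing_core_def
  proof (intro conjI exI AE_I2)
    have [measurable]: "(\<lambda>z. md i (\<lambda>\<rho>. p \<rho> * e (fst z) \<rho>) (norm (snd z))) \<in> borel_measurable (borel \<Otimes>\<^sub>M (borel :: (real ^ 'n) measure))" for i
      unfolding md_def core_mode_def hankel_integral_kernel e_def by measurable
    have "G \<in> borel_measurable (borel \<Otimes>\<^sub>M borel)" unfolding G_def synth_def by measurable
    then show "G \<in> borel_measurable lborel" by (simp add: borel_prod)
    show "schroedinger_solution a (synth N Y (\<lambda>i. md i (\<lambda>_. 1))) (\<lambda>t. synth N Y (\<lambda>i. md i (e t)))"
      unfolding schroedinger_solution_def
    proof (intro allI func_calc_synth[OF n a _ Y])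
      show "hankel_pair CARD('n) (nu CARD('n) a (dg i)) (md i (\<lambda>_. 1)) (\<lambda>\<rho>. 1 * (?I \<rho> * \<psi> i \<rho>))" for i
        by (rule hankel_pair_sym[OF pair]) auto
      show "hankel_pair CARD('n) (nu CARD('n) a (dg i)) (\<lambda>\<rho>. exp (- \<i> * complex_of_real t * complex_of_real (\<rho>\<^sup>2)) * (1 * (?I \<rho> * \<psi> i \<rho>))) (md i (e t))" for i t
        using pair[of "e t" i] ec[of t] unfolding e_def by simp
    qed measurable
    fix t
    show "P_power a (1 / 4 - \<alpha>) (synth N Y (\<lambda>i. md i (e t))) (synth N Y (\<lambda>i. md i (\<lambda>\<rho>. p \<rho> * e t \<rho>)))"
      unfolding P_power_def
    proof (intro func_calc_synth[OF n a _ Y])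
      show "hankel_pair CARD('n) (nu CARD('n) a (dg i)) (md i (e t)) (\<lambda>\<rho>. e t \<rho> * (?I \<rho> * \<psi> i \<rho>))" for i
        by (rule hankel_pair_sym[OF pair[OF _ ec]]) measurable
      have "continuous_on {0<..} (\<lambda>\<rho>. p \<rho> * e t \<rho>)" by (intro continuous_intros ec pc)
      from pair[OF _ this]
      show "hankel_pair CARD('n) (nu CARD('n) a (dg i)) (\<lambda>\<rho>. complex_of_real (\<rho>\<^sup>2 powr (1 / 4 - \<alpha>)) * (e t \<rho> * (?I \<rho> * \<psi> i \<rho>))) (md i (\<lambda>\<rho>. p \<rho> * e t \<rho>))" for i
        by (simp add: p_def mult.assoc)
    qed measurable
    show "G (t, x) = complex_of_real (norm x powr (- 1 / 2 - 2 * \<alpha>)) * synth N Y (\<lambda>i. md i (\<lambda>\<rho>. p \<rho> * e t \<rho>)) x" for x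
      by (simp add: G_def)
  qed
  then show ?thesis unfolding md_def by blast
qed

text \<open>The index k bounds the number of modes and the frequency window simultaneously. By
  Parseval the error is a series over modes, which tends to 0 by dominated convergence for counting
  measure.\<close>

lemma core_dense:
  fixes f :: "real ^ 'n \<Rightarrow> complex"
  assumes n: "CARD('n) \<ge> 2" and a: "a \<ge> - (lam CARD('n))\<^sup>2" and f: "f \<in> L2_ge d"
  shows "\<exists>fs Gs. (\<forall>k. fs k \<in> L2_ge d \<and> smoothing_core a \<alpha> (fs k) (Gs k)) \<and> L2_tendsto lborel fs f sequentially"
proof -
  let ?M = "radial_measure CARD('n)"
  let ?h = "\<lambda>l. hankel_pair CARD('n) (nu CARD('n) a l)"
  have n1: "CARD('n) \<ge> 1" using n by simp
  note nn = nu_nonneg[OF n a]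
  obtain dg and Y :: "nat \<Rightarrow> real ^ 'n \<Rightarrow> real" where Yb: "sphere_basis dg Y" using sphere_basis_exists by blast
  then have Y: "Y i \<in> rharmonic (dg i)" and on: "orthonormal_or_zero sphere_measure Y" for i by (auto simp: sphere_basis_def)
  have fL: "f \<in> L2 lborel" using f by (simp add: L2_ge_def)
  define c where "c i = slice_coef (Y i) f" for i
  have [measurable]: "c i \<in> borel_measurable borel" for i unfolding c_def by (rule slice_coef_measurable[OF fL Y])
  have parseval: "nsq lborel g = (\<Sum>i. nsq ?M (slice_coef (Y i) g))" if "g \<in> L2 lborel" for g
    using polar_parseval(1)[OF Yb that, of "\<lambda>r. 1"] by (simp add: nsq_def slice_coef_def)
  have fin: "(\<Sum>i. nsq ?M (c i)) < \<infinity>"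
    using fL parseval[OF fL] by (simp add: L2_iff_nsq c_def)
  have "nsq ?M (c i) < \<infinity>" for i
    using sum_le_suminf[of "\<lambda>i. nsq ?M (c i)" "{i}"] fin by (auto intro: le_less_trans)
  then have cL: "c i \<in> L2 ?M" for i by (simp add: L2_iff_nsq)
  \<comment> \<open>In degrees below d the component of f vanishes only a.e.; choosing the zero
    function as its transform makes the synthesised mode exactly zero, so the approximants stay in
    \<open>L2_ge\<close>.\<close>
  have "\<exists>\<psi>. ?h (dg i) (c i) \<psi> \<and> (dg i < d \<longrightarrow> \<psi> = (\<lambda>\<rho>. 0))" for i
  proof (cases "dg i < d")
    case True
    have "AE r in ?M. c i r = 0" using f True Y[of i] by (auto simp: L2_ge_iff c_def)
    then have "?h (dg i) (c i) (\<lambda>\<rho>. 0)"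
      by (intro hankel_pair_cong_AE[OF hankel_pair_zero]) (auto elim: eventually_mono)
    then show ?thesis by blast
  next
    case False
    then show ?thesis using hankel_pair_exists[OF n1 nn cL] by blast
  qed
  then have "\<forall>i. \<exists>\<psi>. ?h (dg i) (c i) \<psi> \<and> (dg i < d \<longrightarrow> \<psi> = (\<lambda>\<rho>. 0))" by blast
  from choice[OF this] obtain \<psi> where \<psi>: "\<And>i. ?h (dg i) (c i) (\<psi> i)" and \<psi>0: "\<And>i. dg i < d \<Longrightarrow> \<psi> i = (\<lambda>\<rho>. 0)" by blast
  have \<psi>L: "\<psi> i \<in> L2 ?M" for i using \<psi>[of i] by (simp add: hankel_pair_def)
  have iso: "nsq ?M (\<psi> i) = nsq ?M (c i)" for i by (rule hankel_pair_isometry[OF n1 nn \<psi>])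
  define I where "I k = {1 / real (Suc k)..real (Suc k)}" for k
  define b where "b k i = core_mode CARD('n) (nu CARD('n) a (dg i)) (\<psi> i) (\<lambda>_. 1) k" for k i
  have b: "?h (dg i) (b k i) (\<lambda>\<rho>. indicator (I k) \<rho> * \<psi> i \<rho>)" for k i
    using hankel_pair_sym[OF core_mode_pair[OF n1 nn \<psi>L, of "\<lambda>_. 1" "dg i" k i]] by (simp add: b_def I_def)
  have bL: "b k i \<in> L2 ?M" for k i using b[of i k] by (simp add: hankel_pair_def)
  define fs where "fs k = synth k Y (b k)" for k
  have fsge: "fs k \<in> L2_ge d" for k
    unfolding fs_def
    by (rule synth_L2_ge[OF Y bL]) (simp add: b_def core_mode_def \<psi>0 hankel_integral_def fun_eq_iff)
  have fsL: "fs k \<in> L2 lborel" for k using fsge[of k] by (simp add: L2_ge_def)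
  have "\<forall>k. \<exists>G. smoothing_core a \<alpha> (fs k) G"
    unfolding fs_def b_def using core_element[OF n a, where Y=Y and dg=dg and \<psi>=\<psi>, OF Y \<psi>L] by blast
  from choice[OF this] obtain Gs where Gs: "\<And>k. smoothing_core a \<alpha> (fs k) (Gs k)" by blast
  let ?g = "\<lambda>k x. f x + (-1) * fs k x"
  have gL: "?g k \<in> L2 lborel" for k by (intro L2_add L2_scale fL fsL)
  \<comment> \<open>The error allotted to mode i: the frequencies outside the window if the mode is
    included, and the whole mode otherwise.\<close>
  define T where "T k i = (if i < k then nsq ?M (\<lambda>\<rho>. indicator (- I k) \<rho> * \<psi> i \<rho>) else nsq ?M (\<psi> i))" for k i
  have le: "nsq ?M (slice_coef (Y i) (?g k)) \<le> T k i" for i k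
  \<comment> \<open>A zero basis element would return coefficient 0 instead of the synthesised
    profile, so it is treated apart.\<close>
  proof (cases "rip sphere_measure (Y i) (Y i) = 0")
    case True
    have "?g k \<in> borel_measurable borel" using L2_measurable[OF gL] by simp
    from coef_eq_0[OF rharmonic_L2R[OF Y] slice_measurable[OF this] True]
    have "slice_coef (Y i) (?g k) r = 0" for r by (simp add: slice_coef_def)
    then show ?thesis by (simp add: nsq_def)
  next
    case False
    then have 1: "rip sphere_measure (Y i) (Y i) = 1" using on by (auto simp: orthonormal_or_zero_def)
    have fs: "slice_coef (Y i) (fs k) r = (if i < k then b k i r else 0)" if "r > 0" for r
    proof -
      have "slice_coef (Y i) (fs k) r = (\<Sum>j<k. if j = i then b k i r else 0)"
        unfolding fs_def slice_coef_synth[OF Y Y that]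
        by (intro sum.cong refl) (use on 1 in \<open>auto simp: orthonormal_or_zero_def\<close>)
      then show ?thesis by simp
    qed
    have AE: "AE r in ?M. slice_coef (Y i) (?g k) r = c i r + (-1) * (if i < k then b k i r else 0)"
      using slice_coef_lincomb[OF fL fsL[of k] Y[of i], where c="-1"] AE_radial_pos[of "CARD('n)"]
      by eventually_elim (simp add: c_def fs)
    show ?thesis
    proof (cases "i < k")
      case True
      have "?h (dg i) (\<lambda>r. c i r + (-1) * b k i r) (\<lambda>\<rho>. \<psi> i \<rho> + (-1) * (indicator (I k) \<rho> * \<psi> i \<rho>))"
        by (rule hankel_pair_lincomb[OF n1 nn \<psi> b])
      moreover have "(\<lambda>\<rho>. \<psi> i \<rho> + (-1) * (indicator (I k) \<rho> * \<psi> i \<rho>)) = (\<lambda>\<rho>. indicator (- I k) \<rho> * \<psi> i \<rho>)"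
        by (auto simp: fun_eq_iff indicator_def)
      ultimately have "T k i = nsq ?M (\<lambda>r. c i r + (-1) * b k i r)"
        using hankel_pair_isometry[OF n1 nn] True by (simp add: T_def)
      also have "\<dots> = nsq ?M (slice_coef (Y i) (?g k))"
        using AE True by (intro nsq_cong_AE) (auto elim: eventually_mono)
      finally show ?thesis by simp
    next
      case False
      then have "nsq ?M (slice_coef (Y i) (?g k)) = nsq ?M (c i)"
        using AE by (intro nsq_cong_AE) simp
      then show ?thesis using False by (simp add: T_def iso)
    qed
  qed
  have "(\<lambda>k. \<integral>\<^sup>+i. T k i \<partial>count_space UNIV) \<longlonglongrightarrow> (\<integral>\<^sup>+i. 0 \<partial>count_space (UNIV :: nat set))"
  proof (rule nn_integral_dominated_convergence[where w="\<lambda>i. nsq ?M (\<psi> i)"])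
    show "AE i in count_space UNIV. T k i \<le> nsq ?M (\<psi> i)" for k
      unfolding T_def nsq_def by (intro AE_I2) (auto intro!: nn_integral_mono simp: indicator_def)
    show "(\<integral>\<^sup>+i. nsq ?M (\<psi> i) \<partial>count_space UNIV) < \<infinity>"
      using fin by (simp add: nn_integral_count_space_nat iso)
    show "AE i in count_space UNIV. (\<lambda>k. T k i) \<longlonglongrightarrow> 0"
    proof (rule AE_I2)
      fix i
      have "(\<lambda>k. nsq ?M (\<lambda>\<rho>. indicator (- I k) \<rho> * \<psi> i \<rho>)) \<longlonglongrightarrow> 0"
      proof (rule nsq_indicator_tendsto_0[OF \<psi>L])
        show "AE \<rho> in ?M. \<forall>\<^sub>F k in sequentially. \<rho> \<notin> - I k"
          using AE_radial_pos[of "CARD('n)"]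
        proof eventually_elim
          case (elim \<rho>)
          have "\<forall>\<^sub>F k in sequentially. 1 / real (Suc k) < \<rho>"
            using order_tendstoD(2)[OF LIMSEQ_inverse_real_of_nat elim] by (simp add: inverse_eq_divide)
          moreover have "\<forall>\<^sub>F k in sequentially. \<rho> \<le> real k"
            using filterlim_real_sequentially by (simp add: filterlim_at_top)
          ultimately show ?case by eventually_elim (auto simp: I_def)
        qed
      qed (simp add: I_def)
      moreover have "\<forall>\<^sub>F k in sequentially. nsq ?M (\<lambda>\<rho>. indicator (- I k) \<rho> * \<psi> i \<rho>) = T k i"
        using eventually_gt_at_top[of i] by eventually_elim (simp add: T_def)
      ultimately show "(\<lambda>k. T k i) \<longlonglongrightarrow> 0" by (rule Lim_transform_eventually)
    qed
  qed auto
  then have lim: "(\<lambda>k. \<Sum>i. T k i) \<longlonglongrightarrow> 0" by (simp add: nn_integral_count_space_nat)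
  have "nsq lborel (\<lambda>x. fs k x - f x) \<le> (\<Sum>i. T k i)" for k
  proof -
    have "nsq lborel (\<lambda>x. fs k x - f x) = nsq lborel (?g k)" by (subst nsq_diff_commute) simp
    also have "\<dots> \<le> (\<Sum>i. T k i)" unfolding parseval[OF gL] by (intro suminf_le le) auto
    finally show ?thesis .
  qed
  then have "L2_tendsto lborel fs f sequentially"
    unfolding L2_tendsto_nsq by (intro tendsto_sandwich[OF _ _ tendsto_const lim]) auto
  then show ?thesis using fsge Gs by blast
qed

lemma nsq_triangle:
  assumes [measurable]: "f \<in> borel_measurable M" "g \<in> borel_measurable M" "h \<in> borel_measurable M"
  shows "nsq M (\<lambda>x. f x - h x) \<le> 2 * nsq M (\<lambda>x. f x - g x) + 2 * nsq M (\<lambda>x. g x - h x)"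
  using nsq_add_le[of "\<lambda>x. f x - g x" M "\<lambda>x. g x - h x"] by simp

text \<open>Extension by continuity, in the formulation of \<open>smoothing\<close>: the core
  estimate makes images of approximating sequences Cauchy, completeness gives a limit, and
  comparison of two sequences shows independence of the choice.\<close>

theorem theorem1:
  fixes a \<alpha> :: real and d :: nat
  assumes "CARD('n::finite) \<ge> 2"
    and "d \<ge> d0 CARD('n)"
    and "a \<ge> - (lam CARD('n))\<^sup>2"
    and "nu CARD('n) a d > 0"
    and "0 < \<alpha>" and "\<alpha> < 1 / 4 + nu CARD('n) a d / 2"
  shows "\<exists>C>0. \<forall>f :: real ^ 'n \<Rightarrow> complex. f \<in> L2_ge d \<longrightarrow>
    (\<exists>G. smoothing d a \<alpha> f G) \<and>
    (\<forall>G. smoothing d a \<alpha> f G \<longrightarrow> L2norm lborel G \<le> C * L2norm lborel f)"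
proof -
  note n = assms(1) and a = assms(3)
  \<comment> \<open>The absolute value and the summand 1 make positivity immediate, whatever the
    sign of the Bessel constant.\<close>
  define K where "K = \<bar>pi * bessel_const (4 * \<alpha>) (nu CARD('n) a d)\<bar> + 1"
  have K: "K > 0" unfolding K_def by linarith
  have est: "nsq lborel G \<le> ennreal K * nsq lborel f"
    if "f \<in> L2_ge d" "smoothing_core a \<alpha> f G" for f :: "real ^ 'n \<Rightarrow> complex" and G
  proof -
    have "nsq lborel G \<le> ennreal (pi * bessel_const (4 * \<alpha>) (nu CARD('n) a d)) * nsq lborel f"
      by (rule core_estimate[OF n a assms(5,6) that])
    also have "\<dots> \<le> ennreal K * nsq lborel f"
      unfolding K_def by (intro mult_right_mono ennreal_leI) auto
    finally show ?thesis .
  qed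
  \<comment> \<open>Linearity turns the estimate into a Lipschitz bound. Both arguments are measured
    against a common h, which will be the limit f.\<close>
  have est_diff: "nsq lborel (\<lambda>z. G z - G' z) \<le> ennreal (2 * K) * (nsq lborel (\<lambda>x. f x - h x) + nsq lborel (\<lambda>x. f' x - h x))"
    if f: "f \<in> L2_ge d" "f' \<in> L2_ge d" "h \<in> L2 lborel" and G: "smoothing_core a \<alpha> f G" "smoothing_core a \<alpha> f' G'"
    for f f' h :: "real ^ 'n \<Rightarrow> complex" and G G'
  proof -
    have m: "f \<in> borel_measurable lborel" "f' \<in> borel_measurable lborel" "h \<in> borel_measurable lborel"
      using f by (auto simp: L2_ge_def L2_def)
    have "nsq lborel (\<lambda>z. G z - G' z) \<le> ennreal K * nsq lborel (\<lambda>x. f x - f' x)"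
      using est[OF L2_ge_lincomb[OF f(1,2), of "-1"] smoothing_core_lincomb[OF n a G, of "-1"]] by simp
    also have "\<dots> \<le> ennreal K * (2 * nsq lborel (\<lambda>x. f x - h x) + 2 * nsq lborel (\<lambda>x. h x - f' x))"
      by (intro mult_left_mono nsq_triangle m) simp
    also have "\<dots> = ennreal (2 * K) * (nsq lborel (\<lambda>x. f x - h x) + nsq lborel (\<lambda>x. f' x - h x))"
      using K by (subst (2) nsq_diff_commute) (simp add: ennreal_mult distrib_left mult_ac)
    finally show ?thesis .
  qed
  have GL: "G \<in> L2 lborel" if "f \<in> L2_ge d" "smoothing_core a \<alpha> f G" for f :: "real ^ 'n \<Rightarrow> complex" and G
  proof -
    have "nsq lborel f < \<infinity>" using that(1) by (simp add: L2_ge_def L2_iff_nsq)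
    then have "ennreal K * nsq lborel f < \<infinity>" by (simp add: ennreal_mult_less_top)
    then show ?thesis using est[OF that] that(2) by (auto simp: L2_iff_nsq smoothing_core_def)
  qed
  have "(\<exists>G. smoothing d a \<alpha> f G) \<and> (\<forall>G. smoothing d a \<alpha> f G \<longrightarrow> L2norm lborel G \<le> 2 * sqrt K * L2norm lborel f)"
    if f: "f \<in> L2_ge d" for f :: "real ^ 'n \<Rightarrow> complex"
  proof
    have fL: "f \<in> L2 lborel" using f by (simp add: L2_ge_def)
    obtain fs Gs where core: "\<And>k. fs k \<in> L2_ge d \<and> smoothing_core a \<alpha> (fs k) (Gs k)"
      and lim: "L2_tendsto lborel fs f sequentially" using core_dense[OF n a f] by blast
    have GsL: "Gs k \<in> L2 lborel" for k using core[of k] GL by blast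
    have "\<exists>G\<in>L2 lborel. L2_tendsto lborel Gs G sequentially"
    proof (rule L2_complete[OF GsL])
      fix e :: real assume e: "e > 0"
      have "ennreal (e / (4 * K)) > 0" using e K by simp
      from order_tendstoD(2)[OF lim[unfolded L2_tendsto_nsq] this]
      obtain N where N: "\<And>k. k \<ge> N \<Longrightarrow> nsq lborel (\<lambda>x. fs k x - f x) < ennreal (e / (4 * K))"
        unfolding eventually_sequentially by blast
      have "nsq lborel (\<lambda>x. Gs m x - Gs k x) \<le> ennreal e" if "m \<ge> N" "k \<ge> N" for m k
      proof -
        have "nsq lborel (\<lambda>x. Gs m x - Gs k x)
          \<le> ennreal (2 * K) * (nsq lborel (\<lambda>x. fs m x - f x) + nsq lborel (\<lambda>x. fs k x - f x))"
          using core by (intro est_diff fL) auto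
        also have "\<dots> \<le> ennreal (2 * K) * (ennreal (e / (4 * K)) + ennreal (e / (4 * K)))"
          using N[OF that(1)] N[OF that(2)] by (intro mult_left_mono add_mono) auto
        also have "\<dots> = ennreal e"
          using e K by (simp add: ennreal_plus[symmetric] ennreal_mult[symmetric] del: ennreal_plus)
        finally show ?thesis .
      qed
      then show "\<exists>N. \<forall>m\<ge>N. \<forall>k\<ge>N. nsq lborel (\<lambda>x. Gs m x - Gs k x) \<le> ennreal e" by blast
    qed
    then obtain G where G: "G \<in> L2 lborel" "L2_tendsto lborel Gs G sequentially" by blast
    have "L2_tendsto lborel Gs' G sequentially"
      if core': "\<forall>k. fs' k \<in> L2_ge d \<and> smoothing_core a \<alpha> (fs' k) (Gs' k)" and lim': "L2_tendsto lborel fs' f sequentially" for fs' Gs'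
    proof -
      \<comment> \<open>Compares an arbitrary approximating sequence with the fixed one through the
        Lipschitz bound and then uses convergence of the fixed images to G.\<close>
      let ?u = "\<lambda>k. 2 * (ennreal (2 * K) * (nsq lborel (\<lambda>x. fs' k x - f x) + nsq lborel (\<lambda>x. fs k x - f x)))
        + 2 * nsq lborel (\<lambda>x. Gs k x - G x)"
      have "?u \<longlonglongrightarrow> 2 * (ennreal (2 * K) * (0 + 0)) + 2 * 0"
        using lim lim' G(2) unfolding L2_tendsto_nsq
        by (intro tendsto_add ennreal_tendsto_cmult) auto
      then have u: "?u \<longlonglongrightarrow> 0" by simp
      have "nsq lborel (\<lambda>x. Gs' k x - G x) \<le> ?u k" for k
      proof -
        have "Gs' k \<in> borel_measurable lborel" using core' by (simp add: smoothing_core_def)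
        then have "nsq lborel (\<lambda>x. Gs' k x - G x) \<le> 2 * nsq lborel (\<lambda>x. Gs' k x - Gs k x) + 2 * nsq lborel (\<lambda>x. Gs k x - G x)"
          by (intro nsq_triangle L2_measurable[OF GsL] L2_measurable[OF G(1)])
        also have "\<dots> \<le> ?u k"
          using core core' by (intro add_mono mult_left_mono est_diff fL) auto
        finally show ?thesis .
      qed
      then show ?thesis unfolding L2_tendsto_nsq by (intro tendsto_sandwich[OF _ _ tendsto_const u]) auto
    qed
    then have "smoothing d a \<alpha> f G" unfolding smoothing_def using G(1) core lim by blast
    then show "\<exists>G. smoothing d a \<alpha> f G" by blast
    show "\<forall>G. smoothing d a \<alpha> f G \<longrightarrow> L2norm lborel G \<le> 2 * sqrt K * L2norm lborel f"
    proof (intro allI impI)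
      fix H assume H: "smoothing d a \<alpha> f H"
      then have HL: "H \<in> L2 lborel" and "L2_tendsto lborel Gs H sequentially"
        unfolding smoothing_def using core lim by blast+
      \<comment> \<open>The squared triangle inequality is used twice, for H near Gs k and for fs k
        near f. This doubles K twice, hence 4 K for squares and 2 sqrt K for norms.\<close>
      let ?u = "\<lambda>k. 2 * (ennreal K * (2 * nsq lborel f + 2 * nsq lborel (\<lambda>x. fs k x - f x))) + 2 * nsq lborel (\<lambda>x. Gs k x - H x)"
      have u: "?u \<longlonglongrightarrow> 2 * (ennreal K * (2 * nsq lborel f + 2 * 0)) + 2 * 0"
        using lim \<open>L2_tendsto lborel Gs H sequentially\<close> unfolding L2_tendsto_nsq
        by (intro tendsto_add tendsto_const ennreal_tendsto_cmult) auto
      have "nsq lborel H \<le> ?u k" for k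
      proof -
        have m: "fs k \<in> borel_measurable lborel" "f \<in> borel_measurable lborel" using core[of k] fL by (auto simp: L2_ge_def L2_def)
        have "nsq lborel H \<le> 2 * nsq lborel (Gs k) + 2 * nsq lborel (\<lambda>x. H x - Gs k x)"
          using nsq_add_le[OF L2_measurable[OF GsL[of k]], of "\<lambda>x. H x - Gs k x"] L2_measurable[OF GsL[of k]] L2_measurable[OF HL] by simp
        also have "\<dots> \<le> 2 * (ennreal K * nsq lborel (fs k)) + 2 * nsq lborel (\<lambda>x. Gs k x - H x)"
          using core[of k] est by (subst nsq_diff_commute) (intro add_mono mult_left_mono; simp)
        also have "\<dots> \<le> ?u k"
        proof (intro add_mono mult_left_mono order.refl)
          show "nsq lborel (fs k) \<le> 2 * nsq lborel f + 2 * nsq lborel (\<lambda>x. fs k x - f x)"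
            using nsq_add_le[OF m(2), of "\<lambda>x. fs k x - f x"] m by simp
        qed auto
        finally show ?thesis .
      qed
      then have "nsq lborel H \<le> 2 * (ennreal K * (2 * nsq lborel f + 2 * 0)) + 2 * 0"
        by (intro LIMSEQ_le_const[OF u]) auto
      also have "\<dots> = ennreal (4 * K) * nsq lborel f" using K by (simp add: ennreal_mult mult_ac)
      finally have "ennreal ((L2norm lborel H)\<^sup>2) \<le> ennreal (4 * K * (L2norm lborel f)\<^sup>2)"
        using K by (simp add: nsq_eq_L2norm HL fL ennreal_mult)
      then have sq: "(L2norm lborel H)\<^sup>2 \<le> (2 * sqrt K * L2norm lborel f)\<^sup>2"
        using K by (simp add: power_mult_distrib)
      have "0 \<le> 2 * sqrt K * L2norm lborel f" using K by (simp add: L2norm_def)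
      with sq show "L2norm lborel H \<le> 2 * sqrt K * L2norm lborel f" by (rule power2_le_imp_le)
    qed
  qed
  then show ?thesis using K by (intro exI[of _ "2 * sqrt K"]) auto
qed

end
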